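(* Let $p$ be a prime, $P_0$ a $p$-equipped poset, $(F,G)$ a pair of fields with $G=F(\xi)$ normal of degree $p$ over $F$, $\xi^p\in F$, and let $P=P_0\cup\{0,m\}$ with the system $\mathcal Q$ and the associated ditalgebra $\mathcal D^e$. Let $M$ and $N$ be two objects of $\mathrm{mod}\,\mathcal D^e$ with local bases $\mathscr B(M)$ and $\mathscr B(N)$, respectively. Then $M\cong N$ if and only if they have the same dimension vector $(d_x)$ and there exist: \begin{itemize} \item a non-singular square matrix $T_0\in\mathscr M_{d_0}(G)$; \item for each $x>0$ in $P$, a non-singular square matrix $T_x$, with $T_x\in\mathscr M_{d_x}(G)$ if $x$ is strong and $T_x\in\mathscr M_{d_x}(F)$ if $x$ is weak; \item for each $0<y<^\ell x$ in $P$, a $d_y\times d_x$ matrix $T_{yx}$ over $F\langle1,\xi,\xi^2,\dots,\xi^{\ell-1}\rangle$ (the $F$-span); \end{itemize} such that, for every $x\in P$, $x>0$, $$\mathscr M(M)_x=T_0\,\mathscr M(N)_x\,T_x+\sum_{0<y<x}T_0\,\mathscr M(N)_y\,T_{yx}.$$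
   Context: A finite poset $(P_0,\le)$ is $p$-equipped if each pair $x\le y$ is assigned exactly one $\ell\in\{1,\dots,p\}$, written $x\le^\ell y$ (and $x<^\ell y$ if moreover $x\ne y$), such that $x\le^\ell y\le^mz$ and $x\le^nz$ imply $n\ge\min\{\ell+m-1,p\}$. Then $x\le^1x$ ($x$ is weak) or $x\le^px$ ($x$ is strong). $P=P_0\cup\{0,m\}$ with $0$ a least and $m$ a greatest element, both strong, and all relations involving $0$ or $m$ are $\le^p$. $\mathcal Q_{x,y}=F\langle1,\xi,\dots,\xi^{\ell-1}\rangle\subseteq G$ for $x\le^\ell y$ in $P$ (so $\mathcal Q_{0,x}=\mathcal Q_{x,m}=G$), and $\mathcal Q_x=\mathcal Q_{x,x}$ is $F$ if $x$ is weak, $G$ if strong. $\Lambda=\bigoplus_{x\le y}e_{x,y}\mathcal Q_{x,y}$ ($e_{x,y}$ matrix units, matrix operations), $e_x=e_{x,x}$. The ditalgebra $\mathcal D^e$. $\Lambda=S\oplus J$, $S=\bigoplus_xe_{x,x}\mathcal Q_x$, $J=\bigoplus_{x<y}e_{x,y}\mathcal Q_{x,y}$, $\hat e=1-e_0$. ${}^*J=\mathrm{Hom}_S({}_SJ,S)$ is an $S$-bimodule by $(s\gamma)(u)=\gamma(us)$, $(\gamma s)(u)=\gamma(u)s$ (so $e_x{}^*Je_y$ is dual to $e_yJe_x$). Choose left $\mathcal Q_y$-bases of the $e_yJe_x$ ($y<x$); their union $\{p_i\}$ with dual elements $\gamma_i$ is a dual basis of ${}_SJ$. Put $R^e=w_1\hat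 eS\oplus w_2e_0S$ ($w_1,w_2$ orthogonal idempotents), $W_0=w_{1,2}\hat e\,{}^*Je_0$ (left action through $w_1$, right action through $w_2$), $W_1=w_1\hat e\,{}^*J\hat e$ (both actions through $w_1$), $T=T_{R^e}(W_0\oplus W_1)$, graded with $R^e,W_0$ in degree 0 and $W_1$ in degree 1. The differential $d_e$ (degree 1, $d_e(R^e)=0$, graded Leibniz rule $d_e(ab)=d_e(a)b+(-1)^{\deg a}a\,d_e(b)$) is given by $d_e(w_{1,2}\gamma)=-\sum_{i,j}w_1\gamma_i\otimes w_{1,2}\gamma_j\,\gamma(p_jp_i)$ for $\gamma\in\hat e\,{}^*Je_0$ and $d_e(w_1\gamma)=-\sum_{i,j}w_1\gamma_i\otimes w_1\gamma_j\,\gamma(p_jp_i)$ for $\gamma\in\hat e\,{}^*J\hat e$ (only non-zero terms are written). $\mathcal D^e=(T,d_e)$. $\mathrm{mod}\,\mathcal D^e$: objects are right $T_0$-modules $M$ ($T_0=R^e\oplus W_0$) finite-dimensional over $F$; write $M_0=Mw_2e_0$, $M_x=Mw_1e_x$ for $x>0$. A morphism $f:M\to N$ is a pair $(f^0,f^1)$ with $f^0$ right $R^e$-linear and $f^1:T_1\to\mathrm{Hom}_F(M,N)$ a $T_0$-bimodule morphism (where $(ah)(m)=h(ma)$, $(ha)(m)=h(m)a$) such that $f^0(m)a=f^0(ma)+f^1(d_e(a))(m)$ for $a\in T_0,m\in M$. Composition: $(gf)^0=g^0f^0$, $(gf)^1(v)=g^1(v)f^0+g^0f^1(v)-\sum g^1(v'')f^1(v')$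 where $d_e(v)=\sum v'\otimes v''$; identities are $(\mathrm{id},0)$. Matrices. A local basis of $M$ is $\mathscr B(M)=\bigcup_{x\in P}\mathscr B_x(M)$, $\mathscr B_x(M)=\{m^x_i:1\le i\le d_x\}$ a $\mathcal Q_x$-basis of $M_x$; the dimension vector is $(d_x=\dim_{\mathcal Q_x}M_x)_{x\in P}$. For $x>0$, $\hat u_{0,x}\in e_x{}^*Je_0$ is the element with $\hat u_{0,x}(e_{0,x})=e_0$, and $\mathscr M(M)_x=(M^x_{j,i})$ is the $d_0\times d_x$ matrix over $G$ with $m^x_iw_{1,2}\hat u_{0,x}=\sum_jm^0_jM^x_{j,i}$. *)

theory Defs
  imports
    "HOL-Algebra.Ring"
    "HOL-Computational_Algebra.Computational_Algebra"
    "HOL-Library.Function_Algebras"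
    "HOL-Library.FuncSet"
    "Jordan_Normal_Form.Determinant"
begin

section \<open>Equipped posets and pairs of fields\<close>

text \<open>\<open>lev x y\<close> is the unique \<open>l\<close> with \<open>x \<le>\<^sup>l y\<close>; it is meaningful only for \<open>(x, y) \<in> r\<close>.\<close>

definition p_equipped :: "nat \<Rightarrow> 'a set \<Rightarrow> 'a rel \<Rightarrow> ('a \<Rightarrow> 'a \<Rightarrow> nat) \<Rightarrow> bool" where
  "p_equipped p A r lev \<longleftrightarrow>
     finite A \<and> partial_order_on A r \<and>
     (\<forall>x y. (x, y) \<in> r \<longrightarrow> lev x y \<in> {1..p}) \<and>
     (\<forall>x y z. (x, y) \<in> r \<longrightarrow> (y, z) \<in> r \<longrightarrow> lev x z \<ge> min (lev x y + lev y z - 1) p)"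

text \<open>The fields \<open>F\<close> and \<open>G\<close> are the types \<open>'f\<close> and \<open>'g\<close>; \<open>F\<close> is regarded as a subfield of \<open>G\<close>
  through a field homomorphism \<open>\<iota>\<close>.\<close>

definition is_subfield :: "'g::field set \<Rightarrow> bool" where
  "is_subfield K \<longleftrightarrow> 0 \<in> K \<and> 1 \<in> K \<and>
     (\<forall>a\<in>K. \<forall>b\<in>K. a + b \<in> K \<and> a * b \<in> K) \<and> (\<forall>a\<in>K. - a \<in> K \<and> inverse a \<in> K)"

definition subfield_generated :: "'g::field set \<Rightarrow> 'g set" where
  "subfield_generated A = \<Inter>{K. is_subfield K \<and> A \<subseteq> K}"

definition extension_degree :: "('f::field \<Rightarrow> 'g::field) \<Rightarrow> nat" where
  "extension_degree \<iota> = vector_space.dim (\<lambda>a x. \<iota> a * x) (UNIV :: 'g set)"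

text \<open>Algebraicity, which is part of normality, is not repeated here: it is automatic for the
  extensions of finite degree considered below (\<open>vector_space.dim\<close> is \<open>0\<close> in the infinite
  case).\<close>

definition normal_extension :: "('f::field \<Rightarrow> 'g::field) \<Rightarrow> bool" where
  "normal_extension \<iota> \<longleftrightarrow>
     (\<forall>q. irreducible q \<longrightarrow> (\<exists>x. poly (map_poly \<iota> q) x = 0) \<longrightarrow>
        (\<exists>c as. map_poly \<iota> q = Polynomial.smult c (\<Prod>a\<leftarrow>as. [:- a, 1:])))"


section \<open>The poset \<open>P\<close> and the system \<open>\<Q>\<close>\<close>

datatype 'a pt = Bot | El 'a | Top

record ('a, 'f, 'g) eq_data =
  prm :: nat
  pts0 :: "'a set"
  ord0 :: "'a rel"
  lev0 :: "'a \<Rightarrow> 'a \<Rightarrow> nat"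
  emb :: "'f \<Rightarrow> 'g"
  xi :: 'g


definition pts :: "('a, 'f, 'g) eq_data \<Rightarrow> 'a pt set" where
  "pts D = {Bot, Top} \<union> El ` pts0 D"

definition ple :: "('a, 'f, 'g) eq_data \<Rightarrow> 'a pt \<Rightarrow> 'a pt \<Rightarrow> bool" where
  "ple D x y \<longleftrightarrow> x \<in> pts D \<and> y \<in> pts D \<and>
     (x = Bot \<or> y = Top \<or> (\<exists>a b. x = El a \<and> y = El b \<and> (a, b) \<in> ord0 D))"

definition pless :: "('a, 'f, 'g) eq_data \<Rightarrow> 'a pt \<Rightarrow> 'a pt \<Rightarrow> bool" where
  "pless D x y \<longleftrightarrow> ple D x y \<and> x \<noteq> y"

definition plev :: "('a, 'f, 'g) eq_data \<Rightarrow> 'a pt \<Rightarrow> 'a pt \<Rightarrow> nat" where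
  "plev D x y = (case (x, y) of (El a, El b) \<Rightarrow> lev0 D a b | _ \<Rightarrow> prm D)"

definition strong :: "('a, 'f, 'g) eq_data \<Rightarrow> 'a pt \<Rightarrow> bool" where
  "strong D x \<longleftrightarrow> plev D x x = prm D"

definition F_span_powers :: "('a, 'f::field, 'g::field) eq_data \<Rightarrow> nat \<Rightarrow> 'g set" where
  "F_span_powers D l = range (\<lambda>c. \<Sum>i<l. emb D (c i) * xi D ^ i)"

definition Qsys :: "('a, 'f::field, 'g::field) eq_data \<Rightarrow> 'a pt \<Rightarrow> 'a pt \<Rightarrow> 'g set" where
  "Qsys D x y = F_span_powers D (plev D x y)"


section \<open>The algebra \<open>\<Lambda> = S \<oplus> J\<close> and the dual bimodule \<open>\<^sup>*J\<close>\<close>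

text \<open>Addition of matrices, and of maps between them, is the pointwise one of function types.\<close>

type_synonym ('a, 'g) pmat = "'a pt \<Rightarrow> 'a pt \<Rightarrow> 'g"

definition Lam :: "('a, 'f::field, 'g::field) eq_data \<Rightarrow> ('a, 'g) pmat set" where
  "Lam D = {u. \<forall>x y. u x y \<in> (if ple D x y then Qsys D x y else {0})}"

definition mmul :: "('a, 'f, 'g::field) eq_data \<Rightarrow> ('a, 'g) pmat \<Rightarrow> ('a, 'g) pmat \<Rightarrow> ('a, 'g) pmat" where
  "mmul D u v = (\<lambda>x z. \<Sum>y\<in>pts D. u x y * v y z)"

text \<open>\<open>unit_mat x y c\<close> is \<open>e\<^bsub>x,y\<^esub> c\<close>.\<close>

definition unit_mat :: "'a pt \<Rightarrow> 'a pt \<Rightarrow> 'g::field \<Rightarrow> ('a, 'g) pmat" where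
  "unit_mat x y c = (\<lambda>i j. if i = x \<and> j = y then c else 0)"

definition idemp :: "'a pt \<Rightarrow> ('a, 'g::field) pmat" where
  "idemp x = unit_mat x x 1"

definition ehat :: "('a, 'f, 'g::field) eq_data \<Rightarrow> ('a, 'g) pmat" where
  "ehat D = (\<Sum>x\<in>pts D. idemp x) - idemp Bot"

definition Salg :: "('a, 'f::field, 'g::field) eq_data \<Rightarrow> ('a, 'g) pmat set" where
  "Salg D = {u \<in> Lam D. \<forall>x y. x \<noteq> y \<longrightarrow> u x y = 0}"

definition Jrad :: "('a, 'f::field, 'g::field) eq_data \<Rightarrow> ('a, 'g) pmat set" where
  "Jrad D = {u \<in> Lam D. \<forall>x. u x x = 0}"

text \<open>Elements of \<open>\<^sup>*J\<close> are maps on \<open>J\<close>, extended by \<open>0\<close> to all matrices.\<close>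

definition dualJ :: "('a, 'f::field, 'g::field) eq_data \<Rightarrow> (('a, 'g) pmat \<Rightarrow> ('a, 'g) pmat) set" where
  "dualJ D = {\<gamma>. (\<forall>u\<in>Jrad D. \<gamma> u \<in> Salg D) \<and> (\<forall>u. u \<notin> Jrad D \<longrightarrow> \<gamma> u = 0) \<and>
     (\<forall>u\<in>Jrad D. \<forall>v\<in>Jrad D. \<gamma> (u + v) = \<gamma> u + \<gamma> v) \<and>
     (\<forall>s\<in>Salg D. \<forall>u\<in>Jrad D. \<gamma> (mmul D s u) = mmul D s (\<gamma> u))}"

definition dual_lact ::
  "('a, 'f::field, 'g::field) eq_data \<Rightarrow> ('a, 'g) pmat \<Rightarrow> (('a, 'g) pmat \<Rightarrow> ('a, 'g) pmat)
     \<Rightarrow> ('a, 'g) pmat \<Rightarrow> ('a, 'g) pmat" where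
  "dual_lact D s \<gamma> = (\<lambda>u. if u \<in> Jrad D then \<gamma> (mmul D u s) else 0)"

definition dual_ract ::
  "('a, 'f::field, 'g::field) eq_data \<Rightarrow> (('a, 'g) pmat \<Rightarrow> ('a, 'g) pmat) \<Rightarrow> ('a, 'g) pmat
     \<Rightarrow> ('a, 'g) pmat \<Rightarrow> ('a, 'g) pmat" where
  "dual_ract D \<gamma> s = (\<lambda>u. mmul D (\<gamma> u) s)"

text \<open>A choice of bases is a family \<open>B\<close>, where \<open>B y x\<close> is a left \<open>\<Q>\<^sub>y\<close>-basis of
  \<open>e\<^sub>yJe\<^sub>x\<close> for \<open>y < x\<close>; its members are indexed by the triples \<open>(y, x, u)\<close> with \<open>u \<in> B y x\<close>.\<close>

definition is_J_bases ::
  "('a, 'f::field, 'g::field) eq_data \<Rightarrow> ('a pt \<Rightarrow> 'a pt \<Rightarrow> ('a, 'g) pmat set) \<Rightarrow> bool" where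
  "is_J_bases D B \<longleftrightarrow>
     (\<forall>y x. pless D y x \<longrightarrow>
        (let V = (\<lambda>u. mmul D (mmul D (idemp y) u) (idemp x)) ` Jrad D
         in finite (B y x) \<and> B y x \<subseteq> V \<and>
            (\<forall>v\<in>V. \<exists>!c. c \<in> B y x \<rightarrow>\<^sub>E Qsys D y y \<and>
               v = (\<Sum>b\<in>B y x. mmul D (unit_mat y y (c b)) b))))"

definition dual_elem ::
  "('a, 'f::field, 'g::field) eq_data \<Rightarrow> ('a pt \<Rightarrow> 'a pt \<Rightarrow> ('a, 'g) pmat set)
     \<Rightarrow> 'a pt \<times> 'a pt \<times> ('a, 'g) pmat \<Rightarrow> ('a, 'g) pmat \<Rightarrow> ('a, 'g) pmat" where
  "dual_elem D B = (\<lambda>(y, x, u). THE \<gamma>. \<gamma> \<in> dualJ D \<and>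
     (\<forall>y' x' v. pless D y' x' \<longrightarrow> v \<in> B y' x' \<longrightarrow> \<gamma> v = (if v = u then idemp y else 0)))"

text \<open>The basis elements in \<open>\<^bold>e J \<^bold>e\<close> and in \<open>e\<^sub>0 J \<^bold>e\<close>, where \<open>\<^bold>e = 1 - e\<^sub>0\<close>.\<close>

definition idx1 ::
  "('a, 'f, 'g) eq_data \<Rightarrow> ('a pt \<Rightarrow> 'a pt \<Rightarrow> ('a, 'g) pmat set) \<Rightarrow> ('a pt \<times> 'a pt \<times> ('a, 'g) pmat) set" where
  "idx1 D B = {(y, x, u). pless D Bot y \<and> pless D y x \<and> u \<in> B y x}"

definition idx0 ::
  "('a, 'f, 'g) eq_data \<Rightarrow> ('a pt \<Rightarrow> 'a pt \<Rightarrow> ('a, 'g) pmat set) \<Rightarrow> ('a pt \<times> 'a pt \<times> ('a, 'g) pmat) set" where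
  "idx0 D B = {(y, x, u). y = Bot \<and> pless D y x \<and> u \<in> B y x}"


section \<open>Tensor algebras\<close>

record ('r, 'w) bimodule = "'w partial_object" +
  wadd :: "'w \<Rightarrow> 'w \<Rightarrow> 'w"
  lact :: "'r \<Rightarrow> 'w \<Rightarrow> 'w"
  ract :: "'w \<Rightarrow> 'r \<Rightarrow> 'w"

text \<open>The tensor algebra \<open>T\<^sub>R(W)\<close> is presented as the ring generated by \<open>R\<close> and \<open>W\<close> such that
  \<open>R \<rightarrow> T\<^sub>R(W)\<close> is a ring homomorphism and \<open>W \<rightarrow> T\<^sub>R(W)\<close> is a homomorphism of \<open>R\<close>-bimodules.
  Its elements are classes of ring terms in the generators.\<close>

datatype ('r, 'w) tterm =
  Scal 'r | Gen 'w | Add "('r, 'w) tterm" "('r, 'w) tterm" | Mul "('r, 'w) tterm" "('r, 'w) tterm"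

inductive_set tterms :: "('r, 'c) ring_scheme \<Rightarrow> ('r, 'w) bimodule \<Rightarrow> ('r, 'w) tterm set"
  for R and W where
  Scal: "r \<in> carrier R \<Longrightarrow> Scal r \<in> tterms R W"
| Gen: "w \<in> carrier W \<Longrightarrow> Gen w \<in> tterms R W"
| Add: "s \<in> tterms R W \<Longrightarrow> t \<in> tterms R W \<Longrightarrow> Add s t \<in> tterms R W"
| Mul: "s \<in> tterms R W \<Longrightarrow> t \<in> tterms R W \<Longrightarrow> Mul s t \<in> tterms R W"

inductive teq :: "('r, 'c) ring_scheme \<Rightarrow> ('r, 'w) bimodule \<Rightarrow> ('r, 'w) tterm \<Rightarrow> ('r, 'w) tterm \<Rightarrow> bool"
  for R and W where
  refl: "s \<in> tterms R W \<Longrightarrow> teq R W s s"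
| sym: "teq R W s t \<Longrightarrow> teq R W t s"
| trans: "teq R W s t \<Longrightarrow> teq R W t u \<Longrightarrow> teq R W s u"
| add_cong: "teq R W s s' \<Longrightarrow> teq R W t t' \<Longrightarrow> teq R W (Add s t) (Add s' t')"
| mul_cong: "teq R W s s' \<Longrightarrow> teq R W t t' \<Longrightarrow> teq R W (Mul s t) (Mul s' t')"
| add_assoc: "s \<in> tterms R W \<Longrightarrow> t \<in> tterms R W \<Longrightarrow> u \<in> tterms R W \<Longrightarrow>
    teq R W (Add (Add s t) u) (Add s (Add t u))"
| add_comm: "s \<in> tterms R W \<Longrightarrow> t \<in> tterms R W \<Longrightarrow> teq R W (Add s t) (Add t s)"
| add_zero: "s \<in> tterms R W \<Longrightarrow> teq R W (Add (Scal \<zero>\<^bsub>R\<^esub>) s) s"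
| add_neg: "s \<in> tterms R W \<Longrightarrow> teq R W (Add (Mul (Scal (\<ominus>\<^bsub>R\<^esub> \<one>\<^bsub>R\<^esub>)) s) s) (Scal \<zero>\<^bsub>R\<^esub>)"
| mul_assoc: "s \<in> tterms R W \<Longrightarrow> t \<in> tterms R W \<Longrightarrow> u \<in> tterms R W \<Longrightarrow>
    teq R W (Mul (Mul s t) u) (Mul s (Mul t u))"
| one_mul: "s \<in> tterms R W \<Longrightarrow> teq R W (Mul (Scal \<one>\<^bsub>R\<^esub>) s) s"
| mul_one: "s \<in> tterms R W \<Longrightarrow> teq R W (Mul s (Scal \<one>\<^bsub>R\<^esub>)) s"
| distrib_right: "s \<in> tterms R W \<Longrightarrow> t \<in> tterms R W \<Longrightarrow> u \<in> tterms R W \<Longrightarrow>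
    teq R W (Mul (Add s t) u) (Add (Mul s u) (Mul t u))"
| distrib_left: "s \<in> tterms R W \<Longrightarrow> t \<in> tterms R W \<Longrightarrow> u \<in> tterms R W \<Longrightarrow>
    teq R W (Mul s (Add t u)) (Add (Mul s t) (Mul s u))"
| scal_add: "a \<in> carrier R \<Longrightarrow> b \<in> carrier R \<Longrightarrow> teq R W (Scal (a \<oplus>\<^bsub>R\<^esub> b)) (Add (Scal a) (Scal b))"
| scal_mul: "a \<in> carrier R \<Longrightarrow> b \<in> carrier R \<Longrightarrow> teq R W (Scal (a \<otimes>\<^bsub>R\<^esub> b)) (Mul (Scal a) (Scal b))"
| gen_add: "v \<in> carrier W \<Longrightarrow> w \<in> carrier W \<Longrightarrow> teq R W (Gen (wadd W v w)) (Add (Gen v) (Gen w))"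
| gen_lact: "a \<in> carrier R \<Longrightarrow> w \<in> carrier W \<Longrightarrow> teq R W (Gen (lact W a w)) (Mul (Scal a) (Gen w))"
| gen_ract: "a \<in> carrier R \<Longrightarrow> w \<in> carrier W \<Longrightarrow> teq R W (Gen (ract W w a)) (Mul (Gen w) (Scal a))"

definition tclass :: "('r, 'c) ring_scheme \<Rightarrow> ('r, 'w) bimodule \<Rightarrow> ('r, 'w) tterm \<Rightarrow> ('r, 'w) tterm set" where
  "tclass R W s = {t. teq R W s t}"

definition tensor_algebra :: "('r, 'c) ring_scheme \<Rightarrow> ('r, 'w) bimodule \<Rightarrow> ('r, 'w) tterm set ring" where
  "tensor_algebra R W =
     \<lparr> carrier = tclass R W ` tterms R W,
       monoid.mult = (\<lambda>X Y. {u. \<exists>s\<in>X. \<exists>t\<in>Y. teq R W (Mul s t) u}),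
       one = tclass R W (Scal \<one>\<^bsub>R\<^esub>),
       zero = tclass R W (Scal \<zero>\<^bsub>R\<^esub>),
       add = (\<lambda>X Y. {u. \<exists>s\<in>X. \<exists>t\<in>Y. teq R W (Add s t) u}) \<rparr>"

text \<open>The grading of \<open>T\<^sub>R(W)\<close> with \<open>R\<close> in degree \<open>0\<close> induced by a grading \<open>Wg\<close> of \<open>W\<close>.\<close>

inductive homog :: "('r, 'c) ring_scheme \<Rightarrow> (nat \<Rightarrow> 'w set) \<Rightarrow> nat \<Rightarrow> ('r, 'w) tterm \<Rightarrow> bool"
  for R and Wg where
  "r \<in> carrier R \<Longrightarrow> homog R Wg 0 (Scal r)"
| "w \<in> Wg k \<Longrightarrow> homog R Wg k (Gen w)"
| "homog R Wg k s \<Longrightarrow> homog R Wg k t \<Longrightarrow> homog R Wg k (Add s t)"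
| "homog R Wg k s \<Longrightarrow> homog R Wg l t \<Longrightarrow> homog R Wg (k + l) (Mul s t)"


section \<open>The ditalgebra \<open>\<D>\<^sup>e\<close>\<close>

text \<open>The pair \<open>(a, b)\<close> stands for \<open>w\<^sub>1a + w\<^sub>2b\<close> in \<open>R\<^sup>e\<close>, and \<open>(\<gamma>, \<delta>)\<close> stands for
  \<open>w\<^bsub>1,2\<^esub>\<gamma> + w\<^sub>1\<delta>\<close> in \<open>W\<^sub>0 \<oplus> W\<^sub>1\<close>.\<close>

type_synonym ('a, 'g) Re_elem = "('a, 'g) pmat \<times> ('a, 'g) pmat"
type_synonym ('a, 'g) J_dual = "('a, 'g) pmat \<Rightarrow> ('a, 'g) pmat"
type_synonym ('a, 'g) W_elem = "('a, 'g) J_dual \<times> ('a, 'g) J_dual"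
type_synonym ('a, 'g) T_elem = "(('a, 'g) Re_elem, ('a, 'g) W_elem) tterm set"

definition Re :: "('a, 'f::field, 'g::field) eq_data \<Rightarrow> ('a, 'g) Re_elem ring" where
  "Re D =
     \<lparr> carrier = (mmul D (ehat D) ` Salg D) \<times> (mmul D (idemp Bot) ` Salg D),
       monoid.mult = (\<lambda>(a, b) (a', b'). (mmul D a a', mmul D b b')),
       one = (ehat D, idemp Bot),
       zero = (0, 0),
       add = (\<lambda>(a, b) (a', b'). (a + a', b + b')) \<rparr>"

definition W0 :: "('a, 'f::field, 'g::field) eq_data \<Rightarrow> ('a, 'g) J_dual set" where
  "W0 D = (\<lambda>\<gamma>. dual_ract D (dual_lact D (ehat D) \<gamma>) (idemp Bot)) ` dualJ D"

definition W1 :: "('a, 'f::field, 'g::field) eq_data \<Rightarrow> ('a, 'g) J_dual set" where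
  "W1 D = (\<lambda>\<gamma>. dual_ract D (dual_lact D (ehat D) \<gamma>) (ehat D)) ` dualJ D"

definition Wbim :: "('a, 'f::field, 'g::field) eq_data \<Rightarrow> (('a, 'g) Re_elem, ('a, 'g) W_elem) bimodule" where
  "Wbim D =
     \<lparr> carrier = W0 D \<times> W1 D,
       wadd = (\<lambda>(\<gamma>, \<delta>) (\<gamma>', \<delta>'). (\<gamma> + \<gamma>', \<delta> + \<delta>')),
       lact = (\<lambda>(a, b) (\<gamma>, \<delta>). (dual_lact D a \<gamma>, dual_lact D a \<delta>)),
       ract = (\<lambda>(\<gamma>, \<delta>) (a, b). (dual_ract D \<gamma> b, dual_ract D \<delta> a)) \<rparr>"

definition Wgrade :: "('a, 'f::field, 'g::field) eq_data \<Rightarrow> nat \<Rightarrow> ('a, 'g) W_elem set" where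
  "Wgrade D k = (if k = 0 then W0 D \<times> {0} else if k = 1 then {0} \<times> W1 D else {(0, 0)})"

definition Talg :: "('a, 'f::field, 'g::field) eq_data \<Rightarrow> ('a, 'g) T_elem ring" where
  "Talg D = tensor_algebra (Re D) (Wbim D)"

definition Tdeg :: "('a, 'f::field, 'g::field) eq_data \<Rightarrow> nat \<Rightarrow> ('a, 'g) T_elem set" where
  "Tdeg D k = tclass (Re D) (Wbim D) ` {t. homog (Re D) (Wgrade D) k t}"

definition inR :: "('a, 'f::field, 'g::field) eq_data \<Rightarrow> ('a, 'g) Re_elem \<Rightarrow> ('a, 'g) T_elem" where
  "inR D r = tclass (Re D) (Wbim D) (Scal r)"

definition w12 :: "('a, 'f::field, 'g::field) eq_data \<Rightarrow> ('a, 'g) J_dual \<Rightarrow> ('a, 'g) T_elem" where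
  "w12 D \<gamma> = tclass (Re D) (Wbim D) (Gen (\<gamma>, 0))"

definition w1 :: "('a, 'f::field, 'g::field) eq_data \<Rightarrow> ('a, 'g) J_dual \<Rightarrow> ('a, 'g) T_elem" where
  "w1 D \<gamma> = tclass (Re D) (Wbim D) (Gen (0, \<gamma>))"

text \<open>In the sums defining the differential, the index \<open>i\<close> (resp. \<open>j\<close>) only runs over those
  \<open>p\<^sub>i\<close> (resp. \<open>p\<^sub>j\<close>) for which \<open>w\<^sub>1\<gamma>\<^sub>i\<close> (resp. \<open>w\<^bsub>1,2\<^esub>\<gamma>\<^sub>j\<close>, \<open>w\<^sub>1\<gamma>\<^sub>j\<close>) makes sense; for the
  others, \<open>\<gamma>(p\<^sub>jp\<^sub>i) = 0\<close>. The terms \<open>w\<^bsub>1,2\<^esub>\<gamma>\<^sub>j\<gamma>(p\<^sub>jp\<^sub>i)\<close> and \<open>w\<^sub>1\<gamma>\<^sub>j\<gamma>(p\<^sub>jp\<^sub>i)\<close> use the right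
  action of \<open>\<gamma>(p\<^sub>jp\<^sub>i) \<in> S\<close> on \<open>\<gamma>\<^sub>j\<close>.\<close>

definition is_differential ::
  "('a, 'f::field, 'g::field) eq_data \<Rightarrow> ('a pt \<Rightarrow> 'a pt \<Rightarrow> ('a, 'g) pmat set)
     \<Rightarrow> (('a, 'g) T_elem \<Rightarrow> ('a, 'g) T_elem) \<Rightarrow> bool" where
  "is_differential D B d \<longleftrightarrow>
     d \<in> carrier (Talg D) \<rightarrow>\<^sub>E carrier (Talg D) \<and>
     (\<forall>a\<in>carrier (Talg D). \<forall>b\<in>carrier (Talg D). d (a \<oplus>\<^bsub>Talg D\<^esub> b) = d a \<oplus>\<^bsub>Talg D\<^esub> d b) \<and>
     (\<forall>k. d ` Tdeg D k \<subseteq> Tdeg D (k + 1)) \<and>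
     (\<forall>r\<in>carrier (Re D). d (inR D r) = \<zero>\<^bsub>Talg D\<^esub>) \<and>
     (\<forall>k. \<forall>a\<in>Tdeg D k. \<forall>b\<in>carrier (Talg D).
        d (a \<otimes>\<^bsub>Talg D\<^esub> b) = d a \<otimes>\<^bsub>Talg D\<^esub> b \<oplus>\<^bsub>Talg D\<^esub>
          (if even k then a \<otimes>\<^bsub>Talg D\<^esub> d b else \<ominus>\<^bsub>Talg D\<^esub> (a \<otimes>\<^bsub>Talg D\<^esub> d b))) \<and>
     (\<forall>\<gamma>\<in>W0 D. d (w12 D \<gamma>) =
        \<ominus>\<^bsub>Talg D\<^esub> (\<Oplus>\<^bsub>Talg D\<^esub>i\<in>idx1 D B. \<Oplus>\<^bsub>Talg D\<^esub>j\<in>idx0 D B.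
          w1 D (dual_elem D B i) \<otimes>\<^bsub>Talg D\<^esub>
          w12 D (dual_ract D (dual_elem D B j) (\<gamma> (mmul D (snd (snd j)) (snd (snd i))))))) \<and>
     (\<forall>\<gamma>\<in>W1 D. d (w1 D \<gamma>) =
        \<ominus>\<^bsub>Talg D\<^esub> (\<Oplus>\<^bsub>Talg D\<^esub>i\<in>idx1 D B. \<Oplus>\<^bsub>Talg D\<^esub>j\<in>idx1 D B.
          w1 D (dual_elem D B i) \<otimes>\<^bsub>Talg D\<^esub>
          w1 D (dual_ract D (dual_elem D B j) (\<gamma> (mmul D (snd (snd j)) (snd (snd i)))))))"

definition de ::
  "('a, 'f::field, 'g::field) eq_data \<Rightarrow> ('a pt \<Rightarrow> 'a pt \<Rightarrow> ('a, 'g) pmat set)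
     \<Rightarrow> ('a, 'g) T_elem \<Rightarrow> ('a, 'g) T_elem" where
  "de D B = (THE d. is_differential D B d)"


section \<open>The category \<open>mod \<D>\<^sup>e\<close>\<close>

text \<open>An object is an abelian group \<open>'m\<close> with an action \<open>act m a = m a\<close>; only the values for
  \<open>a \<in> T\<^sub>0\<close> matter. Its \<open>F\<close>-structure is the one given by \<open>F \<subseteq> R\<^sup>e\<close>.\<close>

type_synonym ('m, 'a, 'g) action = "'m \<Rightarrow> ('a, 'g) T_elem \<Rightarrow> 'm"

definition fscale :: "('a, 'f::field, 'g::field) eq_data \<Rightarrow> ('m, 'a, 'g) action \<Rightarrow> 'f \<Rightarrow> 'm \<Rightarrow> 'm" where
  "fscale D act c m = act m (inR D
     (\<Sum>x\<in>pts D - {Bot}. unit_mat x x (emb D c), unit_mat Bot Bot (emb D c)))"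

definition is_object :: "('a, 'f::field, 'g::field) eq_data \<Rightarrow> ('m::ab_group_add, 'a, 'g) action \<Rightarrow> bool" where
  "is_object D act \<longleftrightarrow>
     (\<forall>m n. \<forall>a\<in>Tdeg D 0. act (m + n) a = act m a + act n a) \<and>
     (\<forall>m. \<forall>a\<in>Tdeg D 0. \<forall>b\<in>Tdeg D 0. act m (a \<oplus>\<^bsub>Talg D\<^esub> b) = act m a + act m b) \<and>
     (\<forall>m. \<forall>a\<in>Tdeg D 0. \<forall>b\<in>Tdeg D 0. act m (a \<otimes>\<^bsub>Talg D\<^esub> b) = act (act m a) b) \<and>
     (\<forall>m. act m \<one>\<^bsub>Talg D\<^esub> = m) \<and>
     (\<exists>A. finite A \<and> module.span (fscale D act) A = UNIV)"

text \<open>In a morphism \<open>f = (f\<^sup>0, f\<^sup>1)\<close>, the map \<open>f\<^sup>1\<close> on \<open>T\<^sub>1\<close> is extended by \<open>0\<close> to all sets of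
  terms.\<close>

type_synonym ('m, 'n, 'a, 'g) mor = "('m \<Rightarrow> 'n) \<times> (('a, 'g) T_elem \<Rightarrow> 'm \<Rightarrow> 'n)"

definition is_morphism ::
  "('a, 'f::field, 'g::field) eq_data \<Rightarrow> ('a pt \<Rightarrow> 'a pt \<Rightarrow> ('a, 'g) pmat set)
     \<Rightarrow> ('m::ab_group_add, 'a, 'g) action \<Rightarrow> ('n::ab_group_add, 'a, 'g) action
     \<Rightarrow> ('m, 'n, 'a, 'g) mor \<Rightarrow> bool" where
  "is_morphism D B actM actN = (\<lambda>(f0, f1).
     (\<forall>m m'. f0 (m + m') = f0 m + f0 m') \<and>
     (\<forall>m. \<forall>r\<in>carrier (Re D). f0 (actM m (inR D r)) = actN (f0 m) (inR D r)) \<and>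
     (\<forall>v\<in>Tdeg D 1. module_hom (fscale D actM) (fscale D actN) (f1 v)) \<and>
     (\<forall>v. v \<notin> Tdeg D 1 \<longrightarrow> f1 v = (\<lambda>_. 0)) \<and>
     (\<forall>v\<in>Tdeg D 1. \<forall>v'\<in>Tdeg D 1. \<forall>m. f1 (v \<oplus>\<^bsub>Talg D\<^esub> v') m = f1 v m + f1 v' m) \<and>
     (\<forall>a\<in>Tdeg D 0. \<forall>v\<in>Tdeg D 1. \<forall>m. f1 (a \<otimes>\<^bsub>Talg D\<^esub> v) m = f1 v (actM m a)) \<and>
     (\<forall>a\<in>Tdeg D 0. \<forall>v\<in>Tdeg D 1. \<forall>m. f1 (v \<otimes>\<^bsub>Talg D\<^esub> a) m = actN (f1 v m) a) \<and>
     (\<forall>a\<in>Tdeg D 0. \<forall>m. actN (f0 m) a = f0 (actM m a) + f1 (de D B a) m))"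

text \<open>\<open>cross D g1 f1 w\<close> is \<open>\<Sum> g\<^sup>1(v'') f\<^sup>1(v')\<close> for \<open>w = \<Sum> v' \<otimes> v''\<close> with \<open>v', v'' \<in> T\<^sub>1\<close>; it does
  not depend on the expression chosen for \<open>w\<close>, since \<open>f\<^sup>1\<close> and \<open>g\<^sup>1\<close> are bimodule morphisms.\<close>

definition cross ::
  "('a, 'f::field, 'g::field) eq_data \<Rightarrow> (('a, 'g) T_elem \<Rightarrow> 'n \<Rightarrow> 'l::ab_group_add)
     \<Rightarrow> (('a, 'g) T_elem \<Rightarrow> 'm \<Rightarrow> 'n) \<Rightarrow> ('a, 'g) T_elem \<Rightarrow> 'm \<Rightarrow> 'l" where
  "cross D g1 f1 w = (THE h. \<exists>(n::nat) v' v''.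
     v' \<in> {..<n} \<rightarrow> Tdeg D 1 \<and> v'' \<in> {..<n} \<rightarrow> Tdeg D 1 \<and>
     w = (\<Oplus>\<^bsub>Talg D\<^esub>k\<in>{..<n}. v' k \<otimes>\<^bsub>Talg D\<^esub> v'' k) \<and>
     h = (\<lambda>m. \<Sum>k<n. g1 (v'' k) (f1 (v' k) m)))"

definition comp_mor ::
  "('a, 'f::field, 'g::field) eq_data \<Rightarrow> ('a pt \<Rightarrow> 'a pt \<Rightarrow> ('a, 'g) pmat set)
     \<Rightarrow> ('n, 'l::ab_group_add, 'a, 'g) mor \<Rightarrow> ('m, 'n, 'a, 'g) mor \<Rightarrow> ('m, 'l, 'a, 'g) mor" where
  "comp_mor D B = (\<lambda>(g0, g1) (f0, f1).
     (g0 \<circ> f0,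
      \<lambda>v m. if v \<in> Tdeg D 1 then g1 v (f0 m) + g0 (f1 v m) - cross D g1 f1 (de D B v) m else 0))"

definition id_mor :: "('m::ab_group_add, 'm, 'a, 'g) mor" where
  "id_mor = (id, \<lambda>_ _. 0)"

definition isomorphic ::
  "('a, 'f::field, 'g::field) eq_data \<Rightarrow> ('a pt \<Rightarrow> 'a pt \<Rightarrow> ('a, 'g) pmat set)
     \<Rightarrow> ('m::ab_group_add, 'a, 'g) action \<Rightarrow> ('n::ab_group_add, 'a, 'g) action \<Rightarrow> bool" where
  "isomorphic D B actM actN \<longleftrightarrow>
     (\<exists>f g. is_morphism D B actM actN f \<and> is_morphism D B actN actM g \<and>
        comp_mor D B g f = id_mor \<and> comp_mor D B f g = id_mor)"


section \<open>Local bases, dimension vectors and matrices\<close>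

text \<open>\<open>unit_at D x c\<close> is \<open>w\<^sub>1e\<^sub>xc\<close> for \<open>x > 0\<close> and \<open>w\<^sub>2e\<^sub>0c\<close> for \<open>x = 0\<close>; through these elements \<open>\<Q>\<^sub>x\<close>
  acts on \<open>M\<^sub>x\<close>.\<close>

definition unit_at :: "('a, 'f::field, 'g::field) eq_data \<Rightarrow> 'a pt \<Rightarrow> 'g \<Rightarrow> ('a, 'g) T_elem" where
  "unit_at D x c = inR D (if x = Bot then (0, unit_mat x x c) else (unit_mat x x c, 0))"

definition component ::
  "('a, 'f::field, 'g::field) eq_data \<Rightarrow> ('m, 'a, 'g) action \<Rightarrow> 'a pt \<Rightarrow> 'm set" where
  "component D act x = range (\<lambda>m. act m (unit_at D x 1))"

definition is_Q_basis ::
  "('a, 'f::field, 'g::field) eq_data \<Rightarrow> ('m::ab_group_add, 'a, 'g) action \<Rightarrow> 'a pt \<Rightarrow> 'm list \<Rightarrow> bool" where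
  "is_Q_basis D act x bs \<longleftrightarrow>
     set bs \<subseteq> component D act x \<and>
     (\<forall>m\<in>component D act x. \<exists>!c. c \<in> {..<length bs} \<rightarrow>\<^sub>E Qsys D x x \<and>
        m = (\<Sum>i<length bs. act (bs ! i) (unit_at D x (c i))))"

definition is_local_basis ::
  "('a, 'f::field, 'g::field) eq_data \<Rightarrow> ('m::ab_group_add, 'a, 'g) action \<Rightarrow> ('a pt \<Rightarrow> 'm list) \<Rightarrow> bool" where
  "is_local_basis D act \<B> \<longleftrightarrow> (\<forall>x\<in>pts D. is_Q_basis D act x (\<B> x))"

definition dimvec :: "('a, 'f::field, 'g::field) eq_data \<Rightarrow> ('m::ab_group_add, 'a, 'g) action \<Rightarrow> 'a pt \<Rightarrow> nat" where
  "dimvec D act x = length (SOME bs. is_Q_basis D act x bs)"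

definition u_hat :: "('a, 'f::field, 'g::field) eq_data \<Rightarrow> 'a pt \<Rightarrow> ('a, 'g) J_dual" where
  "u_hat D x = (THE \<gamma>. \<gamma> \<in> (\<lambda>\<delta>. dual_ract D (dual_lact D (idemp x) \<delta>) (idemp Bot)) ` dualJ D \<and>
     \<gamma> (unit_mat Bot x 1) = idemp Bot)"

definition matrix_of ::
  "('a, 'f::field, 'g::field) eq_data \<Rightarrow> ('m::ab_group_add, 'a, 'g) action \<Rightarrow> ('a pt \<Rightarrow> 'm list)
     \<Rightarrow> 'a pt \<Rightarrow> 'g mat" where
  "matrix_of D act \<B> x = (THE A. A \<in> carrier_mat (length (\<B> Bot)) (length (\<B> x)) \<and>
     (\<forall>i<length (\<B> x). act (\<B> x ! i) (w12 D (u_hat D x)) =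
        (\<Sum>j<length (\<B> Bot). act (\<B> Bot ! j) (unit_at D Bot (A $$ (j, i))))))"

text \<open>The sum of a finite family of matrices of a given size; matrices of varying sizes do not form
  a monoid with respect to addition.\<close>

definition mat_sum :: "nat \<Rightarrow> nat \<Rightarrow> ('i \<Rightarrow> 'g::comm_monoid_add mat) \<Rightarrow> 'i set \<Rightarrow> 'g mat" where
  "mat_sum n k A I = mat n k (\<lambda>ij. \<Sum>y\<in>I. A y $$ ij)"

end

(* By the universal property of the tensor algebra, a morphism M -> N of mod D^e is determined by
   f^0 and by the maps f^1(w_1 gamma). Expanding f^1 along the dual basis, such data amount to a
   block triangular matrix X over P, with blocks X_{y,x} over Q_{y,x} for y = x and for 0 < y < x:
   the diagonal blocks give f^0 and the others give f^1. The dual basis identity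
   sum_i (p_i delta)(a gamma_i(c)) = delta(ac) turns the compatibility condition on the arrows
   w_{1,2} gamma into X_0 M_x = N_x X_x + sum_{0<y<x} N_y X_{y,x}, and the composition law into the
   product of matrices. Since a block triangular matrix is invertible within its class as soon as its
   diagonal blocks are, isomorphisms correspond to solutions with invertible diagonal blocks; the
   matrices of the theorem are T_0 = X_0^{-1}, T_x = X_x and T_{yx} = X_{y,x}. *)

theory Submission
  imports Defs "HOL-Library.Product_Plus"
begin

section \<open>The system \<open>\<Q>\<close>\<close>

text \<open>The tensor algebra is given by generators and relations, and \<open>de\<close>,
  \<open>cross\<close>, \<open>u_hat\<close>, \<open>matrix_of\<close> and the dual basis are
  definite descriptions, so existence and uniqueness come before any computation. Two constructions
  carry this. The differential is built on terms as a derivation twisted by the parity automorphism: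
  an inhomogeneous term has no degree to put into a sign, but the automorphism is defined on all
  terms. It descends to T because its values on W_0 and W_1 form bimodule maps; left linearity over
  S is the delicate point, as the bases of J are not compatible with right multiplication by S. The
  sum defining \<open>cross\<close> depends on a chosen expression w = \<Sum> v' v''. Letting T act
  on M \<oplus> N \<oplus> L, with w_1\<delta> shifting one summand, exhibits it as the entry M -> L
  of the action of w, hence as a function of w; a single shift extends bimodule maps from W_1 to
  T_1. Finally, the inverse of a block triangular matrix must again have its blocks in the spans
  Q_{y,x}, so it is computed block by block along the order, starting from inverses of the diagonal
  blocks, taken over F at weak points.\<close>

locale eq_system =
  fixes D :: "('a, 'f::field, 'g::field) eq_data"
  assumes prime_prm: "prime (prm D)"
    and equipped: "p_equipped (prm D) (pts0 D) (ord0 D) (lev0 D)"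
    and emb_hom: "field_hom (emb D)"
    and generated: "subfield_generated (range (emb D) \<union> {xi D}) = UNIV"
    and xi_power: "xi D ^ prm D \<in> range (emb D)"
begin

abbreviation "P \<equiv> pts D"
abbreviation "Q \<equiv> Qsys D"

sublocale emb: field_hom "emb D" by (rule emb_hom)

lemma prm_gt_1: "prm D > 1"
  using prime_prm by (rule prime_gt_1_nat)

lemma F_span_0 [simp]: "0 \<in> F_span_powers D l"
  unfolding F_span_powers_def by (rule image_eqI[of _ _ "\<lambda>_. 0"]) auto

lemma F_span_add:
  assumes "a \<in> F_span_powers D l" "b \<in> F_span_powers D l"
  shows "a + b \<in> F_span_powers D l"
proof -
  obtain c d where "a = (\<Sum>i<l. emb D (c i) * xi D ^ i)" "b = (\<Sum>i<l. emb D (d i) * xi D ^ i)"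
    using assms unfolding F_span_powers_def by auto
  then have "a + b = (\<Sum>i<l. emb D (c i + d i) * xi D ^ i)"
    by (simp add: emb.hom_add sum.distrib algebra_simps)
  then show ?thesis unfolding F_span_powers_def by auto
qed

lemma F_span_scale:
  assumes "a \<in> F_span_powers D l"
  shows "emb D c * a \<in> F_span_powers D l"
proof -
  obtain d where "a = (\<Sum>i<l. emb D (d i) * xi D ^ i)"
    using assms unfolding F_span_powers_def by auto
  then have "emb D c * a = (\<Sum>i<l. emb D (c * d i) * xi D ^ i)"
    by (simp add: emb.hom_mult sum_distrib_left algebra_simps)
  then show ?thesis unfolding F_span_powers_def by auto
qed

lemma F_span_minus: "a \<in> F_span_powers D l \<Longrightarrow> - a \<in> F_span_powers D l"
  using F_span_scale[of a l "-1"] by (simp add: emb.hom_uminus)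

lemma F_span_sum: "(\<And>i. i \<in> I \<Longrightarrow> f i \<in> F_span_powers D l) \<Longrightarrow> sum f I \<in> F_span_powers D l"
  by (induction I rule: infinite_finite_induct) (auto intro: F_span_add)

lemma xi_power_in_F_span: "k < l \<Longrightarrow> xi D ^ k \<in> F_span_powers D l"
  unfolding F_span_powers_def
  by (rule image_eqI[of _ _ "\<lambda>i. if i = k then 1 else 0"])
     (auto simp: if_distrib[of "emb D"] if_distrib[of "\<lambda>a. a * b" for b] sum.delta cong: if_cong)

text \<open>Induction over the span: the generators \<open>emb D c * xi D ^ i\<close> already carry
  their scalars, so closure under addition suffices.\<close>

lemma F_span_subset:
  assumes zero: "0 \<in> A" and add: "\<And>a b. a \<in> A \<Longrightarrow> b \<in> A \<Longrightarrow> a + b \<in> A"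
    and gen: "\<And>c i. i < l \<Longrightarrow> emb D c * xi D ^ i \<in> A"
  shows "F_span_powers D l \<subseteq> A"
proof -
  have "(\<Sum>i<k. emb D (c i) * xi D ^ i) \<in> A" if "k \<le> l" for c k
    using that by (induction k) (auto simp: zero intro!: add gen)
  then show ?thesis unfolding F_span_powers_def by auto
qed

lemma F_span_mono: "l \<le> n \<Longrightarrow> F_span_powers D l \<subseteq> F_span_powers D n"
  by (rule F_span_subset) (auto intro!: F_span_add F_span_scale xi_power_in_F_span)

text \<open>Since \<xi>^p lies in F, the exponent may be reduced modulo p at the cost of a
  scalar.\<close>

lemma xi_power_in_F_span_prm: "xi D ^ k \<in> F_span_powers D (prm D)"
proof -
  obtain c where c: "xi D ^ prm D = emb D c" using xi_power by auto
  have "xi D ^ k = xi D ^ (prm D * (k div prm D) + k mod prm D)" by simp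
  also have "\<dots> = emb D (c ^ (k div prm D)) * xi D ^ (k mod prm D)"
    by (simp only: power_add power_mult c emb.hom_power)
  also have "\<dots> \<in> F_span_powers D (prm D)"
    using prm_gt_1 by (intro F_span_scale xi_power_in_F_span) simp
  finally show ?thesis .
qed

text \<open>The field side of the axiom for levels: exponents i < l and j < m add up to at most l +
  m - 2, which is below l + m - 1, and once n reaches p every power of \<xi> is available.
  Additivity reduces the claim to such monomials, one factor at a time.\<close>

lemma F_span_mult:
  assumes "a \<in> F_span_powers D l" "b \<in> F_span_powers D m" "min (l + m - 1) (prm D) \<le> n"
  shows "a * b \<in> F_span_powers D n"
proof -
  have base: "emb D c * xi D ^ i * (emb D d * xi D ^ j) \<in> F_span_powers D n" if "i < l" "j < m" for c d i j
  proof -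
    have "xi D ^ (i + j) \<in> F_span_powers D n"
    proof (cases "prm D \<le> n")
      case True
      then show ?thesis using F_span_mono xi_power_in_F_span_prm by blast
    next
      case False
      then show ?thesis using that assms(3) by (intro xi_power_in_F_span) linarith
    qed
    from F_span_scale[OF this, of "c * d"] show ?thesis
      by (simp add: emb.hom_mult power_add algebra_simps)
  qed
  have "F_span_powers D m \<subseteq> {b. emb D c * xi D ^ i * b \<in> F_span_powers D n}" if "i < l" for c i
    by (rule F_span_subset) (simp_all add: ring_distribs F_span_add base[OF that])
  then have "F_span_powers D l \<subseteq> {a. a * b \<in> F_span_powers D n}"
    using assms(2) by (intro F_span_subset) (simp_all add: ring_distribs F_span_add subset_iff)
  then show ?thesis using assms(1) by auto
qed

lemma F_span_1: "F_span_powers D 1 = range (emb D)"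
proof -
  have "range (\<lambda>c. emb D (c (0::nat))) = range (emb D)" by auto
  then show ?thesis unfolding F_span_powers_def by simp
qed

text \<open>Multiplication by a nonzero a is an injective F-linear map of the finite-dimensional
  span into itself. Were 1 outside its image, the image of a basis together with 1 would be
  independent and too large; so 1 = ab for some b in the span.\<close>

lemma F_span_inverse:
  assumes "a \<in> F_span_powers D (prm D)"
  shows "inverse a \<in> F_span_powers D (prm D)"
proof (cases "a = 0")
  case False
  let ?K = "F_span_powers D (prm D)"
  let ?s = "\<lambda>c x. emb D c * x"
  interpret vs: vector_space ?s
    by unfold_locales (auto simp: algebra_simps emb.hom_add emb.hom_mult)
  interpret lin: Vector_Spaces.linear ?s ?s "(*) a"
    by unfold_locales (auto simp: algebra_simps)
  have sub: "vs.subspace ?K"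
    unfolding vs.subspace_def by (auto intro: F_span_add F_span_scale)
  have "?K \<subseteq> vs.span ((\<lambda>i. xi D ^ i) ` {..<prm D})"
    by (rule F_span_subset) (auto intro: vs.span_zero vs.span_add vs.span_scale vs.span_base)
  obtain B where B: "B \<subseteq> ?K" "vs.independent B" "?K \<subseteq> vs.span B"
    using vs.maximal_independent_subset[of ?K] by blast
  have fin: "finite B"
    using vs.independent_span_bound[OF _ B(2)] B(1) \<open>?K \<subseteq> vs.span ((\<lambda>i. xi D ^ i) ` {..<prm D})\<close>
    by blast
  have inj: "inj ((*) a)" using False by (auto simp: inj_on_def)
  have aB: "vs.independent ((*) a ` B)"
    using lin.independent_injective_image[OF B(2)] inj by (meson inj_on_subset subset_UNIV)
  have closed: "a * b \<in> ?K" if "b \<in> ?K" for b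
    using F_span_mult[OF assms that] by simp
  have "1 \<in> vs.span ((*) a ` B)"
  proof (rule ccontr)
    assume not: "1 \<notin> vs.span ((*) a ` B)"
    then have ind: "vs.independent (insert 1 ((*) a ` B))"
      using aB vs.independent_insert by (auto dest: vs.span_base)
    have "insert 1 ((*) a ` B) \<subseteq> vs.span B"
      using B closed xi_power_in_F_span_prm[of 0] by auto
    with ind fin have "card (insert 1 ((*) a ` B)) \<le> card B"
      using vs.independent_span_bound by blast
    moreover have "1 \<notin> (*) a ` B" using not vs.span_base by blast
    ultimately show False using fin inj by (simp add: card_image inj_on_subset)
  qed
  then obtain b where "b \<in> vs.span B" "1 = a * b" unfolding lin.span_image by auto
  moreover have "vs.span B \<subseteq> ?K" using B(1) sub by (rule vs.span_minimal)
  ultimately show ?thesis by (metis inverse_unique subsetD)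
qed simp

text \<open>The span of the powers below p is a subfield containing F and \<xi>. Blocks at level p,
  in particular those in row 0, are therefore unrestricted.\<close>

lemma F_span_prm: "F_span_powers D (prm D) = UNIV"
proof -
  have "is_subfield (F_span_powers D (prm D))"
    unfolding is_subfield_def
    using F_span_mult[of _ "prm D" _ "prm D" "prm D"] xi_power_in_F_span_prm[of 0]
    by (auto intro: F_span_add F_span_minus F_span_inverse)
  moreover have "emb D c \<in> F_span_powers D (prm D)" for c
    using F_span_scale[OF xi_power_in_F_span_prm, of c 0] by simp
  ultimately have "subfield_generated (range (emb D) \<union> {xi D}) \<subseteq> F_span_powers D (prm D)"
    unfolding subfield_generated_def using xi_power_in_F_span_prm[of 1] by (intro Inter_lower) auto
  with generated show ?thesis by auto
qed

section \<open>Order and levels on P\<close>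

lemma finite_P [simp]: "finite P"
  using equipped by (simp add: pts_def p_equipped_def)

lemma Bot_P [simp]: "Bot \<in> P" and Top_P [simp]: "Top \<in> P"
  by (auto simp: pts_def)

lemma ple_P: "ple D x y \<Longrightarrow> x \<in> P \<and> y \<in> P"
  by (auto simp: ple_def)

lemma po: "refl_on (pts0 D) (ord0 D)" "trans (ord0 D)" "antisym (ord0 D)" "ord0 D \<subseteq> pts0 D \<times> pts0 D"
  using equipped by (auto simp: p_equipped_def partial_order_on_def preorder_on_def refl_on_def)

lemma ple_refl [simp]: "x \<in> P \<Longrightarrow> ple D x x"
  using po(1) by (auto simp: ple_def pts_def refl_on_def)

lemma Bot_ple [simp]: "x \<in> P \<Longrightarrow> ple D Bot x"
  by (auto simp: ple_def)

lemma ple_trans: "ple D x y \<Longrightarrow> ple D y z \<Longrightarrow> ple D x z"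
  using po(2) by (auto simp: ple_def dest: transD)

lemma ple_antisym: "ple D x y \<Longrightarrow> ple D y x \<Longrightarrow> x = y"
  using po(3) by (auto simp: ple_def dest: antisymD)

lemma pless_Bot: "pless D Bot x \<longleftrightarrow> x \<in> P \<and> x \<noteq> Bot"
  by (auto simp: pless_def ple_def)

lemma pless_P: "pless D x y \<Longrightarrow> x \<in> P" "pless D x y \<Longrightarrow> y \<in> P"
  by (auto simp: pless_def ple_def)

lemma pless_not_Bot: "pless D y x \<Longrightarrow> x \<noteq> Bot"
  by (auto simp: pless_def ple_def)

lemma pless_trans: "pless D x y \<Longrightarrow> pless D y z \<Longrightarrow> pless D x z"
  unfolding pless_def using ple_trans ple_antisym by blast

lemma pless_asym: "pless D x y \<Longrightarrow> \<not> pless D y x"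
  unfolding pless_def using ple_antisym by blast

lemma plev_bounds: "ple D x y \<Longrightarrow> plev D x y \<in> {1..prm D}"
  using equipped prm_gt_1
  by (auto simp: ple_def plev_def p_equipped_def split: pt.splits)

lemma plev_trans: "ple D x y \<Longrightarrow> ple D y z \<Longrightarrow> min (plev D x y + plev D y z - 1) (prm D) \<le> plev D x z"
  using equipped
  by (auto simp: ple_def plev_def p_equipped_def split: pt.splits)

text \<open>The axiom for x \<le> x \<le> x reads l \<ge> min (2 l - 1) p, which leaves only l = 1
  and l = p.\<close>

lemma plev_self: "x \<in> P \<Longrightarrow> plev D x x = 1 \<or> plev D x x = prm D"
  using plev_trans[of x x x] plev_bounds[of x x] by auto

lemma Q_mult: "ple D x y \<Longrightarrow> ple D y z \<Longrightarrow> a \<in> Q x y \<Longrightarrow> b \<in> Q y z \<Longrightarrow> a * b \<in> Q x z"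
  unfolding Qsys_def using F_span_mult plev_trans by blast

lemma Q_0 [simp]: "0 \<in> Q x y"
  and Q_add: "a \<in> Q x y \<Longrightarrow> b \<in> Q x y \<Longrightarrow> a + b \<in> Q x y"
  and Q_minus: "a \<in> Q x y \<Longrightarrow> - a \<in> Q x y"
  and Q_sum: "(\<And>i. i \<in> I \<Longrightarrow> f i \<in> Q x y) \<Longrightarrow> sum f I \<in> Q x y"
  by (auto simp: Qsys_def F_span_add F_span_minus intro!: F_span_sum)

lemma Q_diff: "a \<in> Q x y \<Longrightarrow> b \<in> Q x y \<Longrightarrow> a - b \<in> Q x y"
  using Q_add[of a x y "- b"] Q_minus by simp

lemma Q_Bot [simp]: "Q Bot x = UNIV"
  by (cases x) (simp_all add: Qsys_def plev_def F_span_prm)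

lemma Q_self: "x \<in> P \<Longrightarrow> Q x x = (if strong D x then UNIV else range (emb D))"
  using plev_self[of x] F_span_1 by (auto simp: Qsys_def strong_def F_span_prm)

lemma emb_Q: "ple D x y \<Longrightarrow> emb D c \<in> Q x y"
  using F_span_mono[of 1 "plev D x y"] plev_bounds[of x y] F_span_1 by (auto simp: Qsys_def)

lemma Q_1: "ple D x y \<Longrightarrow> 1 \<in> Q x y"
  using emb_Q[of x y 1] by simp

end

section \<open>The algebra \<open>\<Lambda>\<close> and the bimodule \<open>\<^sup>*J\<close>\<close>

lemma sum_fun_apply: "(\<Sum>i\<in>I. f i) x = (\<Sum>i\<in>I. f i x)" for f :: "'i \<Rightarrow> 'b \<Rightarrow> 'c::comm_monoid_add"
  by (induction I rule: infinite_finite_induct) auto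

context eq_system begin

abbreviation "\<Lambda> \<equiv> Lam D"
abbreviation "S \<equiv> Salg D"
abbreviation "J \<equiv> Jrad D"
abbreviation mmul_D (infixl \<open>\<star>\<close> 70) where "u \<star> v \<equiv> mmul D u v"

lemma mmul_apply: "(u \<star> v) x z = (\<Sum>y\<in>P. u x y * v y z)"
  by (simp add: mmul_def)

lemma mmul_assoc: "(u \<star> v) \<star> w = u \<star> (v \<star> w)"
proof (intro ext)
  fix x z
  have "((u \<star> v) \<star> w) x z = (\<Sum>y\<in>P. \<Sum>y'\<in>P. u x y' * v y' y * w y z)"
    by (simp add: mmul_apply sum_distrib_right)
  also have "\<dots> = (\<Sum>y'\<in>P. \<Sum>y\<in>P. u x y' * v y' y * w y z)" by (rule sum.swap)
  also have "\<dots> = (u \<star> (v \<star> w)) x z"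
    by (simp add: mmul_apply sum_distrib_left mult.assoc)
  finally show "((u \<star> v) \<star> w) x z = (u \<star> (v \<star> w)) x z" .
qed

lemma mmul_add_left: "(u + v) \<star> w = u \<star> w + v \<star> w"
  and mmul_add_right: "w \<star> (u + v) = w \<star> u + w \<star> v"
  by (auto simp: mmul_apply fun_eq_iff sum.distrib algebra_simps)

lemma mmul_zero [simp]: "0 \<star> w = 0" "w \<star> 0 = 0"
  by (auto simp: mmul_apply fun_eq_iff)

lemma mmul_sum_left: "(\<Sum>i\<in>I. f i) \<star> w = (\<Sum>i\<in>I. f i \<star> w)"
  by (induction I rule: infinite_finite_induct) (simp_all only: mmul_add_left mmul_zero sum.infinite sum.empty sum.insert not_False_eq_True)

lemma Lam_iff: "u \<in> \<Lambda> \<longleftrightarrow> (\<forall>x y. if ple D x y then u x y \<in> Q x y else u x y = 0)"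
  by (auto simp: Lam_def)

lemma Lam_zero [simp]: "0 \<in> \<Lambda>" and Lam_add: "u \<in> \<Lambda> \<Longrightarrow> v \<in> \<Lambda> \<Longrightarrow> u + v \<in> \<Lambda>"
  and Lam_minus: "u \<in> \<Lambda> \<Longrightarrow> - u \<in> \<Lambda>"
  by (auto simp: Lam_iff Q_add Q_minus)

lemma Lam_mmul:
  assumes "u \<in> \<Lambda>" "v \<in> \<Lambda>"
  shows "u \<star> v \<in> \<Lambda>"
proof -
  \<comment> \<open>A nonzero summand forces x \<le> y \<le> z, so off the order all summands vanish
    and on it all lie in the span belonging to (x, z).\<close>
  have *: "(ple D x z \<and> u x y * v y z \<in> Q x z) \<or> u x y * v y z = 0" for x y z
  proof (cases "ple D x y \<and> ple D y z")
    case True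
    then show ?thesis using assms Q_mult ple_trans by (auto simp: Lam_iff split: if_splits)
  qed (use assms in \<open>auto simp: Lam_iff split: if_splits\<close>)
  show ?thesis unfolding Lam_iff mmul_apply
    by (metis (no_types, lifting) "*" Q_0 Q_sum sum.neutral)
qed

lemma J_iff: "u \<in> J \<longleftrightarrow> (\<forall>x y. if pless D x y then u x y \<in> Q x y else u x y = 0)"
proof (intro iffI allI)
  fix x y assume "u \<in> J"
  then have "if ple D x y then u x y \<in> Q x y else u x y = 0" "u x x = 0"
    by (auto simp: Jrad_def Lam_iff)
  then show "if pless D x y then u x y \<in> Q x y else u x y = 0"
    by (cases "x = y") (auto simp: pless_def split: if_splits)
next
  assume *: "\<forall>x y. if pless D x y then u x y \<in> Q x y else u x y = 0"
  have "u x x = 0" for x using *[rule_format, of x x] by (simp add: pless_def)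
  moreover have "if ple D x y then u x y \<in> Q x y else u x y = 0" for x y
    using *[rule_format, of x y] calculation by (cases "x = y") (auto simp: pless_def)
  ultimately show "u \<in> J" by (auto simp: Jrad_def Lam_iff)
qed

lemma ple_diag: "ple D x x \<longleftrightarrow> x \<in> P"
  using ple_P ple_refl by blast

lemma S_iff: "u \<in> S \<longleftrightarrow> (\<forall>x y. if x = y \<and> x \<in> P then u x y \<in> Q x y else u x y = 0)"
proof (intro iffI allI)
  fix x y assume "u \<in> S"
  then have "if ple D x y then u x y \<in> Q x y else u x y = 0" "x \<noteq> y \<Longrightarrow> u x y = 0"
    by (auto simp: Salg_def Lam_iff)
  then show "if x = y \<and> x \<in> P then u x y \<in> Q x y else u x y = 0"
    using ple_diag[of x] by (cases "x = y") auto
next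
  assume *: "\<forall>x y. if x = y \<and> x \<in> P then u x y \<in> Q x y else u x y = 0"
  have "u x y = 0" if "x \<noteq> y" for x y using *[rule_format, of x y] that by simp
  moreover have "if ple D x y then u x y \<in> Q x y else u x y = 0" for x y
    using *[rule_format, of x y] ple_diag[of x] by (cases "x = y") auto
  ultimately show "u \<in> S" by (auto simp: Salg_def Lam_iff)
qed

lemma J_Lam: "u \<in> J \<Longrightarrow> u \<in> \<Lambda>" and S_Lam: "u \<in> S \<Longrightarrow> u \<in> \<Lambda>"
  by (auto simp: Jrad_def Salg_def)

lemma J_zero [simp]: "0 \<in> J" and J_add: "u \<in> J \<Longrightarrow> v \<in> J \<Longrightarrow> u + v \<in> J"
  and J_minus: "u \<in> J \<Longrightarrow> - u \<in> J"
  by (auto simp: Jrad_def Lam_add Lam_minus)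

lemma J_sum: "(\<And>i. i \<in> I \<Longrightarrow> f i \<in> J) \<Longrightarrow> sum f I \<in> J"
  by (induction I rule: infinite_finite_induct) (auto intro: J_add)

lemma S_zero [simp]: "0 \<in> S" and S_add: "u \<in> S \<Longrightarrow> v \<in> S \<Longrightarrow> u + v \<in> S"
  and S_minus: "u \<in> S \<Longrightarrow> - u \<in> S"
  by (auto simp: Salg_def Lam_add Lam_minus)

lemma mmul_S_left: "s \<in> S \<Longrightarrow> s \<star> u = (\<lambda>x z. s x x * u x z)"
proof (intro ext)
  fix x z assume s: "s \<in> S"
  then have "(s \<star> u) x z = (\<Sum>y\<in>P. if y = x then s x x * u x z else 0)"
    unfolding mmul_apply by (intro sum.cong) (auto simp: S_iff split: if_splits)
  also have "\<dots> = s x x * u x z" using s by (auto simp: S_iff)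
  finally show "(s \<star> u) x z = s x x * u x z" .
qed

lemma mmul_S_right: "s \<in> S \<Longrightarrow> u \<star> s = (\<lambda>x z. u x z * s z z)"
proof (intro ext)
  fix x z assume s: "s \<in> S"
  then have "(u \<star> s) x z = (\<Sum>y\<in>P. if y = z then u x z * s z z else 0)"
    unfolding mmul_apply by (intro sum.cong) (auto simp: S_iff split: if_splits)
  also have "\<dots> = u x z * s z z" using s by (auto simp: S_iff)
  finally show "(u \<star> s) x z = u x z * s z z" .
qed

lemma S_mmul: "s \<in> S \<Longrightarrow> t \<in> S \<Longrightarrow> s \<star> t \<in> S"
  unfolding mmul_S_left by (auto simp: S_iff intro!: Q_mult[of _ _ _] split: if_splits)

lemma S_diag: "s \<in> S \<Longrightarrow> x \<in> P \<Longrightarrow> s x x \<in> Q x x"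
  and S_off: "s \<in> S \<Longrightarrow> x \<noteq> y \<Longrightarrow> s x y = 0" and S_outside: "s \<in> S \<Longrightarrow> x \<notin> P \<Longrightarrow> s x y = 0"
  by (auto simp: S_iff split: if_splits)

lemma S_eqI: "s \<in> S \<Longrightarrow> t \<in> S \<Longrightarrow> (\<And>x. x \<in> P \<Longrightarrow> s x x = t x x) \<Longrightarrow> s = t"
  by (intro ext) (metis S_iff)

lemma J_nonzero: "u \<in> J \<Longrightarrow> u x y \<noteq> 0 \<Longrightarrow> pless D x y"
  by (auto simp: J_iff split: if_splits)

lemma Lam_nonzero: "u \<in> \<Lambda> \<Longrightarrow> u x y \<noteq> 0 \<Longrightarrow> ple D x y"
  by (auto simp: Lam_iff split: if_splits)

text \<open>Only the diagonal needs an argument: x < y \<le> x is impossible, so every diagonal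
  summand of the product vanishes.\<close>

lemma J_mmul_right: "u \<in> J \<Longrightarrow> v \<in> \<Lambda> \<Longrightarrow> u \<star> v \<in> J"
  and J_mmul_left: "v \<in> \<Lambda> \<Longrightarrow> u \<in> J \<Longrightarrow> v \<star> u \<in> J"
proof -
  assume u: "u \<in> J" and v: "v \<in> \<Lambda>"
  have zero: "u x y * v y x = 0" for x y
  proof (rule ccontr)
    assume "u x y * v y x \<noteq> 0"
    then have "pless D x y" "ple D y x" using J_nonzero[OF u] Lam_nonzero[OF v] by auto
    then show False unfolding pless_def using ple_antisym by blast
  qed
  then have "(u \<star> v) x x = 0" "(v \<star> u) x x = 0" for x
    unfolding mmul_apply by (intro sum.neutral ballI; simp add: mult.commute)+
  then show "u \<star> v \<in> J" "v \<star> u \<in> J"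
    using Lam_mmul[OF J_Lam[OF u] v] Lam_mmul[OF v J_Lam[OF u]] unfolding Jrad_def by simp_all
qed

lemma unit_mat_J: "pless D x y \<Longrightarrow> c \<in> Q x y \<Longrightarrow> unit_mat x y c \<in> J"
  by (auto simp: J_iff unit_mat_def)

lemma unit_mat_S: "x \<in> P \<Longrightarrow> c \<in> Q x x \<Longrightarrow> unit_mat x x c \<in> S"
  by (auto simp: S_iff unit_mat_def)

lemma idemp_S [simp]: "x \<in> P \<Longrightarrow> idemp x \<in> S"
  by (simp add: idemp_def unit_mat_S Q_1)

lemma ehat_eq: "ehat D = (\<lambda>x y. if x = y \<and> x \<in> P \<and> x \<noteq> Bot then 1 else 0)"
proof (intro ext)
  fix x y
  have "(\<Sum>z\<in>P. idemp z) x y = (\<Sum>z\<in>P. if z = x then (if x = y then 1 else 0) else 0)"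
    unfolding sum_fun_apply by (intro sum.cong) (auto simp: idemp_def unit_mat_def)
  then show "ehat D x y = (if x = y \<and> x \<in> P \<and> x \<noteq> Bot then 1 else 0)"
    by (auto simp: ehat_def idemp_def unit_mat_def)
qed

lemma ehat_S [simp]: "ehat D \<in> S"
  by (auto simp: S_iff ehat_eq Q_1)

lemma unit_mat_mmul: "unit_mat x y c \<star> u = (\<lambda>i j. if i = x \<and> y \<in> P then c * u y j else 0)"
proof (intro ext)
  fix i j
  have "(unit_mat x y c \<star> u) i j = (\<Sum>k\<in>P. if k = y then (if i = x then c * u y j else 0) else 0)"
    unfolding mmul_apply by (intro sum.cong) (auto simp: unit_mat_def)
  then show "(unit_mat x y c \<star> u) i j = (if i = x \<and> y \<in> P then c * u y j else 0)" by auto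
qed

lemma mmul_unit_mat: "u \<star> unit_mat x y c = (\<lambda>i j. if j = y \<and> x \<in> P then u i x * c else 0)"
proof (intro ext)
  fix i j
  have "(u \<star> unit_mat x y c) i j = (\<Sum>k\<in>P. if k = x then (if j = y then u i x * c else 0) else 0)"
    unfolding mmul_apply by (intro sum.cong) (auto simp: unit_mat_def)
  then show "(u \<star> unit_mat x y c) i j = (if j = y \<and> x \<in> P then u i x * c else 0)" by auto
qed

lemma unit_mat_mmul_unit_mat: "y \<in> P \<Longrightarrow> unit_mat x y c \<star> unit_mat y z d = unit_mat x z (c * d)"
  unfolding unit_mat_mmul by (auto simp: unit_mat_def fun_eq_iff)

lemma unit_mat_add: "unit_mat x y (c + d) = unit_mat x y c + unit_mat x y d"
  by (auto simp: unit_mat_def fun_eq_iff)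

lemma unit_mat_0 [simp]: "unit_mat x y 0 = 0"
  by (auto simp: unit_mat_def fun_eq_iff)

lemma ehat_mmul: "u \<in> S \<Longrightarrow> (ehat D \<star> u) x x = (if x = Bot then 0 else u x x)"
  unfolding mmul_S_left[OF ehat_S] by (simp add: ehat_eq S_outside)

lemma idemp_mmul: "u \<in> S \<Longrightarrow> (idemp Bot \<star> u) x x = (if x = Bot then u x x else 0)"
  unfolding mmul_S_left[OF idemp_S[OF Bot_P]] by (simp add: idemp_def unit_mat_def)

text \<open>The two factors of R^e are recognised by vanishing diagonal entries, a condition easier
  to check than being a multiple of an idempotent.\<close>

lemma ehat_image: "(\<star>) (ehat D) ` S = {s \<in> S. s Bot Bot = 0}"
proof (intro equalityI subsetI)
  fix s assume s: "s \<in> {s \<in> S. s Bot Bot = 0}"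
  then have "ehat D \<star> s = s" by (intro S_eqI) (auto simp: S_mmul ehat_mmul)
  with s show "s \<in> (\<star>) (ehat D) ` S" by (intro image_eqI[of _ _ s]) auto
qed (auto simp: S_mmul ehat_mmul)

lemma idemp_image: "(\<star>) (idemp Bot) ` S = {s \<in> S. \<forall>x. x \<noteq> Bot \<longrightarrow> s x x = 0}"
proof (intro equalityI subsetI)
  fix s assume s: "s \<in> {s \<in> S. \<forall>x. x \<noteq> Bot \<longrightarrow> s x x = 0}"
  then have "idemp Bot \<star> s = s" by (intro S_eqI) (auto simp: S_mmul idemp_mmul)
  with s show "s \<in> (\<star>) (idemp Bot) ` S" by (intro image_eqI[of _ _ s]) auto
qed (auto simp: S_mmul idemp_mmul)

section \<open>The ring R^e\<close>

abbreviation "S1 \<equiv> {s \<in> S. s Bot Bot = 0}"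
abbreviation "S2 \<equiv> {s \<in> S. \<forall>x. x \<noteq> Bot \<longrightarrow> s x x = 0}"

lemma Re_simps:
  "carrier (Re D) = S1 \<times> S2"
  "(a, b) \<otimes>\<^bsub>Re D\<^esub> (a', b') = (a \<star> a', b \<star> b')"
  "(a, b) \<oplus>\<^bsub>Re D\<^esub> (a', b') = (a + a', b + b')"
  "\<one>\<^bsub>Re D\<^esub> = (ehat D, idemp Bot)" "\<zero>\<^bsub>Re D\<^esub> = (0, 0)"
  by (simp_all add: Re_def ehat_image idemp_image)

lemma ehat_S1: "ehat D \<in> S1" and idemp_S2: "idemp Bot \<in> S2"
proof -
  have "ehat D Bot Bot = 0" "\<forall>x. x \<noteq> Bot \<longrightarrow> idemp Bot x x = 0"
    by (simp_all add: ehat_eq idemp_def unit_mat_def)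
  then show "ehat D \<in> S1" "idemp Bot \<in> S2" by simp_all
qed

lemma S_mmul_commute: "s \<in> S \<Longrightarrow> t \<in> S \<Longrightarrow> s \<star> t = t \<star> s"
  by (rule S_eqI) (simp_all add: S_mmul, simp add: mmul_S_left)

lemma S1_unit: "s \<in> S1 \<Longrightarrow> ehat D \<star> s = s" "s \<in> S1 \<Longrightarrow> s \<star> ehat D = s"
proof -
  assume s: "s \<in> S1"
  then show "ehat D \<star> s = s" by (intro S_eqI) (auto simp: S_mmul ehat_mmul)
  then show "s \<star> ehat D = s" using s S_mmul_commute by auto
qed

lemma S2_unit: "s \<in> S2 \<Longrightarrow> idemp Bot \<star> s = s" "s \<in> S2 \<Longrightarrow> s \<star> idemp Bot = s"
proof -
  assume s: "s \<in> S2"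
  then show "idemp Bot \<star> s = s" by (intro S_eqI) (auto simp: S_mmul idemp_mmul)
  then show "s \<star> idemp Bot = s" using s S_mmul_commute by auto
qed

lemma S1_closed: "a \<in> S1 \<Longrightarrow> b \<in> S1 \<Longrightarrow> a \<star> b \<in> S1" "a \<in> S1 \<Longrightarrow> b \<in> S1 \<Longrightarrow> a + b \<in> S1"
  "a \<in> S1 \<Longrightarrow> - a \<in> S1" "0 \<in> S1"
  and S2_closed: "c \<in> S2 \<Longrightarrow> d \<in> S2 \<Longrightarrow> c \<star> d \<in> S2" "c \<in> S2 \<Longrightarrow> d \<in> S2 \<Longrightarrow> c + d \<in> S2"
  "c \<in> S2 \<Longrightarrow> - c \<in> S2" "0 \<in> S2"
  by (simp_all add: S_mmul S_add S_minus) (simp_all add: mmul_S_left)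

lemma ring_Re: "ring (Re D)"
proof (rule ringI)
  show "abelian_group (Re D)"
  proof (rule abelian_groupI)
    fix x assume "x \<in> carrier (Re D)"
    then obtain a b where x: "x = (a, b)" "a \<in> S1" "b \<in> S2" by (auto simp: Re_simps(1))
    show "\<exists>y\<in>carrier (Re D). y \<oplus>\<^bsub>Re D\<^esub> x = \<zero>\<^bsub>Re D\<^esub>"
      using S1_closed(3)[OF x(2)] S2_closed(3)[OF x(3)]
      by (intro bexI[of _ "(- a, - b)"]) (auto simp: x(1) Re_simps)
  qed (auto simp: Re_simps S_add add.assoc add.commute)
  show "monoid (Re D)"
  proof (rule monoidI)
    show "x \<otimes>\<^bsub>Re D\<^esub> y \<in> carrier (Re D)" if "x \<in> carrier (Re D)" "y \<in> carrier (Re D)" for x y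
      using that S1_closed(1) S2_closed(1) unfolding Re_simps(1) by (cases x; cases y) (auto simp only: Re_simps mem_Sigma_iff)
    show "\<one>\<^bsub>Re D\<^esub> \<in> carrier (Re D)" using ehat_S1 idemp_S2 by (simp add: Re_simps)
    show "\<one>\<^bsub>Re D\<^esub> \<otimes>\<^bsub>Re D\<^esub> x = x" "x \<otimes>\<^bsub>Re D\<^esub> \<one>\<^bsub>Re D\<^esub> = x" if "x \<in> carrier (Re D)" for x
      using that S1_unit S2_unit unfolding Re_simps(1) by (cases x; auto simp only: Re_simps mem_Sigma_iff)+
  qed (auto simp: Re_simps mmul_assoc)
qed (auto simp: Re_simps mmul_add_left mmul_add_right)

end

text \<open>The value of \<open>\<gamma> \<in> \<^sup>*J\<close> on \<open>e\<^bsub>y,x\<^esub>c\<close>, an element of \<open>e\<^sub>yS\<close>, read as a scalar.\<close>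

definition dcoef :: "('a, 'g::field) J_dual \<Rightarrow> 'a pt \<Rightarrow> 'a pt \<Rightarrow> 'g \<Rightarrow> 'g" where
  "dcoef \<gamma> y x c = \<gamma> (unit_mat y x c) y y"

section \<open>Functionals on J and their coordinates\<close>

context eq_system begin

abbreviation "dJ \<equiv> dualJ D"
abbreviation lact_D (infixr \<open>\<rhd>\<close> 72) where "a \<rhd> \<gamma> \<equiv> dual_lact D a \<gamma>"
abbreviation ract_D (infixl \<open>\<lhd>\<close> 72) where "\<gamma> \<lhd> a \<equiv> dual_ract D \<gamma> a"

lemma dualJI:
  assumes "\<And>u. u \<in> J \<Longrightarrow> \<gamma> u \<in> S" "\<And>u. u \<notin> J \<Longrightarrow> \<gamma> u = 0"
    "\<And>u v. u \<in> J \<Longrightarrow> v \<in> J \<Longrightarrow> \<gamma> (u + v) = \<gamma> u + \<gamma> v"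
    "\<And>s u. s \<in> S \<Longrightarrow> u \<in> J \<Longrightarrow> \<gamma> (s \<star> u) = s \<star> \<gamma> u"
  shows "\<gamma> \<in> dJ"
  using assms unfolding dualJ_def by blast

lemma dual_out: "\<gamma> \<in> dJ \<Longrightarrow> u \<notin> J \<Longrightarrow> \<gamma> u = 0"
  and dual_add: "\<gamma> \<in> dJ \<Longrightarrow> u \<in> J \<Longrightarrow> v \<in> J \<Longrightarrow> \<gamma> (u + v) = \<gamma> u + \<gamma> v"
  and dual_smult: "\<gamma> \<in> dJ \<Longrightarrow> s \<in> S \<Longrightarrow> u \<in> J \<Longrightarrow> \<gamma> (s \<star> u) = s \<star> \<gamma> u"
  unfolding dualJ_def by blast+

lemma dual_S: "\<gamma> \<in> dJ \<Longrightarrow> \<gamma> u \<in> S"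
proof (cases "u \<in> J")
  case False
  assume "\<gamma> \<in> dJ"
  with False have "\<gamma> u = 0" by (rule dual_out[rotated])
  then show ?thesis by (simp only: S_zero)
qed (simp add: dualJ_def)

lemma dual_zero: "\<gamma> \<in> dJ \<Longrightarrow> \<gamma> 0 = 0"
  using dual_smult[of \<gamma> 0 0] by simp

lemma dual_sum:
  assumes "\<gamma> \<in> dJ" "\<And>i. i \<in> I \<Longrightarrow> f i \<in> J"
  shows "\<gamma> (\<Sum>i\<in>I. f i) = (\<Sum>i\<in>I. \<gamma> (f i))"
  using assms(2)
proof (induction I rule: infinite_finite_induct)
  case (insert i I)
  then have "\<gamma> (f i + sum f I) = \<gamma> (f i) + \<gamma> (sum f I)"
    by (intro dual_add[OF assms(1)] J_sum) simp_all
  moreover have "(\<Sum>i\<in>I. \<gamma> (f i)) = \<gamma> (sum f I)" using insert by simp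
  ultimately show ?case using insert(1,2) by (simp only: sum.insert not_False_eq_True)
qed (simp_all only: sum.infinite sum.empty dual_zero[OF assms(1)] not_False_eq_True)

lemma dualJ_0 [simp]: "0 \<in> dJ"
  by (rule dualJI) simp_all

lemma dualJ_add:
  assumes \<gamma>: "\<gamma> \<in> dJ" and \<delta>: "\<delta> \<in> dJ"
  shows "\<gamma> + \<delta> \<in> dJ"
  by (rule dualJI)
     (simp_all add: S_add mmul_add_right dual_S[OF \<gamma>] dual_S[OF \<delta>] dual_out[OF \<gamma>] dual_out[OF \<delta>]
        dual_add[OF \<gamma>] dual_add[OF \<delta>] dual_smult[OF \<gamma>] dual_smult[OF \<delta>] add_ac)

lemma lact_apply: "u \<in> J \<Longrightarrow> (a \<rhd> \<gamma>) u = \<gamma> (u \<star> a)" and lact_out: "u \<notin> J \<Longrightarrow> (a \<rhd> \<gamma>) u = 0"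
  and ract_apply: "(\<gamma> \<lhd> b) u = \<gamma> u \<star> b"
  by (simp_all add: dual_lact_def dual_ract_def)

lemma dualJ_lact:
  assumes \<gamma>: "\<gamma> \<in> dJ" and "a \<in> \<Lambda>"
  shows "a \<rhd> \<gamma> \<in> dJ"
  using assms(2)
  by (intro dualJI)
     (simp_all add: lact_apply lact_out dual_S[OF \<gamma>] dual_add[OF \<gamma>] dual_smult[OF \<gamma>] J_mmul_right
        J_mmul_left J_add S_Lam mmul_add_left mmul_assoc del: plus_fun_apply)

lemma dualJ_ract:
  assumes \<gamma>: "\<gamma> \<in> dJ" and "b \<in> S"
  shows "\<gamma> \<lhd> b \<in> dJ"
  using assms(2)
  by (intro dualJI)
     (simp_all add: ract_apply dual_S[OF \<gamma>] S_mmul dual_out[OF \<gamma>] dual_add[OF \<gamma>] dual_smult[OF \<gamma>]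
        mmul_add_left mmul_assoc)

lemma lact_lact: "a \<in> \<Lambda> \<Longrightarrow> a \<rhd> (b \<rhd> \<gamma>) = (a \<star> b) \<rhd> \<gamma>"
  by (intro ext) (simp add: dual_lact_def J_mmul_right mmul_assoc)

lemma lact_ract: "a \<rhd> (\<gamma> \<lhd> b) = (a \<rhd> \<gamma>) \<lhd> b"
  by (intro ext) (simp add: dual_ract_def dual_lact_def)

lemma lact_add_right: "a \<rhd> (\<gamma> + \<delta>) = a \<rhd> \<gamma> + a \<rhd> \<delta>"
  by (intro ext) (simp add: dual_lact_def)

lemma lact_add_left:
  assumes \<gamma>: "\<gamma> \<in> dJ" and "a \<in> \<Lambda>" "b \<in> \<Lambda>"
  shows "(a + b) \<rhd> \<gamma> = a \<rhd> \<gamma> + b \<rhd> \<gamma>"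
proof
  fix u
  show "((a + b) \<rhd> \<gamma>) u = (a \<rhd> \<gamma> + b \<rhd> \<gamma>) u"
  proof (cases "u \<in> J")
    case True
    then have "\<gamma> (u \<star> a + u \<star> b) = \<gamma> (u \<star> a) + \<gamma> (u \<star> b)"
      using assms(2,3) by (intro dual_add[OF \<gamma>] J_mmul_right)
    then show ?thesis using True by (simp add: lact_apply mmul_add_right fun_eq_iff)
  qed (simp add: lact_out)
qed

lemma lact_0 [simp]: "a \<rhd> 0 = 0" and ract_0 [simp]: "0 \<lhd> b = 0" "\<gamma> \<lhd> 0 = 0"
  by (rule ext; simp add: dual_lact_def dual_ract_def)+

lemma lact_zero:
  assumes \<gamma>: "\<gamma> \<in> dJ"
  shows "0 \<rhd> \<gamma> = 0"
  by (rule ext) (simp add: dual_lact_def dual_zero[OF \<gamma>])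

text \<open>As 0 is the least element, no member of J has an entry in column 0. Hence 1 - e_0 acts
  as the identity on the left of the dual of J, and \<open>W0\<close> and \<open>W1\<close> are cut
  out by conditions on the right alone.\<close>

lemma J_mmul_ehat: "u \<in> J \<Longrightarrow> u \<star> ehat D = u"
proof (intro ext)
  fix x z assume "u \<in> J"
  then show "(u \<star> ehat D) x z = u x z"
    unfolding mmul_S_right[OF ehat_S] using J_nonzero[of u x z] pless_not_Bot[of x z] pless_P[of x z]
    by (auto simp: ehat_eq)
qed

lemma lact_ehat:
  assumes \<gamma>: "\<gamma> \<in> dJ"
  shows "ehat D \<rhd> \<gamma> = \<gamma>"
  by (rule ext) (simp add: dual_lact_def J_mmul_ehat dual_out[OF \<gamma>])

text \<open>Left S-linearity, applied to e_y, shows that row y of a value depends only on row y of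
  the argument; splitting that row into matrix units expresses the value through the coordinates
  \<open>dcoef\<close>.\<close>

lemma dual_diag_expand:
  assumes \<gamma>: "\<gamma> \<in> dJ" and u: "u \<in> J" and y: "y \<in> P"
  shows "\<gamma> u y y = (\<Sum>x\<in>{x. pless D y x}. dcoef \<gamma> y x (u y x))"
proof -
  have fin: "finite {x. pless D y x}"
    by (rule finite_subset[OF _ finite_P]) (auto dest: pless_P)
  have "idemp y \<star> u = (\<Sum>x\<in>{x. pless D y x}. unit_mat y x (u y x))"
  proof (intro ext)
    fix i j
    have "(\<Sum>x\<in>{x. pless D y x}. unit_mat y x (u y x)) i j =
        (\<Sum>x\<in>{x. pless D y x}. if x = j then (if i = y then u y j else 0) else 0)"
      unfolding sum_fun_apply by (intro sum.cong) (auto simp: unit_mat_def)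
    also have "\<dots> = (if i = y then u y j else 0)"
      using fin J_nonzero[OF u, of y j] by auto
    finally show "(idemp y \<star> u) i j = (\<Sum>x\<in>{x. pless D y x}. unit_mat y x (u y x)) i j"
      using y by (simp add: idemp_def unit_mat_mmul)
  qed
  moreover have "unit_mat y x (u y x) \<in> J" if "pless D y x" for x
    using that u by (intro unit_mat_J) (auto simp: J_iff)
  ultimately have "\<gamma> (idemp y \<star> u) = (\<Sum>x\<in>{x. pless D y x}. \<gamma> (unit_mat y x (u y x)))"
    using dual_sum[OF \<gamma>, of "{x. pless D y x}" "\<lambda>x. unit_mat y x (u y x)"] by simp
  moreover have "\<gamma> (idemp y \<star> u) = idemp y \<star> \<gamma> u"
    using y u by (intro dual_smult[OF \<gamma>]) auto
  ultimately have "(idemp y \<star> \<gamma> u) y y = (\<Sum>x\<in>{x. pless D y x}. \<gamma> (unit_mat y x (u y x))) y y"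
    by simp
  then show ?thesis using y by (simp add: idemp_def unit_mat_mmul sum_fun_apply dcoef_def)
qed

lemma dual_eqI:
  assumes "\<gamma> \<in> dJ" "\<delta> \<in> dJ"
    and "\<And>y x c. pless D y x \<Longrightarrow> c \<in> Q y x \<Longrightarrow> dcoef \<gamma> y x c = dcoef \<delta> y x c"
  shows "\<gamma> = \<delta>"
proof
  fix u
  show "\<gamma> u = \<delta> u"
  proof (cases "u \<in> J")
    case True
    show ?thesis
    proof (rule S_eqI)
      fix y assume "y \<in> P"
      then show "\<gamma> u y y = \<delta> u y y" unfolding dual_diag_expand[OF assms(1) True \<open>y \<in> P\<close>]
          dual_diag_expand[OF assms(2) True \<open>y \<in> P\<close>]
        using True by (intro sum.cong assms(3)) (auto simp: J_iff)
    qed (use assms in \<open>auto intro: dual_S\<close>)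
  qed (simp add: dual_out[OF assms(1)] dual_out[OF assms(2)])
qed

lemma dcoef_Q: "\<gamma> \<in> dJ \<Longrightarrow> y \<in> P \<Longrightarrow> dcoef \<gamma> y x c \<in> Q y y"
  unfolding dcoef_def by (intro S_diag dual_S)

lemma dcoef_not_pless: "\<gamma> \<in> dJ \<Longrightarrow> \<not> pless D y x \<Longrightarrow> dcoef \<gamma> y x c = 0"
proof -
  assume *: "\<gamma> \<in> dJ" "\<not> pless D y x"
  \<comment> \<open>A matrix unit outside the strict order is not in J unless its scalar vanishes,
    and functionals are extended by 0 off J.\<close>
  have "unit_mat y x c = 0 \<or> unit_mat y x c \<notin> J"
  proof (cases "c = 0")
    case False
    then have "unit_mat y x c y x \<noteq> 0" by (simp add: unit_mat_def)
    then show ?thesis using * J_nonzero by blast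
  qed simp
  then show ?thesis by (auto simp: dcoef_def dual_zero[OF *(1)] dual_out[OF *(1)])
qed

lemma dcoef_add:
  assumes \<gamma>: "\<gamma> \<in> dJ" and "c \<in> Q y x" "d \<in> Q y x"
  shows "dcoef \<gamma> y x (c + d) = dcoef \<gamma> y x c + dcoef \<gamma> y x d"
proof (cases "pless D y x")
  case True
  then show ?thesis using assms(2,3) by (simp add: dcoef_def unit_mat_add dual_add[OF \<gamma>] unit_mat_J)
qed (simp add: dcoef_not_pless \<gamma>)

lemma dcoef_0 [simp]: "\<gamma> \<in> dJ \<Longrightarrow> dcoef \<gamma> y x 0 = 0"
  unfolding dcoef_def unit_mat_0 by (subst dual_zero) simp_all

lemma dcoef_zero [simp]: "dcoef 0 y x c = 0"
  by (simp add: dcoef_def)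

lemma dcoef_sum:
  assumes "\<gamma> \<in> dJ" "\<And>i. i \<in> I \<Longrightarrow> f i \<in> Q y x"
  shows "dcoef \<gamma> y x (\<Sum>i\<in>I. f i) = (\<Sum>i\<in>I. dcoef \<gamma> y x (f i))"
  using assms(2)
  by (induction I rule: infinite_finite_induct)
     (simp_all add: dcoef_0[OF assms(1)] dcoef_add[OF assms(1)] Q_sum)

lemma dcoef_mult:
  "\<gamma> \<in> dJ \<Longrightarrow> q \<in> Q y y \<Longrightarrow> c \<in> Q y x \<Longrightarrow> dcoef \<gamma> y x (q * c) = q * dcoef \<gamma> y x c"
proof (cases "pless D y x")
  case True
  assume *: "\<gamma> \<in> dJ" "q \<in> Q y y" "c \<in> Q y x"
  have y: "y \<in> P" using True pless_P by blast
  have "\<gamma> (unit_mat y y q \<star> unit_mat y x c) = unit_mat y y q \<star> \<gamma> (unit_mat y x c)"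
    using * True y by (intro dual_smult[OF *(1)] unit_mat_S unit_mat_J)
  then show ?thesis using y by (simp add: unit_mat_mmul_unit_mat dcoef_def) (simp add: unit_mat_mmul)
qed (simp add: dcoef_not_pless)

lemma dcoef_add_dual [simp]: "dcoef (\<gamma> + \<delta>) y x c = dcoef \<gamma> y x c + dcoef \<delta> y x c"
  by (simp add: dcoef_def)

lemma dcoef_lact_S:
  assumes "\<gamma> \<in> dJ" "a \<in> S" "c \<in> Q y x"
  shows "dcoef (a \<rhd> \<gamma>) y x c = dcoef \<gamma> y x (c * a x x)"
proof (cases "pless D y x")
  case True
  have "unit_mat y x c \<star> a = unit_mat y x (c * a x x)"
    unfolding mmul_S_right[OF assms(2)] by (auto simp: unit_mat_def fun_eq_iff)
  then show ?thesis using assms True by (simp add: dcoef_def lact_apply unit_mat_J)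
next
  case False
  then show ?thesis using assms by (simp add: dcoef_not_pless dualJ_lact S_Lam)
qed

lemma dcoef_ract: "\<gamma> \<in> dJ \<Longrightarrow> b \<in> S \<Longrightarrow> dcoef (\<gamma> \<lhd> b) y x c = dcoef \<gamma> y x c * b y y"
  by (simp add: dcoef_def ract_apply mmul_S_right)

text \<open>Converse of \<open>dual_diag_expand\<close>: a family of left linear maps from Q_{y,x}
  to Q_y becomes a functional, so that functionals on J and such families are the same
  thing.\<close>

definition mk_dual :: "('a pt \<Rightarrow> 'a pt \<Rightarrow> 'g \<Rightarrow> 'g) \<Rightarrow> ('a, 'g) J_dual" where
  "mk_dual g = (\<lambda>u i j. if u \<in> J \<and> i = j \<and> i \<in> P then \<Sum>x\<in>{x. pless D i x}. g i x (u i x) else 0)"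

lemma finite_above: "finite {x. pless D y x}"
  by (rule finite_subset[OF _ finite_P]) (auto dest: pless_P)

lemma
  assumes Q: "\<And>y x c. pless D y x \<Longrightarrow> c \<in> Q y x \<Longrightarrow> g y x c \<in> Q y y"
    and add: "\<And>y x c d. pless D y x \<Longrightarrow> c \<in> Q y x \<Longrightarrow> d \<in> Q y x \<Longrightarrow> g y x (c + d) = g y x c + g y x d"
    and mult: "\<And>y x q c. pless D y x \<Longrightarrow> q \<in> Q y y \<Longrightarrow> c \<in> Q y x \<Longrightarrow> g y x (q * c) = q * g y x c"
  shows mk_dual: "mk_dual g \<in> dJ"
    and dcoef_mk_dual: "pless D y x \<Longrightarrow> c \<in> Q y x \<Longrightarrow> dcoef (mk_dual g) y x c = g y x c"
proof -
  have JQ: "u y x \<in> Q y x" if "u \<in> J" "pless D y x" for u y x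
    using that by (auto simp: J_iff)
  show "mk_dual g \<in> dJ"
  proof (rule dualJI)
    fix u assume u: "u \<in> J"
    have "g i x (u i x) \<in> Q i i" if "pless D i x" for i x
      using Q[OF that JQ[OF u that]] .
    then show "mk_dual g u \<in> S"
      unfolding S_iff mk_dual_def using u by (auto intro!: Q_sum)
  next
    fix u assume "u \<notin> J"
    then show "mk_dual g u = 0" by (auto simp: mk_dual_def fun_eq_iff)
  next
    fix u v assume "u \<in> J" "v \<in> J"
    then show "mk_dual g (u + v) = mk_dual g u + mk_dual g v"
      by (intro ext) (auto simp: mk_dual_def J_add add JQ simp flip: sum.distrib intro!: sum.cong)
  next
    fix s u assume *: "s \<in> S" "u \<in> J"
    then have "s \<star> u \<in> J" by (intro J_mmul_left S_Lam)
    then show "mk_dual g (s \<star> u) = s \<star> mk_dual g u"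
      unfolding mmul_S_left[OF *(1)] using *
      by (intro ext) (auto simp: mk_dual_def mult JQ S_diag sum_distrib_left intro!: sum.cong)
  qed
  assume *: "pless D y x" "c \<in> Q y x"
  have g0: "g y z 0 = 0" if "pless D y z" for z
    using mult[OF that _ Q_0, of 0] by simp
  have "dcoef (mk_dual g) y x c = (\<Sum>z\<in>{z. pless D y z}. g y z (unit_mat y x c y z))"
    using * pless_P by (simp add: dcoef_def mk_dual_def unit_mat_J)
  also have "\<dots> = (\<Sum>z\<in>{z. pless D y z}. if z = x then g y x c else 0)"
    by (intro sum.cong) (auto simp: unit_mat_def g0)
  also have "\<dots> = g y x c" using * finite_above[of y] by simp
  finally show "dcoef (mk_dual g) y x c = g y x c" .
qed

text \<open>The factor 1 - e_0 on the left acts as the identity, so membership means only that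
  multiplying the values by e_0 on the right changes nothing.\<close>

lemma W0_eq: "W0 D = {\<gamma> \<in> dJ. \<forall>u x. x \<noteq> Bot \<longrightarrow> \<gamma> u x x = 0}"
proof (intro equalityI subsetI)
  fix \<gamma> assume "\<gamma> \<in> W0 D"
  then obtain \<delta> where "\<delta> \<in> dJ" "\<gamma> = \<delta> \<lhd> idemp Bot" by (auto simp: W0_def lact_ehat)
  then show "\<gamma> \<in> {\<gamma> \<in> dJ. \<forall>u x. x \<noteq> Bot \<longrightarrow> \<gamma> u x x = 0}"
    by (simp add: dualJ_ract ract_apply mmul_S_right) (simp add: idemp_def unit_mat_def)
next
  fix \<gamma> assume \<gamma>: "\<gamma> \<in> {\<gamma> \<in> dJ. \<forall>u x. x \<noteq> Bot \<longrightarrow> \<gamma> u x x = 0}"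
  then have "\<gamma> u \<star> idemp Bot = \<gamma> u" for u using dual_S by (intro S2_unit) auto
  then have "\<gamma> \<lhd> idemp Bot = \<gamma>" by (intro ext) (simp add: ract_apply)
  with \<gamma> show "\<gamma> \<in> W0 D" by (auto simp: W0_def lact_ehat intro!: image_eqI[of _ _ \<gamma>])
qed

lemma W1_eq: "W1 D = {\<gamma> \<in> dJ. \<forall>u. \<gamma> u Bot Bot = 0}"
proof (intro equalityI subsetI)
  fix \<gamma> assume "\<gamma> \<in> W1 D"
  then obtain \<delta> where "\<delta> \<in> dJ" "\<gamma> = \<delta> \<lhd> ehat D" by (auto simp: W1_def lact_ehat)
  then show "\<gamma> \<in> {\<gamma> \<in> dJ. \<forall>u. \<gamma> u Bot Bot = 0}"
    by (simp add: dualJ_ract ract_apply mmul_S_right) (simp add: ehat_eq)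
next
  fix \<gamma> assume \<gamma>: "\<gamma> \<in> {\<gamma> \<in> dJ. \<forall>u. \<gamma> u Bot Bot = 0}"
  then have "\<gamma> u \<star> ehat D = \<gamma> u" for u using dual_S by (intro S1_unit) auto
  then have "\<gamma> \<lhd> ehat D = \<gamma>" by (intro ext) (simp add: ract_apply)
  with \<gamma> show "\<gamma> \<in> W1 D" by (auto simp: W1_def lact_ehat intro!: image_eqI[of _ _ \<gamma>])
qed

lemma W0_dual: "\<gamma> \<in> W0 D \<Longrightarrow> \<gamma> \<in> dJ" and W1_dual: "\<gamma> \<in> W1 D \<Longrightarrow> \<gamma> \<in> dJ"
  by (simp_all add: W0_eq W1_eq)

lemma W0_closed [intro]:
  "0 \<in> W0 D" "\<gamma> \<in> W0 D \<Longrightarrow> \<delta> \<in> W0 D \<Longrightarrow> \<gamma> + \<delta> \<in> W0 D"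
  "\<gamma> \<in> W0 D \<Longrightarrow> a \<in> \<Lambda> \<Longrightarrow> a \<rhd> \<gamma> \<in> W0 D" "\<gamma> \<in> W0 D \<Longrightarrow> b \<in> S \<Longrightarrow> \<gamma> \<lhd> b \<in> W0 D"
  by (simp_all add: W0_eq dualJ_add dualJ_lact dualJ_ract ract_apply mmul_S_right)
     (simp add: dual_lact_def)

lemma W1_closed [intro]:
  "0 \<in> W1 D" "\<gamma> \<in> W1 D \<Longrightarrow> \<delta> \<in> W1 D \<Longrightarrow> \<gamma> + \<delta> \<in> W1 D"
  "\<gamma> \<in> W1 D \<Longrightarrow> a \<in> \<Lambda> \<Longrightarrow> a \<rhd> \<gamma> \<in> W1 D" "\<gamma> \<in> W1 D \<Longrightarrow> b \<in> S \<Longrightarrow> \<gamma> \<lhd> b \<in> W1 D"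
  by (simp_all add: W1_eq dualJ_add dualJ_lact dualJ_ract ract_apply mmul_S_right)
     (simp add: dual_lact_def)

lemma dcoef_W0: "\<gamma> \<in> W0 D \<Longrightarrow> y \<noteq> Bot \<Longrightarrow> dcoef \<gamma> y x c = 0"
  and dcoef_W1: "\<gamma> \<in> W1 D \<Longrightarrow> dcoef \<gamma> Bot x c = 0"
  by (simp_all add: W0_eq W1_eq dcoef_def)

end

section \<open>Dual bases of J\<close>

locale eq_bases = eq_system D for D :: "('a, 'f::field, 'g::field) eq_data" +
  fixes B :: "'a pt \<Rightarrow> 'a pt \<Rightarrow> ('a, 'g) pmat set"
  assumes bases: "is_J_bases D B"
begin

lemma pJp_eq: "pless D y x \<Longrightarrow> (\<lambda>u. idemp y \<star> u \<star> idemp x) ` J = unit_mat y x ` Q y x"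
proof (intro equalityI subsetI)
  assume yx: "pless D y x"
  have eq: "idemp y \<star> u \<star> idemp x = unit_mat y x (u y x)" for u
    using pless_P[OF yx] unfolding idemp_def unit_mat_mmul mmul_unit_mat
    by (auto simp: unit_mat_def fun_eq_iff)
  {
    fix v assume "v \<in> (\<lambda>u. idemp y \<star> u \<star> idemp x) ` J"
    then show "v \<in> unit_mat y x ` Q y x" using yx by (auto simp: eq J_iff)
  next
    fix v assume "v \<in> unit_mat y x ` Q y x"
    then obtain c where c: "c \<in> Q y x" "v = unit_mat y x c" by auto
    then have "v = idemp y \<star> v \<star> idemp x" unfolding eq by (simp add: unit_mat_def)
    then show "v \<in> (\<lambda>u. idemp y \<star> u \<star> idemp x) ` J" using unit_mat_J[OF yx c(1)] c(2) by blast
  }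
qed

definition bcoef :: "'a pt \<Rightarrow> 'a pt \<Rightarrow> 'g \<Rightarrow> ('a, 'g) pmat \<Rightarrow> 'g" where
  "bcoef y x v = (THE c. c \<in> B y x \<rightarrow>\<^sub>E Q y y \<and> unit_mat y x v = (\<Sum>b\<in>B y x. unit_mat y y (c b) \<star> b))"

context
  fixes y x assumes yx: "pless D y x"
begin

lemma basis_yx:
  "finite (B y x) \<and> B y x \<subseteq> unit_mat y x ` Q y x \<and>
    (\<forall>v\<in>unit_mat y x ` Q y x. \<exists>!c. c \<in> B y x \<rightarrow>\<^sub>E Q y y \<and> v = (\<Sum>b\<in>B y x. unit_mat y y (c b) \<star> b))"
  using bases[unfolded is_J_bases_def Let_def, rule_format, OF yx] unfolding pJp_eq[OF yx] .

lemma finite_B: "finite (B y x)"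
  using basis_yx by (rule conjunct1)

lemma B_unit_mat: "b \<in> B y x \<Longrightarrow> \<exists>c\<in>Q y x. b = unit_mat y x c"
  using basis_yx[THEN conjunct2, THEN conjunct1] by blast

lemma B_entry_Q: "b \<in> B y x \<Longrightarrow> b y x \<in> Q y x"
  using B_unit_mat[of b] by (auto simp: unit_mat_def)

lemma unit_mat_B: "b \<in> B y x \<Longrightarrow> unit_mat y x (b y x) = b"
  using B_unit_mat[of b] by (auto simp: unit_mat_def)

lemma B_J: "b \<in> B y x \<Longrightarrow> b \<in> J"
  using B_unit_mat[of b] unit_mat_J[OF yx] by auto

lemma ex1_bcoef:
  assumes "v \<in> Q y x"
  shows "\<exists>!c. c \<in> B y x \<rightarrow>\<^sub>E Q y y \<and> unit_mat y x v = (\<Sum>b\<in>B y x. unit_mat y y (c b) \<star> b)"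
  using basis_yx[THEN conjunct2, THEN conjunct2] assms by (rule bspec[OF _ imageI])

text \<open>The basis elements of e_y J e_x are matrix units with a scalar, so expanding a matrix in
  \<open>B y x\<close> amounts to expanding a scalar of Q_{y,x} in the left Q_y-basis formed by
  their entries.\<close>

lemma bsum_eq_unit_mat: "(\<Sum>b\<in>B y x. unit_mat y y (c b) \<star> b) = unit_mat y x (\<Sum>b\<in>B y x. c b * b y x)"
proof (intro ext)
  fix i j
  have "(\<Sum>b\<in>B y x. unit_mat y y (c b) \<star> b) i j = (\<Sum>b\<in>B y x. unit_mat y x (c b * b y x) i j)"
    unfolding sum_fun_apply
  proof (rule sum.cong[OF HOL.refl])
    fix b assume "b \<in> B y x"
    then have "unit_mat y y (c b) \<star> b = unit_mat y y (c b) \<star> unit_mat y x (b y x)"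
      by (simp only: unit_mat_B)
    then show "(unit_mat y y (c b) \<star> b) i j = unit_mat y x (c b * b y x) i j"
      using pless_P[OF yx] by (simp add: unit_mat_mmul_unit_mat)
  qed
  then show "(\<Sum>b\<in>B y x. unit_mat y y (c b) \<star> b) i j = unit_mat y x (\<Sum>b\<in>B y x. c b * b y x) i j"
    by (cases "i = y \<and> j = x") (auto simp: unit_mat_def[of y x])
qed

lemma unit_mat_inject: "unit_mat y x c = unit_mat y x d \<longleftrightarrow> c = (d :: 'g)"
proof
  assume "unit_mat y x c = unit_mat y x d"
  then have "unit_mat y x c y x = unit_mat y x d y x" by simp
  then show "c = d" by (simp add: unit_mat_def)
qed simp

lemma bcoef_iff:
  assumes "v \<in> Q y x"
  shows "c = bcoef y x v \<longleftrightarrow> c \<in> B y x \<rightarrow>\<^sub>E Q y y \<and> v = (\<Sum>b\<in>B y x. c b * b y x)"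
proof -
  note ex1 = ex1_bcoef[OF assms, unfolded bsum_eq_unit_mat unit_mat_inject]
  have bc: "bcoef y x v = (THE c. c \<in> B y x \<rightarrow>\<^sub>E Q y y \<and> v = (\<Sum>b\<in>B y x. c b * b y x))"
    unfolding bcoef_def bsum_eq_unit_mat unit_mat_inject ..
  show ?thesis
  proof
    assume "c = bcoef y x v"
    then show "c \<in> B y x \<rightarrow>\<^sub>E Q y y \<and> v = (\<Sum>b\<in>B y x. c b * b y x)"
      using theI'[OF ex1] unfolding bc by simp
  next
    assume "c \<in> B y x \<rightarrow>\<^sub>E Q y y \<and> v = (\<Sum>b\<in>B y x. c b * b y x)"
    then show "c = bcoef y x v" unfolding bc by (rule the1_equality[OF ex1, symmetric])
  qed
qed

lemma bcoef_sum: "v \<in> Q y x \<Longrightarrow> (\<Sum>b\<in>B y x. bcoef y x v b * b y x) = v"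
  and bcoef_Q: "v \<in> Q y x \<Longrightarrow> b \<in> B y x \<Longrightarrow> bcoef y x v b \<in> Q y y"
proof -
  assume "v \<in> Q y x"
  from bcoef_iff[OF this, THEN iffD1, OF HOL.refl]
  show "(\<Sum>b\<in>B y x. bcoef y x v b * b y x) = v" "b \<in> B y x \<Longrightarrow> bcoef y x v b \<in> Q y y"
    by (auto simp: PiE_def)
qed

lemma bcoef_eqI:
  assumes "v \<in> Q y x" "\<And>b. b \<in> B y x \<Longrightarrow> c b \<in> Q y y" "v = (\<Sum>b\<in>B y x. c b * b y x)" "b \<in> B y x"
  shows "bcoef y x v b = c b"
proof -
  have "restrict c (B y x) = bcoef y x v"
    unfolding bcoef_iff[OF assms(1)] using assms(2) by (auto simp flip: assms(3))
  then show ?thesis using assms(4) by (metis restrict_apply')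
qed

lemma bcoef_add: "v \<in> Q y x \<Longrightarrow> w \<in> Q y x \<Longrightarrow> b \<in> B y x \<Longrightarrow> bcoef y x (v + w) b = bcoef y x v b + bcoef y x w b"
  by (rule bcoef_eqI) (simp_all add: Q_add bcoef_Q bcoef_sum ring_distribs sum.distrib)

lemma Q_mult_left: "q \<in> Q y y \<Longrightarrow> v \<in> Q y x \<Longrightarrow> q * v \<in> Q y x"
  using yx pless_P[OF yx] by (intro Q_mult[of y y x]) (auto simp: pless_def)

lemma bcoef_mult: "q \<in> Q y y \<Longrightarrow> v \<in> Q y x \<Longrightarrow> b \<in> B y x \<Longrightarrow> bcoef y x (q * v) b = q * bcoef y x v b"
  using pless_P[OF yx]
  by (intro bcoef_eqI) (simp_all add: Q_mult_left bcoef_Q bcoef_sum mult.assoc flip: sum_distrib_left, intro Q_mult[of y y y], simp_all add: bcoef_Q)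

lemma bcoef_basis: "u \<in> B y x \<Longrightarrow> b \<in> B y x \<Longrightarrow> bcoef y x (u y x) b = (if b = u then 1 else 0)"
  using pless_P[OF yx] finite_B
  by (intro bcoef_eqI) (auto simp: B_entry_Q Q_1 if_distrib[of "\<lambda>t. t * c" for c] cong: if_cong)

end

text \<open>A basis element u has a nonzero entry at (y, x), since otherwise its coordinate at
  itself would be 0 instead of 1, and the position of a nonzero entry determines the block. This
  matters because \<open>dual_elem\<close> tests basis elements by equality of matrices, without
  their indices.\<close>

lemma B_disjoint:
  assumes "pless D y x" "pless D y' x'" "u \<in> B y x" "u \<in> B y' x'"
  shows "y' = y" "x' = x"
proof -
  have "u y x \<noteq> 0"
  proof
    assume "u y x = 0"
    then have "bcoef y x (u y x) u = bcoef y x (0 * u y x) u" by simp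
    also have "\<dots> = 0"
      using assms B_entry_Q[OF assms(1,3)] by (subst bcoef_mult) auto
    finally show False using bcoef_basis[OF assms(1,3,3)] by simp
  qed
  then have "unit_mat y' x' (u y' x') y x \<noteq> 0"
    unfolding unit_mat_B[OF assms(2,4)] .
  then show "y' = y" "x' = x" by (auto simp: unit_mat_def split: if_splits)
qed

lemma
  assumes yx: "pless D y x" and u: "u \<in> B y x"
  shows dual_elem_dual: "dual_elem D B (y, x, u) \<in> dJ"
    and dcoef_dual_elem: "pless D y' x' \<Longrightarrow> c \<in> Q y' x' \<Longrightarrow>
      dcoef (dual_elem D B (y, x, u)) y' x' c = (if y' = y \<and> x' = x then bcoef y x c u else 0)"
proof -
  \<comment> \<open>The dual element of u reads off the coordinate at u within the block of u and
    ignores all other blocks.\<close>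
  define g where "g = (\<lambda>y' x' c. if y' = y \<and> x' = x then bcoef y x c u else 0)"
  define \<gamma> where "\<gamma> = mk_dual g"
  have gQ: "g y' x' c \<in> Q y' y'" if "pless D y' x'" "c \<in> Q y' x'" for y' x' c
    using that yx u by (auto simp: g_def bcoef_Q)
  have gadd: "g y' x' (c + d) = g y' x' c + g y' x' d" if "pless D y' x'" "c \<in> Q y' x'" "d \<in> Q y' x'" for y' x' c d
    using that yx u by (auto simp: g_def bcoef_add)
  have gmult: "g y' x' (q * c) = q * g y' x' c" if "pless D y' x'" "q \<in> Q y' y'" "c \<in> Q y' x'" for y' x' q c
    using that yx u by (auto simp: g_def bcoef_mult)
  have \<gamma>: "\<gamma> \<in> dJ" unfolding \<gamma>_def by (rule mk_dual) (fact gQ gadd gmult)+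
  have d\<gamma>: "dcoef \<gamma> y' x' c = g y' x' c" if "pless D y' x'" "c \<in> Q y' x'" for y' x' c
    unfolding \<gamma>_def using that by (intro dcoef_mk_dual gQ gadd gmult)
  let ?prop = "\<lambda>\<gamma>. \<gamma> \<in> dJ \<and> (\<forall>y' x' v. pless D y' x' \<longrightarrow> v \<in> B y' x' \<longrightarrow> \<gamma> v = (if v = u then idemp y else 0))"
  have val: "\<delta> v = (if v = u then idemp y else 0) \<longleftrightarrow> dcoef \<delta> y' x' (v y' x') = (if v = u then 1 else 0)"
    if "\<delta> \<in> dJ" "pless D y' x'" "v \<in> B y' x'" for \<delta> y' x' v
  proof -
    have y': "y' \<in> P" using that pless_P by blast
    have v: "unit_mat y' x' (v y' x') = v" using unit_mat_B that by blast
    have "idemp y' \<star> unit_mat y' x' (v y' x') = unit_mat y' x' (v y' x')"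
      using y' by (simp add: idemp_def unit_mat_mmul_unit_mat)
    then have "idemp y' \<star> v = v" unfolding v .
    then have "\<delta> v = idemp y' \<star> \<delta> v"
      using dual_smult[OF that(1), of "idemp y'" v] B_J[OF that(2,3)] y' by simp
    also have "\<dots> = unit_mat y' y' (dcoef \<delta> y' x' (v y' x'))"
    proof (intro ext)
      fix i j
      show "(idemp y' \<star> \<delta> v) i j = unit_mat y' y' (dcoef \<delta> y' x' (v y' x')) i j"
        using S_off[OF dual_S[OF that(1)], of y' j v] y'
        unfolding idemp_def unit_mat_mmul dcoef_def v by (auto simp: unit_mat_def)
    qed
    finally have *: "\<delta> v = unit_mat y' y' (dcoef \<delta> y' x' (v y' x'))" .
    show ?thesis
    proof (cases "v = u")
      case True
      then have "y' = y" using B_disjoint[OF yx that(2) u] that(3) by blast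
      with True show ?thesis unfolding * idemp_def by (auto simp: unit_mat_def fun_eq_iff)
    next
      case False
      then show ?thesis unfolding * by (auto simp: unit_mat_def fun_eq_iff)
    qed
  qed
  have g_basis: "g y' x' (v y' x') = (if v = u then 1 else 0)" if "pless D y' x'" "v \<in> B y' x'" for y' x' v
  proof (cases "y' = y \<and> x' = x")
    case True
    then show ?thesis using that(2) bcoef_basis[OF yx, of v u] u by (auto simp: g_def)
  next
    case False
    then have "v \<noteq> u" using B_disjoint[OF yx that(1) u] that(2) by blast
    with False show ?thesis by (auto simp: g_def)
  qed
  have "?prop \<gamma>"
  proof (intro conjI allI impI)
    fix y' x' v assume v: "pless D y' x'" "v \<in> B y' x'"
    show "\<gamma> v = (if v = u then idemp y else 0)"
      unfolding val[OF \<gamma> v] d\<gamma>[OF v(1) B_entry_Q[OF v]] g_basis[OF v] ..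
  qed (fact \<gamma>)
  moreover have "\<delta> = \<gamma>" if "?prop \<delta>" for \<delta>
  proof (rule dual_eqI[OF _ \<gamma>])
    show \<delta>: "\<delta> \<in> dJ" using that by simp
    have d\<delta>: "dcoef \<delta> y' x' (v y' x') = (if v = u then 1 else 0)" if "pless D y' x'" "v \<in> B y' x'" for y' x' v
      using val[OF \<delta> that] \<open>?prop \<delta>\<close> that by blast
    fix y' x' c assume *: "pless D y' x'" "c \<in> Q y' x'"
    \<comment> \<open>Left linearity carries uniqueness over from the basis elements to every scalar
      of the block.\<close>
    have expand: "dcoef \<eta> y' x' c = (\<Sum>b\<in>B y' x'. bcoef y' x' c b * dcoef \<eta> y' x' (b y' x'))" if "\<eta> \<in> dJ" for \<eta>
    proof -
      have "dcoef \<eta> y' x' c = dcoef \<eta> y' x' (\<Sum>b\<in>B y' x'. bcoef y' x' c b * b y' x')"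
        using bcoef_sum[OF *] by simp
      then show ?thesis using * that
        by (simp add: dcoef_sum dcoef_mult Q_mult_left bcoef_Q B_entry_Q cong: sum.cong)
    qed
    note expand[OF \<delta>]
    also have "(\<Sum>b\<in>B y' x'. bcoef y' x' c b * dcoef \<delta> y' x' (b y' x')) =
        (\<Sum>b\<in>B y' x'. bcoef y' x' c b * dcoef \<gamma> y' x' (b y' x'))"
      using d\<delta>[OF *(1)] d\<gamma>[OF *(1) B_entry_Q[OF *(1)]] g_basis[OF *(1)] by (intro sum.cong HOL.refl) simp
    also have "\<dots> = dcoef \<gamma> y' x' c" by (rule expand[OF \<gamma>, symmetric])
    finally show "dcoef \<delta> y' x' c = dcoef \<gamma> y' x' c" .
  qed
  ultimately have "dual_elem D B (y, x, u) = \<gamma>"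
    unfolding dual_elem_def prod.case by (rule the_equality)
  then show "dual_elem D B (y, x, u) \<in> dJ"
    "pless D y' x' \<Longrightarrow> c \<in> Q y' x' \<Longrightarrow>
      dcoef (dual_elem D B (y, x, u)) y' x' c = (if y' = y \<and> x' = x then bcoef y x c u else 0)"
    using \<gamma> d\<gamma>[of y' x' c] unfolding g_def by simp_all
qed

text \<open>The set A of rows covers both index sets of the differential at once: all rows but 0
  (\<open>idx1_eq\<close>) and row 0 alone (\<open>idx0_eq\<close>).\<close>

definition idx :: "'a pt set \<Rightarrow> ('a pt \<times> 'a pt \<times> ('a, 'g) pmat) set" where
  "idx A = {(y, x, u). y \<in> A \<and> pless D y x \<and> u \<in> B y x}"

lemma idx1_eq: "idx1 D B = idx (- {Bot})" and idx0_eq: "idx0 D B = idx {Bot}"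
  by (auto simp: idx1_def idx0_def idx_def pless_Bot dest: pless_P)

lemma finite_idx [simp]: "finite (idx A)"
proof -
  have "idx A \<subseteq> (\<Union>y\<in>P. \<Union>x\<in>{x. pless D y x}. {y} \<times> {x} \<times> B y x)"
    by (auto simp: idx_def dest: pless_P)
  moreover have "finite \<dots>" using finite_above finite_B by (intro finite_UN_I finite_cartesian_product) auto
  ultimately show ?thesis by (rule finite_subset)
qed

abbreviation "\<gamma>\<^sub>D \<equiv> dual_elem D B"
abbreviation "pb i \<equiv> snd (snd i)"

lemma idx_dual: "i \<in> idx A \<Longrightarrow> \<gamma>\<^sub>D i \<in> dJ" and idx_J: "i \<in> idx A \<Longrightarrow> pb i \<in> J"
  by (auto simp: idx_def dual_elem_dual B_J)

lemma sum_idx: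
  assumes "y \<in> A" "pless D y x" "\<And>i. i \<in> idx A \<Longrightarrow> fst i \<noteq> y \<or> fst (snd i) \<noteq> x \<Longrightarrow> f i = 0"
  shows "(\<Sum>i\<in>idx A. f i) = (\<Sum>u\<in>B y x. f (y, x, u))"
proof -
  have "(\<Sum>i\<in>idx A. f i) = (\<Sum>i\<in>(\<lambda>u. (y, x, u)) ` B y x. f i)"
  proof (rule sum.mono_neutral_right[OF finite_idx])
    show "(\<lambda>u. (y, x, u)) ` B y x \<subseteq> idx A" using assms(1,2) by (auto simp: idx_def)
    show "\<forall>i\<in>idx A - (\<lambda>u. (y, x, u)) ` B y x. f i = 0"
    proof
      fix i assume i: "i \<in> idx A - (\<lambda>u. (y, x, u)) ` B y x"
      then have "fst i \<noteq> y \<or> fst (snd i) \<noteq> x" by (cases i) (auto simp: idx_def)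
      with i show "f i = 0" using assms(3) by blast
    qed
  qed
  also have "\<dots> = (\<Sum>u\<in>B y x. f (y, x, u))" by (subst sum.reindex) (auto simp: inj_on_def)
  finally show ?thesis .
qed

lemma dual_elem_diag:
  assumes "i \<in> idx A" "v \<in> J" "fst i = y"
  shows "\<gamma>\<^sub>D i v y y = bcoef y (fst (snd i)) (v y (fst (snd i))) (pb i)"
proof -
  obtain x u where i: "i = (y, x, u)" "pless D y x" "u \<in> B y x" using assms(1,3) by (cases i) (auto simp: idx_def)
  have "\<gamma>\<^sub>D i v y y = (\<Sum>z\<in>{z. pless D y z}. if z = x then bcoef y x (v y x) u else 0)"
    unfolding dual_diag_expand[OF idx_dual[OF assms(1)] assms(2) pless_P(1)[OF i(2)]]
    unfolding i(1) using dcoef_dual_elem[OF i(2,3)] assms(2) by (intro sum.cong) (auto simp: J_iff)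
  also have "\<dots> = bcoef y x (v y x) u"
    using i(2) finite_above[of y] by simp
  finally show ?thesis unfolding i(1) by simp
qed

text \<open>Each summand is supported at the single position of its index, so the dual basis
  identity can be cut down to any set of rows; entrywise it is \<open>bcoef_sum\<close>.\<close>

lemma dual_basis_expand:
  assumes "v \<in> J"
  shows "(\<Sum>i\<in>idx A. \<gamma>\<^sub>D i v \<star> pb i) = (\<lambda>y x. if y \<in> A then v y x else 0)"
proof (intro ext)
  fix y x
  have entry: "(\<gamma>\<^sub>D i v \<star> pb i) y x = \<gamma>\<^sub>D i v y y * pb i y x" if "i \<in> idx A" for i
    using mmul_S_left[OF dual_S[OF idx_dual[OF that]]] by simp
  have zero: "pb i y x = 0" if "i \<in> idx A" "fst i \<noteq> y \<or> fst (snd i) \<noteq> x" for i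
  proof -
    have "pb i y x = unit_mat (fst i) (fst (snd i)) (pb i (fst i) (fst (snd i))) y x"
      using that(1) by (subst unit_mat_B) (auto simp: idx_def)
    then show ?thesis using that(2) by (auto simp: unit_mat_def)
  qed
  have "(\<Sum>i\<in>idx A. \<gamma>\<^sub>D i v \<star> pb i) y x = (\<Sum>i\<in>idx A. \<gamma>\<^sub>D i v y y * pb i y x)"
    using entry by (simp add: sum_fun_apply)
  also have "\<dots> = (if y \<in> A then v y x else 0)"
  proof (cases "y \<in> A \<and> pless D y x")
    case True
    have "(\<Sum>i\<in>idx A. \<gamma>\<^sub>D i v y y * pb i y x) = (\<Sum>u\<in>B y x. \<gamma>\<^sub>D (y, x, u) v y y * u y x)"
      using True zero by (subst sum_idx[of y A x]) auto
    also have "\<dots> = (\<Sum>u\<in>B y x. bcoef y x (v y x) u * u y x)"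
    proof (intro sum.cong HOL.refl)
      fix u assume "u \<in> B y x"
      then have "(y, x, u) \<in> idx A" using True by (simp add: idx_def)
      from dual_elem_diag[OF this assms]
      show "\<gamma>\<^sub>D (y, x, u) v y y * u y x = bcoef y x (v y x) u * u y x" by simp
    qed
    also have "\<dots> = v y x" using True assms by (intro bcoef_sum) (simp_all add: J_iff)
    finally show ?thesis using True by simp
  next
    case False
    have "pb i y x = 0" if "i \<in> idx A" for i
    proof (rule zero[OF that])
      show "fst i \<noteq> y \<or> fst (snd i) \<noteq> x" using that False by (cases i) (auto simp: idx_def)
    qed
    moreover have "y \<notin> A \<or> v y x = 0" using False J_nonzero[OF assms] by blast
    ultimately show ?thesis by auto
  qed
  finally show "(\<Sum>i\<in>idx A. \<gamma>\<^sub>D i v \<star> pb i) y x = (if y \<in> A then v y x else 0)" .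
qed

end

section \<open>Tensor algebras and the differential\<close>

locale tensor_ring = R: ring R
  for R :: "('r, 'c) ring_scheme" (structure) +
  fixes W :: "('r, 'w) bimodule"
  assumes wadd_closed: "v \<in> carrier W \<Longrightarrow> w \<in> carrier W \<Longrightarrow> wadd W v w \<in> carrier W"
    and lact_closed: "a \<in> carrier R \<Longrightarrow> w \<in> carrier W \<Longrightarrow> lact W a w \<in> carrier W"
    and ract_closed: "a \<in> carrier R \<Longrightarrow> w \<in> carrier W \<Longrightarrow> ract W w a \<in> carrier W"
begin

abbreviation "TT \<equiv> tterms R W"
abbreviation T where "T \<equiv> tensor_algebra R W"
abbreviation cls (\<open>\<lbrakk>_\<rbrakk>\<close>) where "\<lbrakk>s\<rbrakk> \<equiv> tclass R W s"

lemma teq_terms: "teq R W s t \<Longrightarrow> s \<in> TT \<and> t \<in> TT"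
  by (induction rule: teq.induct) (auto intro!: tterms.intros wadd_closed lact_closed ract_closed)

lemma cls_eq_iff: "s \<in> TT \<Longrightarrow> \<lbrakk>s\<rbrakk> = \<lbrakk>t\<rbrakk> \<longleftrightarrow> teq R W s t"
  unfolding tclass_def by (auto intro: teq.trans teq.sym dest: teq.refl)

lemma cls_eqI: "teq R W s t \<Longrightarrow> \<lbrakk>s\<rbrakk> = \<lbrakk>t\<rbrakk>"
  using cls_eq_iff teq_terms by blast

lemma self_in_cls: "s \<in> TT \<Longrightarrow> s \<in> \<lbrakk>s\<rbrakk>"
  by (simp add: tclass_def teq.refl)

lemma T_simps:
  "carrier T = tclass R W ` TT" "\<one>\<^bsub>T\<^esub> = \<lbrakk>Scal \<one>\<rbrakk>" "\<zero>\<^bsub>T\<^esub> = \<lbrakk>Scal \<zero>\<rbrakk>"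
  by (simp_all add: tensor_algebra_def)

lemma cls_carrier: "s \<in> TT \<Longrightarrow> \<lbrakk>s\<rbrakk> \<in> carrier T"
  by (simp add: T_simps)

lemma cls_mult: "s \<in> TT \<Longrightarrow> t \<in> TT \<Longrightarrow> \<lbrakk>s\<rbrakk> \<otimes>\<^bsub>T\<^esub> \<lbrakk>t\<rbrakk> = \<lbrakk>Mul s t\<rbrakk>"
  unfolding tensor_algebra_def monoid.simps tclass_def
  by (auto intro: teq.trans teq.mul_cong teq.refl dest: teq.mul_cong)

lemma cls_add: "s \<in> TT \<Longrightarrow> t \<in> TT \<Longrightarrow> \<lbrakk>s\<rbrakk> \<oplus>\<^bsub>T\<^esub> \<lbrakk>t\<rbrakk> = \<lbrakk>Add s t\<rbrakk>"
  unfolding tensor_algebra_def ring.simps tclass_def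
  by (auto intro: teq.trans teq.add_cong teq.refl dest: teq.add_cong)

lemma T_carrierE:
  assumes "x \<in> carrier T"
  obtains s where "s \<in> TT" "x = \<lbrakk>s\<rbrakk>"
  using assms by (auto simp: T_simps)

lemma Scal_T: "a \<in> carrier R \<Longrightarrow> Scal a \<in> TT" and Gen_T: "w \<in> carrier W \<Longrightarrow> Gen w \<in> TT"
  and Add_T: "s \<in> TT \<Longrightarrow> t \<in> TT \<Longrightarrow> Add s t \<in> TT" and Mul_T: "s \<in> TT \<Longrightarrow> t \<in> TT \<Longrightarrow> Mul s t \<in> TT"
  by (simp_all add: tterms.intros)

lemma ring_T: "ring T"
proof (rule ringI)
  show "abelian_group T"
  proof (rule abelian_groupI)
    fix x y z assume x: "x \<in> carrier T" and y: "y \<in> carrier T" and z: "z \<in> carrier T"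
    from x obtain s where s: "s \<in> TT" "x = \<lbrakk>s\<rbrakk>" by (rule T_carrierE)
    from y obtain t where t: "t \<in> TT" "y = \<lbrakk>t\<rbrakk>" by (rule T_carrierE)
    from z obtain u where u: "u \<in> TT" "z = \<lbrakk>u\<rbrakk>" by (rule T_carrierE)
    show "x \<oplus>\<^bsub>T\<^esub> y \<in> carrier T" using s t by (simp add: cls_add cls_carrier Add_T)
    show "x \<oplus>\<^bsub>T\<^esub> y \<oplus>\<^bsub>T\<^esub> z = x \<oplus>\<^bsub>T\<^esub> (y \<oplus>\<^bsub>T\<^esub> z)"
      using s t u cls_eqI[OF teq.add_assoc[OF s(1) t(1) u(1)]] by (simp add: cls_add Add_T)
    show "x \<oplus>\<^bsub>T\<^esub> y = y \<oplus>\<^bsub>T\<^esub> x"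
      unfolding s(2) t(2) cls_add[OF s(1) t(1)] cls_add[OF t(1) s(1)]
      by (rule cls_eqI, rule teq.add_comm) (fact s t)+
    show "\<zero>\<^bsub>T\<^esub> \<oplus>\<^bsub>T\<^esub> x = x"
      using s cls_eqI[OF teq.add_zero[OF s(1)]] by (simp add: T_simps cls_add Scal_T)
    have "\<lbrakk>Mul (Scal (\<ominus> \<one>)) s\<rbrakk> \<oplus>\<^bsub>T\<^esub> x = \<zero>\<^bsub>T\<^esub>"
      using s cls_eqI[OF teq.add_neg[OF s(1)]] by (simp add: T_simps cls_add Scal_T Mul_T)
    moreover have "\<lbrakk>Mul (Scal (\<ominus> \<one>)) s\<rbrakk> \<in> carrier T"
      using s by (simp add: cls_carrier Scal_T Mul_T)
    ultimately show "\<exists>y\<in>carrier T. y \<oplus>\<^bsub>T\<^esub> x = \<zero>\<^bsub>T\<^esub>" by blast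
  qed (simp add: T_simps(3) cls_carrier Scal_T)
  show "monoid T"
  proof (rule monoidI)
    fix x y z assume x: "x \<in> carrier T" and y: "y \<in> carrier T" and z: "z \<in> carrier T"
    from x obtain s where s: "s \<in> TT" "x = \<lbrakk>s\<rbrakk>" by (rule T_carrierE)
    from y obtain t where t: "t \<in> TT" "y = \<lbrakk>t\<rbrakk>" by (rule T_carrierE)
    from z obtain u where u: "u \<in> TT" "z = \<lbrakk>u\<rbrakk>" by (rule T_carrierE)
    show "x \<otimes>\<^bsub>T\<^esub> y \<in> carrier T" using s t by (simp add: cls_mult cls_carrier Mul_T)
    show "x \<otimes>\<^bsub>T\<^esub> y \<otimes>\<^bsub>T\<^esub> z = x \<otimes>\<^bsub>T\<^esub> (y \<otimes>\<^bsub>T\<^esub> z)"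
      using s t u cls_eqI[OF teq.mul_assoc[OF s(1) t(1) u(1)]] by (simp add: cls_mult Mul_T)
    show "\<one>\<^bsub>T\<^esub> \<otimes>\<^bsub>T\<^esub> x = x" "x \<otimes>\<^bsub>T\<^esub> \<one>\<^bsub>T\<^esub> = x"
      using s cls_eqI[OF teq.one_mul[OF s(1)]] cls_eqI[OF teq.mul_one[OF s(1)]]
      by (simp_all add: T_simps cls_mult Scal_T)
  qed (simp add: T_simps(2) cls_carrier Scal_T)
  fix x y z assume x: "x \<in> carrier T" and y: "y \<in> carrier T" and z: "z \<in> carrier T"
  from x obtain s where s: "s \<in> TT" "x = \<lbrakk>s\<rbrakk>" by (rule T_carrierE)
  from y obtain t where t: "t \<in> TT" "y = \<lbrakk>t\<rbrakk>" by (rule T_carrierE)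
  from z obtain u where u: "u \<in> TT" "z = \<lbrakk>u\<rbrakk>" by (rule T_carrierE)
  show "(x \<oplus>\<^bsub>T\<^esub> y) \<otimes>\<^bsub>T\<^esub> z = x \<otimes>\<^bsub>T\<^esub> z \<oplus>\<^bsub>T\<^esub> y \<otimes>\<^bsub>T\<^esub> z"
    "z \<otimes>\<^bsub>T\<^esub> (x \<oplus>\<^bsub>T\<^esub> y) = z \<otimes>\<^bsub>T\<^esub> x \<oplus>\<^bsub>T\<^esub> z \<otimes>\<^bsub>T\<^esub> y"
    using s t u cls_eqI[OF teq.distrib_right[OF s(1) t(1) u(1)]] cls_eqI[OF teq.distrib_left[OF u(1) s(1) t(1)]]
    by (simp_all add: cls_mult cls_add Mul_T Add_T)
qed

lemma Scal_add: "a \<in> carrier R \<Longrightarrow> b \<in> carrier R \<Longrightarrow> \<lbrakk>Scal (a \<oplus> b)\<rbrakk> = \<lbrakk>Scal a\<rbrakk> \<oplus>\<^bsub>T\<^esub> \<lbrakk>Scal b\<rbrakk>"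
  and Scal_mult: "a \<in> carrier R \<Longrightarrow> b \<in> carrier R \<Longrightarrow> \<lbrakk>Scal (a \<otimes> b)\<rbrakk> = \<lbrakk>Scal a\<rbrakk> \<otimes>\<^bsub>T\<^esub> \<lbrakk>Scal b\<rbrakk>"
  and Gen_add: "v \<in> carrier W \<Longrightarrow> w \<in> carrier W \<Longrightarrow> \<lbrakk>Gen (wadd W v w)\<rbrakk> = \<lbrakk>Gen v\<rbrakk> \<oplus>\<^bsub>T\<^esub> \<lbrakk>Gen w\<rbrakk>"
  and Gen_lact: "a \<in> carrier R \<Longrightarrow> w \<in> carrier W \<Longrightarrow> \<lbrakk>Gen (lact W a w)\<rbrakk> = \<lbrakk>Scal a\<rbrakk> \<otimes>\<^bsub>T\<^esub> \<lbrakk>Gen w\<rbrakk>"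
  and Gen_ract: "a \<in> carrier R \<Longrightarrow> w \<in> carrier W \<Longrightarrow> \<lbrakk>Gen (ract W w a)\<rbrakk> = \<lbrakk>Gen w\<rbrakk> \<otimes>\<^bsub>T\<^esub> \<lbrakk>Scal a\<rbrakk>"
  unfolding cls_add[OF Scal_T Scal_T] cls_mult[OF Scal_T Scal_T] cls_add[OF Gen_T Gen_T]
    cls_mult[OF Scal_T Gen_T] cls_mult[OF Gen_T Scal_T]
  by (rule cls_eqI, erule (1) teq.scal_add teq.scal_mul teq.gen_add teq.gen_lact teq.gen_ract)+

definition bimod_map :: "('w \<Rightarrow> ('r, 'w) tterm set) \<Rightarrow> bool" where
  "bimod_map \<phi> \<longleftrightarrow> \<phi> \<in> carrier W \<rightarrow> carrier T \<and>
     (\<forall>v\<in>carrier W. \<forall>w\<in>carrier W. \<phi> (wadd W v w) = \<phi> v \<oplus>\<^bsub>T\<^esub> \<phi> w) \<and>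
     (\<forall>a\<in>carrier R. \<forall>w\<in>carrier W. \<phi> (lact W a w) = \<lbrakk>Scal a\<rbrakk> \<otimes>\<^bsub>T\<^esub> \<phi> w) \<and>
     (\<forall>a\<in>carrier R. \<forall>w\<in>carrier W. \<phi> (ract W w a) = \<phi> w \<otimes>\<^bsub>T\<^esub> \<lbrakk>Scal a\<rbrakk>)"

text \<open>The ring endomorphism of T that fixes R and extends \<sigma>, written on terms;
  \<open>ext_teq\<close> makes it descend to classes.\<close>

primrec ext :: "('w \<Rightarrow> ('r, 'w) tterm set) \<Rightarrow> ('r, 'w) tterm \<Rightarrow> ('r, 'w) tterm set" where
  "ext \<sigma> (Scal r) = \<lbrakk>Scal r\<rbrakk>"
| "ext \<sigma> (Gen w) = \<sigma> w"
| "ext \<sigma> (Add s t) = ext \<sigma> s \<oplus>\<^bsub>T\<^esub> ext \<sigma> t"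
| "ext \<sigma> (Mul s t) = ext \<sigma> s \<otimes>\<^bsub>T\<^esub> ext \<sigma> t"

text \<open>A derivation vanishing on R and twisted by \<open>ext \<sigma>\<close> on the left
  factor. With the parity automorphism for \<sigma> this is the graded Leibniz rule, but written
  without degrees and hence meaningful for sums of terms of different degrees.\<close>

primrec der :: "('w \<Rightarrow> ('r, 'w) tterm set) \<Rightarrow> ('w \<Rightarrow> ('r, 'w) tterm set) \<Rightarrow> ('r, 'w) tterm \<Rightarrow> ('r, 'w) tterm set" where
  "der \<sigma> \<delta> (Scal r) = \<zero>\<^bsub>T\<^esub>"
| "der \<sigma> \<delta> (Gen w) = \<delta> w"
| "der \<sigma> \<delta> (Add s t) = der \<sigma> \<delta> s \<oplus>\<^bsub>T\<^esub> der \<sigma> \<delta> t"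
| "der \<sigma> \<delta> (Mul s t) = der \<sigma> \<delta> s \<otimes>\<^bsub>T\<^esub> \<lbrakk>t\<rbrakk> \<oplus>\<^bsub>T\<^esub> ext \<sigma> s \<otimes>\<^bsub>T\<^esub> der \<sigma> \<delta> t"

definition rep :: "('r, 'w) tterm set \<Rightarrow> ('r, 'w) tterm" where
  "rep X = (SOME t. t \<in> X)"

lemma rep_teq:
  assumes "s \<in> TT"
  shows "teq R W s (rep \<lbrakk>s\<rbrakk>)"
proof -
  have "rep \<lbrakk>s\<rbrakk> \<in> \<lbrakk>s\<rbrakk>" unfolding rep_def using self_in_cls[OF assms] by (rule someI)
  then show ?thesis by (simp add: tclass_def)
qed

context
  fixes \<sigma> \<delta> assumes \<sigma>: "bimod_map \<sigma>" and \<delta>: "bimod_map \<delta>"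
begin

interpretation T: ring T by (rule ring_T)

lemma ext_carrier: "s \<in> TT \<Longrightarrow> ext \<sigma> s \<in> carrier T"
  by (induction rule: tterms.induct) (use \<sigma> in \<open>auto simp: bimod_map_def cls_carrier tterms.intros\<close>)

lemma der_carrier: "s \<in> TT \<Longrightarrow> der \<sigma> \<delta> s \<in> carrier T"
  by (induction rule: tterms.induct) (use \<delta> in \<open>auto simp: bimod_map_def cls_carrier ext_carrier\<close>)

lemma cls_neg_one: "\<lbrakk>Scal (\<ominus> \<one>)\<rbrakk> = \<ominus>\<^bsub>T\<^esub> \<one>\<^bsub>T\<^esub>"
proof -
  have "\<lbrakk>Scal (\<ominus> \<one>)\<rbrakk> \<oplus>\<^bsub>T\<^esub> \<one>\<^bsub>T\<^esub> = \<zero>\<^bsub>T\<^esub>"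
    unfolding T_simps by (simp add: R.l_neg flip: Scal_add)
  then show ?thesis by (simp add: T.minus_equality cls_carrier tterms.intros)
qed

lemma ext_teq: "teq R W s t \<Longrightarrow> ext \<sigma> s = ext \<sigma> t"
proof (induction rule: teq.induct)
  case (add_neg s)
  then show ?case using ext_carrier[OF add_neg]
    by (simp add: cls_neg_one T.l_minus T.l_neg flip: T_simps(2,3))
next
  case (add_comm s t)
  then show ?case by (simp add: ext_carrier T.a_comm)
qed (use \<sigma> in \<open>simp_all add: bimod_map_def ext_carrier T.a_assoc T.m_assoc T.l_distr T.r_distr Scal_add
      Scal_mult flip: T_simps(2,3)\<close>)

text \<open>The bimodule property of \<delta> takes care of the generators, because the derivation
  vanishes on R. A congruence in the left factor of a product also needs the invariance of
  \<open>ext\<close>, which occurs in the twisted rule.\<close>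

lemma der_teq: "teq R W s t \<Longrightarrow> der \<sigma> \<delta> s = der \<sigma> \<delta> t"
proof (induction rule: teq.induct)
  case (mul_cong s s' t t')
  then show ?case using ext_teq[OF mul_cong(1)] cls_eqI[OF mul_cong(2)] by simp
next
  case (add_neg s)
  then show ?case using der_carrier[OF add_neg] cls_carrier[OF add_neg]
    by (simp add: cls_neg_one T.l_minus T.l_neg)
next
  case (mul_assoc s t u)
  note [simp] = der_carrier[OF mul_assoc(1)] der_carrier[OF mul_assoc(2)] der_carrier[OF mul_assoc(3)]
    ext_carrier[OF mul_assoc(1)] ext_carrier[OF mul_assoc(2)] ext_carrier[OF mul_assoc(3)]
    cls_carrier[OF mul_assoc(1)] cls_carrier[OF mul_assoc(2)] cls_carrier[OF mul_assoc(3)]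
  show ?case
    by (simp add: T.l_distr T.r_distr T.m_assoc T.a_assoc flip: cls_mult[OF mul_assoc(2,3)])
next
  case (distrib_right s t u)
  note [simp] = der_carrier[OF distrib_right(1)] der_carrier[OF distrib_right(2)] der_carrier[OF distrib_right(3)]
    ext_carrier[OF distrib_right(1)] ext_carrier[OF distrib_right(2)] ext_carrier[OF distrib_right(3)]
    cls_carrier[OF distrib_right(1)] cls_carrier[OF distrib_right(2)] cls_carrier[OF distrib_right(3)]
  show ?case by (simp add: T.l_distr T.r_distr T.a_ac)
next
  case (distrib_left s t u)
  note [simp] = der_carrier[OF distrib_left(1)] der_carrier[OF distrib_left(2)] der_carrier[OF distrib_left(3)]
    ext_carrier[OF distrib_left(1)] ext_carrier[OF distrib_left(2)] ext_carrier[OF distrib_left(3)]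
    cls_carrier[OF distrib_left(1)] cls_carrier[OF distrib_left(2)] cls_carrier[OF distrib_left(3)]
  show ?case by (simp add: T.l_distr T.r_distr T.a_ac flip: cls_add[OF distrib_left(2,3)])
next
  case (one_mul s)
  then show ?case using der_carrier[OF one_mul] cls_carrier[OF one_mul] by (simp flip: T_simps(2,3))
next
  case (mul_one s)
  then show ?case using der_carrier[OF mul_one] ext_carrier[OF mul_one] by (simp flip: T_simps(2,3))
next
  case (add_comm s t)
  then show ?case by (simp add: der_carrier T.a_comm)
next
  case (gen_lact a w)
  then show ?case using \<delta> by (simp add: bimod_map_def cls_carrier Scal_T Gen_T Pi_iff)
next
  case (gen_ract a w)
  then show ?case using \<delta> \<sigma> by (simp add: bimod_map_def cls_carrier Scal_T Gen_T Pi_iff)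
qed (use \<delta> in \<open>simp_all add: bimod_map_def der_carrier T.a_assoc cls_carrier Scal_T\<close>)

end

end

section \<open>The grading of T and induction by degree\<close>

context eq_system begin

lemma Wbim_simps:
  "carrier (Wbim D) = W0 D \<times> W1 D" "wadd (Wbim D) (\<gamma>, \<delta>) (\<gamma>', \<delta>') = (\<gamma> + \<gamma>', \<delta> + \<delta>')"
  "lact (Wbim D) (a, b) (\<gamma>, \<delta>) = (a \<rhd> \<gamma>, a \<rhd> \<delta>)" "ract (Wbim D) (\<gamma>, \<delta>) (a, b) = (\<gamma> \<lhd> b, \<delta> \<lhd> a)"
  by (simp_all add: Wbim_def)

lemma Re_S: "(a, b) \<in> carrier (Re D) \<Longrightarrow> a \<in> S \<and> b \<in> S"
  by (simp add: Re_simps)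

sublocale TA: tensor_ring "Re D" "Wbim D"
proof (intro tensor_ring.intro ring_Re tensor_ring_axioms.intro)
  fix v w assume "v \<in> carrier (Wbim D)" "w \<in> carrier (Wbim D)"
  then show "wadd (Wbim D) v w \<in> carrier (Wbim D)"
    by (cases v; cases w) (auto simp: Wbim_simps)
next
  fix a w assume "a \<in> carrier (Re D)" "w \<in> carrier (Wbim D)"
  then show "lact (Wbim D) a w \<in> carrier (Wbim D)" "ract (Wbim D) w a \<in> carrier (Wbim D)"
    by (cases a; cases w; auto simp: Wbim_simps dest!: Re_S intro: S_Lam)+
qed

sublocale T: ring "Talg D"
  unfolding Talg_def by (rule TA.ring_T)

abbreviation "TD \<equiv> Talg D"
abbreviation "cl \<equiv> tclass (Re D) (Wbim D)"
abbreviation "hom_term \<equiv> homog (Re D) (Wgrade D)"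

lemmas T_ops = TA.cls_mult[folded Talg_def] TA.cls_add[folded Talg_def]

lemma Wgrade_carrier: "w \<in> Wgrade D k \<Longrightarrow> w \<in> carrier (Wbim D)"
  by (auto simp: Wgrade_def Wbim_simps split: if_splits)

lemma hom_term_T: "hom_term k s \<Longrightarrow> s \<in> TA.TT"
  by (induction rule: homog.induct) (auto intro: tterms.intros Wgrade_carrier)

lemma Tdeg_carrier: "x \<in> Tdeg D k \<Longrightarrow> x \<in> carrier TD"
  unfolding Tdeg_def Talg_def using hom_term_T TA.cls_carrier by auto

lemma Tdeg_add: "x \<in> Tdeg D k \<Longrightarrow> y \<in> Tdeg D k \<Longrightarrow> x \<oplus>\<^bsub>TD\<^esub> y \<in> Tdeg D k"
  unfolding Tdeg_def using hom_term_T T_ops(2) homog.intros(3) by (smt (verit) image_iff mem_Collect_eq)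

lemma Tdeg_mult: "x \<in> Tdeg D k \<Longrightarrow> y \<in> Tdeg D l \<Longrightarrow> x \<otimes>\<^bsub>TD\<^esub> y \<in> Tdeg D (k + l)"
  unfolding Tdeg_def using hom_term_T T_ops(1) homog.intros(4) by (smt (verit) image_iff mem_Collect_eq)

lemma inR_Tdeg: "r \<in> carrier (Re D) \<Longrightarrow> inR D r \<in> Tdeg D 0"
  and w12_Tdeg: "\<gamma> \<in> W0 D \<Longrightarrow> w12 D \<gamma> \<in> Tdeg D 0"
  and w1_Tdeg: "\<delta> \<in> W1 D \<Longrightarrow> w1 D \<delta> \<in> Tdeg D 1"
  unfolding Tdeg_def inR_def w12_def w1_def
  by (auto intro!: imageI homog.intros simp: Wgrade_def)

lemma inR_carrier: "r \<in> carrier (Re D) \<Longrightarrow> inR D r \<in> carrier TD"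
  and w12_carrier: "\<gamma> \<in> W0 D \<Longrightarrow> w12 D \<gamma> \<in> carrier TD"
  and w1_carrier: "\<delta> \<in> W1 D \<Longrightarrow> w1 D \<delta> \<in> carrier TD"
  using inR_Tdeg w12_Tdeg w1_Tdeg Tdeg_carrier by blast+

lemma inR_add: "r \<in> carrier (Re D) \<Longrightarrow> r' \<in> carrier (Re D) \<Longrightarrow> inR D (r \<oplus>\<^bsub>Re D\<^esub> r') = inR D r \<oplus>\<^bsub>TD\<^esub> inR D r'"
  and inR_mult: "r \<in> carrier (Re D) \<Longrightarrow> r' \<in> carrier (Re D) \<Longrightarrow> inR D (r \<otimes>\<^bsub>Re D\<^esub> r') = inR D r \<otimes>\<^bsub>TD\<^esub> inR D r'"
  unfolding inR_def using TA.Scal_add TA.Scal_mult by (simp_all add: Talg_def)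

lemma inR_one: "inR D (ehat D, idemp Bot) = \<one>\<^bsub>TD\<^esub>" and inR_zero: "inR D (0, 0) = \<zero>\<^bsub>TD\<^esub>"
  by (simp_all add: inR_def Talg_def TA.T_simps Re_simps)

lemma w12_add: "\<gamma> \<in> W0 D \<Longrightarrow> \<gamma>' \<in> W0 D \<Longrightarrow> w12 D (\<gamma> + \<gamma>') = w12 D \<gamma> \<oplus>\<^bsub>TD\<^esub> w12 D \<gamma>'"
  using TA.Gen_add[of "(\<gamma>, 0)" "(\<gamma>', 0)"] by (simp add: Wbim_simps w12_def Talg_def W1_closed)

lemma w1_add: "\<delta> \<in> W1 D \<Longrightarrow> \<delta>' \<in> W1 D \<Longrightarrow> w1 D (\<delta> + \<delta>') = w1 D \<delta> \<oplus>\<^bsub>TD\<^esub> w1 D \<delta>'"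
  using TA.Gen_add[of "(0, \<delta>)" "(0, \<delta>')"] by (simp add: Wbim_simps w1_def Talg_def W0_closed)

lemma Gen_split: "\<gamma> \<in> W0 D \<Longrightarrow> \<delta> \<in> W1 D \<Longrightarrow> cl (Gen (\<gamma>, \<delta>)) = w12 D \<gamma> \<oplus>\<^bsub>TD\<^esub> w1 D \<delta>"
  using TA.Gen_add[of "(\<gamma>, 0)" "(0, \<delta>)"] by (simp add: Wbim_simps w1_def w12_def Talg_def W0_closed W1_closed)

lemma w12_lact: "\<gamma> \<in> W0 D \<Longrightarrow> (a, b) \<in> carrier (Re D) \<Longrightarrow> w12 D (a \<rhd> \<gamma>) = inR D (a, b) \<otimes>\<^bsub>TD\<^esub> w12 D \<gamma>"
  and w12_ract: "\<gamma> \<in> W0 D \<Longrightarrow> (a, b) \<in> carrier (Re D) \<Longrightarrow> w12 D (\<gamma> \<lhd> b) = w12 D \<gamma> \<otimes>\<^bsub>TD\<^esub> inR D (a, b)"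
  using TA.Gen_lact[of "(a, b)" "(\<gamma>, 0)"] TA.Gen_ract[of "(a, b)" "(\<gamma>, 0)"]
  by (simp_all add: Wbim_simps w12_def inR_def Talg_def W1_closed)

lemma w1_lact: "\<delta> \<in> W1 D \<Longrightarrow> (a, b) \<in> carrier (Re D) \<Longrightarrow> w1 D (a \<rhd> \<delta>) = inR D (a, b) \<otimes>\<^bsub>TD\<^esub> w1 D \<delta>"
  and w1_ract: "\<delta> \<in> W1 D \<Longrightarrow> (a, b) \<in> carrier (Re D) \<Longrightarrow> w1 D (\<delta> \<lhd> a) = w1 D \<delta> \<otimes>\<^bsub>TD\<^esub> inR D (a, b)"
  using TA.Gen_lact[of "(a, b)" "(0, \<delta>)"] TA.Gen_ract[of "(a, b)" "(0, \<delta>)"]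
  by (simp_all add: Wbim_simps w1_def inR_def Talg_def W0_closed)

lemma Re_zero: "(0, 0) \<in> carrier (Re D)"
  by (simp add: Re_simps)

lemma w12_zero: "w12 D 0 = \<zero>\<^bsub>TD\<^esub>" and w1_zero: "w1 D 0 = \<zero>\<^bsub>TD\<^esub>"
  using w12_lact[of 0 0 0] w1_lact[of 0 0 0] Re_zero w12_carrier[of 0] w1_carrier[of 0]
  by (simp_all add: inR_zero W0_closed W1_closed)

text \<open>Each \<open>Wgrade D k\<close> contains the zero generator, so 0 is homogeneous of every
  degree.\<close>

lemma Tdeg_zero: "\<zero>\<^bsub>TD\<^esub> \<in> Tdeg D k"
proof -
  have "Gen (0, 0) \<in> {t. hom_term k t}"
    by (auto intro!: homog.intros simp: Wgrade_def W0_closed W1_closed)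
  moreover have "cl (Gen (0, 0)) = \<zero>\<^bsub>TD\<^esub>" using w12_zero by (simp add: w12_def)
  ultimately show ?thesis unfolding Tdeg_def by (metis imageI)
qed

text \<open>The element -1 of R^e has degree 0, and negation is multiplication by it.\<close>

lemma Tdeg_minus: "x \<in> Tdeg D k \<Longrightarrow> \<ominus>\<^bsub>TD\<^esub> x \<in> Tdeg D k"
proof -
  assume x: "x \<in> Tdeg D k"
  have one: "\<one>\<^bsub>Re D\<^esub> \<in> carrier (Re D)" by (rule TA.R.one_closed)
  then have neg: "\<ominus>\<^bsub>Re D\<^esub> \<one>\<^bsub>Re D\<^esub> \<in> carrier (Re D)" by (rule TA.R.a_inv_closed)
  have "inR D (\<ominus>\<^bsub>Re D\<^esub> \<one>\<^bsub>Re D\<^esub>) \<oplus>\<^bsub>TD\<^esub> inR D \<one>\<^bsub>Re D\<^esub> = \<zero>\<^bsub>TD\<^esub>"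
    unfolding inR_add[OF neg one, symmetric] by (simp add: TA.R.l_neg Re_simps(5) inR_zero)
  then have "inR D (\<ominus>\<^bsub>Re D\<^esub> \<one>\<^bsub>Re D\<^esub>) = \<ominus>\<^bsub>TD\<^esub> \<one>\<^bsub>TD\<^esub>"
    using neg by (intro T.minus_equality[symmetric]) (simp_all add: inR_carrier Re_simps(4) inR_one)
  then have "\<ominus>\<^bsub>TD\<^esub> x = inR D (\<ominus>\<^bsub>Re D\<^esub> \<one>\<^bsub>Re D\<^esub>) \<otimes>\<^bsub>TD\<^esub> x"
    using Tdeg_carrier[OF x] by (simp add: T.l_minus)
  then show ?thesis using Tdeg_mult[OF inR_Tdeg[OF neg] x] by simp
qed

lemma Tdeg_finsum:
  "(\<And>i. i \<in> I \<Longrightarrow> f i \<in> Tdeg D k) \<Longrightarrow> (\<Oplus>\<^bsub>TD\<^esub>i\<in>I. f i) \<in> Tdeg D k"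
proof (induction I rule: infinite_finite_induct)
  case (insert i I)
  then show ?case by (subst T.finsum_insert) (auto intro: Tdeg_carrier Tdeg_add)
qed (simp_all add: Tdeg_zero T.finsum_infinite)

text \<open>Natural numbers with sum 0 are both 0, so T_0 is generated by R^e and W_0.\<close>

lemma Tdeg_induct_0 [consumes 1, case_names R W0 add mult]:
  assumes "x \<in> Tdeg D 0"
    and "\<And>r. r \<in> carrier (Re D) \<Longrightarrow> X (inR D r)" "\<And>\<gamma>. \<gamma> \<in> W0 D \<Longrightarrow> X (w12 D \<gamma>)"
    and "\<And>x y. x \<in> Tdeg D 0 \<Longrightarrow> y \<in> Tdeg D 0 \<Longrightarrow> X x \<Longrightarrow> X y \<Longrightarrow> X (x \<oplus>\<^bsub>TD\<^esub> y)"
    and "\<And>x y. x \<in> Tdeg D 0 \<Longrightarrow> y \<in> Tdeg D 0 \<Longrightarrow> X x \<Longrightarrow> X y \<Longrightarrow> X (x \<otimes>\<^bsub>TD\<^esub> y)"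
  shows "X x"
proof -
  have deg: "cl s \<in> Tdeg D k" if "hom_term k s" for s k using that by (auto simp: Tdeg_def)
  have "X (cl s)" if "hom_term k s" "k = 0" for s k
    using that
  proof (induction rule: homog.induct)
    case (1 r)
    then show ?case using assms(2) by (simp add: inR_def)
  next
    case (2 w k)
    then show ?case using assms(3) by (auto simp: w12_def Wgrade_def)
  next
    case (3 k s t)
    then show ?case using assms(4)[of "cl s" "cl t"] deg hom_term_T by (auto simp: T_ops)
  next
    case (4 k s l t)
    then show ?case using assms(5)[of "cl s" "cl t"] deg hom_term_T by (auto simp: T_ops)
  qed
  with assms(1) show ?thesis by (auto simp: Tdeg_def)
qed

text \<open>A product of degree 1 splits as 0 + 1 or 1 + 0: T_1 is generated by w_1 W_1 as a
  bimodule over T_0.\<close>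

lemma Tdeg_induct_1 [consumes 1, case_names W1 add lmult rmult]:
  assumes "x \<in> Tdeg D 1"
    and "\<And>\<delta>. \<delta> \<in> W1 D \<Longrightarrow> X (w1 D \<delta>)"
    and "\<And>x y. x \<in> Tdeg D 1 \<Longrightarrow> y \<in> Tdeg D 1 \<Longrightarrow> X x \<Longrightarrow> X y \<Longrightarrow> X (x \<oplus>\<^bsub>TD\<^esub> y)"
    and "\<And>a x. a \<in> Tdeg D 0 \<Longrightarrow> x \<in> Tdeg D 1 \<Longrightarrow> X x \<Longrightarrow> X (a \<otimes>\<^bsub>TD\<^esub> x)"
    and "\<And>a x. a \<in> Tdeg D 0 \<Longrightarrow> x \<in> Tdeg D 1 \<Longrightarrow> X x \<Longrightarrow> X (x \<otimes>\<^bsub>TD\<^esub> a)"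
  shows "X x"
proof -
  have deg: "cl s \<in> Tdeg D k" if "hom_term k s" for s k using that by (auto simp: Tdeg_def)
  have "X (cl s)" if "hom_term k s" "k = 1" for s k
    using that
  proof (induction rule: homog.induct)
    case (2 w k)
    then show ?case using assms(2) by (auto simp: w1_def Wgrade_def)
  next
    case (3 k s t)
    then show ?case using assms(3)[of "cl s" "cl t"] deg hom_term_T by (auto simp: T_ops)
  next
    case (4 k s l t)
    then consider "k = 0" "l = 1" | "k = 1" "l = 0" by linarith
    then show ?case
    proof cases
      case 1
      then show ?thesis using 4 assms(4)[of "cl s" "cl t"] deg hom_term_T by (auto simp: T_ops)
    next
      case 2
      then show ?thesis using 4 assms(5)[of "cl t" "cl s"] deg hom_term_T by (auto simp: T_ops)
    qed
  qed simp
  with assms(1) show ?thesis by (auto simp: Tdeg_def)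
qed

text \<open>No nonzero generator has degree 2, so T_2 comes from products of two elements of T_1.
  The case \<open>zero\<close> accounts for the zero generator, which is homogeneous of every
  degree.\<close>

lemma Tdeg_induct_2 [consumes 1, case_names zero add lmult rmult mult]:
  assumes "x \<in> Tdeg D 2"
    and "X \<zero>\<^bsub>TD\<^esub>"
    and "\<And>x y. x \<in> Tdeg D 2 \<Longrightarrow> y \<in> Tdeg D 2 \<Longrightarrow> X x \<Longrightarrow> X y \<Longrightarrow> X (x \<oplus>\<^bsub>TD\<^esub> y)"
    and "\<And>a x. a \<in> Tdeg D 0 \<Longrightarrow> x \<in> Tdeg D 2 \<Longrightarrow> X x \<Longrightarrow> X (a \<otimes>\<^bsub>TD\<^esub> x)"
    and "\<And>a x. a \<in> Tdeg D 0 \<Longrightarrow> x \<in> Tdeg D 2 \<Longrightarrow> X x \<Longrightarrow> X (x \<otimes>\<^bsub>TD\<^esub> a)"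
    and "\<And>x y. x \<in> Tdeg D 1 \<Longrightarrow> y \<in> Tdeg D 1 \<Longrightarrow> X (x \<otimes>\<^bsub>TD\<^esub> y)"
  shows "X x"
proof -
  have deg: "cl s \<in> Tdeg D k" if "hom_term k s" for s k using that by (auto simp: Tdeg_def)
  have "X (cl s)" if "hom_term k s" "k = 2" for s k
    using that
  proof (induction rule: homog.induct)
    case (2 w k)
    then show ?case using assms(2) w12_zero by (auto simp: w12_def Wgrade_def)
  next
    case (3 k s t)
    then show ?case using assms(3)[of "cl s" "cl t"] deg hom_term_T by (auto simp: T_ops)
  next
    case (4 k s l t)
    then consider "k = 0" "l = 2" | "k = 2" "l = 0" | "k = 1" "l = 1" by linarith
    then show ?case
    proof cases
      case 1
      then show ?thesis using 4 assms(4)[of "cl s" "cl t"] deg hom_term_T by (auto simp: T_ops)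
    next
      case 2
      then show ?thesis using 4 assms(5)[of "cl t" "cl s"] deg hom_term_T by (auto simp: T_ops)
    next
      case 3
      then show ?thesis using 4 assms(6)[of "cl s" "cl t"] deg hom_term_T by (auto simp: T_ops)
    qed
  qed simp
  with assms(1) show ?thesis by (auto simp: Tdeg_def)
qed

end

lemma (in ring) finsum_swap:
  assumes "finite A" "\<And>i k. i \<in> A \<Longrightarrow> k \<in> B \<Longrightarrow> f i k \<in> carrier R"
  shows "(\<Oplus>i\<in>A. \<Oplus>k\<in>B. f i k) = (\<Oplus>k\<in>B. \<Oplus>i\<in>A. f i k)"
  using assms
proof (induction A rule: finite_induct)
  case (insert a A)
  then have c: "(\<lambda>i. \<Oplus>k\<in>B. f i k) \<in> A \<rightarrow> carrier R" "(\<Oplus>k\<in>B. f a k) \<in> carrier R"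
    by (auto intro!: finsum_closed)
  have "(\<Oplus>i\<in>insert a A. \<Oplus>k\<in>B. f i k) = (\<Oplus>k\<in>B. f a k) \<oplus> (\<Oplus>i\<in>A. \<Oplus>k\<in>B. f i k)"
    using insert c by (intro finsum_insert) auto
  also have "\<dots> = (\<Oplus>k\<in>B. f a k) \<oplus> (\<Oplus>k\<in>B. \<Oplus>i\<in>A. f i k)"
    using insert by simp
  also have "\<dots> = (\<Oplus>k\<in>B. f a k \<oplus> (\<Oplus>i\<in>A. f i k))"
    using insert by (intro finsum_addf[symmetric]) (auto intro!: finsum_closed)
  also have "\<dots> = (\<Oplus>k\<in>B. \<Oplus>i\<in>insert a A. f i k)"
    using insert by (intro finsum_cong) (auto simp: simp_implies_def intro!: finsum_insert[symmetric] finsum_closed)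
  finally show ?case .
qed (simp add: finsum_zero)

section \<open>The differential on generators\<close>

context eq_bases begin

abbreviation "I1 \<equiv> idx (- {Bot})"

lemma I1_dual_W1: "i \<in> I1 \<Longrightarrow> \<gamma>\<^sub>D i \<in> W1 D"
proof -
  assume i: "i \<in> I1"
  then obtain y x u where yx: "i = (y, x, u)" "pless D y x" "u \<in> B y x" "y \<noteq> Bot" by (cases i) (auto simp: idx_def)
  have "\<gamma>\<^sub>D i v Bot Bot = 0" for v
  proof (cases "v \<in> J")
    case True
    have "dcoef (\<gamma>\<^sub>D i) Bot z (v Bot z) = 0" if "pless D Bot z" for z
      using dcoef_dual_elem[OF yx(2,3) that, of "v Bot z"] yx(1,4) by simp
    then show ?thesis
      using dual_diag_expand[OF idx_dual[OF i] True Bot_P] by simp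
  qed (simp add: dual_out[OF idx_dual[OF i]])
  then show ?thesis using idx_dual[OF i] by (simp add: W1_eq)
qed

lemma I0_dual_W0: "i \<in> idx {Bot} \<Longrightarrow> \<gamma>\<^sub>D i \<in> W0 D"
proof -
  assume i: "i \<in> idx {Bot}"
  then obtain x u where yx: "i = (Bot, x, u)" "pless D Bot x" "u \<in> B Bot x" by (cases i) (auto simp: idx_def)
  have "\<gamma>\<^sub>D i v y y = 0" if "y \<noteq> Bot" for v y
  proof (cases "v \<in> J \<and> y \<in> P")
    case True
    have "dcoef (\<gamma>\<^sub>D i) y z (v y z) = 0" if "pless D y z" for z
      using dcoef_dual_elem[OF yx(2,3) that, of "v y z"] True that yx(1) \<open>y \<noteq> Bot\<close> by (simp add: J_iff)
    then show ?thesis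
      using dual_diag_expand[OF idx_dual[OF i], of v y] True by simp
  next
    case False
    then show ?thesis using S_outside[OF dual_S[OF idx_dual[OF i]], of y v y] by (auto simp: dual_out[OF idx_dual[OF i]])
  qed
  then show ?thesis using idx_dual[OF i] by (simp add: W0_eq)
qed

text \<open>By left linearity, removing row 0 of u multiplies the value by 1 - e_0, which fixes the
  values of functionals in \<open>W1\<close>.\<close>

lemma W1_ehat:
  assumes "\<gamma> \<in> W1 D" "u \<in> J"
  shows "\<gamma> (\<lambda>y x. if y \<in> - {Bot} then u y x else 0) = \<gamma> u"
proof -
  have "(\<lambda>y x. if y \<in> - {Bot} then u y x else 0) = ehat D \<star> u"
    unfolding mmul_S_left[OF ehat_S] using J_nonzero[OF assms(2)] pless_P
    by (intro ext) (auto simp: ehat_eq)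
  then have "\<gamma> (\<lambda>y x. if y \<in> - {Bot} then u y x else 0) = ehat D \<star> \<gamma> u"
    using dual_smult[OF W1_dual[OF assms(1)] ehat_S assms(2)] by simp
  also have "\<dots> = \<gamma> u"
    using assms(1) dual_S[OF W1_dual[OF assms(1)]] by (intro S1_unit) (auto simp: W1_eq)
  finally show ?thesis .
qed

lemma W0_idemp:
  assumes "\<gamma> \<in> W0 D" "u \<in> J"
  shows "\<gamma> (\<lambda>y x. if y \<in> {Bot} then u y x else 0) = \<gamma> u"
proof -
  have "(\<lambda>y x. if y \<in> {Bot} then u y x else 0) = idemp Bot \<star> u"
    unfolding idemp_def unit_mat_mmul by (intro ext) auto
  then have "\<gamma> (\<lambda>y x. if y \<in> {Bot} then u y x else 0) = idemp Bot \<star> \<gamma> u"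
    using dual_smult[OF W0_dual[OF assms(1)] idemp_S[OF Bot_P] assms(2)] by simp
  also have "\<dots> = \<gamma> u"
    using assms(1) dual_S[OF W0_dual[OF assms(1)]] by (intro S2_unit) (auto simp: W0_eq)
  finally show ?thesis .
qed

text \<open>Evaluate at u: the coefficient \<gamma>_j(u) moves inside \<eta> by left linearity, and
  the dual basis identity reassembles u there. The last assumption lets \<eta> ignore the rows
  outside A, which that identity loses.\<close>

lemma sum_dual_ract:
  assumes "\<eta> \<in> dJ" "p \<in> \<Lambda>"
    and "\<And>u. u \<in> J \<Longrightarrow> \<eta> ((\<lambda>y x. if y \<in> A then u y x else 0) \<star> p) = \<eta> (u \<star> p)"
  shows "(\<Sum>j\<in>idx A. \<gamma>\<^sub>D j \<lhd> \<eta> (pb j \<star> p)) = p \<rhd> \<eta>"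
proof
  fix u
  show "(\<Sum>j\<in>idx A. \<gamma>\<^sub>D j \<lhd> \<eta> (pb j \<star> p)) u = (p \<rhd> \<eta>) u"
  proof (cases "u \<in> J")
    case True
    have J: "\<gamma>\<^sub>D j u \<star> (pb j \<star> p) \<in> J" if "j \<in> idx A" for j
      using J_mmul_left[OF S_Lam[OF dual_S[OF idx_dual[OF that]]] J_mmul_right[OF idx_J[OF that] assms(2)]] .
    have "(\<Sum>j\<in>idx A. \<gamma>\<^sub>D j \<lhd> \<eta> (pb j \<star> p)) u = (\<Sum>j\<in>idx A. \<eta> (\<gamma>\<^sub>D j u \<star> (pb j \<star> p)))"
      unfolding sum_fun_apply[where x = u] ract_apply
    proof (intro sum.cong HOL.refl)
      fix j assume j: "j \<in> idx A"
      show "\<gamma>\<^sub>D j u \<star> \<eta> (pb j \<star> p) = \<eta> (\<gamma>\<^sub>D j u \<star> (pb j \<star> p))"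
        using dual_smult[OF assms(1) dual_S[OF idx_dual[OF j]] J_mmul_right[OF idx_J[OF j] assms(2)]] ..
    qed
    also have "\<dots> = \<eta> (\<Sum>j\<in>idx A. \<gamma>\<^sub>D j u \<star> (pb j \<star> p))" using J by (rule dual_sum[OF assms(1), symmetric])
    also have "(\<Sum>j\<in>idx A. \<gamma>\<^sub>D j u \<star> (pb j \<star> p)) = (\<Sum>j\<in>idx A. \<gamma>\<^sub>D j u \<star> pb j) \<star> p"
      unfolding mmul_sum_left mmul_assoc ..
    also have "\<eta> \<dots> = \<eta> (u \<star> p)" unfolding dual_basis_expand[OF True] by (rule assms(3)[OF True])
    finally show ?thesis using True by (simp add: lact_apply)
  next
    case False
    have "(\<Sum>j\<in>idx A. \<gamma>\<^sub>D j \<lhd> \<eta> (pb j \<star> p)) u = (\<Sum>j\<in>idx A. 0)"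
      unfolding sum_fun_apply[where x = u] ract_apply
    proof (intro sum.cong HOL.refl)
      fix j assume j: "j \<in> idx A"
      show "\<gamma>\<^sub>D j u \<star> \<eta> (pb j \<star> p) = 0" unfolding dual_out[OF idx_dual[OF j] False] by simp
    qed
    then show ?thesis using False by (simp add: lact_out)
  qed
qed

lemma restrict_rows_mmul: "(\<lambda>y x. if y \<in> A then u y x else 0) \<star> p = (\<lambda>y x. if y \<in> A then (u \<star> p) y x else 0)"
  by (intro ext) (simp add: mmul_apply)

lemma sum_dual_ract_W1:
  assumes "\<eta> \<in> W1 D" "p \<in> \<Lambda>"
  shows "(\<Sum>j\<in>I1. \<gamma>\<^sub>D j \<lhd> \<eta> (pb j \<star> p)) = p \<rhd> \<eta>"
  using assms by (intro sum_dual_ract W1_dual) (simp_all only: restrict_rows_mmul W1_ehat J_mmul_right)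

lemma sum_dual_ract_W0:
  assumes "\<eta> \<in> W0 D" "p \<in> \<Lambda>"
  shows "(\<Sum>j\<in>idx {Bot}. \<gamma>\<^sub>D j \<lhd> \<eta> (pb j \<star> p)) = p \<rhd> \<eta>"
  using assms by (intro sum_dual_ract W0_dual) (simp_all only: restrict_rows_mmul W0_idemp J_mmul_right)

lemma W0_sum: "(\<And>j. j \<in> I \<Longrightarrow> f j \<in> W0 D) \<Longrightarrow> sum f I \<in> W0 D"
  and W1_sum: "(\<And>j. j \<in> I \<Longrightarrow> f j \<in> W1 D) \<Longrightarrow> sum f I \<in> W1 D"
  by (induction I rule: infinite_finite_induct; simp only: sum.infinite sum.empty sum.insert W0_closed W1_closed
      not_False_eq_True insert_iff simp_thms)+

lemma w12_sum: "(\<And>j. j \<in> I \<Longrightarrow> f j \<in> W0 D) \<Longrightarrow> w12 D (sum f I) = (\<Oplus>\<^bsub>TD\<^esub>j\<in>I. w12 D (f j))"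
proof (induction I rule: infinite_finite_induct)
  case (insert j I)
  then have "w12 D (sum f I) = (\<Oplus>\<^bsub>TD\<^esub>j\<in>I. w12 D (f j))" by simp
  with insert show ?case
    by (subst T.finsum_insert) (auto simp: w12_carrier w12_add W0_sum)
qed (simp_all only: sum.infinite sum.empty w12_zero T.finsum_infinite T.finsum_empty not_False_eq_True)

lemma w1_sum: "(\<And>j. j \<in> I \<Longrightarrow> f j \<in> W1 D) \<Longrightarrow> w1 D (sum f I) = (\<Oplus>\<^bsub>TD\<^esub>j\<in>I. w1 D (f j))"
proof (induction I rule: infinite_finite_induct)
  case (insert j I)
  then have "w1 D (sum f I) = (\<Oplus>\<^bsub>TD\<^esub>j\<in>I. w1 D (f j))" by simp
  with insert show ?case
    by (subst T.finsum_insert) (auto simp: w1_carrier w1_add W1_sum)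
qed (simp_all only: sum.infinite sum.empty w1_zero T.finsum_infinite T.finsum_empty not_False_eq_True)

text \<open>The common shape of the two formulas for \<open>d\<^sub>e\<close>: as \<open>\<Sum>\<^sub>j \<gamma>\<^sub>j \<gamma>(p\<^sub>jp\<^sub>i)\<close> is the functional
  \<open>v \<mapsto> \<gamma>(vp\<^sub>i)\<close>, only the sum over \<open>i\<close> remains.\<close>

definition dW :: "(('a, 'g) J_dual \<Rightarrow> ('a, 'g) T_elem) \<Rightarrow> ('a, 'g) J_dual \<Rightarrow> ('a, 'g) T_elem" where
  "dW \<omega> \<gamma> = \<ominus>\<^bsub>TD\<^esub> (\<Oplus>\<^bsub>TD\<^esub>i\<in>I1. w1 D (\<gamma>\<^sub>D i) \<otimes>\<^bsub>TD\<^esub> \<omega> (pb i \<rhd> \<gamma>))"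

end

text \<open>Treats both families of generators at once: \<open>V\<close> and \<open>\<omega>\<close>
  stand for \<open>W0\<close> and \<open>w12\<close>, and for \<open>W1\<close> and
  \<open>w1\<close>.\<close>

locale dW_target = eq_bases D B for D :: "('a, 'f::field, 'g::field) eq_data" and B +
  fixes V :: "('a, 'g) J_dual set" and \<omega> :: "('a, 'g) J_dual \<Rightarrow> ('a, 'g) T_elem"
  assumes V_dual: "V \<subseteq> dJ"
    and V_lact: "\<gamma> \<in> V \<Longrightarrow> a \<in> \<Lambda> \<Longrightarrow> a \<rhd> \<gamma> \<in> V"
    and \<omega>_carrier: "\<gamma> \<in> V \<Longrightarrow> \<omega> \<gamma> \<in> carrier TD"
    and \<omega>_add: "\<gamma> \<in> V \<Longrightarrow> \<gamma>' \<in> V \<Longrightarrow> \<omega> (\<gamma> + \<gamma>') = \<omega> \<gamma> \<oplus>\<^bsub>TD\<^esub> \<omega> \<gamma>'"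
    and \<omega>_sum: "(\<And>j. j \<in> I \<Longrightarrow> f j \<in> V) \<Longrightarrow> \<omega> (sum f I) = (\<Oplus>\<^bsub>TD\<^esub>j\<in>(I :: ('a pt \<times> 'a pt \<times> ('a, 'g) pmat) set). \<omega> (f j))"
    and \<omega>_lact: "\<gamma> \<in> V \<Longrightarrow> (a, b) \<in> carrier (Re D) \<Longrightarrow> \<omega> (a \<rhd> \<gamma>) = inR D (a, b) \<otimes>\<^bsub>TD\<^esub> \<omega> \<gamma>"
begin

lemma dW_term_carrier: "\<gamma> \<in> V \<Longrightarrow> i \<in> I1 \<Longrightarrow> w1 D (\<gamma>\<^sub>D i) \<otimes>\<^bsub>TD\<^esub> \<omega> (pb i \<rhd> \<gamma>) \<in> carrier TD"
  by (intro T.m_closed w1_carrier I1_dual_W1 \<omega>_carrier V_lact J_Lam) (auto intro: idx_J)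

lemma dW_carrier: "\<gamma> \<in> V \<Longrightarrow> dW \<omega> \<gamma> \<in> carrier TD"
  unfolding dW_def by (intro T.a_inv_closed T.finsum_closed) (auto intro: dW_term_carrier)

lemma dW_add: "\<gamma> \<in> V \<Longrightarrow> \<gamma>' \<in> V \<Longrightarrow> dW \<omega> (\<gamma> + \<gamma>') = dW \<omega> \<gamma> \<oplus>\<^bsub>TD\<^esub> dW \<omega> \<gamma>'"
proof -
  assume *: "\<gamma> \<in> V" "\<gamma>' \<in> V"
  have "(\<Oplus>\<^bsub>TD\<^esub>i\<in>I1. w1 D (\<gamma>\<^sub>D i) \<otimes>\<^bsub>TD\<^esub> \<omega> (pb i \<rhd> (\<gamma> + \<gamma>'))) =
      (\<Oplus>\<^bsub>TD\<^esub>i\<in>I1. w1 D (\<gamma>\<^sub>D i) \<otimes>\<^bsub>TD\<^esub> \<omega> (pb i \<rhd> \<gamma>) \<oplus>\<^bsub>TD\<^esub> w1 D (\<gamma>\<^sub>D i) \<otimes>\<^bsub>TD\<^esub> \<omega> (pb i \<rhd> \<gamma>'))"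
  proof (rule T.finsum_cong'[OF HOL.refl])
    fix i assume i: "i \<in> I1"
    then have p: "pb i \<in> \<Lambda>" by (intro J_Lam idx_J)
    show "w1 D (\<gamma>\<^sub>D i) \<otimes>\<^bsub>TD\<^esub> \<omega> (pb i \<rhd> (\<gamma> + \<gamma>')) =
        w1 D (\<gamma>\<^sub>D i) \<otimes>\<^bsub>TD\<^esub> \<omega> (pb i \<rhd> \<gamma>) \<oplus>\<^bsub>TD\<^esub> w1 D (\<gamma>\<^sub>D i) \<otimes>\<^bsub>TD\<^esub> \<omega> (pb i \<rhd> \<gamma>')"
      unfolding lact_add_right using * p i
      by (simp add: \<omega>_add V_lact T.r_distr \<omega>_carrier w1_carrier I1_dual_W1)
  qed (use * in \<open>auto intro: dW_term_carrier\<close>)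
  also have "\<dots> = (\<Oplus>\<^bsub>TD\<^esub>i\<in>I1. w1 D (\<gamma>\<^sub>D i) \<otimes>\<^bsub>TD\<^esub> \<omega> (pb i \<rhd> \<gamma>)) \<oplus>\<^bsub>TD\<^esub> (\<Oplus>\<^bsub>TD\<^esub>i\<in>I1. w1 D (\<gamma>\<^sub>D i) \<otimes>\<^bsub>TD\<^esub> \<omega> (pb i \<rhd> \<gamma>'))"
    using * by (intro T.finsum_addf) (auto intro: dW_term_carrier)
  finally show ?thesis
    unfolding dW_def using * by (subst T.minus_add[symmetric]) (auto intro!: T.finsum_closed dW_term_carrier)
qed

text \<open>The right action touches only the last tensor factor, so the dual basis stays as it
  is.\<close>

lemma dW_ract:
  assumes "\<gamma> \<in> V" "r \<in> carrier (Re D)" "\<gamma> \<lhd> t \<in> V"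
    and ract: "\<And>\<eta>. \<eta> \<in> V \<Longrightarrow> \<omega> (\<eta> \<lhd> t) = \<omega> \<eta> \<otimes>\<^bsub>TD\<^esub> inR D r"
  shows "dW \<omega> (\<gamma> \<lhd> t) = dW \<omega> \<gamma> \<otimes>\<^bsub>TD\<^esub> inR D r"
proof -
  have "(\<Oplus>\<^bsub>TD\<^esub>i\<in>I1. w1 D (\<gamma>\<^sub>D i) \<otimes>\<^bsub>TD\<^esub> \<omega> (pb i \<rhd> (\<gamma> \<lhd> t))) =
      (\<Oplus>\<^bsub>TD\<^esub>i\<in>I1. w1 D (\<gamma>\<^sub>D i) \<otimes>\<^bsub>TD\<^esub> \<omega> (pb i \<rhd> \<gamma>) \<otimes>\<^bsub>TD\<^esub> inR D r)"
  proof (rule T.finsum_cong'[OF HOL.refl])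
    fix i assume i: "i \<in> I1"
    then have p: "pb i \<in> \<Lambda>" by (intro J_Lam idx_J)
    show "w1 D (\<gamma>\<^sub>D i) \<otimes>\<^bsub>TD\<^esub> \<omega> (pb i \<rhd> (\<gamma> \<lhd> t)) = w1 D (\<gamma>\<^sub>D i) \<otimes>\<^bsub>TD\<^esub> \<omega> (pb i \<rhd> \<gamma>) \<otimes>\<^bsub>TD\<^esub> inR D r"
      unfolding lact_ract using assms p i
      by (simp add: ract V_lact T.m_assoc \<omega>_carrier w1_carrier I1_dual_W1 inR_carrier)
  qed (use assms in \<open>auto intro: dW_term_carrier inR_carrier\<close>)
  also have "\<dots> = (\<Oplus>\<^bsub>TD\<^esub>i\<in>I1. w1 D (\<gamma>\<^sub>D i) \<otimes>\<^bsub>TD\<^esub> \<omega> (pb i \<rhd> \<gamma>)) \<otimes>\<^bsub>TD\<^esub> inR D r"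
    using assms by (intro T.finsum_ldistr[symmetric]) (auto intro: dW_term_carrier inR_carrier)
  finally show ?thesis
    unfolding dW_def using assms by (simp add: T.l_minus inR_carrier T.finsum_closed dW_term_carrier)
qed

text \<open>The bases of J are adapted to left multiplication only, so p_i a has to be expanded
  again, as \<Sum>_k \<gamma>_k(p_i a) p_k. The coefficient crosses the tensor sign to \<gamma>_i,
  and by \<open>sum_dual_ract_W1\<close> the sum over i of \<gamma>_i \<gamma>_k(p_i a) is a
  \<gamma>_k.\<close>

lemma dW_lact:
  assumes \<gamma>: "\<gamma> \<in> V" and r: "(a, b) \<in> carrier (Re D)"
  shows "dW \<omega> (a \<rhd> \<gamma>) = inR D (a, b) \<otimes>\<^bsub>TD\<^esub> dW \<omega> \<gamma>"
proof -
  have a: "a \<in> S" "a \<in> \<Lambda>" using Re_S[OF r] S_Lam by auto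
  note W1 = I1_dual_W1
  have pJ: "pb i \<star> a \<in> J" if "i \<in> I1" for i using that a by (intro J_mmul_right idx_J)
  let ?c = "\<lambda>k i. \<gamma>\<^sub>D k (pb i \<star> a)"
  have c: "(?c k i, 0) \<in> carrier (Re D)" "?c k i \<in> S" "?c k i \<in> \<Lambda>" if "k \<in> I1" for k i
    using W1[OF that] dual_S[OF W1_dual[OF W1[OF that]]] S_Lam by (auto simp: Re_simps W1_eq)
  have V: "pb i \<rhd> \<gamma> \<in> V" if "i \<in> I1" for i using that \<gamma> by (intro V_lact J_Lam idx_J)
  have p\<gamma>: "(pb i \<star> a) \<rhd> \<gamma> = (\<Sum>k\<in>I1. ?c k i \<rhd> (pb k \<rhd> \<gamma>))" if i: "i \<in> I1" for i
  proof -
    \<comment> \<open>For i in \<open>I1\<close> the matrix p_i has no row 0, so the expansion over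
      \<open>I1\<close> recovers p_i a completely.\<close>
    have "(\<lambda>y x. if y \<in> - {Bot} then (pb i \<star> a) y x else 0) = pb i \<star> a"
    proof (intro ext)
      fix y x
      have "pb i Bot x = 0"
      proof (cases i)
        case (fields y' x' u)
        then have "pless D y' x'" "u \<in> B y' x'" "y' \<noteq> Bot" using i by (auto simp: idx_def)
        then have "unit_mat y' x' (u y' x') Bot x = 0" by (simp add: unit_mat_def)
        then show ?thesis using unit_mat_B[OF \<open>pless D y' x'\<close> \<open>u \<in> B y' x'\<close>] fields by simp
      qed
      then show "(if y \<in> - {Bot} then (pb i \<star> a) y x else 0) = (pb i \<star> a) y x"
        by (simp add: mmul_S_right[OF a(1)])
    qed
    then have "(pb i \<star> a) \<rhd> \<gamma> = (\<Sum>k\<in>I1. ?c k i \<star> pb k) \<rhd> \<gamma>"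
      using dual_basis_expand[OF pJ[OF i], of "- {Bot}"] by simp
    also have "\<dots> = (\<Sum>k\<in>I1. (?c k i \<star> pb k) \<rhd> \<gamma>)"
    proof -
      \<comment> \<open>Membership in \<Lambda> is carried along because additivity of the action in
        the matrix, \<open>lact_add_left\<close>, requires it.\<close>
      have "(\<Sum>k\<in>K. ?c k i \<star> pb k) \<in> \<Lambda> \<and> (\<Sum>k\<in>K. ?c k i \<star> pb k) \<rhd> \<gamma> = (\<Sum>k\<in>K. (?c k i \<star> pb k) \<rhd> \<gamma>)"
        if "K \<subseteq> I1" for K
        using finite_subset[OF that finite_idx] that
      proof (induction K rule: finite_induct)
        case empty
        show ?case using lact_zero[OF subsetD[OF V_dual \<gamma>]] by (simp only: sum.empty Lam_zero simp_thms)
      next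
        case (insert k K)
        then have "k \<in> I1" by simp
        then have k: "?c k i \<star> pb k \<in> \<Lambda>" by (intro Lam_mmul[OF c(3) J_Lam[OF idx_J]])
        have "?c k i \<star> pb k + (\<Sum>k\<in>K. ?c k i \<star> pb k) \<in> \<Lambda>" using k insert by (intro Lam_add) auto
        moreover have "(?c k i \<star> pb k + (\<Sum>k\<in>K. ?c k i \<star> pb k)) \<rhd> \<gamma> =
            (?c k i \<star> pb k) \<rhd> \<gamma> + (\<Sum>k\<in>K. (?c k i \<star> pb k) \<rhd> \<gamma>)"
          using lact_add_left[OF _ k, of \<gamma> "\<Sum>k\<in>K. ?c k i \<star> pb k"] insert \<gamma> V_dual by auto
        ultimately show ?case using insert(1,2) by (simp only: sum.insert not_False_eq_True simp_thms)
      qed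
      then show ?thesis by blast
    qed
    also have "\<dots> = (\<Sum>k\<in>I1. ?c k i \<rhd> (pb k \<rhd> \<gamma>))"
      by (intro sum.cong HOL.refl) (simp add: lact_lact c(3))
    finally show ?thesis .
  qed
  have \<omega>: "\<omega> (pb i \<rhd> (a \<rhd> \<gamma>)) = (\<Oplus>\<^bsub>TD\<^esub>k\<in>I1. inR D (?c k i, 0) \<otimes>\<^bsub>TD\<^esub> \<omega> (pb k \<rhd> \<gamma>))" if i: "i \<in> I1" for i
  proof -
    have "pb i \<rhd> (a \<rhd> \<gamma>) = (\<Sum>k\<in>I1. ?c k i \<rhd> (pb k \<rhd> \<gamma>))"
      using p\<gamma>[OF i] lact_lact[OF J_Lam[OF idx_J[OF i]]] by simp
    then have "\<omega> (pb i \<rhd> (a \<rhd> \<gamma>)) = (\<Oplus>\<^bsub>TD\<^esub>k\<in>I1. \<omega> (?c k i \<rhd> (pb k \<rhd> \<gamma>)))"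
      using \<omega>_sum[of I1 "\<lambda>k. ?c k i \<rhd> (pb k \<rhd> \<gamma>)", OF V_lact[OF V c(3)]] by simp
    also have "\<dots> = (\<Oplus>\<^bsub>TD\<^esub>k\<in>I1. inR D (?c k i, 0) \<otimes>\<^bsub>TD\<^esub> \<omega> (pb k \<rhd> \<gamma>))"
    proof (rule T.finsum_cong'[OF HOL.refl Pi_I])
      fix k assume k: "k \<in> I1"
      show "inR D (?c k i, 0) \<otimes>\<^bsub>TD\<^esub> \<omega> (pb k \<rhd> \<gamma>) \<in> carrier TD"
        by (rule T.m_closed[OF inR_carrier[OF c(1)[OF k]] \<omega>_carrier[OF V[OF k]]])
      show "\<omega> (?c k i \<rhd> (pb k \<rhd> \<gamma>)) = inR D (?c k i, 0) \<otimes>\<^bsub>TD\<^esub> \<omega> (pb k \<rhd> \<gamma>)"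
        by (rule \<omega>_lact[OF V[OF k] c(1)[OF k]])
    qed
    finally show ?thesis .
  qed
  have car: "w1 D (\<gamma>\<^sub>D i \<lhd> ?c k i) \<otimes>\<^bsub>TD\<^esub> \<omega> (pb k \<rhd> \<gamma>) \<in> carrier TD" if "i \<in> I1" "k \<in> I1" for i k
    by (rule T.m_closed[OF w1_carrier[OF W1_closed(4)[OF W1[OF that(1)] c(2)[OF that(2)]]] \<omega>_carrier[OF V[OF that(2)]]])
  have "(\<Oplus>\<^bsub>TD\<^esub>i\<in>I1. w1 D (\<gamma>\<^sub>D i) \<otimes>\<^bsub>TD\<^esub> \<omega> (pb i \<rhd> (a \<rhd> \<gamma>))) =
      (\<Oplus>\<^bsub>TD\<^esub>i\<in>I1. \<Oplus>\<^bsub>TD\<^esub>k\<in>I1. w1 D (\<gamma>\<^sub>D i \<lhd> ?c k i) \<otimes>\<^bsub>TD\<^esub> \<omega> (pb k \<rhd> \<gamma>))"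
  proof (rule T.finsum_cong'[OF HOL.refl])
    fix i assume i: "i \<in> I1"
    have "w1 D (\<gamma>\<^sub>D i) \<otimes>\<^bsub>TD\<^esub> \<omega> (pb i \<rhd> (a \<rhd> \<gamma>)) =
        (\<Oplus>\<^bsub>TD\<^esub>k\<in>I1. w1 D (\<gamma>\<^sub>D i) \<otimes>\<^bsub>TD\<^esub> (inR D (?c k i, 0) \<otimes>\<^bsub>TD\<^esub> \<omega> (pb k \<rhd> \<gamma>)))"
      unfolding \<omega>[OF i]
      by (rule T.finsum_rdistr[OF finite_idx w1_carrier[OF W1[OF i]] Pi_I])
         (rule T.m_closed[OF inR_carrier[OF c(1)] \<omega>_carrier[OF V]])
    also have "\<dots> = (\<Oplus>\<^bsub>TD\<^esub>k\<in>I1. w1 D (\<gamma>\<^sub>D i \<lhd> ?c k i) \<otimes>\<^bsub>TD\<^esub> \<omega> (pb k \<rhd> \<gamma>))"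
    proof (rule T.finsum_cong'[OF HOL.refl])
      fix k assume k: "k \<in> I1"
      show "w1 D (\<gamma>\<^sub>D i) \<otimes>\<^bsub>TD\<^esub> (inR D (?c k i, 0) \<otimes>\<^bsub>TD\<^esub> \<omega> (pb k \<rhd> \<gamma>)) =
          w1 D (\<gamma>\<^sub>D i \<lhd> ?c k i) \<otimes>\<^bsub>TD\<^esub> \<omega> (pb k \<rhd> \<gamma>)"
        unfolding w1_ract[OF W1[OF i] c(1)[OF k]]
        by (rule T.m_assoc[symmetric]) (intro w1_carrier W1 i inR_carrier c k \<omega>_carrier V)+
    qed (rule Pi_I, rule car[OF i])
    finally show "w1 D (\<gamma>\<^sub>D i) \<otimes>\<^bsub>TD\<^esub> \<omega> (pb i \<rhd> (a \<rhd> \<gamma>)) =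
      (\<Oplus>\<^bsub>TD\<^esub>k\<in>I1. w1 D (\<gamma>\<^sub>D i \<lhd> ?c k i) \<otimes>\<^bsub>TD\<^esub> \<omega> (pb k \<rhd> \<gamma>))" .
  qed (rule Pi_I, rule T.finsum_closed, rule Pi_I, rule car)
  also have "\<dots> = (\<Oplus>\<^bsub>TD\<^esub>k\<in>I1. \<Oplus>\<^bsub>TD\<^esub>i\<in>I1. w1 D (\<gamma>\<^sub>D i \<lhd> ?c k i) \<otimes>\<^bsub>TD\<^esub> \<omega> (pb k \<rhd> \<gamma>))"
    using car by (intro T.finsum_swap finite_idx)
  also have "\<dots> = (\<Oplus>\<^bsub>TD\<^esub>k\<in>I1. inR D (a, b) \<otimes>\<^bsub>TD\<^esub> (w1 D (\<gamma>\<^sub>D k) \<otimes>\<^bsub>TD\<^esub> \<omega> (pb k \<rhd> \<gamma>)))"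
  proof (rule T.finsum_cong'[OF HOL.refl])
    fix k assume k: "k \<in> I1"
    have "(\<Oplus>\<^bsub>TD\<^esub>i\<in>I1. w1 D (\<gamma>\<^sub>D i \<lhd> ?c k i) \<otimes>\<^bsub>TD\<^esub> \<omega> (pb k \<rhd> \<gamma>)) =
        (\<Oplus>\<^bsub>TD\<^esub>i\<in>I1. w1 D (\<gamma>\<^sub>D i \<lhd> ?c k i)) \<otimes>\<^bsub>TD\<^esub> \<omega> (pb k \<rhd> \<gamma>)"
      by (rule T.finsum_ldistr[OF finite_idx \<omega>_carrier[OF V[OF k]] Pi_I, symmetric])
         (rule w1_carrier[OF W1_closed(4)[OF W1 c(2)[OF k]]])
    also have "(\<Oplus>\<^bsub>TD\<^esub>i\<in>I1. w1 D (\<gamma>\<^sub>D i \<lhd> ?c k i)) = w1 D (\<Sum>i\<in>I1. \<gamma>\<^sub>D i \<lhd> ?c k i)"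
      by (rule w1_sum[symmetric], rule W1_closed(4)[OF W1 c(2)[OF k]])
    also have "(\<Sum>i\<in>I1. \<gamma>\<^sub>D i \<lhd> ?c k i) = a \<rhd> \<gamma>\<^sub>D k"
      by (rule sum_dual_ract_W1[OF W1[OF k] a(2)])
    also have "w1 D (a \<rhd> \<gamma>\<^sub>D k) = inR D (a, b) \<otimes>\<^bsub>TD\<^esub> w1 D (\<gamma>\<^sub>D k)" by (rule w1_lact[OF W1[OF k] r])
    finally show "(\<Oplus>\<^bsub>TD\<^esub>i\<in>I1. w1 D (\<gamma>\<^sub>D i \<lhd> ?c k i) \<otimes>\<^bsub>TD\<^esub> \<omega> (pb k \<rhd> \<gamma>)) =
        inR D (a, b) \<otimes>\<^bsub>TD\<^esub> (w1 D (\<gamma>\<^sub>D k) \<otimes>\<^bsub>TD\<^esub> \<omega> (pb k \<rhd> \<gamma>))"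
      using T.m_assoc[OF inR_carrier[OF r] w1_carrier[OF W1[OF k]] \<omega>_carrier[OF V[OF k]]] by simp
  qed (use dW_term_carrier[OF \<gamma>] inR_carrier[OF r] in auto)
  also have "\<dots> = inR D (a, b) \<otimes>\<^bsub>TD\<^esub> (\<Oplus>\<^bsub>TD\<^esub>k\<in>I1. w1 D (\<gamma>\<^sub>D k) \<otimes>\<^bsub>TD\<^esub> \<omega> (pb k \<rhd> \<gamma>))"
    using dW_term_carrier[OF \<gamma>] inR_carrier[OF r] by (intro T.finsum_rdistr[symmetric]) auto
  finally show ?thesis
    unfolding dW_def using r \<gamma> by (simp add: T.r_minus inR_carrier T.finsum_closed dW_term_carrier)
qed

end

section \<open>Existence and uniqueness of the differential\<close>

context eq_bases begin

interpretation d12: dW_target D B "W0 D" "w12 D"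
  by unfold_locales (simp_all add: W0_dual subsetI W0_closed w12_carrier w12_add w12_sum w12_lact)

interpretation d1: dW_target D B "W1 D" "w1 D"
  by unfold_locales (simp_all add: W1_dual subsetI W1_closed w1_carrier w1_add w1_sum w1_lact)

lemma neg_mult_distrib:
  assumes "x \<in> carrier TD" "y \<in> carrier TD" "z \<in> carrier TD"
  shows "x \<otimes>\<^bsub>TD\<^esub> (y \<ominus>\<^bsub>TD\<^esub> z) = x \<otimes>\<^bsub>TD\<^esub> y \<ominus>\<^bsub>TD\<^esub> x \<otimes>\<^bsub>TD\<^esub> z"
    "(y \<ominus>\<^bsub>TD\<^esub> z) \<otimes>\<^bsub>TD\<^esub> x = y \<otimes>\<^bsub>TD\<^esub> x \<ominus>\<^bsub>TD\<^esub> z \<otimes>\<^bsub>TD\<^esub> x"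
  using assms by (simp_all add: a_minus_def T.r_distr T.l_distr T.r_minus T.l_minus)

text \<open>The parity automorphism on generators; it induces (-1)^k in degree k
  (\<open>sg_homog\<close>) and is the twist of the derivation \<open>dv\<close>.\<close>

definition sgn_W :: "('a, 'g) W_elem \<Rightarrow> ('a, 'g) T_elem" where
  "sgn_W = (\<lambda>(\<gamma>, \<delta>). w12 D \<gamma> \<ominus>\<^bsub>TD\<^esub> w1 D \<delta>)"

definition der_W :: "('a, 'g) W_elem \<Rightarrow> ('a, 'g) T_elem" where
  "der_W = (\<lambda>(\<gamma>, \<delta>). dW (w12 D) \<gamma> \<oplus>\<^bsub>TD\<^esub> dW (w1 D) \<delta>)"

lemma bimod_map_iff:
  "TA.bimod_map \<phi> \<longleftrightarrow> (\<forall>\<gamma>\<in>W0 D. \<forall>\<delta>\<in>W1 D. \<phi> (\<gamma>, \<delta>) \<in> carrier TD \<and>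
     (\<forall>\<gamma>'\<in>W0 D. \<forall>\<delta>'\<in>W1 D. \<phi> (\<gamma> + \<gamma>', \<delta> + \<delta>') = \<phi> (\<gamma>, \<delta>) \<oplus>\<^bsub>TD\<^esub> \<phi> (\<gamma>', \<delta>')) \<and>
     (\<forall>a b. (a, b) \<in> carrier (Re D) \<longrightarrow> \<phi> (a \<rhd> \<gamma>, a \<rhd> \<delta>) = inR D (a, b) \<otimes>\<^bsub>TD\<^esub> \<phi> (\<gamma>, \<delta>) \<and>
        \<phi> (\<gamma> \<lhd> b, \<delta> \<lhd> a) = \<phi> (\<gamma>, \<delta>) \<otimes>\<^bsub>TD\<^esub> inR D (a, b)))"
  unfolding TA.bimod_map_def Talg_def[symmetric] inR_def[symmetric] Wbim_simps(1) by (force simp: Wbim_simps Pi_iff)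

lemma bimod_sgn_W: "TA.bimod_map sgn_W"
  unfolding bimod_map_iff sgn_W_def prod.case
proof (intro ballI conjI allI impI)
  fix \<gamma> \<delta> assume *: "\<gamma> \<in> W0 D" "\<delta> \<in> W1 D"
  show "w12 D \<gamma> \<ominus>\<^bsub>TD\<^esub> w1 D \<delta> \<in> carrier TD" using * by (simp add: w12_carrier w1_carrier)
  fix \<gamma>' \<delta>' assume "\<gamma>' \<in> W0 D" "\<delta>' \<in> W1 D"
  then show "w12 D (\<gamma> + \<gamma>') \<ominus>\<^bsub>TD\<^esub> w1 D (\<delta> + \<delta>') = w12 D \<gamma> \<ominus>\<^bsub>TD\<^esub> w1 D \<delta> \<oplus>\<^bsub>TD\<^esub> (w12 D \<gamma>' \<ominus>\<^bsub>TD\<^esub> w1 D \<delta>')"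
    using * by (simp add: w12_carrier w1_carrier w12_add w1_add a_minus_def T.minus_add T.a_ac)
next
  fix \<gamma> \<delta> a b assume *: "\<gamma> \<in> W0 D" "\<delta> \<in> W1 D" "(a, b) \<in> carrier (Re D)"
  show "w12 D (a \<rhd> \<gamma>) \<ominus>\<^bsub>TD\<^esub> w1 D (a \<rhd> \<delta>) = inR D (a, b) \<otimes>\<^bsub>TD\<^esub> (w12 D \<gamma> \<ominus>\<^bsub>TD\<^esub> w1 D \<delta>)"
    "w12 D (\<gamma> \<lhd> b) \<ominus>\<^bsub>TD\<^esub> w1 D (\<delta> \<lhd> a) = (w12 D \<gamma> \<ominus>\<^bsub>TD\<^esub> w1 D \<delta>) \<otimes>\<^bsub>TD\<^esub> inR D (a, b)"
    unfolding w12_lact[OF *(1,3)] w1_lact[OF *(2,3)] w12_ract[OF *(1,3)] w1_ract[OF *(2,3)]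
    using * by (simp_all add: neg_mult_distrib w12_carrier w1_carrier inR_carrier)
qed

lemma bimod_der_W: "TA.bimod_map der_W"
  unfolding bimod_map_iff der_W_def prod.case
proof (intro ballI conjI allI impI)
  fix \<gamma> \<delta> assume *: "\<gamma> \<in> W0 D" "\<delta> \<in> W1 D"
  show "dW (w12 D) \<gamma> \<oplus>\<^bsub>TD\<^esub> dW (w1 D) \<delta> \<in> carrier TD" using * by (simp add: d12.dW_carrier d1.dW_carrier)
  fix \<gamma>' \<delta>' assume "\<gamma>' \<in> W0 D" "\<delta>' \<in> W1 D"
  then show "dW (w12 D) (\<gamma> + \<gamma>') \<oplus>\<^bsub>TD\<^esub> dW (w1 D) (\<delta> + \<delta>') =
      dW (w12 D) \<gamma> \<oplus>\<^bsub>TD\<^esub> dW (w1 D) \<delta> \<oplus>\<^bsub>TD\<^esub> (dW (w12 D) \<gamma>' \<oplus>\<^bsub>TD\<^esub> dW (w1 D) \<delta>')"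
    using * by (simp add: d12.dW_carrier d1.dW_carrier d12.dW_add d1.dW_add T.a_ac)
next
  fix \<gamma> \<delta> a b assume *: "\<gamma> \<in> W0 D" "\<delta> \<in> W1 D" "(a, b) \<in> carrier (Re D)"
  have ab: "a \<in> S" "b \<in> S" using Re_S[OF *(3)] by auto
  show "dW (w12 D) (a \<rhd> \<gamma>) \<oplus>\<^bsub>TD\<^esub> dW (w1 D) (a \<rhd> \<delta>) = inR D (a, b) \<otimes>\<^bsub>TD\<^esub> (dW (w12 D) \<gamma> \<oplus>\<^bsub>TD\<^esub> dW (w1 D) \<delta>)"
    unfolding d12.dW_lact[OF *(1,3)] d1.dW_lact[OF *(2,3)]
    using * by (simp add: T.r_distr d12.dW_carrier d1.dW_carrier inR_carrier)
  have "dW (w12 D) (\<gamma> \<lhd> b) = dW (w12 D) \<gamma> \<otimes>\<^bsub>TD\<^esub> inR D (a, b)"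
    using *(1,3) ab w12_ract[OF _ *(3)] by (intro d12.dW_ract) auto
  moreover have "dW (w1 D) (\<delta> \<lhd> a) = dW (w1 D) \<delta> \<otimes>\<^bsub>TD\<^esub> inR D (a, b)"
    using *(2,3) ab w1_ract[OF _ *(3)] by (intro d1.dW_ract) auto
  ultimately show "dW (w12 D) (\<gamma> \<lhd> b) \<oplus>\<^bsub>TD\<^esub> dW (w1 D) (\<delta> \<lhd> a) =
      (dW (w12 D) \<gamma> \<oplus>\<^bsub>TD\<^esub> dW (w1 D) \<delta>) \<otimes>\<^bsub>TD\<^esub> inR D (a, b)"
    using * by (simp add: T.l_distr d12.dW_carrier d1.dW_carrier inR_carrier)
qed

lemma dW_zero: "dW (w12 D) 0 = \<zero>\<^bsub>TD\<^esub>" "dW (w1 D) 0 = \<zero>\<^bsub>TD\<^esub>"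
  using d12.dW_lact[of 0 0 0] d1.dW_lact[of 0 0 0] Re_zero d12.dW_carrier[of 0] d1.dW_carrier[of 0]
  by (simp_all add: W0_closed W1_closed inR_zero)

lemma dW_w12_Tdeg: "\<gamma> \<in> W0 D \<Longrightarrow> dW (w12 D) \<gamma> \<in> Tdeg D 1"
  unfolding dW_def
proof (intro Tdeg_minus Tdeg_finsum)
  fix i assume \<gamma>: "\<gamma> \<in> W0 D" and i: "i \<in> I1"
  show "w1 D (\<gamma>\<^sub>D i) \<otimes>\<^bsub>TD\<^esub> w12 D (pb i \<rhd> \<gamma>) \<in> Tdeg D 1"
    using Tdeg_mult[OF w1_Tdeg[OF I1_dual_W1[OF i]] w12_Tdeg[OF W0_closed(3)[OF \<gamma> J_Lam[OF idx_J[OF i]]]]]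
    by (simp add: numeral_2_eq_2)
qed

lemma dW_w1_Tdeg: "\<gamma> \<in> W1 D \<Longrightarrow> dW (w1 D) \<gamma> \<in> Tdeg D 2"
  unfolding dW_def
proof (intro Tdeg_minus Tdeg_finsum)
  fix i assume \<gamma>: "\<gamma> \<in> W1 D" and i: "i \<in> I1"
  show "w1 D (\<gamma>\<^sub>D i) \<otimes>\<^bsub>TD\<^esub> w1 D (pb i \<rhd> \<gamma>) \<in> Tdeg D 2"
    using Tdeg_mult[OF w1_Tdeg[OF I1_dual_W1[OF i]] w1_Tdeg[OF W1_closed(3)[OF \<gamma> J_Lam[OF idx_J[OF i]]]]]
    by (simp add: numeral_2_eq_2)
qed

abbreviation "sg \<equiv> TA.ext sgn_W"
abbreviation "dv \<equiv> TA.der sgn_W der_W"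

lemma sg_homog: "hom_term k s \<Longrightarrow> sg s = (if even k then cl s else \<ominus>\<^bsub>TD\<^esub> cl s)"
proof (induction rule: homog.induct)
  case (1 r)
  then show ?case by simp
next
  case (2 w k)
  then obtain \<gamma> \<delta> where w: "w = (\<gamma>, \<delta>)" "\<gamma> \<in> W0 D" "\<delta> \<in> W1 D"
    using Wgrade_carrier[OF 2] by (cases w) (auto simp: Wbim_simps)
  then have "k = 0 \<and> \<delta> = 0 \<or> k = 1 \<and> \<gamma> = 0 \<or> \<gamma> = 0 \<and> \<delta> = 0" using 2 by (auto simp: Wgrade_def split: if_splits)
  then show ?case unfolding w(1) Gen_split[OF w(2,3)] using w(2,3)
    by (auto simp: sgn_W_def w12_zero w1_zero w12_carrier w1_carrier a_minus_def)
next
  case (3 k s t)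
  then show ?case using hom_term_T[THEN TA.cls_carrier, folded Talg_def]
    by (auto simp: T_ops[symmetric] hom_term_T T.minus_add simp flip: Talg_def)
next
  case (4 k s l t)
  then show ?case using hom_term_T[THEN TA.cls_carrier, folded Talg_def]
    by (auto simp: T_ops[symmetric] hom_term_T T.l_minus T.r_minus simp flip: Talg_def)
qed

lemma dv_homog: "hom_term k s \<Longrightarrow> dv s \<in> Tdeg D (k + 1)"
proof (induction rule: homog.induct)
  case (1 r)
  then show ?case using Tdeg_zero[of 1] by (simp flip: Talg_def)
next
  case (2 w k)
  then obtain \<gamma> \<delta> where w: "w = (\<gamma>, \<delta>)" "\<gamma> \<in> W0 D" "\<delta> \<in> W1 D"
    using Wgrade_carrier[OF 2] by (cases w) (auto simp: Wbim_simps)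
  then have "k = 0 \<and> \<delta> = 0 \<or> k = 1 \<and> \<gamma> = 0 \<or> \<gamma> = 0 \<and> \<delta> = 0" using 2 by (auto simp: Wgrade_def split: if_splits)
  then show ?case unfolding w(1) using dW_w12_Tdeg[OF w(2)] dW_w1_Tdeg[OF w(3)] w(2,3)
    by (auto simp: der_W_def dW_zero d12.dW_carrier d1.dW_carrier Tdeg_zero numeral_2_eq_2)
next
  case (3 k s t)
  then show ?case using Tdeg_add by (simp flip: Talg_def)
next
  case (4 k s l t)
  have cl: "cl s \<in> Tdeg D k" "cl t \<in> Tdeg D l" using 4 by (auto simp: Tdeg_def)
  then have "sg s \<in> Tdeg D k" unfolding sg_homog[OF 4(1)] by (simp add: Tdeg_minus)
  then have "dv s \<otimes>\<^bsub>TD\<^esub> cl t \<in> Tdeg D (k + l + 1)" "sg s \<otimes>\<^bsub>TD\<^esub> dv t \<in> Tdeg D (k + l + 1)"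
    using Tdeg_mult[OF 4(3) cl(2)] Tdeg_mult[OF _ 4(4), of "sg s" k] by (simp_all add: add.commute add.left_commute)
  then show ?case using Tdeg_add by (simp flip: Talg_def)
qed

text \<open>\<open>dv\<close> passed to classes through representatives. The value
  \<open>undefined\<close> off the carrier matches the extensional function space in
  \<open>is_differential\<close>.\<close>

definition dd :: "('a, 'g) T_elem \<Rightarrow> ('a, 'g) T_elem" where
  "dd X = (if X \<in> carrier TD then dv (TA.rep X) else undefined)"

lemma dd_cls: "s \<in> TA.TT \<Longrightarrow> dd (cl s) = dv s"
  using TA.der_teq[OF bimod_sgn_W bimod_der_W TA.rep_teq] TA.cls_carrier by (simp add: dd_def Talg_def)

lemma inner_sum_W0:
  assumes "\<gamma> \<in> W0 D" "i \<in> I1"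
  shows "(\<Oplus>\<^bsub>TD\<^esub>j\<in>idx {Bot}. w1 D (\<gamma>\<^sub>D i) \<otimes>\<^bsub>TD\<^esub> w12 D (\<gamma>\<^sub>D j \<lhd> \<gamma> (pb j \<star> pb i))) =
    w1 D (\<gamma>\<^sub>D i) \<otimes>\<^bsub>TD\<^esub> w12 D (pb i \<rhd> \<gamma>)"
proof -
  have W: "\<gamma>\<^sub>D j \<lhd> \<gamma> (pb j \<star> pb i) \<in> W0 D" if "j \<in> idx {Bot}" for j
    using W0_closed(4)[OF I0_dual_W0[OF that] dual_S[OF W0_dual[OF assms(1)]]] .
  have "w12 D (\<Sum>j\<in>idx {Bot}. \<gamma>\<^sub>D j \<lhd> \<gamma> (pb j \<star> pb i)) = (\<Oplus>\<^bsub>TD\<^esub>j\<in>idx {Bot}. w12 D (\<gamma>\<^sub>D j \<lhd> \<gamma> (pb j \<star> pb i)))"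
    using W by (rule w12_sum)
  moreover have "w1 D (\<gamma>\<^sub>D i) \<otimes>\<^bsub>TD\<^esub> (\<Oplus>\<^bsub>TD\<^esub>j\<in>idx {Bot}. w12 D (\<gamma>\<^sub>D j \<lhd> \<gamma> (pb j \<star> pb i))) =
      (\<Oplus>\<^bsub>TD\<^esub>j\<in>idx {Bot}. w1 D (\<gamma>\<^sub>D i) \<otimes>\<^bsub>TD\<^esub> w12 D (\<gamma>\<^sub>D j \<lhd> \<gamma> (pb j \<star> pb i)))"
    by (rule T.finsum_rdistr[OF finite_idx w1_carrier[OF I1_dual_W1[OF assms(2)]] Pi_I]) (rule w12_carrier[OF W])
  ultimately show ?thesis using sum_dual_ract_W0[OF assms(1) J_Lam[OF idx_J[OF assms(2)]]] by simp
qed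

lemma inner_sum_W1:
  assumes "\<gamma> \<in> W1 D" "i \<in> I1"
  shows "(\<Oplus>\<^bsub>TD\<^esub>j\<in>I1. w1 D (\<gamma>\<^sub>D i) \<otimes>\<^bsub>TD\<^esub> w1 D (\<gamma>\<^sub>D j \<lhd> \<gamma> (pb j \<star> pb i))) =
    w1 D (\<gamma>\<^sub>D i) \<otimes>\<^bsub>TD\<^esub> w1 D (pb i \<rhd> \<gamma>)"
proof -
  have W: "\<gamma>\<^sub>D j \<lhd> \<gamma> (pb j \<star> pb i) \<in> W1 D" if "j \<in> I1" for j
    using W1_closed(4)[OF I1_dual_W1[OF that] dual_S[OF W1_dual[OF assms(1)]]] .
  have "w1 D (\<Sum>j\<in>I1. \<gamma>\<^sub>D j \<lhd> \<gamma> (pb j \<star> pb i)) = (\<Oplus>\<^bsub>TD\<^esub>j\<in>I1. w1 D (\<gamma>\<^sub>D j \<lhd> \<gamma> (pb j \<star> pb i)))"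
    using W by (rule w1_sum)
  moreover have "w1 D (\<gamma>\<^sub>D i) \<otimes>\<^bsub>TD\<^esub> (\<Oplus>\<^bsub>TD\<^esub>j\<in>I1. w1 D (\<gamma>\<^sub>D j \<lhd> \<gamma> (pb j \<star> pb i))) =
      (\<Oplus>\<^bsub>TD\<^esub>j\<in>I1. w1 D (\<gamma>\<^sub>D i) \<otimes>\<^bsub>TD\<^esub> w1 D (\<gamma>\<^sub>D j \<lhd> \<gamma> (pb j \<star> pb i)))"
    by (rule T.finsum_rdistr[OF finite_idx w1_carrier[OF I1_dual_W1[OF assms(2)]] Pi_I]) (rule w1_carrier[OF W])
  ultimately show ?thesis using sum_dual_ract_W1[OF assms(1) J_Lam[OF idx_J[OF assms(2)]]] by simp
qed

text \<open>Evaluating the inner sums over j once and for all removes half of the dual basis from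
  the formulas; from here on the differential is given by \<open>dW\<close>.\<close>

lemma is_differential_iff:
  "is_differential D B d \<longleftrightarrow>
     d \<in> carrier TD \<rightarrow>\<^sub>E carrier TD \<and>
     (\<forall>a\<in>carrier TD. \<forall>b\<in>carrier TD. d (a \<oplus>\<^bsub>TD\<^esub> b) = d a \<oplus>\<^bsub>TD\<^esub> d b) \<and>
     (\<forall>k. d ` Tdeg D k \<subseteq> Tdeg D (k + 1)) \<and>
     (\<forall>r\<in>carrier (Re D). d (inR D r) = \<zero>\<^bsub>TD\<^esub>) \<and>
     (\<forall>k. \<forall>a\<in>Tdeg D k. \<forall>b\<in>carrier TD.
        d (a \<otimes>\<^bsub>TD\<^esub> b) = d a \<otimes>\<^bsub>TD\<^esub> b \<oplus>\<^bsub>TD\<^esub>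
          (if even k then a \<otimes>\<^bsub>TD\<^esub> d b else \<ominus>\<^bsub>TD\<^esub> (a \<otimes>\<^bsub>TD\<^esub> d b))) \<and>
     (\<forall>\<gamma>\<in>W0 D. d (w12 D \<gamma>) = dW (w12 D) \<gamma>) \<and> (\<forall>\<gamma>\<in>W1 D. d (w1 D \<gamma>) = dW (w1 D) \<gamma>)"
proof -
  have "(\<Oplus>\<^bsub>TD\<^esub>i\<in>I1. \<Oplus>\<^bsub>TD\<^esub>j\<in>idx {Bot}. w1 D (\<gamma>\<^sub>D i) \<otimes>\<^bsub>TD\<^esub> w12 D (\<gamma>\<^sub>D j \<lhd> \<gamma> (pb j \<star> pb i))) =
      (\<Oplus>\<^bsub>TD\<^esub>i\<in>I1. w1 D (\<gamma>\<^sub>D i) \<otimes>\<^bsub>TD\<^esub> w12 D (pb i \<rhd> \<gamma>))" if "\<gamma> \<in> W0 D" for \<gamma>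
    using that inner_sum_W0[OF that] d12.dW_term_carrier[OF that] by (intro T.finsum_cong') auto
  moreover have "(\<Oplus>\<^bsub>TD\<^esub>i\<in>I1. \<Oplus>\<^bsub>TD\<^esub>j\<in>I1. w1 D (\<gamma>\<^sub>D i) \<otimes>\<^bsub>TD\<^esub> w1 D (\<gamma>\<^sub>D j \<lhd> \<gamma> (pb j \<star> pb i))) =
      (\<Oplus>\<^bsub>TD\<^esub>i\<in>I1. w1 D (\<gamma>\<^sub>D i) \<otimes>\<^bsub>TD\<^esub> w1 D (pb i \<rhd> \<gamma>))" if "\<gamma> \<in> W1 D" for \<gamma>
    using that inner_sum_W1[OF that] d1.dW_term_carrier[OF that] by (intro T.finsum_cong') auto
  ultimately show ?thesis unfolding is_differential_def idx1_eq idx0_eq dW_def by (simp cong: ball_cong)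
qed

lemma is_differential_dd: "is_differential D B dd"
  unfolding is_differential_iff
proof (intro conjI allI ballI)
  note der = TA.der_carrier[OF bimod_sgn_W bimod_der_W, folded Talg_def]
  note TE = TA.T_carrierE[folded Talg_def]
  show "dd \<in> carrier TD \<rightarrow>\<^sub>E carrier TD"
  proof (rule PiE_I)
    fix x assume "x \<in> carrier TD"
    then show "dd x \<in> carrier TD" by (rule TE) (simp add: dd_cls der)
  qed (simp add: dd_def)
  {
    fix a b assume "a \<in> carrier TD" "b \<in> carrier TD"
    then obtain s t where st: "s \<in> TA.TT" "a = cl s" "t \<in> TA.TT" "b = cl t" by (metis TE)
    show "dd (a \<oplus>\<^bsub>TD\<^esub> b) = dd a \<oplus>\<^bsub>TD\<^esub> dd b"
      using st by (simp add: T_ops dd_cls TA.Add_T) (simp add: Talg_def)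
  }
  show "dd ` Tdeg D k \<subseteq> Tdeg D (k + 1)" for k
  proof
    fix x assume "x \<in> dd ` Tdeg D k"
    then obtain s where "hom_term k s" "x = dd (cl s)" by (auto simp: Tdeg_def)
    then show "x \<in> Tdeg D (k + 1)" using dv_homog by (simp add: dd_cls hom_term_T)
  qed
  show "dd (inR D r) = \<zero>\<^bsub>TD\<^esub>" if "r \<in> carrier (Re D)" for r
    using that by (simp add: inR_def dd_cls TA.Scal_T) (simp add: Talg_def)
  {
    fix k a b assume "a \<in> Tdeg D k" "b \<in> carrier TD"
    then obtain s t where st: "hom_term k s" "a = cl s" "t \<in> TA.TT" "b = cl t"
      unfolding Tdeg_def by (metis (no_types, lifting) TE imageE mem_Collect_eq)
    have car: "cl s \<in> carrier TD" "dv t \<in> carrier TD"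
      using st der hom_term_T TA.cls_carrier by (simp_all add: Talg_def)
    have "dd (a \<otimes>\<^bsub>TD\<^esub> b) = dv s \<otimes>\<^bsub>TD\<^esub> cl t \<oplus>\<^bsub>TD\<^esub> sg s \<otimes>\<^bsub>TD\<^esub> dv t"
      using st by (simp add: T_ops hom_term_T dd_cls TA.Mul_T) (simp add: Talg_def)
    then show "dd (a \<otimes>\<^bsub>TD\<^esub> b) = dd a \<otimes>\<^bsub>TD\<^esub> b \<oplus>\<^bsub>TD\<^esub>
        (if even k then a \<otimes>\<^bsub>TD\<^esub> dd b else \<ominus>\<^bsub>TD\<^esub> (a \<otimes>\<^bsub>TD\<^esub> dd b))"
      using st car by (simp add: dd_cls hom_term_T sg_homog T.l_minus)
  }
  show "dd (w12 D \<gamma>) = dW (w12 D) \<gamma>" if "\<gamma> \<in> W0 D" for \<gamma>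
    using that by (simp add: w12_def dd_cls TA.Gen_T Wbim_simps W1_closed der_W_def)
      (simp add: dW_zero d12.dW_carrier flip: w12_def)
  show "dd (w1 D \<gamma>) = dW (w1 D) \<gamma>" if "\<gamma> \<in> W1 D" for \<gamma>
    using that by (simp add: w1_def dd_cls TA.Gen_T Wbim_simps W0_closed der_W_def)
      (simp add: dW_zero d1.dW_carrier flip: w1_def)
qed

text \<open>The Leibniz rule in \<open>is_differential\<close> speaks only of homogeneous left
  factors. Two differentials are therefore compared on homogeneous terms, and additivity extends the
  comparison to sums of homogeneous elements, which exhaust T.\<close>

inductive_set hsum :: "('a, 'g) T_elem set" where
  base: "x \<in> Tdeg D k \<Longrightarrow> x \<in> hsum"
| sum: "x \<in> hsum \<Longrightarrow> y \<in> hsum \<Longrightarrow> x \<oplus>\<^bsub>TD\<^esub> y \<in> hsum"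

lemma hsum_carrier: "x \<in> hsum \<Longrightarrow> x \<in> carrier TD"
  by (induction rule: hsum.induct) (auto intro: Tdeg_carrier)

lemma hsum_mult: "x \<in> hsum \<Longrightarrow> y \<in> hsum \<Longrightarrow> x \<otimes>\<^bsub>TD\<^esub> y \<in> hsum"
proof (induction arbitrary: y rule: hsum.induct)
  case (base x k)
  from base(2) show ?case
  proof (induction rule: hsum.induct)
    case (base y l)
    then show ?case using \<open>x \<in> Tdeg D k\<close> by (auto intro: hsum.base Tdeg_mult)
  next
    case (sum y z)
    then show ?case using Tdeg_carrier[OF \<open>x \<in> Tdeg D k\<close>] by (simp add: T.r_distr hsum_carrier hsum.sum)
  qed
next
  case (sum x z)
  then show ?case by (simp add: T.l_distr hsum_carrier hsum.sum)
qed

lemma hsum_eq: "hsum = carrier TD"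
proof
  show "carrier TD \<subseteq> hsum"
  proof
    fix x assume "x \<in> carrier TD"
    then obtain s where s: "s \<in> TA.TT" "x = cl s" using TA.T_carrierE[folded Talg_def] by blast
    have "cl s \<in> hsum" using s(1)
    proof (induction rule: tterms.induct)
      case (Scal r)
      then show ?case using hsum.base[OF inR_Tdeg[OF Scal]] by (simp add: inR_def)
    next
      case (Gen w)
      then obtain \<gamma> \<delta> where "w = (\<gamma>, \<delta>)" "\<gamma> \<in> W0 D" "\<delta> \<in> W1 D" by (auto simp: Wbim_simps)
      then show ?case using hsum.base[OF w12_Tdeg] hsum.base[OF w1_Tdeg] by (simp add: Gen_split hsum.sum)
    qed (auto simp: hsum.sum hsum_mult simp flip: T_ops)
    then show "x \<in> hsum" using s by simp
  qed
qed (auto intro: hsum_carrier)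

lemma is_differential_unique:
  assumes "is_differential D B d" "is_differential D B d'"
  shows "d = d'"
proof -
  note d = assms(1)[unfolded is_differential_iff] and d' = assms(2)[unfolded is_differential_iff]
  have hom: "d (cl s) = d' (cl s)" if "hom_term k s" for k s
    using that
  proof (induction rule: homog.induct)
    case (1 r)
    then show ?case using d d' by (simp flip: inR_def)
  next
    case (2 w k)
    then obtain \<gamma> \<delta> where w: "w = (\<gamma>, \<delta>)" "\<gamma> \<in> W0 D" "\<delta> \<in> W1 D"
      using Wgrade_carrier[OF 2] by (cases w) (auto simp: Wbim_simps)
    then show ?case using d d' by (simp add: Gen_split w12_carrier w1_carrier)
  next
    case (3 k s t)
    moreover have "cl s \<in> carrier TD" "cl t \<in> carrier TD" using 3 hom_term_T TA.cls_carrier by (auto simp: Talg_def)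
    ultimately show ?case using d d' by (simp add: hom_term_T flip: T_ops)
  next
    case (4 k s l t)
    moreover have "cl s \<in> Tdeg D k" using 4 by (auto simp: Tdeg_def)
    moreover have "cl t \<in> carrier TD" using 4 hom_term_T TA.cls_carrier by (auto simp: Talg_def)
    ultimately show ?case using d d' by (simp add: hom_term_T flip: T_ops)
  qed
  have "d x = d' x" if "x \<in> carrier TD" for x
    using that unfolding hsum_eq[symmetric]
  proof (induction rule: hsum.induct)
    case (base x k)
    then show ?case using hom by (auto simp: Tdeg_def)
  next
    case (sum x y)
    then show ?case using d d' by (simp add: hsum_carrier)
  qed
  then show ?thesis using d d' by (metis PiE_ext)
qed

lemma is_differential_de: "is_differential D B (de D B)"
  unfolding de_def using is_differential_dd is_differential_unique by (metis theI)

lemma de_Tdeg: "x \<in> Tdeg D k \<Longrightarrow> de D B x \<in> Tdeg D (k + 1)"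
  and de_add: "a \<in> carrier TD \<Longrightarrow> b \<in> carrier TD \<Longrightarrow> de D B (a \<oplus>\<^bsub>TD\<^esub> b) = de D B a \<oplus>\<^bsub>TD\<^esub> de D B b"
  and de_inR: "r \<in> carrier (Re D) \<Longrightarrow> de D B (inR D r) = \<zero>\<^bsub>TD\<^esub>"
  and de_w12: "\<gamma> \<in> W0 D \<Longrightarrow> de D B (w12 D \<gamma>) = dW (w12 D) \<gamma>"
  and de_w1: "\<gamma> \<in> W1 D \<Longrightarrow> de D B (w1 D \<gamma>) = dW (w1 D) \<gamma>"
  using is_differential_de unfolding is_differential_iff by blast+

lemma de_mult_0: "a \<in> Tdeg D 0 \<Longrightarrow> b \<in> carrier TD \<Longrightarrow>
    de D B (a \<otimes>\<^bsub>TD\<^esub> b) = de D B a \<otimes>\<^bsub>TD\<^esub> b \<oplus>\<^bsub>TD\<^esub> a \<otimes>\<^bsub>TD\<^esub> de D B b"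
  and de_mult_1: "a \<in> Tdeg D 1 \<Longrightarrow> b \<in> carrier TD \<Longrightarrow>
    de D B (a \<otimes>\<^bsub>TD\<^esub> b) = de D B a \<otimes>\<^bsub>TD\<^esub> b \<ominus>\<^bsub>TD\<^esub> a \<otimes>\<^bsub>TD\<^esub> de D B b"
  using is_differential_de unfolding is_differential_iff a_minus_def by force+

end

section \<open>Morphisms and their composition\<close>

context eq_system begin

definition rF :: "'f \<Rightarrow> ('a, 'g) Re_elem" where
  "rF c = (\<Sum>x\<in>P - {Bot}. unit_mat x x (emb D c), unit_mat Bot Bot (emb D c))"

lemma rF_fst: "fst (rF c) = (\<lambda>x y. if x = y \<and> x \<in> P \<and> x \<noteq> Bot then emb D c else 0)"
proof (intro ext)
  fix x y
  have "fst (rF c) x y = (\<Sum>z\<in>P - {Bot}. if z = x then (if x = y then emb D c else 0) else 0)"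
    unfolding rF_def fst_conv sum_fun_apply by (intro sum.cong) (auto simp: unit_mat_def)
  then show "fst (rF c) x y = (if x = y \<and> x \<in> P \<and> x \<noteq> Bot then emb D c else 0)"
    by auto
qed

lemma rF_snd: "snd (rF c) = (\<lambda>x y. if x = Bot \<and> y = Bot then emb D c else 0)"
  by (auto simp: rF_def unit_mat_def)

lemma rF_carrier: "rF c \<in> carrier (Re D)"
proof -
  have "fst (rF c) \<in> S1" "snd (rF c) \<in> S2"
    unfolding rF_fst rF_snd S_iff by (auto intro!: emb_Q)
  then show ?thesis by (cases "rF c") (simp add: Re_simps)
qed

lemma rF_hom: "rF (c + d) = rF c \<oplus>\<^bsub>Re D\<^esub> rF d" "rF (c * d) = rF c \<otimes>\<^bsub>Re D\<^esub> rF d" "rF 1 = \<one>\<^bsub>Re D\<^esub>"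
proof -
  have S: "fst (rF c) \<in> S" "snd (rF c) \<in> S" for c
    using Re_S[of "fst (rF c)" "snd (rF c)"] rF_carrier[of c] by simp_all
  have "rF (c + d) = (fst (rF c) + fst (rF d), snd (rF c) + snd (rF d))"
    by (rule prod_eqI; simp only: fst_conv snd_conv)
       (auto simp: rF_fst rF_snd fun_eq_iff emb.hom_add)
  then show "rF (c + d) = rF c \<oplus>\<^bsub>Re D\<^esub> rF d"
    by (metis Re_simps(3) prod.collapse)
  have "rF (c * d) = (fst (rF c) \<star> fst (rF d), snd (rF c) \<star> snd (rF d))"
    unfolding mmul_S_left[OF S(1)] mmul_S_left[OF S(2)]
    by (rule prod_eqI; simp only: fst_conv snd_conv)
       (auto simp: rF_fst rF_snd fun_eq_iff emb.hom_mult)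
  then show "rF (c * d) = rF c \<otimes>\<^bsub>Re D\<^esub> rF d"
    by (metis Re_simps(2) prod.collapse)
  show "rF 1 = \<one>\<^bsub>Re D\<^esub>"
    unfolding Re_simps by (rule prod_eqI) (auto simp: rF_fst rF_snd ehat_eq idemp_def unit_mat_def fun_eq_iff)
qed

lemma fscale_eq: "fscale D act c m = act m (inR D (rF c))"
  by (simp add: fscale_def rF_def)

lemma rF_commute_Re: "r \<in> carrier (Re D) \<Longrightarrow> rF c \<otimes>\<^bsub>Re D\<^esub> r = r \<otimes>\<^bsub>Re D\<^esub> rF c"
  using rF_carrier[of c] S_mmul_commute by (cases r; cases "rF c") (auto simp: Re_simps)

text \<open>Scalars from F lie in every Q_y and G is commutative, so \<gamma>(u c) = \<gamma>(c u) =
  c \<gamma>(u). The two cases differ only in the factor of R^e through which the right action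
  passes.\<close>

lemma lact_rF:
  assumes \<gamma>: "\<gamma> \<in> dJ"
  shows "\<gamma> \<in> W0 D \<Longrightarrow> fst (rF c) \<rhd> \<gamma> = \<gamma> \<lhd> snd (rF c)" "\<gamma> \<in> W1 D \<Longrightarrow> fst (rF c) \<rhd> \<gamma> = \<gamma> \<lhd> fst (rF c)"
proof -
  have S: "fst (rF c) \<in> S" "snd (rF c) \<in> S"
    using Re_S[of "fst (rF c)" "snd (rF c)"] rF_carrier[of c] by simp_all
  have L: "dcoef (fst (rF c) \<rhd> \<gamma>) y x e = emb D c * dcoef \<gamma> y x e" if "pless D y x" "e \<in> Q y x" for y x e
  proof -
    have "x \<in> P" "x \<noteq> Bot" "ple D y y" using that pless_P pless_not_Bot by auto
    then have "dcoef (fst (rF c) \<rhd> \<gamma>) y x e = dcoef \<gamma> y x (emb D c * e)"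
      using dcoef_lact_S[OF \<gamma> S(1) that(2)] by (simp add: rF_fst mult.commute)
    then show ?thesis using dcoef_mult[OF \<gamma> emb_Q[OF \<open>ple D y y\<close>] that(2)] by simp
  qed
  show "fst (rF c) \<rhd> \<gamma> = \<gamma> \<lhd> snd (rF c)" if "\<gamma> \<in> W0 D"
  proof (rule dual_eqI)
    fix y x e assume *: "pless D y x" "e \<in> Q y x"
    show "dcoef (fst (rF c) \<rhd> \<gamma>) y x e = dcoef (\<gamma> \<lhd> snd (rF c)) y x e"
      using L[OF *] dcoef_ract[OF \<gamma> S(2)] dcoef_W0[OF that, of y x e] by (auto simp: rF_snd)
  qed (intro dualJ_lact dualJ_ract \<gamma> S S_Lam)+
  show "fst (rF c) \<rhd> \<gamma> = \<gamma> \<lhd> fst (rF c)" if "\<gamma> \<in> W1 D"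
  proof (rule dual_eqI)
    fix y x e assume *: "pless D y x" "e \<in> Q y x"
    show "dcoef (fst (rF c) \<rhd> \<gamma>) y x e = dcoef (\<gamma> \<lhd> fst (rF c)) y x e"
      using L[OF *] dcoef_ract[OF \<gamma> S(1)] dcoef_W1[OF that, of x e] pless_P[OF *(1)] by (auto simp: rF_fst)
  qed (intro dualJ_lact dualJ_ract \<gamma> S S_Lam)+
qed

lemma rF_central_0: "a \<in> Tdeg D 0 \<Longrightarrow> inR D (rF c) \<otimes>\<^bsub>TD\<^esub> a = a \<otimes>\<^bsub>TD\<^esub> inR D (rF c)"
proof (induction rule: Tdeg_induct_0)
  case (R r)
  then show ?case using rF_commute_Re[of r c] rF_carrier[of c] by (simp flip: inR_mult)
next
  case (W0 \<gamma>)
  have r: "(fst (rF c), snd (rF c)) \<in> carrier (Re D)" using rF_carrier by simp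
  show ?case using w12_lact[OF W0 r] w12_ract[OF W0 r] lact_rF(1)[OF W0_dual[OF W0] W0] by simp
next
  case (add x y)
  then show ?case using inR_carrier[OF rF_carrier] by (simp add: T.l_distr T.r_distr Tdeg_carrier)
next
  case (mult x y)
  note [simp] = inR_carrier[OF rF_carrier] Tdeg_carrier[OF mult(1)] Tdeg_carrier[OF mult(2)]
  have "inR D (rF c) \<otimes>\<^bsub>TD\<^esub> (x \<otimes>\<^bsub>TD\<^esub> y) = x \<otimes>\<^bsub>TD\<^esub> (inR D (rF c) \<otimes>\<^bsub>TD\<^esub> y)"
    using mult(3) by (simp flip: T.m_assoc)
  then show ?case using mult(4) by (simp add: T.m_assoc)
qed

text \<open>This centrality is what makes the values of a bimodule map on T_1 linear over F.\<close>

lemma rF_central_1: "v \<in> Tdeg D 1 \<Longrightarrow> inR D (rF c) \<otimes>\<^bsub>TD\<^esub> v = v \<otimes>\<^bsub>TD\<^esub> inR D (rF c)"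
proof (induction rule: Tdeg_induct_1)
  case (W1 \<delta>)
  have r: "(fst (rF c), snd (rF c)) \<in> carrier (Re D)" using rF_carrier by simp
  show ?case using w1_lact[OF W1 r] w1_ract[OF W1 r] lact_rF(2)[OF W1_dual[OF W1] W1] by simp
next
  case (add x y)
  then show ?case using inR_carrier[OF rF_carrier] by (simp add: T.l_distr T.r_distr Tdeg_carrier)
next
  case (lmult a x)
  note [simp] = inR_carrier[OF rF_carrier] Tdeg_carrier[OF lmult(1)] Tdeg_carrier[OF lmult(2)]
  have "inR D (rF c) \<otimes>\<^bsub>TD\<^esub> (a \<otimes>\<^bsub>TD\<^esub> x) = a \<otimes>\<^bsub>TD\<^esub> (inR D (rF c) \<otimes>\<^bsub>TD\<^esub> x)"
    using rF_central_0[OF lmult(1)] by (simp flip: T.m_assoc)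
  then show ?case using lmult(3) by (simp add: T.m_assoc)
next
  case (rmult a x)
  note [simp] = inR_carrier[OF rF_carrier] Tdeg_carrier[OF rmult(1)] Tdeg_carrier[OF rmult(2)]
  have "inR D (rF c) \<otimes>\<^bsub>TD\<^esub> (x \<otimes>\<^bsub>TD\<^esub> a) = x \<otimes>\<^bsub>TD\<^esub> (inR D (rF c) \<otimes>\<^bsub>TD\<^esub> a)"
    using rmult(3) by (simp flip: T.m_assoc)
  then show ?case using rF_central_0[OF rmult(1)] by (simp add: T.m_assoc)
qed

end

section \<open>Objects of the module category\<close>

locale eq_module = eq_system D for D :: "('a, 'f::field, 'g::field) eq_data" +
  fixes act :: "('m::ab_group_add, 'a, 'g) action"
  assumes object: "is_object D act"
begin

lemma act_add: "a \<in> Tdeg D 0 \<Longrightarrow> act (m + n) a = act m a + act n a"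
  and act_add_T: "a \<in> Tdeg D 0 \<Longrightarrow> b \<in> Tdeg D 0 \<Longrightarrow> act m (a \<oplus>\<^bsub>TD\<^esub> b) = act m a + act m b"
  and act_mult: "a \<in> Tdeg D 0 \<Longrightarrow> b \<in> Tdeg D 0 \<Longrightarrow> act m (a \<otimes>\<^bsub>TD\<^esub> b) = act (act m a) b"
  and act_one: "act m \<one>\<^bsub>TD\<^esub> = m"
  using object by (auto simp: is_object_def)

lemma act_0 [simp]: "a \<in> Tdeg D 0 \<Longrightarrow> act 0 a = 0"
  using act_add[of a 0 0] by simp

lemma act_zero: "act m \<zero>\<^bsub>TD\<^esub> = 0"
  using act_add_T[OF Tdeg_zero Tdeg_zero, of m] by simp

lemma act_sum: "a \<in> Tdeg D 0 \<Longrightarrow> act (sum f I) a = (\<Sum>i\<in>I. act (f i) a)"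
  by (induction I rule: infinite_finite_induct) (simp_all add: act_add)

lemma module_fscale: "Modules.module (fscale D act)"
proof (rule Modules.module.intro)
  fix a b :: 'f and x y :: 'm
  note [simp] = inR_Tdeg[OF rF_carrier]
  show "fscale D act a (x + y) = fscale D act a x + fscale D act a y"
    by (simp add: fscale_eq act_add)
  show "fscale D act (a + b) x = fscale D act a x + fscale D act b x"
    unfolding fscale_eq rF_hom inR_add[OF rF_carrier rF_carrier] by (simp add: act_add_T)
  show "fscale D act a (fscale D act b x) = fscale D act (a * b) x"
    unfolding fscale_eq mult.commute[of a b] rF_hom inR_mult[OF rF_carrier rF_carrier] by (simp add: act_mult)
  show "fscale D act 1 x = x"
    unfolding fscale_eq rF_hom using inR_one act_one[of x] by (simp add: Re_simps)
qed

end

text \<open>Since (a h)(m) = h(m a), left multiplication acts on the argument. Only additivity of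
  the values is demanded; F-linearity follows, see \<open>ext1_hom\<close>.\<close>

definition bimod_hom ::
  "('a, 'f::field, 'g::field) eq_data \<Rightarrow> ('m::ab_group_add, 'a, 'g) action \<Rightarrow> ('n::ab_group_add, 'a, 'g) action
     \<Rightarrow> (('a, 'g) J_dual \<Rightarrow> 'm \<Rightarrow> 'n) \<Rightarrow> bool" where
  "bimod_hom D actM actN h \<longleftrightarrow>
     (\<forall>\<delta>\<in>W1 D. \<forall>m m'. h \<delta> (m + m') = h \<delta> m + h \<delta> m') \<and>
     (\<forall>\<delta>\<in>W1 D. \<forall>\<delta>'\<in>W1 D. \<forall>m. h (\<delta> + \<delta>') m = h \<delta> m + h \<delta>' m) \<and>
     (\<forall>\<delta>\<in>W1 D. \<forall>a b. (a, b) \<in> carrier (Re D) \<longrightarrow> (\<forall>m. h (dual_lact D a \<delta>) m = h \<delta> (actM m (inR D (a, b))) \<and>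
        h (dual_ract D \<delta> a) m = actN (h \<delta> m) (inR D (a, b))))"

text \<open>Terms act from the right, so the left factor of a product is applied first. Elements of
  degree 1 shift by one summand and those of degree 2 send M to L; the third summand is there for
  the sake of \<open>cross\<close>.\<close>

primrec tev ::
  "('a, 'f::field, 'g::field) eq_data \<Rightarrow> ('m::ab_group_add, 'a, 'g) action \<Rightarrow> ('n::ab_group_add, 'a, 'g) action \<Rightarrow>
   ('l::ab_group_add, 'a, 'g) action \<Rightarrow> (('a, 'g) J_dual \<Rightarrow> 'm \<Rightarrow> 'n) \<Rightarrow> (('a, 'g) J_dual \<Rightarrow> 'n \<Rightarrow> 'l) \<Rightarrow>
   (('a, 'g) Re_elem, ('a, 'g) W_elem) tterm \<Rightarrow> 'm \<times> 'n \<times> 'l \<Rightarrow> 'm \<times> 'n \<times> 'l" where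
  "tev D actM actN actL h k (Scal r) p =
     (actM (fst p) (inR D r), actN (fst (snd p)) (inR D r), actL (snd (snd p)) (inR D r))"
| "tev D actM actN actL h k (Gen w) p =
     (actM (fst p) (w12 D (fst w)), actN (fst (snd p)) (w12 D (fst w)) + h (snd w) (fst p),
      actL (snd (snd p)) (w12 D (fst w)) + k (snd w) (fst (snd p)))"
| "tev D actM actN actL h k (Add s t) p = tev D actM actN actL h k s p + tev D actM actN actL h k t p"
| "tev D actM actN actL h k (Mul s t) p = tev D actM actN actL h k t (tev D actM actN actL h k s p)"

text \<open>Bimodule maps \<open>h : W\<^sub>1 \<rightarrow> Hom(M, N)\<close> and \<open>k : W\<^sub>1 \<rightarrow> Hom(N, L)\<close> turn \<open>M \<oplus> N \<oplus> L\<close> into a right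
  \<open>T\<close>-module.\<close>

locale eq_tower = M: eq_module D actM + N: eq_module D actN + L: eq_module D actL
  for D :: "('a, 'f::field, 'g::field) eq_data" and actM :: "('m::ab_group_add, 'a, 'g) action"
    and actN :: "('n::ab_group_add, 'a, 'g) action" and actL :: "('l::ab_group_add, 'a, 'g) action" +
  fixes h :: "('a, 'g) J_dual \<Rightarrow> 'm \<Rightarrow> 'n" and k :: "('a, 'g) J_dual \<Rightarrow> 'n \<Rightarrow> 'l"
  assumes bimod_h: "bimod_hom D actM actN h" and bimod_k: "bimod_hom D actN actL k"
begin

abbreviation "ev \<equiv> tev D actM actN actL h k"

lemmas acts = M.act_add N.act_add L.act_add M.act_add_T N.act_add_T L.act_add_T
  M.act_mult N.act_mult L.act_mult

lemma h_simps: "\<delta> \<in> W1 D \<Longrightarrow> h \<delta> (m + m') = h \<delta> m + h \<delta> m'"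
  "\<delta> \<in> W1 D \<Longrightarrow> \<delta>' \<in> W1 D \<Longrightarrow> h (\<delta> + \<delta>') m = h \<delta> m + h \<delta>' m"
  "\<delta> \<in> W1 D \<Longrightarrow> (a, b) \<in> carrier (Re D) \<Longrightarrow> h (a \<rhd> \<delta>) m = h \<delta> (actM m (inR D (a, b)))"
  "\<delta> \<in> W1 D \<Longrightarrow> (a, b) \<in> carrier (Re D) \<Longrightarrow> h (\<delta> \<lhd> a) m = actN (h \<delta> m) (inR D (a, b))"
  using bimod_h unfolding bimod_hom_def by blast+

lemma k_simps: "\<delta> \<in> W1 D \<Longrightarrow> k \<delta> (m + m') = k \<delta> m + k \<delta> m'"
  "\<delta> \<in> W1 D \<Longrightarrow> \<delta>' \<in> W1 D \<Longrightarrow> k (\<delta> + \<delta>') m = k \<delta> m + k \<delta>' m"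
  "\<delta> \<in> W1 D \<Longrightarrow> (a, b) \<in> carrier (Re D) \<Longrightarrow> k (a \<rhd> \<delta>) m = k \<delta> (actN m (inR D (a, b)))"
  "\<delta> \<in> W1 D \<Longrightarrow> (a, b) \<in> carrier (Re D) \<Longrightarrow> k (\<delta> \<lhd> a) m = actL (k \<delta> m) (inR D (a, b))"
  using bimod_k unfolding bimod_hom_def by blast+

lemma ev_add: "s \<in> M.TA.TT \<Longrightarrow> ev s (p + q) = ev s p + ev s q"
proof (induction s arbitrary: p q rule: tterms.induct)
  case (Scal r)
  then show ?case by (simp add: acts M.inR_Tdeg prod_eq_iff)
next
  case (Gen w)
  then have "fst w \<in> W0 D" "snd w \<in> W1 D" by (auto simp: M.Wbim_simps)
  then show ?case by (simp add: acts M.w12_Tdeg h_simps k_simps prod_eq_iff algebra_simps)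
qed (simp_all add: add_ac)

lemma ev_teq: "teq (Re D) (Wbim D) s t \<Longrightarrow> ev s p = ev t p"
proof (induction arbitrary: p rule: teq.induct)
  case (add_assoc s t u)
  then show ?case by (simp add: add.assoc)
next
  case (add_comm s t)
  then show ?case by (simp add: add.commute)
next
  case (add_zero s)
  have "inR D \<zero>\<^bsub>Re D\<^esub> = \<zero>\<^bsub>M.TD\<^esub>" by (simp add: M.Re_simps(5) M.inR_zero)
  then show ?case by (simp add: M.act_zero N.act_zero L.act_zero prod_eq_iff)
next
  case (add_neg s)
  have one: "\<one>\<^bsub>Re D\<^esub> \<in> carrier (Re D)" "\<ominus>\<^bsub>Re D\<^esub> \<one>\<^bsub>Re D\<^esub> \<in> carrier (Re D)"
    by (simp_all add: M.TA.R.one_closed)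
  have i1: "inR D \<one>\<^bsub>Re D\<^esub> = \<one>\<^bsub>M.TD\<^esub>" by (simp add: M.Re_simps(4) M.inR_one)
  have "inR D (\<ominus>\<^bsub>Re D\<^esub> \<one>\<^bsub>Re D\<^esub>) \<oplus>\<^bsub>M.TD\<^esub> inR D \<one>\<^bsub>Re D\<^esub> = \<zero>\<^bsub>M.TD\<^esub>"
    unfolding M.inR_add[OF one(2,1), symmetric] by (simp add: M.TA.R.l_neg M.Re_simps(5) M.inR_zero)
  then have z: "actM m (inR D (\<ominus>\<^bsub>Re D\<^esub> \<one>\<^bsub>Re D\<^esub>)) + m = 0" "actN n (inR D (\<ominus>\<^bsub>Re D\<^esub> \<one>\<^bsub>Re D\<^esub>)) + n = 0"
    "actL l (inR D (\<ominus>\<^bsub>Re D\<^esub> \<one>\<^bsub>Re D\<^esub>)) + l = 0" for m n l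
    using M.act_add_T[OF M.inR_Tdeg[OF one(2)] M.inR_Tdeg[OF one(1)], of m]
      N.act_add_T[OF M.inR_Tdeg[OF one(2)] M.inR_Tdeg[OF one(1)], of n]
      L.act_add_T[OF M.inR_Tdeg[OF one(2)] M.inR_Tdeg[OF one(1)], of l]
    by (simp_all add: i1 M.act_one N.act_one L.act_one M.act_zero N.act_zero L.act_zero)
  have "ev (Scal (\<ominus>\<^bsub>Re D\<^esub> \<one>\<^bsub>Re D\<^esub>)) p + p = 0" using z by (simp add: prod_eq_iff)
  \<comment> \<open>As \<open>ev s\<close> is additive, the relation reduces to (-1) + 1 = 0 before
    \<open>s\<close> is applied.\<close>
  have "ev (Add (Mul (Scal (\<ominus>\<^bsub>Re D\<^esub> \<one>\<^bsub>Re D\<^esub>)) s) s) p = ev s (ev (Scal (\<ominus>\<^bsub>Re D\<^esub> \<one>\<^bsub>Re D\<^esub>)) p + p)"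
    unfolding ev_add[OF add_neg] by simp
  also have "\<dots> = ev s 0" using \<open>ev (Scal (\<ominus>\<^bsub>Re D\<^esub> \<one>\<^bsub>Re D\<^esub>)) p + p = 0\<close> by simp
  also have "\<dots> = 0" using ev_add[OF add_neg, of 0 0] by simp
  also have "\<dots> = ev (Scal \<zero>\<^bsub>Re D\<^esub>) p"
    by (simp add: M.Re_simps(5) M.inR_zero M.act_zero N.act_zero L.act_zero prod_eq_iff)
  finally show ?case .
next
  case (one_mul s)
  have "inR D \<one>\<^bsub>Re D\<^esub> = \<one>\<^bsub>M.TD\<^esub>" by (simp add: M.Re_simps(4) M.inR_one)
  then show ?case by (simp add: M.act_one N.act_one L.act_one)
next
  case (mul_one s)
  have "inR D \<one>\<^bsub>Re D\<^esub> = \<one>\<^bsub>M.TD\<^esub>" by (simp add: M.Re_simps(4) M.inR_one)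
  then show ?case by (simp add: M.act_one N.act_one L.act_one)
next
  case (distrib_right s t u)
  then show ?case by (simp add: ev_add)
next
  case (scal_add a b)
  then show ?case by (simp add: M.inR_add acts M.inR_Tdeg prod_eq_iff)
next
  case (scal_mul a b)
  then show ?case by (simp add: M.inR_mult acts M.inR_Tdeg prod_eq_iff)
next
  case (gen_add v w)
  then obtain \<gamma> \<delta> \<gamma>' \<delta>' where *: "v = (\<gamma>, \<delta>)" "w = (\<gamma>', \<delta>')" "\<gamma> \<in> W0 D" "\<delta> \<in> W1 D" "\<gamma>' \<in> W0 D" "\<delta>' \<in> W1 D"
    by (auto simp: M.Wbim_simps)
  show ?case unfolding *(1,2) using *(3-)
    by (simp add: M.Wbim_simps M.w12_add acts M.w12_Tdeg h_simps k_simps prod_eq_iff add_ac)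
next
  case (gen_lact r w)
  then obtain \<gamma> \<delta> a b where *: "w = (\<gamma>, \<delta>)" "r = (a, b)" "\<gamma> \<in> W0 D" "\<delta> \<in> W1 D" "(a, b) \<in> carrier (Re D)"
    by (cases r) (auto simp: M.Wbim_simps)
  show ?case unfolding *(1,2) using *(3-)
    by (simp add: M.Wbim_simps acts M.w12_Tdeg M.inR_Tdeg h_simps(3)[OF *(4,5)] k_simps(3)[OF *(4,5)] M.w12_lact[OF *(3,5)] prod_eq_iff)
next
  case (gen_ract r w)
  then obtain \<gamma> \<delta> a b where *: "w = (\<gamma>, \<delta>)" "r = (a, b)" "\<gamma> \<in> W0 D" "\<delta> \<in> W1 D" "(a, b) \<in> carrier (Re D)"
    by (cases r) (auto simp: M.Wbim_simps)
  show ?case unfolding *(1,2) using *(3-)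
    by (simp add: M.Wbim_simps acts M.w12_Tdeg M.inR_Tdeg h_simps(4)[OF *(4,5)] k_simps(4)[OF *(4,5)] M.w12_ract[OF *(3,5)] prod_eq_iff)
qed simp_all

definition tact :: "'m \<times> 'n \<times> 'l \<Rightarrow> ('a, 'g) T_elem \<Rightarrow> 'm \<times> 'n \<times> 'l" where
  "tact p X = ev (M.TA.rep X) p"

lemma tact_cls: "s \<in> M.TA.TT \<Longrightarrow> tact p (M.cl s) = ev s p"
  unfolding tact_def using ev_teq[OF M.TA.rep_teq] by simp

lemma tact_add: "X \<in> carrier M.TD \<Longrightarrow> tact (p + q) X = tact p X + tact q X"
  by (rule M.TA.T_carrierE[folded Talg_def], assumption) (simp add: tact_cls ev_add)

lemma tact_add_T: "X \<in> carrier M.TD \<Longrightarrow> Y \<in> carrier M.TD \<Longrightarrow> tact p (X \<oplus>\<^bsub>M.TD\<^esub> Y) = tact p X + tact p Y"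
  and tact_mult: "X \<in> carrier M.TD \<Longrightarrow> Y \<in> carrier M.TD \<Longrightarrow> tact p (X \<otimes>\<^bsub>M.TD\<^esub> Y) = tact (tact p X) Y"
proof -
  assume "X \<in> carrier M.TD" "Y \<in> carrier M.TD"
  then obtain s t where "s \<in> M.TA.TT" "X = M.cl s" "t \<in> M.TA.TT" "Y = M.cl t"
    by (metis M.TA.T_carrierE[folded Talg_def])
  then show "tact p (X \<oplus>\<^bsub>M.TD\<^esub> Y) = tact p X + tact p Y" "tact p (X \<otimes>\<^bsub>M.TD\<^esub> Y) = tact (tact p X) Y"
    by (simp_all add: M.T_ops tact_cls M.TA.Add_T M.TA.Mul_T)
qed

lemma h_0: "\<delta> \<in> W1 D \<Longrightarrow> h \<delta> 0 = 0" "h 0 m = 0" and k_0: "\<delta> \<in> W1 D \<Longrightarrow> k \<delta> 0 = 0" "k 0 n = 0"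
  using h_simps(1)[of \<delta> 0 0] k_simps(1)[of \<delta> 0 0] h_simps(2)[of 0 0 m] k_simps(2)[of 0 0 n] M.W1_closed(1) by simp_all

lemma tact_inR: "r \<in> carrier (Re D) \<Longrightarrow> tact (m, n, l) (inR D r) = (actM m (inR D r), actN n (inR D r), actL l (inR D r))"
  and tact_w12: "\<gamma> \<in> W0 D \<Longrightarrow> tact (m, n, l) (w12 D \<gamma>) = (actM m (w12 D \<gamma>), actN n (w12 D \<gamma>), actL l (w12 D \<gamma>))"
  and tact_w1: "\<delta> \<in> W1 D \<Longrightarrow> tact (m, n, l) (w1 D \<delta>) = (0, h \<delta> m, k \<delta> n)"
proof -
  show "tact (m, n, l) (inR D r) = (actM m (inR D r), actN n (inR D r), actL l (inR D r))" if "r \<in> carrier (Re D)"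
    using tact_cls[OF M.TA.Scal_T[OF that], of "(m, n, l)"] by (simp add: inR_def)
  show "tact (m, n, l) (w12 D \<gamma>) = (actM m (w12 D \<gamma>), actN n (w12 D \<gamma>), actL l (w12 D \<gamma>))" if "\<gamma> \<in> W0 D"
    using tact_cls[OF M.TA.Gen_T[of "(\<gamma>, 0)"], of "(m, n, l)"] that M.W1_closed(1) by (simp add: M.Wbim_simps h_0 k_0 flip: w12_def)
  show "tact (m, n, l) (w1 D \<delta>) = (0, h \<delta> m, k \<delta> n)" if "\<delta> \<in> W1 D"
    using tact_cls[OF M.TA.Gen_T[of "(0, \<delta>)"], of "(m, n, l)"] that M.W0_closed(1)
    by (simp add: M.Wbim_simps M.w12_zero M.act_zero N.act_zero L.act_zero flip: w1_def)
qed

lemma tact_zero: "tact p \<zero>\<^bsub>M.TD\<^esub> = 0"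
  using tact_add_T[OF M.T.zero_closed M.T.zero_closed, of p] by simp

lemma tact_finsum: "(\<And>i. i \<in> I \<Longrightarrow> f i \<in> carrier M.TD) \<Longrightarrow> tact p (\<Oplus>\<^bsub>M.TD\<^esub>i\<in>I. f i) = (\<Sum>i\<in>I. tact p (f i))"
proof (induction I rule: infinite_finite_induct)
  case (insert i I)
  then show ?case by (subst M.T.finsum_insert) (auto simp: tact_add_T M.T.finsum_closed Pi_iff)
qed (simp_all add: M.T.finsum_infinite tact_zero)

lemma tact_0_deg: "a \<in> Tdeg D 0 \<Longrightarrow> tact (m, n, l) a = (actM m a, actN n a, actL l a)"
proof (induction arbitrary: m n l rule: M.Tdeg_induct_0)
  case (add x y)
  then show ?case by (simp add: tact_add_T M.Tdeg_carrier acts)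
next
  case (mult x y)
  then show ?case by (simp add: tact_mult M.Tdeg_carrier acts)
qed (simp_all add: tact_inR tact_w12)

lemma tact_split: "X \<in> carrier M.TD \<Longrightarrow> tact (m + m', 0, 0) X = tact (m, 0, 0) X + tact (m', 0, 0) X"
  using tact_add[of X "(m, 0, 0)" "(m', 0, 0)"] by simp

text \<open>The extension of \<open>h\<close> to a \<open>T\<^sub>0\<close>-bimodule map on \<open>T\<^sub>1\<close>.\<close>

definition ext1 :: "('a, 'g) T_elem \<Rightarrow> 'm \<Rightarrow> 'n" where
  "ext1 v = (if v \<in> Tdeg D 1 then (\<lambda>m. fst (snd (tact (m, 0, 0) v))) else (\<lambda>_. 0))"

lemma ext1_add: "v \<in> Tdeg D 1 \<Longrightarrow> v' \<in> Tdeg D 1 \<Longrightarrow> ext1 (v \<oplus>\<^bsub>M.TD\<^esub> v') m = ext1 v m + ext1 v' m"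
  by (simp add: ext1_def M.Tdeg_add tact_add_T M.Tdeg_carrier)

lemma ext1_add_right: "v \<in> Tdeg D 1 \<Longrightarrow> ext1 v (m + m') = ext1 v m + ext1 v m'"
  by (simp add: ext1_def tact_split M.Tdeg_carrier)

lemma ext1_lmult: "a \<in> Tdeg D 0 \<Longrightarrow> v \<in> Tdeg D 1 \<Longrightarrow> ext1 (a \<otimes>\<^bsub>M.TD\<^esub> v) m = ext1 v (actM m a)"
  using M.Tdeg_mult[of a 0 v 1] by (simp add: ext1_def tact_mult M.Tdeg_carrier tact_0_deg)

lemma ext1_rmult: "a \<in> Tdeg D 0 \<Longrightarrow> v \<in> Tdeg D 1 \<Longrightarrow> ext1 (v \<otimes>\<^bsub>M.TD\<^esub> a) m = actN (ext1 v m) a"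
  using M.Tdeg_mult[of v 1 a 0] tact_0_deg[of a "fst (tact (m, 0, 0) v)" "fst (snd (tact (m, 0, 0) v))" "snd (snd (tact (m, 0, 0) v))"]
  by (simp add: ext1_def tact_mult M.Tdeg_carrier)

lemma ext1_w1: "\<delta> \<in> W1 D \<Longrightarrow> ext1 (w1 D \<delta>) m = h \<delta> m"
  using M.w1_Tdeg[of \<delta>] by (simp add: ext1_def tact_w1)

lemma ext1_out: "v \<notin> Tdeg D 1 \<Longrightarrow> ext1 v = (\<lambda>_. 0)"
  by (simp add: ext1_def)

text \<open>By centrality of F a scalar can be moved from the left of v to its right, that is, from
  the argument to the value.\<close>

lemma ext1_hom: "v \<in> Tdeg D 1 \<Longrightarrow> module_hom (fscale D actM) (fscale D actN) (ext1 v)"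
proof (intro module_hom.intro module_hom_axioms.intro M.module_fscale N.module_fscale)
  fix c m assume v: "v \<in> Tdeg D 1"
  note r = M.inR_Tdeg[OF M.rF_carrier]
  show "ext1 v (fscale D actM c m) = fscale D actN c (ext1 v m)"
    unfolding M.fscale_eq using ext1_lmult[OF r v] ext1_rmult[OF r v] M.rF_central_1[OF v] by metis
qed (rule ext1_add_right)

end

declare One_nat_def [simp del]

context eq_module begin

lemma act_diff: "a \<in> Tdeg D 0 \<Longrightarrow> act (m - n) a = act m a - act n a"
  using act_add[of a "m - n" n] by simp

end

section \<open>Morphisms generated by maps on W_1\<close>

locale eq_pair = eq_bases D B + M: eq_module D actM + N: eq_module D actN
  for D :: "('a, 'f::field, 'g::field) eq_data" and B
    and actM :: "('m::ab_group_add, 'a, 'g) action" and actN :: "('n::ab_group_add, 'a, 'g) action"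
begin

lemma morphism_iff:
  "is_morphism D B actM actN (f0, f1) \<longleftrightarrow>
     (\<forall>m m'. f0 (m + m') = f0 m + f0 m') \<and>
     (\<forall>m. \<forall>r\<in>carrier (Re D). f0 (actM m (inR D r)) = actN (f0 m) (inR D r)) \<and>
     (\<forall>v\<in>Tdeg D 1. module_hom (fscale D actM) (fscale D actN) (f1 v)) \<and>
     (\<forall>v. v \<notin> Tdeg D 1 \<longrightarrow> f1 v = (\<lambda>_. 0)) \<and>
     (\<forall>v\<in>Tdeg D 1. \<forall>v'\<in>Tdeg D 1. \<forall>m. f1 (v \<oplus>\<^bsub>TD\<^esub> v') m = f1 v m + f1 v' m) \<and>
     (\<forall>a\<in>Tdeg D 0. \<forall>v\<in>Tdeg D 1. \<forall>m. f1 (a \<otimes>\<^bsub>TD\<^esub> v) m = f1 v (actM m a)) \<and>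
     (\<forall>a\<in>Tdeg D 0. \<forall>v\<in>Tdeg D 1. \<forall>m. f1 (v \<otimes>\<^bsub>TD\<^esub> a) m = actN (f1 v m) a) \<and>
     (\<forall>a\<in>Tdeg D 0. \<forall>m. actN (f0 m) a = f0 (actM m a) + f1 (de D B a) m)"
  by (simp add: is_morphism_def)

context
  fixes f0 f1 assumes mor: "is_morphism D B actM actN (f0, f1)"
begin

lemma mor0: "f0 (m + m') = f0 m + f0 m'" "r \<in> carrier (Re D) \<Longrightarrow> f0 (actM m (inR D r)) = actN (f0 m) (inR D r)"
  and mor1: "v \<notin> Tdeg D 1 \<Longrightarrow> f1 v = (\<lambda>_. 0)"
    "v \<in> Tdeg D 1 \<Longrightarrow> v' \<in> Tdeg D 1 \<Longrightarrow> f1 (v \<oplus>\<^bsub>TD\<^esub> v') m = f1 v m + f1 v' m"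
    "a \<in> Tdeg D 0 \<Longrightarrow> v \<in> Tdeg D 1 \<Longrightarrow> f1 (a \<otimes>\<^bsub>TD\<^esub> v) m = f1 v (actM m a)"
    "a \<in> Tdeg D 0 \<Longrightarrow> v \<in> Tdeg D 1 \<Longrightarrow> f1 (v \<otimes>\<^bsub>TD\<^esub> a) m = actN (f1 v m) a"
    "a \<in> Tdeg D 0 \<Longrightarrow> actN (f0 m) a = f0 (actM m a) + f1 (de D B a) m"
  and mor1_add: "v \<in> Tdeg D 1 \<Longrightarrow> f1 v (m + m') = f1 v m + f1 v m'"
proof -
  note * = mor[unfolded morphism_iff]
  show "f0 (m + m') = f0 m + f0 m'" using * by blast
  show "r \<in> carrier (Re D) \<Longrightarrow> f0 (actM m (inR D r)) = actN (f0 m) (inR D r)" using * by blast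
  show "v \<notin> Tdeg D 1 \<Longrightarrow> f1 v = (\<lambda>_. 0)" using * by blast
  show "v \<in> Tdeg D 1 \<Longrightarrow> v' \<in> Tdeg D 1 \<Longrightarrow> f1 (v \<oplus>\<^bsub>TD\<^esub> v') m = f1 v m + f1 v' m" using * by blast
  show "a \<in> Tdeg D 0 \<Longrightarrow> v \<in> Tdeg D 1 \<Longrightarrow> f1 (a \<otimes>\<^bsub>TD\<^esub> v) m = f1 v (actM m a)" using * by blast
  show "a \<in> Tdeg D 0 \<Longrightarrow> v \<in> Tdeg D 1 \<Longrightarrow> f1 (v \<otimes>\<^bsub>TD\<^esub> a) m = actN (f1 v m) a" using * by blast
  show "a \<in> Tdeg D 0 \<Longrightarrow> actN (f0 m) a = f0 (actM m a) + f1 (de D B a) m" using * by blast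
  assume "v \<in> Tdeg D 1"
  then have "module_hom (fscale D actM) (fscale D actN) (f1 v)" using * by blast
  then show "f1 v (m + m') = f1 v m + f1 v m'" by (rule module_hom.add)
qed

lemma mor_bimod: "bimod_hom D actM actN (\<lambda>\<delta>. f1 (w1 D \<delta>))"
  unfolding bimod_hom_def
  by (simp add: mor1_add mor1 w1_Tdeg w1_add w1_lact w1_ract inR_Tdeg)

lemma mor_1_zero: "f1 \<zero>\<^bsub>TD\<^esub> m = 0"
  using mor1(2)[OF Tdeg_zero Tdeg_zero, of m] by simp

lemma mor_1_minus: "v \<in> Tdeg D 1 \<Longrightarrow> f1 (\<ominus>\<^bsub>TD\<^esub> v) m = - f1 v m"
  using mor1(2)[OF _ Tdeg_minus, of v v m] mor_1_zero by (simp add: T.r_neg Tdeg_carrier eq_neg_iff_add_eq_0 add.commute)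

lemma mor_1_finsum: "(\<And>i. i \<in> I \<Longrightarrow> w i \<in> Tdeg D 1) \<Longrightarrow> f1 (\<Oplus>\<^bsub>TD\<^esub>i\<in>I. w i) m = (\<Sum>i\<in>I. f1 (w i) m)"
proof (induction I rule: infinite_finite_induct)
  case (insert i I)
  then show ?case by (subst T.finsum_insert) (auto simp: mor1 Tdeg_finsum intro: Tdeg_carrier)
qed (simp_all add: T.finsum_infinite mor_1_zero)

lemma dW_w12_term: "\<gamma> \<in> W0 D \<Longrightarrow> i \<in> I1 \<Longrightarrow> w1 D (\<gamma>\<^sub>D i) \<in> Tdeg D 1 \<and> w12 D (pb i \<rhd> \<gamma>) \<in> Tdeg D 0 \<and> pb i \<rhd> \<gamma> \<in> W0 D"
  using w1_Tdeg[OF I1_dual_W1] w12_Tdeg W0_closed(3)[OF _ J_Lam[OF idx_J]] by blast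

lemma mor_de_w12:
  assumes "\<gamma> \<in> W0 D"
  shows "f1 (de D B (w12 D \<gamma>)) m = - (\<Sum>i\<in>I1. actN (f1 (w1 D (\<gamma>\<^sub>D i)) m) (w12 D (pb i \<rhd> \<gamma>)))"
proof -
  have t: "w1 D (\<gamma>\<^sub>D i) \<otimes>\<^bsub>TD\<^esub> w12 D (pb i \<rhd> \<gamma>) \<in> Tdeg D 1" if "i \<in> I1" for i
    using Tdeg_mult[of _ 1 _ 0] dW_w12_term[OF assms that] by simp
  have "f1 (de D B (w12 D \<gamma>)) m = - f1 (\<Oplus>\<^bsub>TD\<^esub>i\<in>I1. w1 D (\<gamma>\<^sub>D i) \<otimes>\<^bsub>TD\<^esub> w12 D (pb i \<rhd> \<gamma>)) m"
    unfolding de_w12[OF assms] dW_def by (rule mor_1_minus, rule Tdeg_finsum, rule t)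
  also have "f1 (\<Oplus>\<^bsub>TD\<^esub>i\<in>I1. w1 D (\<gamma>\<^sub>D i) \<otimes>\<^bsub>TD\<^esub> w12 D (pb i \<rhd> \<gamma>)) m =
      (\<Sum>i\<in>I1. f1 (w1 D (\<gamma>\<^sub>D i) \<otimes>\<^bsub>TD\<^esub> w12 D (pb i \<rhd> \<gamma>)) m)"
    by (rule mor_1_finsum, rule t)
  also have "\<dots> = (\<Sum>i\<in>I1. actN (f1 (w1 D (\<gamma>\<^sub>D i)) m) (w12 D (pb i \<rhd> \<gamma>)))"
    using mor1(4) dW_w12_term[OF assms] by (intro sum.cong HOL.refl) blast
  finally show ?thesis .
qed

end

text \<open>Only one shift is wanted here, so the tower is completed by the zero map from N to
  itself.\<close>

definition generated_mor :: "(('a, 'g) J_dual \<Rightarrow> 'm \<Rightarrow> 'n) \<Rightarrow> ('a, 'g) T_elem \<Rightarrow> 'm \<Rightarrow> 'n" where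
  "generated_mor h = eq_tower.ext1 D actM actN actN h (\<lambda>_ _. 0)"

text \<open>The compatibility condition need only be imposed on the arrows w_{1,2}\<gamma>: on R^e,
  where the differential vanishes, it is linearity of f^0, and it passes to sums and, by the Leibniz
  rule, to products in T_0.\<close>

lemma
  assumes h: "bimod_hom D actM actN h"
    and add: "\<And>m m'. f0 (m + m') = f0 m + f0 m'"
    and lin: "\<And>m r. r \<in> carrier (Re D) \<Longrightarrow> f0 (actM m (inR D r)) = actN (f0 m) (inR D r)"
    and W0: "\<And>m \<gamma>. \<gamma> \<in> W0 D \<Longrightarrow> actN (f0 m) (w12 D \<gamma>) =
      f0 (actM m (w12 D \<gamma>)) - (\<Sum>i\<in>I1. actN (h (\<gamma>\<^sub>D i) m) (w12 D (pb i \<rhd> \<gamma>)))"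
  shows generated_morphism: "is_morphism D B actM actN (f0, generated_mor h)"
    and generated_mor_w1: "\<delta> \<in> W1 D \<Longrightarrow> generated_mor h (w1 D \<delta>) m = h \<delta> m"
proof -
  interpret tw: eq_tower D actM actN actN h "\<lambda>_ _. 0"
  proof (intro eq_tower.intro eq_tower_axioms.intro M.eq_module_axioms N.eq_module_axioms h)
    show "bimod_hom D actN actN (\<lambda>_ _. 0)" 
      unfolding bimod_hom_def by (intro conjI ballI allI impI) (simp_all only: add_0_right N.act_0[OF inR_Tdeg])
  qed
  have e: "generated_mor h = tw.ext1" unfolding generated_mor_def ..
  show w1: "generated_mor h (w1 D \<delta>) m = h \<delta> m" if "\<delta> \<in> W1 D" for \<delta> m
    using tw.ext1_w1[OF that] by (simp add: e)
  have e0: "tw.ext1 \<zero>\<^bsub>TD\<^esub> m = 0" for m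
    using tw.ext1_add[OF Tdeg_zero Tdeg_zero, of m] by simp
  have efin: "tw.ext1 (\<Oplus>\<^bsub>TD\<^esub>i\<in>I. w i) m = (\<Sum>i\<in>I. tw.ext1 (w i) m)" if "\<And>i. i \<in> I \<Longrightarrow> w i \<in> Tdeg D 1"
    for I :: "('a pt \<times> 'a pt \<times> ('a, 'g) pmat) set" and w m
    using that
  proof (induction I rule: infinite_finite_induct)
    case (insert i I)
    then have w: "w i \<in> Tdeg D 1" "\<And>j. j \<in> I \<Longrightarrow> w j \<in> Tdeg D 1" by blast+
    have "(\<Oplus>\<^bsub>TD\<^esub>i\<in>insert i I. w i) = w i \<oplus>\<^bsub>TD\<^esub> (\<Oplus>\<^bsub>TD\<^esub>i\<in>I. w i)"
      using insert(1,2) by (rule T.finsum_insert) (rule Pi_I Tdeg_carrier w | assumption)+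
    moreover have "(\<Oplus>\<^bsub>TD\<^esub>i\<in>I. w i) \<in> Tdeg D 1" by (rule Tdeg_finsum, rule w(2))
    moreover have "tw.ext1 (\<Oplus>\<^bsub>TD\<^esub>i\<in>I. w i) m = (\<Sum>i\<in>I. tw.ext1 (w i) m)"
      by (rule insert(3), rule w(2))
    ultimately show ?case using insert(1,2) by (simp add: tw.ext1_add[OF w(1)])
  qed (simp_all add: T.finsum_infinite e0)
  have emin: "tw.ext1 (\<ominus>\<^bsub>TD\<^esub> v) m = - tw.ext1 v m" if "v \<in> Tdeg D 1" for v m
    using tw.ext1_add[OF that Tdeg_minus[OF that], of m] e0 that
    by (simp add: T.r_neg Tdeg_carrier eq_neg_iff_add_eq_0 add.commute)
  have gen: "actN (f0 m) a = f0 (actM m a) + tw.ext1 (de D B a) m" if "a \<in> Tdeg D 0" for a m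
    using that
  proof (induction arbitrary: m rule: Tdeg_induct_0)
    case (R r)
    then show ?case by (simp add: lin de_inR e0)
  next
    case (W0 \<gamma>)
    have tm: "w1 D (\<gamma>\<^sub>D i) \<in> Tdeg D 1" "w12 D (pb i \<rhd> \<gamma>) \<in> Tdeg D 0" if "i \<in> I1" for i
      using w1_Tdeg[OF I1_dual_W1[OF that]] w12_Tdeg[OF W0_closed(3)[OF W0 J_Lam[OF idx_J[OF that]]]] by auto
    have t: "w1 D (\<gamma>\<^sub>D i) \<otimes>\<^bsub>TD\<^esub> w12 D (pb i \<rhd> \<gamma>) \<in> Tdeg D 1" if "i \<in> I1" for i
      using Tdeg_mult[of _ 1 _ 0] tm[OF that] by simp
    have "tw.ext1 (de D B (w12 D \<gamma>)) m = - tw.ext1 (\<Oplus>\<^bsub>TD\<^esub>i\<in>I1. w1 D (\<gamma>\<^sub>D i) \<otimes>\<^bsub>TD\<^esub> w12 D (pb i \<rhd> \<gamma>)) m"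
      unfolding de_w12[OF W0] dW_def by (rule emin, rule Tdeg_finsum, rule t)
    also have "tw.ext1 (\<Oplus>\<^bsub>TD\<^esub>i\<in>I1. w1 D (\<gamma>\<^sub>D i) \<otimes>\<^bsub>TD\<^esub> w12 D (pb i \<rhd> \<gamma>)) m =
        (\<Sum>i\<in>I1. tw.ext1 (w1 D (\<gamma>\<^sub>D i) \<otimes>\<^bsub>TD\<^esub> w12 D (pb i \<rhd> \<gamma>)) m)"
      by (rule efin, rule t)
    also have "\<dots> = (\<Sum>i\<in>I1. actN (h (\<gamma>\<^sub>D i) m) (w12 D (pb i \<rhd> \<gamma>)))"
    proof (intro sum.cong HOL.refl)
      fix i assume i: "i \<in> I1"
      show "tw.ext1 (w1 D (\<gamma>\<^sub>D i) \<otimes>\<^bsub>TD\<^esub> w12 D (pb i \<rhd> \<gamma>)) m = actN (h (\<gamma>\<^sub>D i) m) (w12 D (pb i \<rhd> \<gamma>))"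
        unfolding tw.ext1_rmult[OF tm(2)[OF i] tm(1)[OF i]] tw.ext1_w1[OF I1_dual_W1[OF i]] ..
    qed
    finally show ?case using assms(4)[OF W0] by simp
  next
    case (add x y)
    then show ?case using de_Tdeg[of _ 0]
      by (simp add: N.act_add_T M.act_add_T assms(2) de_add Tdeg_carrier tw.ext1_add)
  next
    case (mult x y)
    have d: "de D B x \<in> Tdeg D 1" "de D B y \<in> Tdeg D 1" using mult(1,2) de_Tdeg[of _ 0] by auto
    have dd: "de D B x \<otimes>\<^bsub>TD\<^esub> y \<in> Tdeg D 1" "x \<otimes>\<^bsub>TD\<^esub> de D B y \<in> Tdeg D 1"
      using Tdeg_mult[OF d(1) mult(2)] Tdeg_mult[OF mult(1) d(2)] by simp_all
    have "actN (f0 m) (x \<otimes>\<^bsub>TD\<^esub> y) = actN (f0 (actM m x) + tw.ext1 (de D B x) m) y"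
      using mult by (simp add: N.act_mult)
    also have "\<dots> = f0 (actM m (x \<otimes>\<^bsub>TD\<^esub> y)) + (tw.ext1 (de D B y) (actM m x) + actN (tw.ext1 (de D B x) m) y)"
      using mult by (simp add: N.act_add M.act_mult add.assoc)
    also have "tw.ext1 (de D B y) (actM m x) + actN (tw.ext1 (de D B x) m) y = tw.ext1 (de D B (x \<otimes>\<^bsub>TD\<^esub> y)) m"
      unfolding de_mult_0[OF mult(1) Tdeg_carrier[OF mult(2)]] tw.ext1_add[OF dd]
        tw.ext1_lmult[OF mult(1) d(2)] tw.ext1_rmult[OF mult(2) d(1)] by simp
    finally show ?case .
  qed
  show "is_morphism D B actM actN (f0, generated_mor h)"
    unfolding morphism_iff e
    by (intro conjI allI ballI impI)
       (rule add, erule lin, erule tw.ext1_hom, erule tw.ext1_out, erule (1) tw.ext1_add,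
        erule (1) tw.ext1_lmult, erule (1) tw.ext1_rmult, erule gen)
qed

end

section \<open>Composition of morphisms\<close>

locale eq_triple = MN: eq_pair D B actM actN + NL: eq_pair D B actN actL
  for D :: "('a, 'f::field, 'g::field) eq_data" and B
    and actM :: "('m::ab_group_add, 'a, 'g) action" and actN :: "('n::ab_group_add, 'a, 'g) action"
    and actL :: "('l::ab_group_add, 'a, 'g) action" +
  fixes f0 f1 g0 g1
  assumes f: "is_morphism D B actM actN (f0, f1)" and g: "is_morphism D B actN actL (g0, g1)"
begin

sublocale tw: eq_tower D actM actN actL "\<lambda>\<delta>. f1 (w1 D \<delta>)" "\<lambda>\<delta>. g1 (w1 D \<delta>)"
  by (intro eq_tower.intro eq_tower_axioms.intro MN.M.eq_module_axioms MN.N.eq_module_axioms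
      NL.N.eq_module_axioms MN.mor_bimod[OF f] NL.mor_bimod[OF g])

abbreviation "TD \<equiv> Talg D"

text \<open>Both f^1 and g^1 are determined by their values on w_1 W_1, so they are the entries M ->
  N and N -> L of the action of T_1.\<close>

lemma tact_1: "v \<in> Tdeg D 1 \<Longrightarrow> tw.tact (m, n, l) v = (0, f1 v m, g1 v n)"
proof (induction arbitrary: m n l rule: MN.Tdeg_induct_1)
  case (W1 \<delta>)
  then show ?case by (rule tw.tact_w1)
next
  case (add x y)
  then show ?case by (simp add: tw.tact_add_T MN.Tdeg_carrier MN.mor1[OF f] NL.mor1[OF g])
next
  case (lmult a x)
  then show ?case
    by (simp add: tw.tact_mult MN.Tdeg_carrier tw.tact_0_deg MN.mor1[OF f] NL.mor1[OF g])
next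
  case (rmult a x)
  then show ?case
    by (simp add: tw.tact_mult MN.Tdeg_carrier tw.tact_0_deg MN.mor1[OF f] NL.mor1[OF g])
qed

inductive_set sums2 :: "('a, 'g) T_elem set" where
  zero: "\<zero>\<^bsub>TD\<^esub> \<in> sums2"
| step: "w \<in> sums2 \<Longrightarrow> x \<in> Tdeg D 1 \<Longrightarrow> y \<in> Tdeg D 1 \<Longrightarrow> x \<otimes>\<^bsub>TD\<^esub> y \<oplus>\<^bsub>TD\<^esub> w \<in> sums2"

lemma sums2_carrier: "w \<in> sums2 \<Longrightarrow> w \<in> carrier TD"
  by (induction rule: sums2.induct) (auto simp: MN.Tdeg_carrier)

lemma sums2_add: "w \<in> sums2 \<Longrightarrow> w' \<in> sums2 \<Longrightarrow> w \<oplus>\<^bsub>TD\<^esub> w' \<in> sums2"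
  by (induction rule: sums2.induct)
     (simp_all add: sums2_carrier MN.Tdeg_carrier MN.T.a_assoc sums2.step)

text \<open>A factor from T_0 is absorbed into the adjacent factor of each product.\<close>

lemma Tdeg_2_sums2: "w \<in> Tdeg D 2 \<Longrightarrow> w \<in> sums2"
proof (induction rule: MN.Tdeg_induct_2)
  case (lmult a x)
  from lmult(3) show ?case
  proof (induction rule: sums2.induct)
    case zero
    then show ?case using lmult(1) by (simp add: MN.Tdeg_carrier sums2.zero)
  next
    case (step w x y)
    have "a \<otimes>\<^bsub>TD\<^esub> x \<in> Tdeg D 1" using MN.Tdeg_mult[OF lmult(1) step(2)] by simp
    from sums2.step[OF step(4) this step(3)] show ?case
      using lmult(1) step by (simp add: MN.Tdeg_carrier MN.T.r_distr MN.T.m_assoc sums2_carrier)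
  qed
next
  case (rmult a x)
  from rmult(3) show ?case
  proof (induction rule: sums2.induct)
    case zero
    then show ?case using rmult(1) by (simp add: MN.Tdeg_carrier sums2.zero)
  next
    case (step w x y)
    have "y \<otimes>\<^bsub>TD\<^esub> a \<in> Tdeg D 1" using MN.Tdeg_mult[OF step(3) rmult(1)] by simp
    from sums2.step[OF step(4) step(2) this] show ?case
      using rmult(1) step by (simp add: MN.Tdeg_carrier MN.T.l_distr MN.T.m_assoc sums2_carrier)
  qed
next
  case (mult x y)
  then show ?case using sums2.step[OF sums2.zero mult] by (simp add: MN.Tdeg_carrier)
qed (simp_all add: sums2.zero sums2_add)

lemma sums2_repr:
  "w \<in> sums2 \<Longrightarrow> \<exists>(n::nat) v' v''. v' \<in> {..<n} \<rightarrow> Tdeg D 1 \<and> v'' \<in> {..<n} \<rightarrow> Tdeg D 1 \<and>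
     w = (\<Oplus>\<^bsub>TD\<^esub>k\<in>{..<n}. v' k \<otimes>\<^bsub>TD\<^esub> v'' k)"
proof (induction rule: sums2.induct)
  case zero
  then show ?case by (intro exI[of _ 0]) auto
next
  case (step w x y)
  then obtain n v' v'' where *: "v' \<in> {..<n} \<rightarrow> Tdeg D 1" "v'' \<in> {..<n::nat} \<rightarrow> Tdeg D 1"
    "w = (\<Oplus>\<^bsub>TD\<^esub>k\<in>{..<n}. v' k \<otimes>\<^bsub>TD\<^esub> v'' k)" by blast
  let ?v' = "v'(n := x)" and ?v'' = "v''(n := y)"
  have c: "v' k \<in> carrier TD" "v'' k \<in> carrier TD" if "k < n" for k
    using that *(1,2) by (auto simp: Pi_iff intro: MN.Tdeg_carrier)
  have xy: "x \<in> carrier TD" "y \<in> carrier TD" using step(2,3) by (auto intro: MN.Tdeg_carrier)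
  have "(\<Oplus>\<^bsub>TD\<^esub>k\<in>{..<Suc n}. ?v' k \<otimes>\<^bsub>TD\<^esub> ?v'' k) = x \<otimes>\<^bsub>TD\<^esub> y \<oplus>\<^bsub>TD\<^esub> (\<Oplus>\<^bsub>TD\<^esub>k\<in>{..<n}. ?v' k \<otimes>\<^bsub>TD\<^esub> ?v'' k)"
    unfolding lessThan_Suc using c xy by (subst MN.T.finsum_insert) auto
  also have "(\<Oplus>\<^bsub>TD\<^esub>k\<in>{..<n}. ?v' k \<otimes>\<^bsub>TD\<^esub> ?v'' k) = w"
    unfolding *(3) using c by (intro MN.T.finsum_cong') auto
  finally show ?case using * step(2,3)
    by (intro exI[of _ "Suc n"] exI[of _ ?v'] exI[of _ ?v'']) (auto simp: less_Suc_eq)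
qed

text \<open>The entry M -> L of the action of w. Being defined through w itself, it does not depend
  on how w is written as a sum of products.\<close>

definition cr :: "('a, 'g) T_elem \<Rightarrow> 'm \<Rightarrow> 'l" where
  "cr w m = snd (snd (tw.tact (m, 0, 0) w))"

lemma cr_add: "w \<in> Tdeg D 2 \<Longrightarrow> w' \<in> Tdeg D 2 \<Longrightarrow> cr (w \<oplus>\<^bsub>TD\<^esub> w') m = cr w m + cr w' m"
  by (simp add: cr_def tw.tact_add_T MN.Tdeg_carrier)

lemma cr_mult: "x \<in> Tdeg D 1 \<Longrightarrow> y \<in> Tdeg D 1 \<Longrightarrow> cr (x \<otimes>\<^bsub>TD\<^esub> y) m = g1 y (f1 x m)"
  by (simp add: cr_def tw.tact_mult MN.Tdeg_carrier tact_1)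

lemma cr_lmult: "a \<in> Tdeg D 0 \<Longrightarrow> w \<in> Tdeg D 2 \<Longrightarrow> cr (a \<otimes>\<^bsub>TD\<^esub> w) m = cr w (actM m a)"
  by (simp add: cr_def tw.tact_mult MN.Tdeg_carrier tw.tact_0_deg)

lemma cr_rmult: "a \<in> Tdeg D 0 \<Longrightarrow> w \<in> Tdeg D 2 \<Longrightarrow> cr (w \<otimes>\<^bsub>TD\<^esub> a) m = actL (cr w m) a"
  using tw.tact_0_deg[of a "fst (tw.tact (m, 0, 0) w)" "fst (snd (tw.tact (m, 0, 0) w))" "snd (snd (tw.tact (m, 0, 0) w))"]
  by (simp add: cr_def tw.tact_mult MN.Tdeg_carrier)

lemma cr_zero: "cr \<zero>\<^bsub>TD\<^esub> m = 0"
  by (simp add: cr_def tw.tact_zero)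

lemma cr_minus: "w \<in> Tdeg D 2 \<Longrightarrow> cr (\<ominus>\<^bsub>TD\<^esub> w) m = - cr w m"
  using cr_add[OF _ MN.Tdeg_minus, of w w m] cr_zero
  by (simp add: MN.T.r_neg MN.Tdeg_carrier eq_neg_iff_add_eq_0 add.commute)

lemma cr_finsum: "(\<And>i. i \<in> I \<Longrightarrow> w i \<in> carrier TD) \<Longrightarrow> cr (\<Oplus>\<^bsub>TD\<^esub>i\<in>I. w i) m = (\<Sum>i\<in>I. cr (w i) m)"
proof -
  assume "\<And>i. i \<in> I \<Longrightarrow> w i \<in> carrier TD"
  then have "cr (\<Oplus>\<^bsub>TD\<^esub>i\<in>I. w i) m = snd (snd (\<Sum>i\<in>I. tw.tact (m, 0, 0) (w i)))"
    unfolding cr_def by (subst tw.tact_finsum) auto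
  also have "\<dots> = (\<Sum>i\<in>I. cr (w i) m)"
    unfolding cr_def by (induction I rule: infinite_finite_induct) auto
  finally show ?thesis .
qed

lemma cross_eq: "w \<in> Tdeg D 2 \<Longrightarrow> cross D g1 f1 w = cr w"
  unfolding cross_def
proof (rule the_equality)
  have repr: "h = cr w" if "v' \<in> {..<n} \<rightarrow> Tdeg D 1" "v'' \<in> {..<n::nat} \<rightarrow> Tdeg D 1"
    "w = (\<Oplus>\<^bsub>TD\<^esub>k\<in>{..<n}. v' k \<otimes>\<^bsub>TD\<^esub> v'' k)" "h = (\<lambda>m. \<Sum>k<n. g1 (v'' k) (f1 (v' k) m))" for n v' v'' h w
  proof
    fix m
    have "cr w m = (\<Sum>k<n. cr (v' k \<otimes>\<^bsub>TD\<^esub> v'' k) m)"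
      unfolding that(3) using that(1,2)
      by (intro cr_finsum MN.T.m_closed) (auto intro: MN.Tdeg_carrier)
    also have "\<dots> = h m" unfolding that(4) using that(1,2) by (intro sum.cong) (auto simp: cr_mult Pi_iff)
    finally show "h m = cr w m" ..
  qed
  assume w: "w \<in> Tdeg D 2"
  from sums2_repr[OF Tdeg_2_sums2[OF w]] obtain n v' v'' where
    *: "v' \<in> {..<n} \<rightarrow> Tdeg D 1" "v'' \<in> {..<n::nat} \<rightarrow> Tdeg D 1" "w = (\<Oplus>\<^bsub>TD\<^esub>k\<in>{..<n}. v' k \<otimes>\<^bsub>TD\<^esub> v'' k)"
    by blast
  show "\<exists>(n::nat) v' v''. v' \<in> {..<n} \<rightarrow> Tdeg D 1 \<and> v'' \<in> {..<n} \<rightarrow> Tdeg D 1 \<and>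
     w = (\<Oplus>\<^bsub>TD\<^esub>k\<in>{..<n}. v' k \<otimes>\<^bsub>TD\<^esub> v'' k) \<and> cr w = (\<lambda>m. \<Sum>k<n. g1 (v'' k) (f1 (v' k) m))"
    by (intro exI conjI) (rule * repr[OF * HOL.refl, symmetric])+
  show "h = cr w" if "\<exists>(n::nat) v' v''. v' \<in> {..<n} \<rightarrow> Tdeg D 1 \<and> v'' \<in> {..<n} \<rightarrow> Tdeg D 1 \<and>
     w = (\<Oplus>\<^bsub>TD\<^esub>k\<in>{..<n}. v' k \<otimes>\<^bsub>TD\<^esub> v'' k) \<and> h = (\<lambda>m. \<Sum>k<n. g1 (v'' k) (f1 (v' k) m))" for h
    using that repr by blast
qed

definition comp1 :: "('a, 'g) T_elem \<Rightarrow> 'm \<Rightarrow> 'l" where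
  "comp1 v m = g1 v (f0 m) + g0 (f1 v m) - cr (de D B v) m"

lemma de_1: "v \<in> Tdeg D 1 \<Longrightarrow> de D B v \<in> Tdeg D 2" and de_0: "a \<in> Tdeg D 0 \<Longrightarrow> de D B a \<in> Tdeg D 1"
  using MN.de_Tdeg[of v 1] MN.de_Tdeg[of a 0] by (simp_all add: numeral_2_eq_2)

lemma comp_mor_eq: "comp_mor D B (g0, g1) (f0, f1) = (g0 \<circ> f0, \<lambda>v m. if v \<in> Tdeg D 1 then comp1 v m else 0)"
  unfolding comp_mor_def prod.case comp1_def by (auto simp: cross_eq de_1 fun_eq_iff)

text \<open>The Leibniz term d(a) v contributes g^1(v) f^1(d(a)) to the crossed sum. The same term
  arises when f^0(m) a is rewritten by the compatibility of f, and the two cancel.\<close>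

lemma comp1_lmult:
  assumes a: "a \<in> Tdeg D 0" and v: "v \<in> Tdeg D 1"
  shows "comp1 (a \<otimes>\<^bsub>TD\<^esub> v) m = comp1 v (actM m a)"
proof -
  have t: "de D B a \<otimes>\<^bsub>TD\<^esub> v \<in> Tdeg D 2" "a \<otimes>\<^bsub>TD\<^esub> de D B v \<in> Tdeg D 2"
    using MN.Tdeg_mult[OF de_0[OF a] v] MN.Tdeg_mult[OF a de_1[OF v]] by (simp_all add: numeral_2_eq_2)
  have "cr (de D B (a \<otimes>\<^bsub>TD\<^esub> v)) m = g1 v (f1 (de D B a) m) + cr (de D B v) (actM m a)"
    unfolding MN.de_mult_0[OF a MN.Tdeg_carrier[OF v]] cr_add[OF t] cr_mult[OF de_0[OF a] v] cr_lmult[OF a de_1[OF v]] ..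
  moreover have "g1 (a \<otimes>\<^bsub>TD\<^esub> v) (f0 m) = g1 v (f0 (actM m a)) + g1 v (f1 (de D B a) m)"
    unfolding NL.mor1(3)[OF g a v] MN.mor1(5)[OF f a] NL.mor1_add[OF g v] ..
  ultimately show ?thesis unfolding comp1_def MN.mor1(3)[OF f a v] by simp
qed

text \<open>Here the compatibility of g provides the cancelling term, and the minus sign of the
  Leibniz rule in degree 1 is what makes it cancel.\<close>

lemma comp1_rmult:
  assumes a: "a \<in> Tdeg D 0" and v: "v \<in> Tdeg D 1"
  shows "comp1 (v \<otimes>\<^bsub>TD\<^esub> a) m = actL (comp1 v m) a"
proof -
  have t: "de D B v \<otimes>\<^bsub>TD\<^esub> a \<in> Tdeg D 2" "v \<otimes>\<^bsub>TD\<^esub> de D B a \<in> Tdeg D 2"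
    using MN.Tdeg_mult[OF de_1[OF v] a] MN.Tdeg_mult[OF v de_0[OF a]] by (simp_all add: numeral_2_eq_2)
  have "cr (de D B (v \<otimes>\<^bsub>TD\<^esub> a)) m = actL (cr (de D B v) m) a - g1 (de D B a) (f1 v m)"
    unfolding MN.de_mult_1[OF v MN.Tdeg_carrier[OF a]] a_minus_def cr_add[OF t(1) MN.Tdeg_minus[OF t(2)]]
      cr_minus[OF t(2)] cr_mult[OF v de_0[OF a]] cr_rmult[OF a de_1[OF v]] by simp
  moreover have "g0 (f1 (v \<otimes>\<^bsub>TD\<^esub> a) m) = actL (g0 (f1 v m)) a - g1 (de D B a) (f1 v m)"
    unfolding MN.mor1(4)[OF f a v] using NL.mor1(5)[OF g a, of "f1 v m"] by simp
  ultimately show ?thesis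
    unfolding comp1_def NL.mor1(4)[OF g a v] by (simp add: NL.N.act_add NL.N.act_diff a)
qed

lemma comp1_add: "v \<in> Tdeg D 1 \<Longrightarrow> v' \<in> Tdeg D 1 \<Longrightarrow> comp1 (v \<oplus>\<^bsub>TD\<^esub> v') m = comp1 v m + comp1 v' m"
  by (simp add: comp1_def NL.mor1[OF g] MN.mor1[OF f] NL.mor0[OF g] MN.de_add MN.Tdeg_carrier cr_add de_1)

text \<open>The minus sign of the composition law meets the one in the differential of w_1\<delta>,
  so all three terms appear with a plus.\<close>

lemma comp1_w1:
  assumes "\<delta> \<in> W1 D"
  shows "comp1 (w1 D \<delta>) m = g1 (w1 D \<delta>) (f0 m) + g0 (f1 (w1 D \<delta>) m) +
    (\<Sum>i\<in>MN.I1. g1 (w1 D (dual_lact D (snd (snd i)) \<delta>)) (f1 (w1 D (dual_elem D B i)) m))"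
proof -
  have t: "w1 D (dual_elem D B i) \<in> Tdeg D 1" "w1 D (dual_lact D (snd (snd i)) \<delta>) \<in> Tdeg D 1" if "i \<in> MN.I1" for i
    using MN.w1_Tdeg[OF MN.I1_dual_W1[OF that]]
      MN.w1_Tdeg[OF MN.W1_closed(3)[OF assms MN.J_Lam[OF MN.idx_J[OF that]]]] by auto
  have t2: "w1 D (dual_elem D B i) \<otimes>\<^bsub>TD\<^esub> w1 D (dual_lact D (snd (snd i)) \<delta>) \<in> Tdeg D 2" if "i \<in> MN.I1" for i
    using MN.Tdeg_mult[OF t[OF that]] by (simp add: numeral_2_eq_2)
  have "cr (de D B (w1 D \<delta>)) m =
      - (\<Sum>i\<in>MN.I1. cr (w1 D (dual_elem D B i) \<otimes>\<^bsub>TD\<^esub> w1 D (dual_lact D (snd (snd i)) \<delta>)) m)"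
  proof -
    have "cr (de D B (w1 D \<delta>)) m =
        - cr (\<Oplus>\<^bsub>TD\<^esub>i\<in>MN.I1. w1 D (dual_elem D B i) \<otimes>\<^bsub>TD\<^esub> w1 D (dual_lact D (snd (snd i)) \<delta>)) m"
      unfolding MN.de_w1[OF assms] MN.dW_def by (rule cr_minus, rule MN.Tdeg_finsum, rule t2)
    also have "cr (\<Oplus>\<^bsub>TD\<^esub>i\<in>MN.I1. w1 D (dual_elem D B i) \<otimes>\<^bsub>TD\<^esub> w1 D (dual_lact D (snd (snd i)) \<delta>)) m =
        (\<Sum>i\<in>MN.I1. cr (w1 D (dual_elem D B i) \<otimes>\<^bsub>TD\<^esub> w1 D (dual_lact D (snd (snd i)) \<delta>)) m)"
      by (rule cr_finsum, rule MN.Tdeg_carrier, rule t2)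
    finally show ?thesis .
  qed
  also have "(\<Sum>i\<in>MN.I1. cr (w1 D (dual_elem D B i) \<otimes>\<^bsub>TD\<^esub> w1 D (dual_lact D (snd (snd i)) \<delta>)) m) =
      (\<Sum>i\<in>MN.I1. g1 (w1 D (dual_lact D (snd (snd i)) \<delta>)) (f1 (w1 D (dual_elem D B i)) m))"
    by (intro sum.cong HOL.refl cr_mult t)
  finally show ?thesis unfolding comp1_def by simp
qed

text \<open>The first component of the composite is again compatible with both actions of T_0, hence
  determined by its values on w_1 W_1.\<close>

lemma comp1_eq_0:
  assumes "\<And>\<delta> m. \<delta> \<in> W1 D \<Longrightarrow> comp1 (w1 D \<delta>) m = 0"
  shows "v \<in> Tdeg D 1 \<Longrightarrow> comp1 v m = 0"
  by (induction arbitrary: m rule: MN.Tdeg_induct_1)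
     (simp_all add: assms comp1_add comp1_lmult comp1_rmult NL.N.act_0)

end

section \<open>Coordinates\<close>

context eq_system begin

definition ua :: "'a pt \<Rightarrow> 'g \<Rightarrow> ('a, 'g) Re_elem" where
  "ua x c = (if x = Bot then (0, unit_mat x x c) else (unit_mat x x c, 0))"

lemma unit_at_eq: "unit_at D x c = inR D (ua x c)"
  by (simp add: unit_at_def ua_def)

lemma ua_carrier: "x \<in> P \<Longrightarrow> c \<in> Q x x \<Longrightarrow> ua x c \<in> carrier (Re D)"
proof -
  assume *: "x \<in> P" "c \<in> Q x x"
  have "unit_mat x x c \<in> S" using * by (rule unit_mat_S)
  moreover have "x \<noteq> Bot \<Longrightarrow> unit_mat x x c Bot Bot = 0" "\<forall>y. y \<noteq> Bot \<longrightarrow> unit_mat Bot Bot c y y = 0"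
    by (auto simp: unit_mat_def)
  ultimately show ?thesis unfolding ua_def Re_simps by (auto simp: S1_closed(4)[simplified] S2_closed(4)[simplified])
qed

text \<open>The scalar by which an element of R^e acts on the component at x; component 0 belongs to
  the second factor of R^e.\<close>

definition entry :: "('a, 'g) Re_elem \<Rightarrow> 'a pt \<Rightarrow> 'g" where
  "entry r x = (if x = Bot then snd r x x else fst r x x)"

lemma entry_Q: "r \<in> carrier (Re D) \<Longrightarrow> x \<in> P \<Longrightarrow> entry r x \<in> Q x x"
  using Re_S[of "fst r" "snd r"] S_diag[of "fst r" x] S_diag[of "snd r" x] by (simp add: entry_def)

lemma entry_ua: "entry (ua x c) y = (if x = y then c else 0)"
  by (auto simp: entry_def ua_def unit_mat_def)

lemma ua_mult_right:
  assumes r: "r \<in> carrier (Re D)" and x: "x \<in> P" "c \<in> Q x x"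
  shows "r \<otimes>\<^bsub>Re D\<^esub> ua x c = ua x (entry r x * c)"
proof -
  obtain a b where ab: "r = (a, b)" by (cases r)
  have S: "a \<in> S" "b \<in> S" using r Re_S unfolding ab by auto
  have m: "s \<star> unit_mat x x c = unit_mat x x (s x x * c)" if "s \<in> S" for s
    unfolding mmul_S_left[OF that] by (auto simp: unit_mat_def fun_eq_iff)
  show ?thesis using m[OF S(1)] m[OF S(2)] unfolding ab
    by (cases "x = Bot") (simp_all add: ua_def Re_simps entry_def)
qed

lemma ua_add: "ua x (c + e) = ua x c \<oplus>\<^bsub>Re D\<^esub> ua x e"
  by (simp add: ua_def Re_simps unit_mat_add)

end

context eq_module begin

abbreviation sc :: "'a pt \<Rightarrow> 'g \<Rightarrow> 'm \<Rightarrow> 'm" where "sc x c m \<equiv> act m (unit_at D x c)"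

lemma ua_Tdeg: "x \<in> P \<Longrightarrow> c \<in> Q x x \<Longrightarrow> unit_at D x c \<in> Tdeg D 0"
  unfolding unit_at_eq by (intro inR_Tdeg ua_carrier)

lemma sc_add: "x \<in> P \<Longrightarrow> c \<in> Q x x \<Longrightarrow> sc x c (m + n) = sc x c m + sc x c n"
  by (rule act_add) (rule ua_Tdeg)

lemma sc_0 [simp]: "x \<in> P \<Longrightarrow> c \<in> Q x x \<Longrightarrow> sc x c 0 = 0"
  by (rule act_0) (rule ua_Tdeg)

lemma sc_sum: "x \<in> P \<Longrightarrow> c \<in> Q x x \<Longrightarrow> sc x c (sum f I) = (\<Sum>i\<in>I. sc x c (f i))"
  by (rule act_sum) (rule ua_Tdeg)

lemma sc_add_left: "x \<in> P \<Longrightarrow> c \<in> Q x x \<Longrightarrow> e \<in> Q x x \<Longrightarrow> sc x (c + e) m = sc x c m + sc x e m"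
  unfolding unit_at_eq ua_add inR_add[OF ua_carrier ua_carrier] by (intro act_add_T inR_Tdeg ua_carrier)

lemma sc_zero [simp]: "x \<in> P \<Longrightarrow> sc x 0 m = 0"
  using sc_add_left[of x 0 0 m] by simp

lemma sc_inR:
  "x \<in> P \<Longrightarrow> c \<in> Q x x \<Longrightarrow> r \<in> carrier (Re D) \<Longrightarrow> sc x c (act m (inR D r)) = sc x (entry r x * c) m"
  using act_mult[OF inR_Tdeg inR_Tdeg, of r "ua x c" m] ua_mult_right[of r x c]
  by (simp add: unit_at_eq ua_carrier flip: inR_mult)

lemma sc_sc: "x \<in> P \<Longrightarrow> c \<in> Q x x \<Longrightarrow> y \<in> P \<Longrightarrow> e \<in> Q y y \<Longrightarrow>
    sc y e (sc x c m) = (if x = y then sc x (c * e) m else 0)"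
  using sc_inR[of y e "ua x c" m] by (simp add: ua_carrier entry_ua flip: unit_at_eq)

lemma one_Q [simp]: "x \<in> P \<Longrightarrow> 1 \<in> Q x x"
  by (rule Q_1) simp

lemma Q_self_mult: "x \<in> P \<Longrightarrow> c \<in> Q x x \<Longrightarrow> e \<in> Q x x \<Longrightarrow> c * e \<in> Q x x"
  by (rule Q_mult[of x x x]) simp_all

text \<open>The elements w_1 e_x with x > 0 and w_2 e_0 are idempotents adding up to 1 in
  R^e.\<close>

lemma sum_sc_one: "(\<Sum>x\<in>P. sc x 1 m) = m"
proof -
  have "ua x 1 \<in> carrier (Re D)" if "x \<in> P" for x using that by (simp add: ua_carrier)
  \<comment> \<open>Partial sums are collected inside R^e before acting; the induction therefore
    also records that they lie in its carrier.\<close>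
  have "(\<Sum>x\<in>I. sc x 1 m) = act m (inR D (\<Sum>x\<in>I - {Bot}. idemp x, if Bot \<in> I then idemp Bot else 0)) \<and>
      (\<Sum>x\<in>I - {Bot}. idemp x, if Bot \<in> I then idemp Bot else 0) \<in> carrier (Re D)" if "I \<subseteq> P" for I
    using finite_subset[OF that finite_P] that
  proof (induction I rule: finite_induct)
    case empty
    show ?case using act_zero[of m] Re_zero
      by (simp only: sum.empty empty_Diff empty_iff if_False inR_zero simp_thms)
  next
    case (insert x I)
    let ?s = "\<lambda>I. (\<Sum>x\<in>I - {Bot}. idemp x, if Bot \<in> I then idemp Bot else 0)"
    have x: "ua x 1 \<in> carrier (Re D)" using insert by (simp add: ua_carrier)
    have IH: "?s I \<in> carrier (Re D)" "(\<Sum>x\<in>I. sc x 1 m) = act m (inR D (?s I))" using insert by auto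
    have eq: "?s (insert x I) = ua x 1 \<oplus>\<^bsub>Re D\<^esub> ?s I"
    proof (cases "x = Bot")
      case True
      then show ?thesis using insert(2) by (simp add: ua_def Re_simps idemp_def)
    next
      case False
      then have "insert x I - {Bot} = insert x (I - {Bot})" by auto
      then show ?thesis using False insert(1,2) by (simp add: ua_def Re_simps idemp_def)
    qed
    have "?s (insert x I) \<in> carrier (Re D)" unfolding eq using x IH(1) by (rule TA.R.add.m_closed)
    moreover have "(\<Sum>x\<in>insert x I. sc x 1 m) = act m (inR D (?s (insert x I)))"
    proof -
      have "(\<Sum>x\<in>insert x I. sc x 1 m) = sc x 1 m + (\<Sum>x\<in>I. sc x 1 m)" using insert(1,2) by simp
      also have "\<dots> = act m (inR D (ua x 1)) + act m (inR D (?s I))" 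
        unfolding IH(2) unfolding unit_at_eq ..
      also have "\<dots> = act m (inR D (?s (insert x I)))"
        unfolding eq inR_add[OF x IH(1)] by (rule act_add_T[OF inR_Tdeg[OF x] inR_Tdeg[OF IH(1)], symmetric])
      finally show ?thesis .
    qed
    ultimately show ?case by blast
  qed
  then have *: "(\<Sum>x\<in>P. sc x 1 m) = act m (inR D (\<Sum>x\<in>P - {Bot}. idemp x, idemp Bot))" by simp
  have "(\<Sum>x\<in>P - {Bot}. idemp x) = ehat D"
    unfolding ehat_def by (subst sum.remove[OF finite_P Bot_P]) simp
  then show ?thesis unfolding * by (simp add: inR_one act_one)
qed

lemma component_iff: "x \<in> P \<Longrightarrow> m \<in> component D act x \<longleftrightarrow> sc x 1 m = m"
proof
  assume x: "x \<in> P" and "m \<in> component D act x"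
  then obtain n where "m = sc x 1 n" by (auto simp: component_def)
  then show "sc x 1 m = m" using x sc_sc[of x 1 x 1 n] by simp
next
  assume "sc x 1 m = m"
  then show "m \<in> component D act x" unfolding component_def by (metis rangeI)
qed

end

section \<open>Coordinates in a local basis\<close>

locale eq_based = eq_module D act for D :: "('a, 'f::field, 'g::field) eq_data"
    and act :: "('m::ab_group_add, 'a, 'g) action" +
  fixes bs :: "'a pt \<Rightarrow> 'm list"
  assumes local_basis: "is_local_basis D act bs"
begin

definition K :: "('a pt \<times> nat) set" where "K = Sigma P (\<lambda>x. {..<length (bs x)})"

abbreviation "bvec p \<equiv> bs (fst p) ! snd p"

lemma finite_K [simp]: "finite K"
  by (simp add: K_def)

lemma K_P: "p \<in> K \<Longrightarrow> fst p \<in> P" and K_lt: "p \<in> K \<Longrightarrow> snd p < length (bs (fst p))"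
  by (auto simp: K_def)

lemma K_pair: "(x, i) \<in> K \<longleftrightarrow> x \<in> P \<and> i < length (bs x)"
  by (simp add: K_def)

text \<open>Coordinates of the component of m at x; \<open>sc x 1\<close> projects onto that
  component, so m itself may be arbitrary.\<close>

definition cos :: "'a pt \<Rightarrow> 'm \<Rightarrow> nat \<Rightarrow> 'g" where
  "cos x m = (THE c. c \<in> {..<length (bs x)} \<rightarrow>\<^sub>E Q x x \<and> sc x 1 m = (\<Sum>i<length (bs x). sc x (c i) (bs x ! i)))"

definition co :: "'a pt \<times> nat \<Rightarrow> 'm \<Rightarrow> 'g" where
  "co p m = cos (fst p) m (snd p)"

definition mk :: "('a pt \<times> nat \<Rightarrow> 'g) \<Rightarrow> 'm" where
  "mk v = (\<Sum>p\<in>K. sc (fst p) (v p) (bvec p))"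

lemma ex1_cos:
  assumes "x \<in> P"
  shows "\<exists>!c. c \<in> {..<length (bs x)} \<rightarrow>\<^sub>E Q x x \<and> sc x 1 m = (\<Sum>i<length (bs x). sc x (c i) (bs x ! i))"
proof -
  have "is_Q_basis D act x (bs x)" using local_basis assms by (simp add: is_local_basis_def)
  moreover have "sc x 1 m \<in> component D act x" by (simp add: component_def)
  ultimately show ?thesis unfolding is_Q_basis_def by blast
qed

lemma bs_component: "p \<in> K \<Longrightarrow> sc (fst p) 1 (bvec p) = bvec p"
proof -
  assume p: "p \<in> K"
  have "set (bs (fst p)) \<subseteq> component D act (fst p)"
    using local_basis K_P[OF p] unfolding is_local_basis_def is_Q_basis_def by blast
  then show ?thesis using component_iff[OF K_P[OF p]] nth_mem[OF K_lt[OF p]] by blast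
qed

lemma cos_iff:
  assumes "x \<in> P"
  shows "c = cos x m \<longleftrightarrow> c \<in> {..<length (bs x)} \<rightarrow>\<^sub>E Q x x \<and> sc x 1 m = (\<Sum>i<length (bs x). sc x (c i) (bs x ! i))"
proof
  note ex1 = ex1_cos[OF assms, of m]
  show "c \<in> {..<length (bs x)} \<rightarrow>\<^sub>E Q x x \<and> sc x 1 m = (\<Sum>i<length (bs x). sc x (c i) (bs x ! i))" if "c = cos x m"
    unfolding that cos_def using theI'[OF ex1] .
  show "c = cos x m" if "c \<in> {..<length (bs x)} \<rightarrow>\<^sub>E Q x x \<and> sc x 1 m = (\<Sum>i<length (bs x). sc x (c i) (bs x ! i))"
    unfolding cos_def by (rule the1_equality[symmetric], rule ex1, rule that)
qed

lemma co_Q: "p \<in> K \<Longrightarrow> co p m \<in> Q (fst p) (fst p)"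
  using cos_iff[of "fst p" "cos (fst p) m" m] K_P[of p] K_lt[of p] by (auto simp: co_def)

lemma co_expand: "x \<in> P \<Longrightarrow> sc x 1 m = (\<Sum>i<length (bs x). sc x (co (x, i) m) (bs x ! i))"
  using cos_iff[of x "cos x m" m] by (simp add: co_def)

lemma co_eqI:
  assumes "\<And>i. i < length (bs x) \<Longrightarrow> c i \<in> Q x x" "sc x 1 m = (\<Sum>i<length (bs x). sc x (c i) (bs x ! i))"
    "(x, k) \<in> K"
  shows "co (x, k) m = c k"
proof -
  have x: "x \<in> P" "k < length (bs x)" using assms(3) by (auto simp: K_def)
  have "restrict c {..<length (bs x)} = cos x m"
    unfolding cos_iff[OF x(1)] using assms(1) by (auto simp: assms(2) intro!: sum.cong)
  then show ?thesis using x(2) by (auto simp: co_def dest!: fun_cong[of _ _ k])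
qed

lemma co_add: "p \<in> K \<Longrightarrow> co p (m + n) = co p m + co p n"
proof -
  assume p: "p \<in> K"
  obtain x k where xk: "p = (x, k)" by (cases p)
  have x: "x \<in> P" using p by (simp add: xk K_pair)
  have cQ: "co (x, i) m \<in> Q x x" if "i < length (bs x)" for i m using co_Q[of "(x, i)" m] that x by (simp add: K_pair)
  show ?thesis unfolding xk
    by (rule co_eqI[where c = "\<lambda>k. co (x, k) m + co (x, k) n"])
       (use p x cQ co_expand[OF x, of m] co_expand[OF x, of n] in
         \<open>simp_all add: xk Q_add sc_add sc_add_left flip: sum.distrib\<close>)
qed

lemma co_0 [simp]: "p \<in> K \<Longrightarrow> co p 0 = 0"
proof -
  assume "p \<in> K"
  from co_add[OF this, of 0 0] have "co p 0 = co p 0 + co p 0" by (simp only: add_0_right)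
  then show ?thesis by (rule add_cancel_right_right[THEN iffD1])
qed

lemma co_sum: "p \<in> K \<Longrightarrow> co p (sum f I) = (\<Sum>i\<in>I. co p (f i))"
  by (induction I rule: infinite_finite_induct) (simp_all add: co_add)

lemma co_minus: "p \<in> K \<Longrightarrow> co p (- m) = - co p m"
  using co_add[of p m "- m"] by (simp add: eq_neg_iff_add_eq_0 add.commute)

lemma co_diff: "p \<in> K \<Longrightarrow> co p (m - n) = co p m - co p n"
  using co_add[of p m "- n"] co_minus[of p n] by simp

lemma co_inR:
  assumes "p \<in> K" "r \<in> carrier (Re D)"
  shows "co p (act m (inR D r)) = co p m * entry r (fst p)"
proof -
  obtain x k where xk: "p = (x, k)" by (cases p)
  have x: "x \<in> P" using assms by (simp add: xk K_pair)
  have cQ: "co (x, i) m \<in> Q x x" if "i < length (bs x)" for i m using co_Q[of "(x, i)" m] that x by (simp add: K_pair)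
  have e: "entry r x \<in> Q x x" using assms(2) x by (rule entry_Q)
  have "sc x 1 (act m (inR D r)) = sc x (entry r x) (sc x 1 m)"
    using sc_inR[OF x one_Q[OF x] assms(2), of m] sc_sc[OF x one_Q[OF x] x e, of m] by simp
  also have "\<dots> = (\<Sum>i<length (bs x). sc x (co (x, i) m * entry r x) (bs x ! i))"
    unfolding co_expand[OF x] sc_sum[OF x e] using cQ x e by (intro sum.cong HOL.refl) (simp add: sc_sc)
  finally show ?thesis
    unfolding xk fst_conv using assms(1) cQ e x by (intro co_eqI) (simp_all add: xk Q_self_mult)
qed

lemma co_sc: "p \<in> K \<Longrightarrow> x \<in> P \<Longrightarrow> c \<in> Q x x \<Longrightarrow> co p (sc x c m) = (if fst p = x then co p m * c else 0)"
  unfolding unit_at_eq by (subst co_inR) (auto simp: ua_carrier entry_ua)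

lemma co_bvec: "p \<in> K \<Longrightarrow> q \<in> K \<Longrightarrow> co p (bvec q) = (if p = q then 1 else 0)"
proof -
  assume p: "p \<in> K" and q: "q \<in> K"
  show ?thesis
  proof (cases "fst p = fst q")
    case False
    then show ?thesis using co_sc[OF p K_P[OF q], of 1 "bvec q"] bs_component[OF q] K_P[OF q] by auto
  next
    case True
    obtain x k i where xk: "p = (x, k)" "q = (x, i)" using True by (cases p; cases q) auto
    have x: "x \<in> P" "i < length (bs x)" using q by (simp_all add: xk K_pair)
    have "(\<Sum>j<length (bs x). sc x (if j = i then 1 else 0) (bs x ! j)) = (\<Sum>j<length (bs x). if j = i then sc x 1 (bs x ! i) else 0)"
      using x by (intro sum.cong) auto
    also have "\<dots> = sc x 1 (bs x ! i)" using x by simp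
    finally have "co (x, k) (bs x ! i) = (if k = i then 1 else 0)"
      using x p by (intro co_eqI) (simp_all add: xk)
    then show ?thesis by (simp add: xk)
  qed
qed

lemma mk_co: "mk (\<lambda>p. co p m) = m"
proof -
  have "mk (\<lambda>p. co p m) = (\<Sum>x\<in>P. \<Sum>i<length (bs x). sc x (co (x, i) m) (bs x ! i))"
    unfolding mk_def K_def by (subst sum.Sigma) (simp_all add: case_prod_beta)
  also have "\<dots> = (\<Sum>x\<in>P. sc x 1 m)" by (intro sum.cong HOL.refl co_expand[symmetric])
  also have "\<dots> = m" by (rule sum_sc_one)
  finally show ?thesis .
qed

lemma co_mk: "(\<And>p. p \<in> K \<Longrightarrow> v p \<in> Q (fst p) (fst p)) \<Longrightarrow> q \<in> K \<Longrightarrow> co q (mk v) = v q"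
proof -
  assume v: "\<And>p. p \<in> K \<Longrightarrow> v p \<in> Q (fst p) (fst p)" and q: "q \<in> K"
  have "co q (mk v) = (\<Sum>p\<in>K. if p = q then v q else 0)"
    unfolding mk_def co_sum[OF q] using q v K_P by (intro sum.cong) (auto simp: co_sc co_bvec)
  then show ?thesis using q by simp
qed

lemma co_ext: "(\<And>p. p \<in> K \<Longrightarrow> co p m = co p n) \<Longrightarrow> m = n"
  using mk_co[of m] mk_co[of n] unfolding mk_def by (metis (mono_tags, lifting) sum.cong)

text \<open>The coefficients lie in Q_x, over which the maps of interest need not be linear, so they
  stay inside \<phi>.\<close>

lemma additive_expand:
  assumes "\<And>m m'. \<phi> (m + m') = \<phi> m + (\<phi> m' :: 'b::ab_group_add)"
  shows "\<phi> m = (\<Sum>p\<in>K. \<phi> (sc (fst p) (co p m) (bvec p)))"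
proof -
  have \<phi>0: "\<phi> 0 = 0" using assms[of 0 0] by simp
  have "\<phi> (sum f I) = (\<Sum>i\<in>I. \<phi> (f i))" for f and I :: "('a pt \<times> nat) set"
    by (induction I rule: infinite_finite_induct) (simp_all add: \<phi>0 assms)
  then have "\<phi> (mk (\<lambda>p. co p m)) = (\<Sum>p\<in>K. \<phi> (sc (fst p) (co p m) (bvec p)))"
    unfolding mk_def .
  then show ?thesis by (simp add: mk_co)
qed

end

section \<open>The action of W_0 and the matrices of an object\<close>

context eq_system begin

text \<open>Q_0 is all of G, so in row 0 a functional is determined by its value at 1.\<close>

lemma dcoef_Bot: "\<gamma> \<in> dJ \<Longrightarrow> dcoef \<gamma> Bot x c = c * dcoef \<gamma> Bot x 1"
  using dcoef_mult[of \<gamma> c Bot 1 x] by simp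

lemma dcoef_lact_idemp:
  assumes "\<gamma> \<in> dJ" "z \<in> P" "e \<in> Q z z" "c \<in> Q y x"
  shows "dcoef (unit_mat z z e \<rhd> \<gamma>) y x c = (if z = x then dcoef \<gamma> y x (c * e) else 0)"
  using dcoef_lact_S[OF assms(1) unit_mat_S[OF assms(2,3)] assms(4)] assms(1)
  by (auto simp: unit_mat_def)

lemma dcoef_ract_idemp:
  assumes "\<gamma> \<in> dJ" "z \<in> P" "e \<in> Q z z"
  shows "dcoef (\<gamma> \<lhd> unit_mat z z e) y x c = (if z = y then dcoef \<gamma> y x c * e else 0)"
  using dcoef_ract[OF assms(1) unit_mat_S[OF assms(2,3)]] by (auto simp: unit_mat_def)

text \<open>The two idempotents kill every coordinate except the one at (0, x), and there left
  G-linearity makes the normalisation at 1 determine everything.\<close>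

lemma
  assumes x: "pless D Bot x"
  shows u_hat_W0: "u_hat D x \<in> W0 D"
    and dcoef_u_hat: "pless D y z \<Longrightarrow> c \<in> Q y z \<Longrightarrow> dcoef (u_hat D x) y z c = (if y = Bot \<and> z = x then c else 0)"
proof -
  define g where "g = (\<lambda>y z (c::'g). if y = (Bot::'a pt) \<and> z = x then c else 0)"
  define \<gamma> where "\<gamma> = mk_dual g"
  have xP: "x \<in> P" using x pless_P by blast
  have *: "\<gamma> \<in> dJ" "pless D y z \<Longrightarrow> c \<in> Q y z \<Longrightarrow> dcoef \<gamma> y z c = g y z c" for y z c
    unfolding \<gamma>_def by (rule mk_dual dcoef_mk_dual; auto simp: g_def)+
  let ?im = "(\<lambda>\<delta>. (idemp x \<rhd> \<delta>) \<lhd> idemp Bot) ` dJ"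
  have im: "dcoef ((idemp x \<rhd> \<delta>) \<lhd> idemp Bot) y z c = (if y = Bot \<and> z = x then dcoef \<delta> y z c else 0)"
    if "\<delta> \<in> dJ" "c \<in> Q y z" for \<delta> y z c
    using that dcoef_ract_idemp[OF dualJ_lact[OF that(1) S_Lam[OF idemp_S[OF xP]]] Bot_P, of 1 y z c]
      dcoef_lact_idemp[OF that(1) xP _ that(2), of 1] xP
    by (auto simp: idemp_def Q_1)
  have im_dual: "\<delta> \<in> dJ \<Longrightarrow> (idemp x \<rhd> \<delta>) \<lhd> idemp Bot \<in> dJ" for \<delta>
    using xP by (intro dualJ_ract dualJ_lact S_Lam idemp_S) auto
  have "(idemp x \<rhd> \<gamma>) \<lhd> idemp Bot = \<gamma>"
    by (rule dual_eqI) (auto simp: im_dual *(1) im *(2) g_def)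
  then have \<gamma>im: "\<gamma> \<in> ?im" using *(1) by (metis imageI)
  have val: "\<delta> (unit_mat Bot x 1) = idemp Bot \<longleftrightarrow> dcoef \<delta> Bot x 1 = 1" if "\<delta> \<in> dJ" for \<delta>
  proof
    assume "\<delta> (unit_mat Bot x 1) = idemp Bot"
    then show "dcoef \<delta> Bot x 1 = 1" by (simp add: dcoef_def idemp_def unit_mat_def)
  next
    assume d: "dcoef \<delta> Bot x 1 = 1"
    have "\<delta> (unit_mat Bot x 1) = \<delta> (idemp Bot \<star> unit_mat Bot x 1)"
      by (simp add: idemp_def unit_mat_mmul_unit_mat)
    also have "\<dots> = idemp Bot \<star> \<delta> (unit_mat Bot x 1)"
      by (rule dual_smult[OF that]) (simp_all add: unit_mat_J x)
    also have "\<dots> = idemp Bot"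
    proof (rule S_eqI)
      show "idemp Bot \<star> \<delta> (unit_mat Bot x 1) \<in> S" by (intro S_mmul dual_S[OF that] idemp_S Bot_P)
      show "(idemp Bot \<star> \<delta> (unit_mat Bot x 1)) y y = idemp Bot y y" if "y \<in> P" for y
        using d idemp_mmul[OF dual_S[OF \<open>\<delta> \<in> dJ\<close>]] by (auto simp: dcoef_def) (auto simp: idemp_def unit_mat_def)
    qed (rule idemp_S[OF Bot_P])
    finally show "\<delta> (unit_mat Bot x 1) = idemp Bot" .
  qed
  have "u_hat D x = \<gamma>"
    unfolding u_hat_def
  proof (rule the_equality)
    show "\<gamma> \<in> ?im \<and> \<gamma> (unit_mat Bot x 1) = idemp Bot"
      using \<gamma>im x *(2)[of Bot x 1] by (simp add: val *(1) g_def)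
    fix \<delta> assume d: "\<delta> \<in> ?im \<and> \<delta> (unit_mat Bot x 1) = idemp Bot"
    then obtain \<eta> where \<eta>: "\<eta> \<in> dJ" "\<delta> = (idemp x \<rhd> \<eta>) \<lhd> idemp Bot" by blast
    have \<delta>: "\<delta> \<in> dJ" using \<eta> im_dual by simp
    show "\<delta> = \<gamma>"
    proof (rule dual_eqI[OF \<delta> *(1)])
      fix y z c assume yz: "pless D y z" "c \<in> Q y z"
      show "dcoef \<delta> y z c = dcoef \<gamma> y z c"
        using im[OF \<eta>(1) yz(2)] dcoef_Bot[OF \<delta>, of x c] d val[OF \<delta>]
        by (auto simp: *(2)[OF yz] g_def \<eta>(2))
    qed
  qed
  moreover have "\<gamma> u y y = 0" if "y \<noteq> Bot" for u y
    using that by (auto simp: \<gamma>_def mk_dual_def g_def intro!: sum.neutral)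
  ultimately show "u_hat D x \<in> W0 D"
    "pless D y z \<Longrightarrow> c \<in> Q y z \<Longrightarrow> dcoef (u_hat D x) y z c = (if y = Bot \<and> z = x then c else 0)"
    using * by (simp_all add: W0_eq g_def)
qed

end

context eq_based begin

definition Mt :: "'a pt \<Rightarrow> nat \<Rightarrow> nat \<Rightarrow> 'g" where
  "Mt x j i = co (Bot, j) (act (bs x ! i) (w12 D (u_hat D x)))"

text \<open>On e_0 J e_x every functional is a right multiple of the normalised one: (e_x c)
  \<gamma> equals \<open>u_hat D x\<close> times \<gamma>(c). For x = 0 the result is 0, because the
  left action on W_0 passes through w_1.\<close>

lemma act_w12_sc:
  assumes \<gamma>: "\<gamma> \<in> W0 D" and x: "x \<in> P" "c \<in> Q x x"
  shows "act (sc x c m) (w12 D \<gamma>) = (if x = Bot then 0 else sc Bot (dcoef \<gamma> Bot x c) (act m (w12 D (u_hat D x))))"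
proof (cases "x = Bot")
  case True
  then have "unit_at D x c \<otimes>\<^bsub>TD\<^esub> w12 D \<gamma> = w12 D (0 \<rhd> \<gamma>)"
    using w12_lact[OF \<gamma>, of 0 "unit_mat x x c"] ua_carrier[OF x] by (simp add: unit_at_eq ua_def)
  also have "\<dots> = \<zero>\<^bsub>TD\<^esub>" using lact_zero[OF W0_dual[OF \<gamma>]] by (simp add: w12_zero)
  finally show ?thesis
    using True act_mult[OF ua_Tdeg[OF x] w12_Tdeg[OF \<gamma>], of m] by (simp add: act_zero)
next
  case False
  have u: "u_hat D x \<in> W0 D" and ud: "u_hat D x \<in> dJ" and Bx: "pless D Bot x"
    using False x by (auto simp: pless_Bot intro!: u_hat_W0 W0_dual)
  have \<gamma>d: "\<gamma> \<in> dJ" using \<gamma> by (rule W0_dual)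
  let ?c = "dcoef \<gamma> Bot x c"
  have "unit_mat x x c \<rhd> \<gamma> = u_hat D x \<lhd> unit_mat Bot Bot ?c"
  proof (rule dual_eqI)
    fix y z e assume yz: "pless D y z" "e \<in> Q y z"
    show "dcoef (unit_mat x x c \<rhd> \<gamma>) y z e = dcoef (u_hat D x \<lhd> unit_mat Bot Bot ?c) y z e"
      using dcoef_lact_idemp[OF \<gamma>d x yz(2)] dcoef_ract_idemp[OF ud Bot_P, of ?c y z e] dcoef_u_hat[OF Bx yz]
        dcoef_W0[OF \<gamma>, of y z] dcoef_Bot[OF \<gamma>d, of x c] dcoef_Bot[OF \<gamma>d, of x "e * c"]
      by (auto simp: mult.assoc)
  qed (intro dualJ_lact dualJ_ract \<gamma>d ud S_Lam unit_mat_S x Bot_P; simp)+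
  then have "unit_at D x c \<otimes>\<^bsub>TD\<^esub> w12 D \<gamma> = w12 D (u_hat D x) \<otimes>\<^bsub>TD\<^esub> unit_at D Bot ?c"
    using w12_lact[OF \<gamma>, of "unit_mat x x c" 0] w12_ract[OF u, of 0 "unit_mat Bot Bot ?c"]
      ua_carrier[OF x] ua_carrier[OF Bot_P, of ?c] False by (simp add: unit_at_eq ua_def)
  then show ?thesis using False act_mult[OF ua_Tdeg[OF x] w12_Tdeg[OF \<gamma>], of m]
      act_mult[OF w12_Tdeg[OF u] ua_Tdeg[OF Bot_P], of ?c m] by simp
qed

lemma co_w12_Bot:
  assumes \<gamma>: "\<gamma> \<in> W0 D" and j: "(Bot, j) \<in> K"
  shows "co (Bot, j) (act m (w12 D \<gamma>)) = (\<Sum>p\<in>K. dcoef \<gamma> Bot (fst p) 1 * (Mt (fst p) j (snd p) * co p m))"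
proof -
  have "co (Bot, j) (act m (w12 D \<gamma>)) = (\<Sum>p\<in>K. co (Bot, j) (act (sc (fst p) (co p m) (bvec p)) (w12 D \<gamma>)))"
    by (rule additive_expand) (simp add: act_add[OF w12_Tdeg[OF \<gamma>]] co_add[OF j])
  also have "\<dots> = (\<Sum>p\<in>K. dcoef \<gamma> Bot (fst p) 1 * (Mt (fst p) j (snd p) * co p m))"
  proof (intro sum.cong HOL.refl)
    fix p assume p: "p \<in> K"
    show "co (Bot, j) (act (sc (fst p) (co p m) (bvec p)) (w12 D \<gamma>)) = dcoef \<gamma> Bot (fst p) 1 * (Mt (fst p) j (snd p) * co p m)"
    proof (cases "fst p = Bot")
      case True
      then show ?thesis using act_w12_sc[OF \<gamma> K_P[OF p] co_Q[OF p]] j dcoef_not_pless[OF W0_dual[OF \<gamma>], of Bot Bot 1]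
        by (simp add: pless_def)
    next
      case False
      then show ?thesis using act_w12_sc[OF \<gamma> K_P[OF p] co_Q[OF p]] j dcoef_Bot[OF W0_dual[OF \<gamma>], of "fst p" "co p m"]
        by (simp add: co_sc Mt_def)
    qed
  qed
  finally show ?thesis .
qed

text \<open>Elements of W_0 end in w_2 e_0, so they map everything into M_0.\<close>

lemma co_w12_other:
  assumes \<gamma>: "\<gamma> \<in> W0 D" and p: "p \<in> K" "fst p \<noteq> Bot"
  shows "co p (act m (w12 D \<gamma>)) = 0"
proof -
  have x: "fst p \<in> P" using p K_P by blast
  have r: "(unit_mat (fst p) (fst p) 1, 0) \<in> carrier (Re D)" using ua_carrier[OF x one_Q[OF x]] p(2) by (simp add: ua_def)
  have "w12 D \<gamma> \<otimes>\<^bsub>TD\<^esub> unit_at D (fst p) 1 = \<zero>\<^bsub>TD\<^esub>"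
    using w12_ract[OF \<gamma> r] p(2) by (simp add: unit_at_eq ua_def w12_zero)
  then have "sc (fst p) 1 (act m (w12 D \<gamma>)) = 0"
    using act_mult[OF w12_Tdeg[OF \<gamma>] ua_Tdeg[OF x one_Q[OF x]], of m] by (simp add: act_zero)
  then have "co p (sc (fst p) 1 (act m (w12 D \<gamma>))) = 0" using p by simp
  then show ?thesis using co_sc[OF p(1) x one_Q[OF x]] by simp
qed

lemma matrix_of_eq:
  assumes x: "pless D Bot x"
  shows "matrix_of D act bs x = mat (length (bs Bot)) (length (bs x)) (\<lambda>(j, i). Mt x j i)"
  unfolding matrix_of_def
proof (rule the_equality)
  have u: "u_hat D x \<in> W0 D" using x by (rule u_hat_W0)
  have comp: "sc Bot 1 (act (bs x ! i) (w12 D (u_hat D x))) = act (bs x ! i) (w12 D (u_hat D x))" for i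
  proof -
    have "w12 D (u_hat D x) \<otimes>\<^bsub>TD\<^esub> unit_at D Bot 1 = w12 D (u_hat D x \<lhd> idemp Bot)"
      using w12_ract[OF u, of 0 "idemp Bot"] ua_carrier[OF Bot_P, of 1] by (simp add: unit_at_eq ua_def idemp_def)
    also have "u_hat D x \<lhd> idemp Bot = u_hat D x"
    proof
      fix v
      show "(u_hat D x \<lhd> idemp Bot) v = u_hat D x v"
        unfolding ract_apply using u dual_S[OF W0_dual[OF u]] by (intro S2_unit(2)) (simp add: W0_eq)
    qed
    finally show ?thesis
      using act_mult[OF w12_Tdeg[OF u] ua_Tdeg[OF Bot_P, of 1], of "bs x ! i"] by simp
  qed
  let ?A = "mat (length (bs Bot)) (length (bs x)) (\<lambda>(j, i). Mt x j i)"
  show "?A \<in> carrier_mat (length (bs Bot)) (length (bs x)) \<and>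
    (\<forall>i<length (bs x). act (bs x ! i) (w12 D (u_hat D x)) =
        (\<Sum>j<length (bs Bot). act (bs Bot ! j) (unit_at D Bot (?A $$ (j, i)))))"
  proof (intro conjI allI impI)
    fix i assume "i < length (bs x)"
    then show "act (bs x ! i) (w12 D (u_hat D x)) =
        (\<Sum>j<length (bs Bot). act (bs Bot ! j) (unit_at D Bot (?A $$ (j, i))))"
      using co_expand[OF Bot_P, of "act (bs x ! i) (w12 D (u_hat D x))"] unfolding comp by (simp add: Mt_def)
  qed simp
  fix A assume A: "A \<in> carrier_mat (length (bs Bot)) (length (bs x)) \<and>
    (\<forall>i<length (bs x). act (bs x ! i) (w12 D (u_hat D x)) =
        (\<Sum>j<length (bs Bot). act (bs Bot ! j) (unit_at D Bot (A $$ (j, i)))))"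
  show "A = ?A"
  proof (rule eq_matI)
    fix j i assume ji: "j < dim_row ?A" "i < dim_col ?A"
    then have "sc Bot 1 (act (bs x ! i) (w12 D (u_hat D x))) = (\<Sum>j<length (bs Bot). sc Bot (A $$ (j, i)) (bs Bot ! j))"
      unfolding comp using A by simp
    then have "co (Bot, j) (act (bs x ! i) (w12 D (u_hat D x))) = A $$ (j, i)"
      using ji by (intro co_eqI) (simp_all add: K_pair)
    then show "A $$ (j, i) = ?A $$ (j, i)" using ji by (simp add: Mt_def)
  qed (use A in auto)
qed

end

context eq_bases begin

text \<open>The basis element p_i is a matrix unit with a scalar, so e_{t,w} p_i vanishes unless w
  is the row of p_i.\<close>

lemma dcoef_lact_basis:
  assumes "\<delta> \<in> dJ" "i \<in> idx A" "pless D t w" "e \<in> Q t w"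
  shows "dcoef (pb i \<rhd> \<delta>) t w e =
    (if w = fst i then dcoef \<delta> t (fst (snd i)) (e * pb i (fst i) (fst (snd i))) else 0)"
proof -
  obtain y z u where i: "i = (y, z, u)" "pless D y z" "u \<in> B y z" using assms(2) by (cases i) (auto simp: idx_def)
  have w: "w \<in> P" using assms(3) pless_P by blast
  have "unit_mat t w e \<star> u = unit_mat t w e \<star> unit_mat y z (u y z)"
    unfolding unit_mat_B[OF i(2,3)] ..
  also have "\<dots> = (if w = y then unit_mat t z (e * u y z) else 0)"
    using w unfolding unit_mat_mmul by (auto simp: unit_mat_def fun_eq_iff)
  finally have "unit_mat t w e \<star> u = (if w = y then unit_mat t z (e * u y z) else 0)" .
  then show ?thesis
    using assms(1) dual_zero[OF assms(1)] unit_mat_J[OF assms(3,4)]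
    by (simp add: i(1) dcoef_def lact_apply)
qed

text \<open>Only the basis elements of the block (y, x) contribute, and for them p_i \<delta> is
  evaluated by \<open>dcoef_lact_basis\<close>. Additivity takes the sum inside \<delta>, where it
  rebuilds c from its coordinates.\<close>

lemma dual_basis_dcoef:
  assumes "\<delta> \<in> dJ" "pless D z y" "pless D y x" "a \<in> Q z y" "c \<in> Q y x"
  shows "(\<Sum>i\<in>I1. dcoef (pb i \<rhd> \<delta>) z y (a * dcoef (\<gamma>\<^sub>D i) y x c)) = dcoef \<delta> z x (a * c)"
proof -
  have y: "y \<noteq> Bot" "y \<in> P" using assms(2) pless_not_Bot pless_P by auto
  have le: "ple D z y" "ple D y x" "ple D y y" using assms(2,3) y by (auto simp: pless_def)
  have d: "dcoef (\<gamma>\<^sub>D i) y x c = (if fst i = y \<and> fst (snd i) = x then bcoef y x c (pb i) else 0)" if "i \<in> I1" for i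
    using that dcoef_dual_elem[OF _ _ assms(3,5), of "fst i" "fst (snd i)" "pb i"] by (cases i) (auto simp: idx_def)
  have dQ: "dcoef (\<gamma>\<^sub>D i) y x c \<in> Q y y" if "i \<in> I1" for i by (rule dcoef_Q[OF idx_dual[OF that] y(2)])
  have "(\<Sum>i\<in>I1. dcoef (pb i \<rhd> \<delta>) z y (a * dcoef (\<gamma>\<^sub>D i) y x c)) =
      (\<Sum>u\<in>B y x. dcoef (pb (y, x, u) \<rhd> \<delta>) z y (a * dcoef (\<gamma>\<^sub>D (y, x, u)) y x c))"
  proof (rule sum_idx)
    show "y \<in> - {Bot}" using y by simp
    fix i assume i: "i \<in> I1" "fst i \<noteq> y \<or> fst (snd i) \<noteq> x"
    then have "dcoef (\<gamma>\<^sub>D i) y x c = 0" using d[OF i(1)] by auto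
    then show "dcoef (pb i \<rhd> \<delta>) z y (a * dcoef (\<gamma>\<^sub>D i) y x c) = 0"
      using dualJ_lact[OF assms(1) J_Lam[OF idx_J[OF i(1)]]] by simp
  qed (rule assms(3))
  also have "\<dots> = (\<Sum>u\<in>B y x. dcoef \<delta> z x (a * (bcoef y x c u * u y x)))"
  proof (intro sum.cong HOL.refl)
    fix u assume u: "u \<in> B y x"
    then have i: "(y, x, u) \<in> I1" using assms(3) y by (simp add: idx_def)
    have "a * dcoef (\<gamma>\<^sub>D (y, x, u)) y x c \<in> Q z y" using Q_mult[OF le(1,3) assms(4) dQ[OF i]] .
    then show "dcoef (pb (y, x, u) \<rhd> \<delta>) z y (a * dcoef (\<gamma>\<^sub>D (y, x, u)) y x c) = dcoef \<delta> z x (a * (bcoef y x c u * u y x))"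
      using dcoef_lact_basis[OF assms(1) i assms(2)] d[OF i] by (simp add: mult.assoc)
  qed
  also have "\<dots> = dcoef \<delta> z x (\<Sum>u\<in>B y x. a * (bcoef y x c u * u y x))"
  proof (rule dcoef_sum[symmetric, OF assms(1)])
    fix u assume u: "u \<in> B y x"
    show "a * (bcoef y x c u * u y x) \<in> Q z x"
      using Q_mult[OF le(1,2) assms(4) Q_mult_left[OF assms(3) bcoef_Q[OF assms(3,5) u] B_entry_Q[OF assms(3) u]]] .
  qed
  also have "(\<Sum>u\<in>B y x. a * (bcoef y x c u * u y x)) = a * c"
    unfolding sum_distrib_left[symmetric] bcoef_sum[OF assms(3,5)] ..
  finally show ?thesis .
qed

end

context eq_system begin

text \<open>Blocks (0, x) with x > 0 are excluded: row 0 of J gives the arrows W_0, which belong to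
  the objects, whereas morphisms involve only W_1.\<close>

definition adm :: "'a pt \<Rightarrow> 'a pt \<Rightarrow> bool" where
  "adm y x \<longleftrightarrow> y = x \<or> y \<noteq> Bot \<and> pless D y x"

end

context eq_based begin

lemma sum_K_fst: "x \<in> P \<Longrightarrow> (\<Sum>p\<in>K. if fst p = x then f p else 0) = (\<Sum>i<length (bs x). f (x, i))"
proof -
  assume x: "x \<in> P"
  have "(\<Sum>p\<in>K. if fst p = x then f p else 0) = (\<Sum>p\<in>{p \<in> K. fst p = x}. f p)"
    by (rule sum.inter_filter[symmetric]) simp
  also have "{p \<in> K. fst p = x} = Pair x ` {..<length (bs x)}" using x by (auto simp: K_def)
  also have "(\<Sum>p\<in>Pair x ` {..<length (bs x)}. f p) = (\<Sum>i<length (bs x). f (x, i))"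
    by (subst sum.reindex) (auto simp: inj_on_def)
  finally show ?thesis .
qed

lemma co_u_hat:
  assumes x: "pless D Bot x" and j: "(Bot, j) \<in> K"
  shows "co (Bot, j) (act m (w12 D (u_hat D x))) = (\<Sum>p\<in>K. if fst p = x then Mt x j (snd p) * co p m else 0)"
  unfolding co_w12_Bot[OF u_hat_W0[OF x] j]
proof (intro sum.cong HOL.refl)
  fix p assume p: "p \<in> K"
  show "dcoef (u_hat D x) Bot (fst p) 1 * (Mt (fst p) j (snd p) * co p m) =
      (if fst p = x then Mt x j (snd p) * co p m else 0)"
  proof (cases "fst p = Bot")
    case True
    then show ?thesis using x dcoef_not_pless[OF W0_dual[OF u_hat_W0[OF x]], of Bot Bot 1]
      by (auto simp: pless_def)
  next
    case False
    then show ?thesis using dcoef_u_hat[OF x, of Bot "fst p" 1] K_P[OF p] by (auto simp: pless_Bot)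
  qed
qed

end

section \<open>Morphisms and block triangular matrices\<close>

locale eq_based_pair = eq_pair D B actM actN + M: eq_based D actM bM + N: eq_based D actN bN
  for D :: "('a, 'f::field, 'g::field) eq_data" and B
    and actM :: "('m::ab_group_add, 'a, 'g) action" and actN :: "('n::ab_group_add, 'a, 'g) action"
    and bM bN
begin

definition tri :: "('a pt \<times> nat \<Rightarrow> 'a pt \<times> nat \<Rightarrow> 'g) \<Rightarrow> bool" where
  "tri X \<longleftrightarrow> (\<forall>q\<in>N.K. \<forall>p\<in>M.K. X q p \<in> Q (fst q) (fst p) \<and> (adm (fst q) (fst p) \<or> X q p = 0))"

text \<open>The matrix identity \<open>X\<^sub>0 \<M>(M)\<^sub>x = \<Sum>\<^sub>y \<M>(N)\<^sub>y X\<^bsub>y,x\<^esub>\<close>.\<close>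

definition intertwines :: "('a pt \<times> nat \<Rightarrow> 'a pt \<times> nat \<Rightarrow> 'g) \<Rightarrow> bool" where
  "intertwines X \<longleftrightarrow> (\<forall>j p. (Bot, j) \<in> N.K \<longrightarrow> p \<in> M.K \<longrightarrow> fst p \<noteq> Bot \<longrightarrow>
     (\<Sum>r\<in>M.K. if fst r = Bot then X (Bot, j) r * M.Mt (fst p) (snd r) (snd p) else 0) =
     (\<Sum>q\<in>N.K. if fst q \<noteq> Bot then N.Mt (fst q) j (snd q) * X q p else 0))"

text \<open>In coordinates f^1(w_1\<gamma>_i) should be \<gamma>_i applied to the block X, compare
  \<open>mat1\<close>; an off-diagonal block is therefore recovered as \<Sum> \<gamma>_i(X)
  p_i.\<close>

definition mor_mat :: "('m \<Rightarrow> 'n) \<Rightarrow> (('a, 'g) T_elem \<Rightarrow> 'm \<Rightarrow> 'n) \<Rightarrow> 'a pt \<times> nat \<Rightarrow> 'a pt \<times> nat \<Rightarrow> 'g" where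
  "mor_mat f0 f1 q p = (if fst q = fst p then N.co q (f0 (M.bvec p)) else
     (\<Sum>i\<in>I1. if fst i = fst q \<and> fst (snd i) = fst p
        then N.co q (f1 (w1 D (\<gamma>\<^sub>D i)) (M.bvec p)) * pb i (fst q) (fst p) else 0))"

lemma mor_mat_tri: "tri (mor_mat f0 f1)"
  unfolding tri_def
proof (intro ballI conjI)
  fix q p assume q: "q \<in> N.K" and p: "p \<in> M.K"
  show "mor_mat f0 f1 q p \<in> Q (fst q) (fst p)"
  proof (cases "fst q = fst p")
    case True
    then show ?thesis using N.co_Q[OF q] by (simp add: mor_mat_def)
  next
    case False
    have "N.co q n * pb i (fst q) (fst p) \<in> Q (fst q) (fst p)"
      if "i \<in> I1" "fst i = fst q \<and> fst (snd i) = fst p" for i n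
    proof -
      have "pless D (fst q) (fst p)" "pb i \<in> B (fst q) (fst p)" using that by (auto simp: idx_def)
      then show ?thesis using Q_mult_left[OF _ N.co_Q[OF q] B_entry_Q] by blast
    qed
    then show ?thesis using False unfolding mor_mat_def by (auto intro!: Q_sum)
  qed
  show "adm (fst q) (fst p) \<or> mor_mat f0 f1 q p = 0"
  proof (cases "adm (fst q) (fst p)")
    case False
    then have "\<not> (fst i = fst q \<and> fst (snd i) = fst p)" if "i \<in> I1" for i
      using that by (auto simp: idx_def adm_def)
    then have "(\<Sum>i\<in>I1. if fst i = fst q \<and> fst (snd i) = fst p
        then N.co q (f1 (w1 D (\<gamma>\<^sub>D i)) (M.bvec p)) * pb i (fst q) (fst p) else 0) = 0"
      by (intro sum.neutral ballI if_not_P)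
    moreover have "fst q \<noteq> fst p" using False by (simp add: adm_def)
    ultimately show ?thesis by (simp add: mor_mat_def)
  qed simp
qed

text \<open>The compatibility condition is evaluated at the arrow \<open>u_hat D x\<close> and at a
  basis vector of M_x. The term from the differential involves p_i acting on
  \<open>u_hat D x\<close>, which is nonzero only for p_i in column x; these p_i are the ones that
  make up the blocks (y, x) with 0 < y < x.\<close>

lemma mor_mat_intertwines:
  assumes f: "is_morphism D B actM actN (f0, f1)"
  shows "intertwines (mor_mat f0 f1)"
  unfolding intertwines_def
proof (intro allI impI)
  fix j p assume j: "(Bot, j) \<in> N.K" and p: "p \<in> M.K" "fst p \<noteq> Bot"
  let ?x = "fst p" and ?b = "M.bvec p"
  have x: "pless D Bot ?x" using p M.K_P by (simp add: pless_Bot)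
  note W = u_hat_W0[OF x]
  let ?u = "u_hat D ?x"
  have "N.co (Bot, j) (actN (f0 ?b) (w12 D ?u)) = N.co (Bot, j) (f0 (actM ?b (w12 D ?u))) -
      (\<Sum>i\<in>I1. N.co (Bot, j) (actN (f1 (w1 D (\<gamma>\<^sub>D i)) ?b) (w12 D (pb i \<rhd> ?u))))"
    unfolding mor1(5)[OF f w12_Tdeg[OF W]] mor_de_w12[OF f W] N.co_add[OF j] N.co_minus[OF j] N.co_sum[OF j] by simp
  moreover have "N.co (Bot, j) (actN (f0 ?b) (w12 D ?u)) =
      (\<Sum>q\<in>N.K. if fst q = ?x then N.Mt ?x j (snd q) * mor_mat f0 f1 q p else 0)"
    unfolding N.co_u_hat[OF x j] by (intro sum.cong) (auto simp: mor_mat_def)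
  moreover have "N.co (Bot, j) (f0 (actM ?b (w12 D ?u))) =
      (\<Sum>r\<in>M.K. if fst r = Bot then mor_mat f0 f1 (Bot, j) r * M.Mt ?x (snd r) (snd p) else 0)"
  proof -
    have "N.co (Bot, j) (f0 (actM ?b (w12 D ?u))) =
        (\<Sum>r\<in>M.K. N.co (Bot, j) (f0 (M.sc (fst r) (M.co r (actM ?b (w12 D ?u))) (M.bvec r))))"
      by (rule M.additive_expand) (simp add: mor0[OF f] N.co_add[OF j])
    also have "\<dots> = (\<Sum>r\<in>M.K. if fst r = Bot then mor_mat f0 f1 (Bot, j) r * M.Mt ?x (snd r) (snd p) else 0)"
    proof (intro sum.cong HOL.refl)
      fix r assume r: "r \<in> M.K"
      let ?c = "M.co r (actM ?b (w12 D ?u))"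
      have "f0 (M.sc (fst r) ?c (M.bvec r)) = N.sc (fst r) ?c (f0 (M.bvec r))"
        unfolding unit_at_eq by (rule mor0(2)[OF f ua_carrier[OF M.K_P[OF r] M.co_Q[OF r]]])
      then have "N.co (Bot, j) (f0 (M.sc (fst r) ?c (M.bvec r))) =
          (if fst r = Bot then N.co (Bot, j) (f0 (M.bvec r)) * ?c else 0)"
        using N.co_sc[OF j M.K_P[OF r] M.co_Q[OF r]] by simp
      moreover have "?c = M.Mt ?x (snd r) (snd p)" if "fst r = Bot"
        unfolding M.Mt_def that[symmetric] by simp
      ultimately show "N.co (Bot, j) (f0 (M.sc (fst r) ?c (M.bvec r))) =
          (if fst r = Bot then mor_mat f0 f1 (Bot, j) r * M.Mt ?x (snd r) (snd p) else 0)"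
        by (simp add: mor_mat_def)
    qed
    finally show ?thesis .
  qed
  moreover have "(\<Sum>i\<in>I1. N.co (Bot, j) (actN (f1 (w1 D (\<gamma>\<^sub>D i)) ?b) (w12 D (pb i \<rhd> ?u)))) =
      (\<Sum>q\<in>N.K. if fst q \<noteq> Bot \<and> fst q \<noteq> ?x then N.Mt (fst q) j (snd q) * mor_mat f0 f1 q p else 0)"
  proof -
    have "N.co (Bot, j) (actN n (w12 D (pb i \<rhd> ?u))) =
        (\<Sum>q\<in>N.K. if fst i = fst q \<and> fst (snd i) = ?x
          then N.Mt (fst q) j (snd q) * (N.co q n * pb i (fst q) ?x) else 0)"
      if i: "i \<in> I1" for i n
      unfolding N.co_w12_Bot[OF W0_closed(3)[OF W J_Lam[OF idx_J[OF i]]] j]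
    proof (intro sum.cong HOL.refl)
      fix q assume q: "q \<in> N.K"
      have i': "pless D (fst i) (fst (snd i))" "pless D Bot (fst i)" "pless D Bot (fst (snd i))"
        using i by (auto simp: idx_def pless_Bot dest: pless_P pless_not_Bot)
      show "dcoef (pb i \<rhd> ?u) Bot (fst q) 1 * (N.Mt (fst q) j (snd q) * N.co q n) =
          (if fst i = fst q \<and> fst (snd i) = ?x then N.Mt (fst q) j (snd q) * (N.co q n * pb i (fst q) ?x) else 0)"
      proof (cases "fst q = Bot")
        case True
        then show ?thesis
          using i' dcoef_not_pless[OF dualJ_lact[OF W0_dual[OF W] J_Lam[OF idx_J[OF i]]], of Bot Bot 1]
          by (auto simp: pless_def)
      next
        case False
        then have "pless D Bot (fst q)" using N.K_P[OF q] by (simp add: pless_Bot)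
        from dcoef_lact_basis[OF W0_dual[OF W] i this, of 1]
        show ?thesis using dcoef_u_hat[OF x i'(3)] by (auto simp: ac_simps)
      qed
    qed
    then have "(\<Sum>i\<in>I1. N.co (Bot, j) (actN (f1 (w1 D (\<gamma>\<^sub>D i)) ?b) (w12 D (pb i \<rhd> ?u)))) =
        (\<Sum>i\<in>I1. \<Sum>q\<in>N.K. if fst i = fst q \<and> fst (snd i) = ?x
          then N.Mt (fst q) j (snd q) * (N.co q (f1 (w1 D (\<gamma>\<^sub>D i)) ?b) * pb i (fst q) ?x) else 0)"
      by (intro sum.cong HOL.refl) blast
    also have "\<dots> = (\<Sum>q\<in>N.K. \<Sum>i\<in>I1. if fst i = fst q \<and> fst (snd i) = ?x
          then N.Mt (fst q) j (snd q) * (N.co q (f1 (w1 D (\<gamma>\<^sub>D i)) ?b) * pb i (fst q) ?x) else 0)"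
      by (rule sum.swap)
    also have "\<dots> = (\<Sum>q\<in>N.K. if fst q \<noteq> Bot \<and> fst q \<noteq> ?x then N.Mt (fst q) j (snd q) * mor_mat f0 f1 q p else 0)"
    proof (intro sum.cong HOL.refl)
      fix q assume q: "q \<in> N.K"
      show "(\<Sum>i\<in>I1. if fst i = fst q \<and> fst (snd i) = ?x
          then N.Mt (fst q) j (snd q) * (N.co q (f1 (w1 D (\<gamma>\<^sub>D i)) ?b) * pb i (fst q) ?x) else 0) =
        (if fst q \<noteq> Bot \<and> fst q \<noteq> ?x then N.Mt (fst q) j (snd q) * mor_mat f0 f1 q p else 0)"
      proof (cases "fst q \<noteq> Bot \<and> fst q \<noteq> ?x")
        case True
        then show ?thesis unfolding mor_mat_def by (auto simp: sum_distrib_left intro!: sum.cong)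
      next
        case False
        then have "\<not> (fst i = fst q \<and> fst (snd i) = ?x)" if "i \<in> I1" for i
          using that by (auto simp: idx_def pless_def)
        then show ?thesis unfolding if_not_P[OF False] by (intro sum.neutral ballI if_not_P)
      qed
    qed
    finally show ?thesis .
  qed
  \<comment> \<open>The diagonal block at x comes from f^0 and the remaining ones from f^1; together
    they exhaust the rows above 0.\<close>
  moreover have "(\<Sum>q\<in>N.K. if fst q = ?x then N.Mt ?x j (snd q) * mor_mat f0 f1 q p else 0) +
      (\<Sum>q\<in>N.K. if fst q \<noteq> Bot \<and> fst q \<noteq> ?x then N.Mt (fst q) j (snd q) * mor_mat f0 f1 q p else 0) =
      (\<Sum>q\<in>N.K. if fst q \<noteq> Bot then N.Mt (fst q) j (snd q) * mor_mat f0 f1 q p else 0)"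
    unfolding sum.distrib[symmetric] using p(2) by (intro sum.cong) auto
  ultimately show "(\<Sum>r\<in>M.K. if fst r = Bot then mor_mat f0 f1 (Bot, j) r * M.Mt ?x (snd r) (snd p) else 0) =
     (\<Sum>q\<in>N.K. if fst q \<noteq> Bot then N.Mt (fst q) j (snd q) * mor_mat f0 f1 q p else 0)"
    by (simp add: algebra_simps)
qed

definition mat0 :: "('a pt \<times> nat \<Rightarrow> 'a pt \<times> nat \<Rightarrow> 'g) \<Rightarrow> 'm \<Rightarrow> 'n" where
  "mat0 X m = N.mk (\<lambda>q. \<Sum>p\<in>M.K. if fst p = fst q then X q p * M.co p m else 0)"

definition mat1 :: "('a pt \<times> nat \<Rightarrow> 'a pt \<times> nat \<Rightarrow> 'g) \<Rightarrow> ('a, 'g) J_dual \<Rightarrow> 'm \<Rightarrow> 'n" where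
  "mat1 X \<delta> m = N.mk (\<lambda>q. \<Sum>p\<in>M.K. dcoef \<delta> (fst q) (fst p) (X q p * M.co p m))"

context
  fixes X assumes X: "tri X"
begin

lemma tri_Q: "q \<in> N.K \<Longrightarrow> p \<in> M.K \<Longrightarrow> c \<in> Q (fst p) (fst p) \<Longrightarrow> X q p * c \<in> Q (fst q) (fst p)"
proof (cases "adm (fst q) (fst p)")
  case True
  assume *: "q \<in> N.K" "p \<in> M.K" "c \<in> Q (fst p) (fst p)"
  then have "X q p \<in> Q (fst q) (fst p)" using X by (simp add: tri_def)
  moreover have "ple D (fst q) (fst p)" using True M.K_P[OF *(2)] by (auto simp: adm_def pless_def)
  ultimately show ?thesis using * M.K_P[OF *(2)] by (intro Q_mult[of "fst q" "fst p" "fst p"]) auto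
next
  case False
  assume *: "q \<in> N.K" "p \<in> M.K"
  then have "X q p = 0" using X False unfolding tri_def by blast
  then show ?thesis by simp
qed

lemma co_mat0: "q \<in> N.K \<Longrightarrow> N.co q (mat0 X m) = (\<Sum>p\<in>M.K. if fst p = fst q then X q p * M.co p m else 0)"
  unfolding mat0_def
proof (rule N.co_mk)
  fix q assume q: "q \<in> N.K"
  show "(\<Sum>p\<in>M.K. if fst p = fst q then X q p * M.co p m else 0) \<in> Q (fst q) (fst q)"
  proof (rule Q_sum)
    fix p assume "p \<in> M.K"
    then show "(if fst p = fst q then X q p * M.co p m else 0) \<in> Q (fst q) (fst q)"
      using tri_Q[OF q _ M.co_Q, of p m] by (cases "fst p = fst q") simp_all
  qed
qed

lemma co_mat1:
  "\<delta> \<in> dJ \<Longrightarrow> q \<in> N.K \<Longrightarrow> N.co q (mat1 X \<delta> m) = (\<Sum>p\<in>M.K. dcoef \<delta> (fst q) (fst p) (X q p * M.co p m))"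
  unfolding mat1_def by (rule N.co_mk) (auto intro!: Q_sum dcoef_Q dest: N.K_P)

lemma mat0_add: "mat0 X (m + m') = mat0 X m + mat0 X m'"
  by (rule N.co_ext)
     (auto simp: co_mat0 N.co_add M.co_add algebra_simps simp flip: sum.distrib intro!: sum.cong)

lemma mat0_inR: "r \<in> carrier (Re D) \<Longrightarrow> mat0 X (actM m (inR D r)) = actN (mat0 X m) (inR D r)"
  by (rule N.co_ext)
     (auto simp: co_mat0 N.co_inR M.co_inR sum_distrib_right mult.assoc intro!: sum.cong)

lemma mat1_bimod: "bimod_hom D actM actN (mat1 X)"
  unfolding bimod_hom_def
proof (intro conjI ballI allI impI)
  fix \<delta> m m' assume \<delta>: "\<delta> \<in> W1 D"
  note d = W1_dual[OF \<delta>]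
  show "mat1 X \<delta> (m + m') = mat1 X \<delta> m + mat1 X \<delta> m'"
  proof (rule N.co_ext)
    fix q assume q: "q \<in> N.K"
    show "N.co q (mat1 X \<delta> (m + m')) = N.co q (mat1 X \<delta> m + mat1 X \<delta> m')"
      unfolding N.co_add[OF q] co_mat1[OF d q] sum.distrib[symmetric]
      by (intro sum.cong HOL.refl) (simp add: M.co_add ring_distribs dcoef_add[OF d] tri_Q[OF q] M.co_Q)
  qed
next
  fix \<delta> \<delta>' m assume *: "\<delta> \<in> W1 D" "\<delta>' \<in> W1 D"
  show "mat1 X (\<delta> + \<delta>') m = mat1 X \<delta> m + mat1 X \<delta>' m"
  proof (rule N.co_ext)
    fix q assume q: "q \<in> N.K"
    show "N.co q (mat1 X (\<delta> + \<delta>') m) = N.co q (mat1 X \<delta> m + mat1 X \<delta>' m)"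
      unfolding N.co_add[OF q] co_mat1[OF W1_dual[OF *(1)] q] co_mat1[OF W1_dual[OF *(2)] q]
        co_mat1[OF dualJ_add[OF W1_dual[OF *(1)] W1_dual[OF *(2)]] q] by (simp add: sum.distrib)
  qed
next
  fix \<delta> a b m assume \<delta>: "\<delta> \<in> W1 D" and r: "(a, b) \<in> carrier (Re D)"
  note d = W1_dual[OF \<delta>]
  have S: "a \<in> S" using Re_S[OF r] by simp
  show "mat1 X (a \<rhd> \<delta>) m = mat1 X \<delta> (actM m (inR D (a, b)))"
  proof (rule N.co_ext)
    fix q assume q: "q \<in> N.K"
    show "N.co q (mat1 X (a \<rhd> \<delta>) m) = N.co q (mat1 X \<delta> (actM m (inR D (a, b))))"
      unfolding co_mat1[OF d q] co_mat1[OF dualJ_lact[OF d S_Lam[OF S]] q]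
    proof (intro sum.cong HOL.refl)
      fix p assume p: "p \<in> M.K"
      show "dcoef (a \<rhd> \<delta>) (fst q) (fst p) (X q p * M.co p m) =
          dcoef \<delta> (fst q) (fst p) (X q p * M.co p (actM m (inR D (a, b))))"
      \<comment> \<open>At p in component 0 nothing lies strictly below, so both sides vanish;
        elsewhere \<open>entry\<close> reads the first factor a, through which W_1 is acted
        upon.\<close>
      proof (cases "fst p = Bot")
        case True
        then have "\<not> pless D (fst q) (fst p)" using pless_not_Bot by auto
        then show ?thesis using dcoef_not_pless d dualJ_lact[OF d S_Lam[OF S]] by simp
      next
        case False
        then show ?thesis using dcoef_lact_S[OF d S tri_Q[OF q p M.co_Q[OF p]]]
          by (simp add: M.co_inR[OF p r] entry_def mult.assoc)
      qed
    qed
  qed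
  show "mat1 X (\<delta> \<lhd> a) m = actN (mat1 X \<delta> m) (inR D (a, b))"
  proof (rule N.co_ext)
    fix q assume q: "q \<in> N.K"
    show "N.co q (mat1 X (\<delta> \<lhd> a) m) = N.co q (actN (mat1 X \<delta> m) (inR D (a, b)))"
      unfolding N.co_inR[OF q r] co_mat1[OF d q] co_mat1[OF dualJ_ract[OF d S] q] sum_distrib_right
      using dcoef_ract[OF d S] dcoef_W1[OF \<delta>] by (intro sum.cong HOL.refl) (auto simp: entry_def)
  qed
qed

text \<open>In row 0 every term carries a factor \<gamma>(e_{0,x}) and a coordinate of m. Up to
  these weights, the three terms are the diagonal part, the left-hand side and the off-diagonal part
  of the identity \<open>intertwines\<close>. In all other rows everything vanishes.\<close>

lemma mat_W0:
  assumes C: "intertwines X" and \<gamma>: "\<gamma> \<in> W0 D"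
  shows "actN (mat0 X m) (w12 D \<gamma>) =
    mat0 X (actM m (w12 D \<gamma>)) - (\<Sum>i\<in>I1. actN (mat1 X (\<gamma>\<^sub>D i) m) (w12 D (pb i \<rhd> \<gamma>)))"
proof (rule N.co_ext)
  fix q assume q: "q \<in> N.K"
  note p\<gamma> = W0_closed(3)[OF \<gamma> J_Lam[OF idx_J]]
  show "N.co q (actN (mat0 X m) (w12 D \<gamma>)) =
    N.co q (mat0 X (actM m (w12 D \<gamma>)) - (\<Sum>i\<in>I1. actN (mat1 X (\<gamma>\<^sub>D i) m) (w12 D (pb i \<rhd> \<gamma>))))"
  proof (cases "fst q = Bot")
    case False
    have "N.co q (mat0 X (actM m (w12 D \<gamma>))) = 0"
      unfolding co_mat0[OF q] using M.co_w12_other[OF \<gamma>] False by (intro sum.neutral) auto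
    moreover have "N.co q (actN n (w12 D (pb i \<rhd> \<gamma>))) = 0" if "i \<in> I1" for i n
      using N.co_w12_other[OF p\<gamma>[OF that] q False] .
    ultimately show ?thesis
      by (simp add: N.co_diff[OF q] N.co_sum[OF q] N.co_w12_other[OF \<gamma> q False])
  next
    case True
    then obtain j where qj: "q = (Bot, j)" by (cases q) auto
    note j = q[unfolded qj]
    let ?g = "\<lambda>x. dcoef \<gamma> Bot x 1"
    have g: "dcoef \<gamma> Bot x c = c * ?g x" for x c by (rule dcoef_Bot[OF W0_dual[OF \<gamma>]])
    have g0: "?g Bot = 0" by (rule dcoef_not_pless[OF W0_dual[OF \<gamma>]]) (simp add: pless_def)
    have L: "N.co q (actN (mat0 X m) (w12 D \<gamma>)) =
        (\<Sum>p\<in>M.K. \<Sum>r\<in>N.K. if fst r = fst p then ?g (fst p) * (N.Mt (fst r) j (snd r) * X r p * M.co p m) else 0)"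
    proof -
      have "N.co q (actN (mat0 X m) (w12 D \<gamma>)) =
        (\<Sum>r\<in>N.K. \<Sum>p\<in>M.K. if fst r = fst p then ?g (fst p) * (N.Mt (fst r) j (snd r) * X r p * M.co p m) else 0)"
        unfolding qj N.co_w12_Bot[OF \<gamma> j]
        by (intro sum.cong HOL.refl) (auto simp: co_mat0 sum_distrib_left mult.assoc intro!: sum.cong)
      then show ?thesis by (subst sum.swap)
    qed
    have R1: "N.co q (mat0 X (actM m (w12 D \<gamma>))) =
        (\<Sum>p\<in>M.K. ?g (fst p) * ((\<Sum>r\<in>M.K. if fst r = Bot then X q r * M.Mt (fst p) (snd r) (snd p) else 0) * M.co p m))"
    proof -
      have "N.co q (mat0 X (actM m (w12 D \<gamma>))) = (\<Sum>r\<in>M.K. \<Sum>p\<in>M.K.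
          ?g (fst p) * ((if fst r = Bot then X q r * M.Mt (fst p) (snd r) (snd p) else 0) * M.co p m))"
        unfolding co_mat0[OF q]
      proof (intro sum.cong HOL.refl)
        fix r assume r: "r \<in> M.K"
        show "(if fst r = fst q then X q r * M.co r (actM m (w12 D \<gamma>)) else 0) = (\<Sum>p\<in>M.K.
            ?g (fst p) * ((if fst r = Bot then X q r * M.Mt (fst p) (snd r) (snd p) else 0) * M.co p m))"
        proof (cases "fst r = Bot")
          case rB: True
          then have "r = (Bot, snd r)" by (cases r) simp
          then show ?thesis using rB True r M.co_w12_Bot[OF \<gamma>, of "snd r" m]
            by (simp add: sum_distrib_left ac_simps)
        qed (use True in simp)
      qed
      then show ?thesis by (subst (asm) sum.swap) (simp add: sum_distrib_left sum_distrib_right)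
    qed
    \<comment> \<open>Bringing the sum over i to the innermost position makes
      \<open>dual_basis_dcoef\<close> applicable, which eliminates the dual basis.\<close>
    have R2: "N.co q (\<Sum>i\<in>I1. actN (mat1 X (\<gamma>\<^sub>D i) m) (w12 D (pb i \<rhd> \<gamma>))) =
        (\<Sum>p\<in>M.K. \<Sum>r\<in>N.K. if fst r \<noteq> Bot \<and> fst r \<noteq> fst p
           then ?g (fst p) * (N.Mt (fst r) j (snd r) * X r p * M.co p m) else 0)"
    proof -
      have "N.co q (\<Sum>i\<in>I1. actN (mat1 X (\<gamma>\<^sub>D i) m) (w12 D (pb i \<rhd> \<gamma>))) =
          (\<Sum>i\<in>I1. \<Sum>r\<in>N.K. \<Sum>p\<in>M.K. dcoef (pb i \<rhd> \<gamma>) Bot (fst r)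
             (N.Mt (fst r) j (snd r) * dcoef (\<gamma>\<^sub>D i) (fst r) (fst p) (X r p * M.co p m)))"
        unfolding N.co_sum[OF q]
      proof (intro sum.cong HOL.refl)
        fix i assume i: "i \<in> I1"
        note pd = W0_dual[OF p\<gamma>[OF i]]
        have "N.co q (actN (mat1 X (\<gamma>\<^sub>D i) m) (w12 D (pb i \<rhd> \<gamma>))) =
            (\<Sum>r\<in>N.K. dcoef (pb i \<rhd> \<gamma>) Bot (fst r) 1 * (N.Mt (fst r) j (snd r) *
              (\<Sum>p\<in>M.K. dcoef (\<gamma>\<^sub>D i) (fst r) (fst p) (X r p * M.co p m))))"
          unfolding qj N.co_w12_Bot[OF p\<gamma>[OF i] j]
          by (intro sum.cong HOL.refl) (simp add: co_mat1[OF idx_dual[OF i]])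
        also have "\<dots> = (\<Sum>r\<in>N.K. \<Sum>p\<in>M.K. dcoef (pb i \<rhd> \<gamma>) Bot (fst r)
             (N.Mt (fst r) j (snd r) * dcoef (\<gamma>\<^sub>D i) (fst r) (fst p) (X r p * M.co p m)))"
          unfolding sum_distrib_left
          by (intro sum.cong HOL.refl, subst (2) dcoef_Bot[OF pd]) (simp add: ac_simps)
        finally show "N.co q (actN (mat1 X (\<gamma>\<^sub>D i) m) (w12 D (pb i \<rhd> \<gamma>))) = \<dots>" .
      qed
      also have "\<dots> = (\<Sum>r\<in>N.K. \<Sum>i\<in>I1. \<Sum>p\<in>M.K. dcoef (pb i \<rhd> \<gamma>) Bot (fst r)
             (N.Mt (fst r) j (snd r) * dcoef (\<gamma>\<^sub>D i) (fst r) (fst p) (X r p * M.co p m)))"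
        by (rule sum.swap)
      also have "\<dots> = (\<Sum>r\<in>N.K. \<Sum>p\<in>M.K. \<Sum>i\<in>I1. dcoef (pb i \<rhd> \<gamma>) Bot (fst r)
             (N.Mt (fst r) j (snd r) * dcoef (\<gamma>\<^sub>D i) (fst r) (fst p) (X r p * M.co p m)))"
        by (intro sum.cong HOL.refl, rule sum.swap)
      also have "\<dots> = (\<Sum>r\<in>N.K. \<Sum>p\<in>M.K. if fst r \<noteq> Bot \<and> fst r \<noteq> fst p
           then ?g (fst p) * (N.Mt (fst r) j (snd r) * X r p * M.co p m) else 0)"
      proof (intro sum.cong HOL.refl)
        fix r p assume r: "r \<in> N.K" and p: "p \<in> M.K"
        have c: "X r p * M.co p m \<in> Q (fst r) (fst p)" using tri_Q[OF r p M.co_Q[OF p]] .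
        show "(\<Sum>i\<in>I1. dcoef (pb i \<rhd> \<gamma>) Bot (fst r)
             (N.Mt (fst r) j (snd r) * dcoef (\<gamma>\<^sub>D i) (fst r) (fst p) (X r p * M.co p m))) =
          (if fst r \<noteq> Bot \<and> fst r \<noteq> fst p
           then ?g (fst p) * (N.Mt (fst r) j (snd r) * X r p * M.co p m) else 0)"
        proof (cases "fst r \<noteq> Bot \<and> pless D (fst r) (fst p)")
          case True
          then have "pless D Bot (fst r)" "fst r \<noteq> fst p" using N.K_P[OF r] by (auto simp: pless_Bot pless_def)
          moreover have "dcoef \<gamma> Bot (fst p) (N.Mt (fst r) j (snd r) * (X r p * M.co p m)) =
              ?g (fst p) * (N.Mt (fst r) j (snd r) * X r p * M.co p m)"
            by (subst g) (simp only: ac_simps)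
          ultimately show ?thesis
            using True dual_basis_dcoef[OF W0_dual[OF \<gamma>] \<open>pless D Bot (fst r)\<close> _ _ c, of "N.Mt (fst r) j (snd r)"]
            by simp
        next
          case False
          have "dcoef (pb i \<rhd> \<gamma>) Bot (fst r)
             (N.Mt (fst r) j (snd r) * dcoef (\<gamma>\<^sub>D i) (fst r) (fst p) (X r p * M.co p m)) = 0" if i: "i \<in> I1" for i
          proof (cases "fst r = Bot")
            case True
            then show ?thesis using dcoef_not_pless[OF W0_dual[OF p\<gamma>[OF i]], of Bot Bot] by (simp add: pless_def)
          next
            case rB: False
            then have "dcoef (\<gamma>\<^sub>D i) (fst r) (fst p) (X r p * M.co p m) = 0"
              using False by (intro dcoef_not_pless[OF idx_dual[OF i]]) simp
            then show ?thesis using W0_dual[OF p\<gamma>[OF i]] by simp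
          qed
          moreover have "X r p = 0" if "fst r \<noteq> Bot" "fst r \<noteq> fst p"
            using X r p that False by (auto simp: tri_def adm_def)
          ultimately show ?thesis by auto
        qed
      qed
      finally show ?thesis by (subst sum.swap)
    qed
    have "N.co q (mat0 X (actM m (w12 D \<gamma>))) =
        (\<Sum>p\<in>M.K. \<Sum>r\<in>N.K. if fst r \<noteq> Bot then ?g (fst p) * (N.Mt (fst r) j (snd r) * X r p * M.co p m) else 0)"
      unfolding R1
    proof (intro sum.cong HOL.refl)
      fix p assume p: "p \<in> M.K"
      show "?g (fst p) * ((\<Sum>r\<in>M.K. if fst r = Bot then X q r * M.Mt (fst p) (snd r) (snd p) else 0) * M.co p m) =
          (\<Sum>r\<in>N.K. if fst r \<noteq> Bot then ?g (fst p) * (N.Mt (fst r) j (snd r) * X r p * M.co p m) else 0)"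
      proof (cases "fst p = Bot")
        case True
        then show ?thesis using g0 by (simp cong: if_cong)
      next
        case False
        show ?thesis
          unfolding C[unfolded intertwines_def, rule_format, OF j p False, folded qj] sum_distrib_left sum_distrib_right
          by (intro sum.cong HOL.refl) (simp add: ac_simps)
      qed
    qed
    also have "\<dots> = N.co q (actN (mat0 X m) (w12 D \<gamma>)) + N.co q (\<Sum>i\<in>I1. actN (mat1 X (\<gamma>\<^sub>D i) m) (w12 D (pb i \<rhd> \<gamma>)))"
      unfolding L R2 sum.distrib[symmetric] using g0 by (intro sum.cong HOL.refl) auto
    finally show ?thesis unfolding N.co_diff[OF q] by simp
  qed
qed

lemma mat_morphism: "intertwines X \<Longrightarrow> is_morphism D B actM actN (mat0 X, generated_mor (mat1 X))"
  by (rule generated_morphism[OF mat1_bimod mat0_add mat0_inR mat_W0])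

lemma mat_mor_w1: "intertwines X \<Longrightarrow> \<delta> \<in> W1 D \<Longrightarrow> generated_mor (mat1 X) (w1 D \<delta>) m = mat1 X \<delta> m"
  by (rule generated_mor_w1[OF mat1_bimod mat0_add mat0_inR mat_W0])

end

end

section \<open>Composites of morphisms and products of matrices\<close>

locale eq_based_iso = MN: eq_based_pair D B actM actN bM bN + NM: eq_based_pair D B actN actM bN bM
  for D :: "('a, 'f::field, 'g::field) eq_data" and B
    and actM :: "('m::ab_group_add, 'a, 'g) action" and actN :: "('n::ab_group_add, 'a, 'g) action"
    and bM bN
begin

context
  fixes X Y
  assumes X: "MN.tri X" and Y: "NM.tri Y"
begin

lemma tri_product:
  assumes "q \<in> MN.M.K" "r \<in> MN.N.K" "p \<in> MN.M.K" "Y q r * X r p \<noteq> 0"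
  shows "MN.adm (fst q) (fst r)" "MN.adm (fst r) (fst p)"
proof -
  have "Y q r \<noteq> 0" "X r p \<noteq> 0" using assms(4) by auto
  then show "MN.adm (fst q) (fst r)" "MN.adm (fst r) (fst p)"
    using X Y assms unfolding MN.tri_def NM.tri_def by blast+
qed

lemma adm_antisym: "MN.adm x y \<Longrightarrow> MN.adm y x \<Longrightarrow> x = y"
  using MN.pless_asym by (auto simp: MN.adm_def)

context
  assumes CX: "MN.intertwines X" and CY: "NM.intertwines Y"
    and inv: "\<And>q p. q \<in> MN.M.K \<Longrightarrow> p \<in> MN.M.K \<Longrightarrow> (\<Sum>r\<in>MN.N.K. Y q r * X r p) = (if q = p then 1 else 0)"
begin

text \<open>Within a diagonal block of YX only r from the same block contributes: a nonzero product
  through another block would make the two blocks admissible in both directions.\<close>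

lemma mat0_inverse: "NM.mat0 Y (MN.mat0 X m) = m"
proof (rule MN.M.co_ext)
  fix q assume q: "q \<in> MN.M.K"
  have "MN.M.co q (NM.mat0 Y (MN.mat0 X m)) =
      (\<Sum>r\<in>MN.N.K. \<Sum>p\<in>MN.M.K. if fst p = fst q then Y q r * X r p * MN.M.co p m else 0)"
    unfolding NM.co_mat0[OF Y q]
  proof (intro sum.cong HOL.refl)
    fix r assume r: "r \<in> MN.N.K"
    have "Y q r * X r p = 0" if "fst r \<noteq> fst q" "p \<in> MN.M.K" "fst p = fst q" for p
      using tri_product[OF q r that(2)] that adm_antisym[of "fst q" "fst r"] by auto
    then show "(if fst r = fst q then Y q r * MN.N.co r (MN.mat0 X m) else 0) =
        (\<Sum>p\<in>MN.M.K. if fst p = fst q then Y q r * X r p * MN.M.co p m else 0)"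
      by (auto simp: MN.co_mat0[OF X r] sum_distrib_left mult.assoc intro!: sum.cong sum.neutral)
  qed
  also have "\<dots> = (\<Sum>p\<in>MN.M.K. \<Sum>r\<in>MN.N.K. if fst p = fst q then Y q r * X r p * MN.M.co p m else 0)"
    by (rule sum.swap)
  also have "\<dots> = (\<Sum>p\<in>MN.M.K. if p = q then MN.M.co p m else 0)"
  proof (intro sum.cong HOL.refl)
    fix p assume p: "p \<in> MN.M.K"
    have "(\<Sum>r\<in>MN.N.K. Y q r * X r p * MN.M.co p m) = (if q = p then 1 else 0) * MN.M.co p m"
      unfolding sum_distrib_right[symmetric] inv[OF q p] ..
    then show "(\<Sum>r\<in>MN.N.K. if fst p = fst q then Y q r * X r p * MN.M.co p m else 0) =
        (if p = q then MN.M.co p m else 0)" by (cases "fst p = fst q") auto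
  qed
  finally show "MN.M.co q (NM.mat0 Y (MN.mat0 X m)) = MN.M.co q m" using q by simp
qed

text \<open>The three terms of the composite contribute the products \<open>Y\<^bsub>z,y\<^esub>X\<^bsub>y,x\<^esub>\<close> with \<open>y = x\<close>, \<open>y = z\<close>
  and \<open>z < y < x\<close>, so that they add up to the \<open>(z, x)\<close>-block of \<open>YX\<close>.\<close>

lemma mat1_inverse:
  assumes \<delta>: "\<delta> \<in> W1 D"
  shows "NM.mat1 Y \<delta> (MN.mat0 X m) + NM.mat0 Y (MN.mat1 X \<delta> m) +
    (\<Sum>i\<in>MN.I1. NM.mat1 Y (dual_lact D (snd (snd i)) \<delta>) (MN.mat1 X (dual_elem D B i) m)) = 0"
proof (rule MN.M.co_ext)
  fix q assume q: "q \<in> MN.M.K"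
  note d = MN.W1_dual[OF \<delta>]
  note d' = MN.dualJ_lact[OF d MN.J_Lam[OF MN.idx_J]]
  let ?t = "\<lambda>r p. Y q r * (X r p * MN.M.co p m)"
  have XQ: "X r p * MN.M.co p m \<in> Qsys D (fst r) (fst p)" if "r \<in> MN.N.K" "p \<in> MN.M.K" for r p
    using MN.tri_Q[OF X that MN.M.co_Q[OF that(2)]] .
  have tQ: "?t r p \<in> Qsys D (fst q) (fst p)" if "r \<in> MN.N.K" "p \<in> MN.M.K" for r p
  proof (cases "Y q r * X r p = 0")
    case True
    then show ?thesis by auto
  next
    case False
    have le: "ple D (fst q) (fst r)" "ple D (fst r) (fst p)"
      using tri_product[OF q that False] MN.N.K_P[OF that(1)] MN.M.K_P[OF that(2)]
      by (auto simp: MN.adm_def pless_def)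
    have "Y q r \<in> Qsys D (fst q) (fst r)" using Y q that unfolding NM.tri_def by blast
    from MN.Q_mult[OF le this XQ[OF that]] show ?thesis .
  qed
  have 1: "MN.M.co q (NM.mat1 Y \<delta> (MN.mat0 X m)) =
      (\<Sum>r\<in>MN.N.K. \<Sum>p\<in>MN.M.K. if fst p = fst r then dcoef \<delta> (fst q) (fst p) (?t r p) else 0)"
    unfolding NM.co_mat1[OF Y d q]
  proof (intro sum.cong HOL.refl)
    fix r assume r: "r \<in> MN.N.K"
    have "dcoef \<delta> (fst q) (fst r) (Y q r * MN.N.co r (MN.mat0 X m)) =
        dcoef \<delta> (fst q) (fst r) (\<Sum>p\<in>MN.M.K. if fst p = fst r then ?t r p else 0)"
      unfolding MN.co_mat0[OF X r] sum_distrib_left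
      by (intro arg_cong[of _ _ "dcoef \<delta> (fst q) (fst r)"] sum.cong) auto
    also have "\<dots> = (\<Sum>p\<in>MN.M.K. dcoef \<delta> (fst q) (fst r) (if fst p = fst r then ?t r p else 0))"
    proof (rule MN.dcoef_sum[OF d])
      fix p assume p: "p \<in> MN.M.K"
      show "(if fst p = fst r then ?t r p else 0) \<in> Qsys D (fst q) (fst r)"
        using tQ[OF r p] by (cases "fst p = fst r") simp_all
    qed
    also have "\<dots> = (\<Sum>p\<in>MN.M.K. if fst p = fst r then dcoef \<delta> (fst q) (fst p) (?t r p) else 0)"
      using d by (intro sum.cong) auto
    finally show "dcoef \<delta> (fst q) (fst r) (Y q r * MN.N.co r (MN.mat0 X m)) = \<dots>" .
  qed
  have 2: "MN.M.co q (NM.mat0 Y (MN.mat1 X \<delta> m)) =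
      (\<Sum>r\<in>MN.N.K. \<Sum>p\<in>MN.M.K. if fst r = fst q then dcoef \<delta> (fst q) (fst p) (?t r p) else 0)"
    unfolding NM.co_mat0[OF Y q]
  proof (intro sum.cong HOL.refl)
    fix r assume r: "r \<in> MN.N.K"
    show "(if fst r = fst q then Y q r * MN.N.co r (MN.mat1 X \<delta> m) else 0) =
        (\<Sum>p\<in>MN.M.K. if fst r = fst q then dcoef \<delta> (fst q) (fst p) (?t r p) else 0)"
    proof (cases "fst r = fst q")
      case True
      have "Y q r \<in> Qsys D (fst q) (fst q)" using Y q r True unfolding NM.tri_def by force
      then show ?thesis using True XQ[OF r]
        by (simp add: MN.co_mat1[OF X d r] sum_distrib_left MN.dcoef_mult[OF d])
    qed simp
  qed
  have 3: "MN.M.co q (\<Sum>i\<in>MN.I1. NM.mat1 Y (dual_lact D (snd (snd i)) \<delta>) (MN.mat1 X (dual_elem D B i) m)) =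
      (\<Sum>r\<in>MN.N.K. \<Sum>p\<in>MN.M.K. if pless D (fst q) (fst r) \<and> pless D (fst r) (fst p)
        then dcoef \<delta> (fst q) (fst p) (?t r p) else 0)"
  proof -
    let ?s = "\<lambda>i r p. dcoef (dual_lact D (snd (snd i)) \<delta>) (fst q) (fst r)
        (Y q r * dcoef (dual_elem D B i) (fst r) (fst p) (X r p * MN.M.co p m))"
    have "MN.M.co q (\<Sum>i\<in>MN.I1. NM.mat1 Y (dual_lact D (snd (snd i)) \<delta>) (MN.mat1 X (dual_elem D B i) m)) =
        (\<Sum>i\<in>MN.I1. \<Sum>r\<in>MN.N.K. \<Sum>p\<in>MN.M.K. ?s i r p)"
      unfolding MN.M.co_sum[OF q]
    proof (intro sum.cong HOL.refl)
      fix i assume i: "i \<in> MN.I1"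
      show "MN.M.co q (NM.mat1 Y (dual_lact D (snd (snd i)) \<delta>) (MN.mat1 X (dual_elem D B i) m)) =
          (\<Sum>r\<in>MN.N.K. \<Sum>p\<in>MN.M.K. ?s i r p)"
        unfolding NM.co_mat1[OF Y d'[OF i] q]
      proof (intro sum.cong HOL.refl)
        fix r assume r: "r \<in> MN.N.K"
        show "dcoef (dual_lact D (snd (snd i)) \<delta>) (fst q) (fst r)
            (Y q r * MN.N.co r (MN.mat1 X (dual_elem D B i) m)) = (\<Sum>p\<in>MN.M.K. ?s i r p)"
          unfolding MN.co_mat1[OF X MN.idx_dual[OF i] r] sum_distrib_left
          by (rule MN.dcoef_sum[OF d'[OF i]])
             (rule NM.tri_Q[OF Y q r MN.dcoef_Q[OF MN.idx_dual[OF i] MN.N.K_P[OF r]]])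
      qed
    qed
    also have "\<dots> = (\<Sum>r\<in>MN.N.K. \<Sum>i\<in>MN.I1. \<Sum>p\<in>MN.M.K. ?s i r p)"
      by (rule sum.swap)
    also have "\<dots> = (\<Sum>r\<in>MN.N.K. \<Sum>p\<in>MN.M.K. \<Sum>i\<in>MN.I1. ?s i r p)"
      by (intro sum.cong HOL.refl, rule sum.swap)
    also have "\<dots> = (\<Sum>r\<in>MN.N.K. \<Sum>p\<in>MN.M.K. if pless D (fst q) (fst r) \<and> pless D (fst r) (fst p)
        then dcoef \<delta> (fst q) (fst p) (?t r p) else 0)"
    proof (intro sum.cong HOL.refl)
      fix r p assume r: "r \<in> MN.N.K" and p: "p \<in> MN.M.K"
      show "(\<Sum>i\<in>MN.I1. ?s i r p) = (if pless D (fst q) (fst r) \<and> pless D (fst r) (fst p)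
        then dcoef \<delta> (fst q) (fst p) (?t r p) else 0)"
      proof (cases "pless D (fst q) (fst r) \<and> pless D (fst r) (fst p)")
        case True
        have "Y q r \<in> Qsys D (fst q) (fst r)" using Y q r unfolding NM.tri_def by blast
        from MN.dual_basis_dcoef[OF d _ _ this XQ[OF r p]] show ?thesis using True by simp
      next
        case False
        have "?s i r p = 0" if i: "i \<in> MN.I1" for i
        proof (cases "pless D (fst q) (fst r)")
          case True
          then have "dcoef (dual_elem D B i) (fst r) (fst p) (X r p * MN.M.co p m) = 0"
            using False by (intro MN.dcoef_not_pless[OF MN.idx_dual[OF i]]) simp
          then show ?thesis using d'[OF i] by simp
        qed (rule MN.dcoef_not_pless[OF d'[OF i]])
        then show ?thesis using False by (simp only: if_False sum.neutral_const cong: sum.cong)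
      qed
    qed
    finally show ?thesis .
  qed
  have "MN.M.co q (NM.mat1 Y \<delta> (MN.mat0 X m) + NM.mat0 Y (MN.mat1 X \<delta> m) +
    (\<Sum>i\<in>MN.I1. NM.mat1 Y (dual_lact D (snd (snd i)) \<delta>) (MN.mat1 X (dual_elem D B i) m))) =
      (\<Sum>r\<in>MN.N.K. \<Sum>p\<in>MN.M.K. dcoef \<delta> (fst q) (fst p) (?t r p))"
    unfolding MN.M.co_add[OF q] 1 2 3 sum.distrib[symmetric]
  proof (intro sum.cong HOL.refl)
    fix r p assume r: "r \<in> MN.N.K" and p: "p \<in> MN.M.K"
    let ?d = "dcoef \<delta> (fst q) (fst p) (?t r p)"
    \<comment> \<open>If the product is nonzero, its two factors sit in admissible blocks. When q
      and p belong to different blocks, exactly one of the three conditions then holds; when they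
      belong to the same block, \<delta> has no coordinate there and all terms vanish.\<close>
    show "(if fst p = fst r then ?d else 0) + (if fst r = fst q then ?d else 0) +
        (if pless D (fst q) (fst r) \<and> pless D (fst r) (fst p) then ?d else 0) = ?d"
    proof (cases "Y q r * X r p = 0")
      case True
      then have t: "?t r p = 0" by auto
      have d0: "?d = 0" unfolding t by (rule MN.dcoef_0[OF d])
      show ?thesis unfolding d0 by simp
    next
      case False
      note a = tri_product[OF q r p False]
      show ?thesis
      proof (cases "fst p = fst q")
        case True
        then have d0: "?d = 0" by (intro MN.dcoef_not_pless[OF d]) (simp add: pless_def)
        show ?thesis unfolding d0 by simp
      next
        case False
        then show ?thesis using a by (auto simp: MN.adm_def pless_def)
      qed
    qed
  qed
  also have "\<dots> = (\<Sum>p\<in>MN.M.K. \<Sum>r\<in>MN.N.K. dcoef \<delta> (fst q) (fst p) (?t r p))"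
    by (rule sum.swap)
  \<comment> \<open>Summed over r, the argument of \<delta> comes from an entry of YX = 1. Nonzero
    entries lie in diagonal blocks, where functionals on J have coordinate 0.\<close>
  also have "\<dots> = 0"
  proof (rule sum.neutral, rule ballI)
    fix p assume p: "p \<in> MN.M.K"
    have "(\<Sum>r\<in>MN.N.K. dcoef \<delta> (fst q) (fst p) (?t r p)) = dcoef \<delta> (fst q) (fst p) (\<Sum>r\<in>MN.N.K. ?t r p)"
      by (rule MN.dcoef_sum[OF d tQ[OF _ p], symmetric])
    also have "(\<Sum>r\<in>MN.N.K. ?t r p) = (if q = p then 1 else 0) * MN.M.co p m"
      unfolding inv[OF q p, symmetric] sum_distrib_right by (simp add: mult.assoc)
    also have "dcoef \<delta> (fst q) (fst p) \<dots> = 0"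
      using d by (cases "q = p") (auto intro!: MN.dcoef_not_pless simp: pless_def)
    finally show "(\<Sum>r\<in>MN.N.K. dcoef \<delta> (fst q) (fst p) (?t r p)) = 0" .
  qed
  finally show "MN.M.co q (NM.mat1 Y \<delta> (MN.mat0 X m) + NM.mat0 Y (MN.mat1 X \<delta> m) +
    (\<Sum>i\<in>MN.I1. NM.mat1 Y (dual_lact D (snd (snd i)) \<delta>) (MN.mat1 X (dual_elem D B i) m))) = MN.M.co q 0"
    using q by simp
qed

lemma mat_mor_inverse:
  "comp_mor D B (NM.mat0 Y, NM.generated_mor (NM.mat1 Y)) (MN.mat0 X, MN.generated_mor (MN.mat1 X)) = id_mor"
proof -
  interpret T: eq_triple D B actM actN actM "MN.mat0 X" "MN.generated_mor (MN.mat1 X)"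
      "NM.mat0 Y" "NM.generated_mor (NM.mat1 Y)"
    by (intro eq_triple.intro eq_triple_axioms.intro MN.eq_pair_axioms NM.eq_pair_axioms
        MN.mat_morphism[OF X CX] NM.mat_morphism[OF Y CY])
  have 0: "T.comp1 (w1 D \<delta>) m = 0" if \<delta>: "\<delta> \<in> W1 D" for \<delta> m
  proof -
    have "(\<Sum>i\<in>MN.I1. NM.generated_mor (NM.mat1 Y) (w1 D (dual_lact D (snd (snd i)) \<delta>))
          (MN.generated_mor (MN.mat1 X) (w1 D (dual_elem D B i)) m)) =
        (\<Sum>i\<in>MN.I1. NM.mat1 Y (dual_lact D (snd (snd i)) \<delta>) (MN.mat1 X (dual_elem D B i) m))"
    proof (intro sum.cong HOL.refl)
      fix i assume i: "i \<in> MN.I1"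
      show "NM.generated_mor (NM.mat1 Y) (w1 D (dual_lact D (snd (snd i)) \<delta>))
          (MN.generated_mor (MN.mat1 X) (w1 D (dual_elem D B i)) m) =
        NM.mat1 Y (dual_lact D (snd (snd i)) \<delta>) (MN.mat1 X (dual_elem D B i) m)"
        unfolding MN.mat_mor_w1[OF X CX MN.I1_dual_W1[OF i]]
          NM.mat_mor_w1[OF Y CY MN.W1_closed(3)[OF \<delta> MN.J_Lam[OF MN.idx_J[OF i]]]] ..
    qed
    then show ?thesis
      unfolding T.comp1_w1[OF \<delta>] MN.mat_mor_w1[OF X CX \<delta>] NM.mat_mor_w1[OF Y CY \<delta>]
      using mat1_inverse[OF \<delta>] by simp
  qed
  have c: "T.comp1 v m = 0" if "v \<in> Tdeg D 1" for v m by (rule T.comp1_eq_0[OF 0 that])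
  show ?thesis
    unfolding T.comp_mor_eq id_mor_def by (auto simp: fun_eq_iff mat0_inverse c)
qed

end

text \<open>The identity X_0 M = N X is multiplied by Y_0 on the left and by Y on the right. This
  respects the restriction to row 0 on one side and to the rows above 0 on the other, because
  triangular matrices have no blocks (0, x) or (x, 0) with x > 0.\<close>

lemma inverse_intertwines:
  assumes CX: "MN.intertwines X"
    and YX: "\<And>q p. q \<in> MN.M.K \<Longrightarrow> p \<in> MN.M.K \<Longrightarrow> (\<Sum>r\<in>MN.N.K. Y q r * X r p) = (if q = p then 1 else 0)"
    and XY: "\<And>q p. q \<in> MN.N.K \<Longrightarrow> p \<in> MN.N.K \<Longrightarrow> (\<Sum>r\<in>MN.M.K. X q r * Y r p) = (if q = p then 1 else 0)"
  shows "NM.intertwines Y"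
  unfolding NM.intertwines_def
proof (intro allI impI)
  fix j p assume j: "(Bot, j) \<in> MN.M.K" and p: "p \<in> MN.N.K" "fst p \<noteq> Bot"
  let ?NM = "\<lambda>s q. MN.N.Mt (fst q) (snd s) (snd q)" and ?MM = "\<lambda>s q. MN.M.Mt (fst q) (snd s) (snd q)"
  have bot: "Y (Bot, j) s = 0" if "s \<in> MN.N.K" "fst s \<noteq> Bot" for s
    using Y[unfolded NM.tri_def, rule_format, OF j that(1)] that(2) by (simp add: MN.adm_def)
  have Ybot: "Y r p = 0" if "r \<in> MN.M.K" "fst r = Bot" for r
    using Y p that unfolding NM.tri_def by (force simp: MN.adm_def)
  have Xbot: "X q r = 0" if "q \<in> MN.N.K" "fst q \<noteq> Bot" "r \<in> MN.M.K" "fst r = Bot" for q r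
    using X that unfolding MN.tri_def by (force simp: MN.adm_def dest: MN.pless_not_Bot)
  \<comment> \<open>Insert XY = 1 to the right of the matrices of N.\<close>
  have "(\<Sum>s\<in>MN.N.K. if fst s = Bot then Y (Bot, j) s * ?NM s p else 0) =
      (\<Sum>s\<in>MN.N.K. if fst s = Bot then Y (Bot, j) s * 
        (\<Sum>q\<in>MN.N.K. if fst q \<noteq> Bot then ?NM s q * (\<Sum>r\<in>MN.M.K. X q r * Y r p) else 0) else 0)"
  proof (intro sum.cong HOL.refl)
    fix s assume s: "s \<in> MN.N.K"
    have "(\<Sum>q\<in>MN.N.K. if fst q \<noteq> Bot then ?NM s q * (\<Sum>r\<in>MN.M.K. X q r * Y r p) else 0) =
        (\<Sum>q\<in>MN.N.K. if q = p then ?NM s p else 0)"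
      using p by (intro sum.cong) (auto simp: XY[OF _ p(1)])
    then show "(if fst s = Bot then Y (Bot, j) s * ?NM s p else 0) =
        (if fst s = Bot then Y (Bot, j) s * 
          (\<Sum>q\<in>MN.N.K. if fst q \<noteq> Bot then ?NM s q * (\<Sum>r\<in>MN.M.K. X q r * Y r p) else 0) else 0)"
      using p by simp
  qed
  \<comment> \<open>Replace N X by X_0 M, row r = 0 of Y contributing nothing in column p.\<close>
  also have "\<dots> = (\<Sum>s\<in>MN.N.K. if fst s = Bot then Y (Bot, j) s *
        (\<Sum>r\<in>MN.M.K. if fst r \<noteq> Bot then (\<Sum>r'\<in>MN.M.K. if fst r' = Bot then X s r' * ?MM r' r else 0) * Y r p else 0) else 0)"
  proof (intro sum.cong HOL.refl)
    fix s assume s: "s \<in> MN.N.K"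
    show "(if fst s = Bot then Y (Bot, j) s * 
        (\<Sum>q\<in>MN.N.K. if fst q \<noteq> Bot then ?NM s q * (\<Sum>r\<in>MN.M.K. X q r * Y r p) else 0) else 0) =
      (if fst s = Bot then Y (Bot, j) s *
        (\<Sum>r\<in>MN.M.K. if fst r \<noteq> Bot then (\<Sum>r'\<in>MN.M.K. if fst r' = Bot then X s r' * ?MM r' r else 0) * Y r p else 0) else 0)"
    proof (cases "fst s = Bot")
      case True
      then obtain k where sk: "s = (Bot, k)" by (cases s) auto
      have "(\<Sum>q\<in>MN.N.K. if fst q \<noteq> Bot then ?NM s q * (\<Sum>r\<in>MN.M.K. X q r * Y r p) else 0) =
          (\<Sum>q\<in>MN.N.K. \<Sum>r\<in>MN.M.K. if fst r \<noteq> Bot then (if fst q \<noteq> Bot then ?NM s q * X q r else 0) * Y r p else 0)"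
        using Xbot Ybot by (auto simp: sum_distrib_left mult.assoc intro!: sum.cong sum.neutral)
      also have "\<dots> = (\<Sum>r\<in>MN.M.K. \<Sum>q\<in>MN.N.K. if fst r \<noteq> Bot then (if fst q \<noteq> Bot then ?NM s q * X q r else 0) * Y r p else 0)"
        by (rule sum.swap)
      also have "\<dots> = (\<Sum>r\<in>MN.M.K. if fst r \<noteq> Bot then (\<Sum>r'\<in>MN.M.K. if fst r' = Bot then X s r' * ?MM r' r else 0) * Y r p else 0)"
      proof (intro sum.cong HOL.refl)
        fix r assume r: "r \<in> MN.M.K"
        show "(\<Sum>q\<in>MN.N.K. if fst r \<noteq> Bot then (if fst q \<noteq> Bot then ?NM s q * X q r else 0) * Y r p else 0) =
          (if fst r \<noteq> Bot then (\<Sum>r'\<in>MN.M.K. if fst r' = Bot then X s r' * ?MM r' r else 0) * Y r p else 0)"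
          using CX[unfolded MN.intertwines_def, rule_format, OF s[unfolded sk] r] unfolding sk snd_conv
          by (cases "fst r = Bot") (simp_all flip: sum_distrib_right)
      qed
      finally show ?thesis by simp
    qed simp
  qed
  also have "\<dots> = (\<Sum>s\<in>MN.N.K. \<Sum>r\<in>MN.M.K. if fst r \<noteq> Bot
        then (\<Sum>r'\<in>MN.M.K. if fst r' = Bot then Y (Bot, j) s * X s r' * ?MM r' r else 0) * Y r p else 0)"
  proof (intro sum.cong HOL.refl)
    fix s assume s: "s \<in> MN.N.K"
    show "(if fst s = Bot then Y (Bot, j) s *
        (\<Sum>r\<in>MN.M.K. if fst r \<noteq> Bot then (\<Sum>r'\<in>MN.M.K. if fst r' = Bot then X s r' * ?MM r' r else 0) * Y r p else 0) else 0) =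
      (\<Sum>r\<in>MN.M.K. if fst r \<noteq> Bot
        then (\<Sum>r'\<in>MN.M.K. if fst r' = Bot then Y (Bot, j) s * X s r' * ?MM r' r else 0) * Y r p else 0)"
    proof (cases "fst s = Bot")
      case True
      then show ?thesis
        by (auto simp: sum_distrib_left sum_distrib_right mult.assoc intro!: sum.cong)
    next
      case False
      then show ?thesis using bot[OF s] by (simp cong: if_cong)
    qed
  qed
  also have "\<dots> = (\<Sum>r\<in>MN.M.K. if fst r \<noteq> Bot
        then (\<Sum>r'\<in>MN.M.K. if fst r' = Bot then (\<Sum>s\<in>MN.N.K. Y (Bot, j) s * X s r') * ?MM r' r else 0) * Y r p else 0)"
  proof (subst sum.swap, intro sum.cong HOL.refl)
    fix r assume r: "r \<in> MN.M.K"
    have "(\<Sum>s\<in>MN.N.K. \<Sum>r'\<in>MN.M.K. if fst r' = Bot then Y (Bot, j) s * X s r' * ?MM r' r else 0) =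
        (\<Sum>r'\<in>MN.M.K. if fst r' = Bot then (\<Sum>s\<in>MN.N.K. Y (Bot, j) s * X s r') * ?MM r' r else 0)"
      by (subst sum.swap) (auto simp: sum_distrib_right intro!: sum.cong)
    then show "(\<Sum>s\<in>MN.N.K. if fst r \<noteq> Bot
        then (\<Sum>r'\<in>MN.M.K. if fst r' = Bot then Y (Bot, j) s * X s r' * ?MM r' r else 0) * Y r p else 0) =
      (if fst r \<noteq> Bot
        then (\<Sum>r'\<in>MN.M.K. if fst r' = Bot then (\<Sum>s\<in>MN.N.K. Y (Bot, j) s * X s r') * ?MM r' r else 0) * Y r p else 0)"
      by (cases "fst r = Bot") (simp_all flip: sum_distrib_right)
  qed
  \<comment> \<open>Row (0, j) of YX = 1 removes the product Y_0 X_0.\<close>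
  also have "\<dots> = (\<Sum>r\<in>MN.M.K. if fst r \<noteq> Bot then MN.M.Mt (fst r) j (snd r) * Y r p else 0)"
  proof (intro sum.cong HOL.refl)
    fix r assume r: "r \<in> MN.M.K"
    have "(\<Sum>r'\<in>MN.M.K. if fst r' = Bot then (\<Sum>s\<in>MN.N.K. Y (Bot, j) s * X s r') * ?MM r' r else 0) =
        (\<Sum>r'\<in>MN.M.K. if r' = (Bot, j) then MN.M.Mt (fst r) j (snd r) else 0)"
      by (intro sum.cong HOL.refl) (auto simp: YX[OF j])
    then show "(if fst r \<noteq> Bot
        then (\<Sum>r'\<in>MN.M.K. if fst r' = Bot then (\<Sum>s\<in>MN.N.K. Y (Bot, j) s * X s r') * ?MM r' r else 0) * Y r p else 0) =
      (if fst r \<noteq> Bot then MN.M.Mt (fst r) j (snd r) * Y r p else 0)"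
      using j by simp
  qed
  finally show "(\<Sum>r\<in>MN.N.K. if fst r = Bot then Y (Bot, j) r * MN.N.Mt (fst p) (snd r) (snd p) else 0) =
     (\<Sum>q\<in>MN.M.K. if fst q \<noteq> Bot then MN.M.Mt (fst q) j (snd q) * Y q p else 0)" .
qed

end

end

section \<open>Inverses of block triangular matrices\<close>

lemma sum_delta_times: "finite I \<Longrightarrow> j \<in> I \<Longrightarrow> (\<Sum>i\<in>I. (if j = i then 1 else 0) * f i) = (f j :: 'g::field)"
  by (simp add: if_distrib[of "\<lambda>a. a * b" for b] cong: if_cong)

lemma sum_times_delta: "finite I \<Longrightarrow> j \<in> I \<Longrightarrow> (\<Sum>i\<in>I. f i * (if i = j then 1 else 0)) = (f j :: 'g::field)"
  by (simp add: if_distrib[of "\<lambda>a. b * a" for b] cong: if_cong)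

text \<open>If n < k, padding A with zero rows and B with zero columns gives square matrices with
  B'A' = 1. Then A'B' = 1 as well, although row n of A' is zero.\<close>

lemma left_inverse_dim_le:
  fixes A B :: "nat \<Rightarrow> nat \<Rightarrow> 'g::field"
  assumes "\<And>i j. i < k \<Longrightarrow> j < k \<Longrightarrow> (\<Sum>l<n. B i l * A l j) = (if i = j then 1 else 0)"
  shows "k \<le> n"
proof (rule ccontr)
  assume k: "\<not> k \<le> n"
  define A' where "A' = mat k k (\<lambda>(i, j). if i < n then A i j else 0)"
  define B' where "B' = mat k k (\<lambda>(i, j). if j < n then B i j else 0)"
  have c: "A' \<in> carrier_mat k k" "B' \<in> carrier_mat k k" by (simp_all add: A'_def B'_def)
  have "B' * A' = 1\<^sub>m k"
  proof (rule eq_matI)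
    fix i j assume "i < dim_row (1\<^sub>m k)" "j < dim_col (1\<^sub>m k)"
    then have ij: "i < k" "j < k" by simp_all
    have "(B' * A') $$ (i, j) = (\<Sum>l\<in>{0..<k}. if l < n then B i l * A l j else 0)"
      using ij by (auto simp: A'_def B'_def scalar_prod_def intro!: sum.cong)
    also have "\<dots> = (\<Sum>l<n. B i l * A l j)"
      using k by (auto simp: sum.If_cases intro!: sum.cong)
    finally show "(B' * A') $$ (i, j) = 1\<^sub>m k $$ (i, j)" using assms[OF ij] ij by simp
  qed (use c in auto)
  then have "A' * B' = 1\<^sub>m k" using mat_mult_left_right_inverse c by blast
  moreover have "(A' * B') $$ (n, n) = 0"
    using k by (auto simp: A'_def B'_def scalar_prod_def intro!: sum.neutral)
  ultimately show False using k by simp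
qed

lemma mat_inverse_exists:
  assumes "(A :: 'g::field mat) \<in> carrier_mat n n" "det A \<noteq> 0"
  obtains B where "B \<in> carrier_mat n n" "A * B = 1\<^sub>m n" "B * A = 1\<^sub>m n"
proof -
  have "A \<in> Units (ring_mat TYPE('g) n ())" by (rule det_non_zero_imp_unit[OF assms])
  then show ?thesis using that unfolding Units_def by (auto simp: ring_mat_def)
qed

lemma mat_det_nonzero: "(A :: 'g::field mat) \<in> carrier_mat n n \<Longrightarrow> B \<in> carrier_mat n n \<Longrightarrow> A * B = 1\<^sub>m n \<Longrightarrow> det A \<noteq> 0"
  using det_mult[of A n B] by auto

context eq_system begin

text \<open>At a weak point the matrix comes from one over F, whose determinant is nonzero too, so
  the inverse already exists over F.\<close>

lemma mat_inverse_Q: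
  assumes A: "A \<in> carrier_mat n n" "det A \<noteq> 0" and x: "x \<in> P" and AQ: "elements_mat A \<subseteq> Q x x"
  obtains B where "B \<in> carrier_mat n n" "A * B = 1\<^sub>m n" "B * A = 1\<^sub>m n" "elements_mat B \<subseteq> Q x x"
proof (cases "strong D x")
  case True
  obtain B where "B \<in> carrier_mat n n" "A * B = 1\<^sub>m n" "B * A = 1\<^sub>m n" by (rule mat_inverse_exists[OF A])
  then show ?thesis using that x True by (auto simp: Q_self)
next
  case False
  then have Q: "Q x x = range (emb D)" using x by (simp add: Q_self)
  define A' where "A' = map_mat (inv_into UNIV (emb D)) A"
  have A': "A' \<in> carrier_mat n n" using A by (simp add: A'_def)
  have AA': "A = map_mat (emb D) A'"
  proof (rule eq_matI)
    fix i j assume "i < dim_row (map_mat (emb D) A')" "j < dim_col (map_mat (emb D) A')"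
    then have ij: "i < n" "j < n" using A' by auto
    then have "A $$ (i, j) \<in> range (emb D)" using AQ A(1) Q by blast
    then show "A $$ (i, j) = map_mat (emb D) A' $$ (i, j)" using ij A by (simp add: A'_def f_inv_into_f)
  qed (use A A' in auto)
  have "det A' \<noteq> 0" using A(2) unfolding AA' emb.hom_det by auto
  then obtain B where B: "B \<in> carrier_mat n n" "A' * B = 1\<^sub>m n" "B * A' = 1\<^sub>m n" by (rule mat_inverse_exists[OF A'])
  show ?thesis
  proof (rule that[of "map_mat (emb D) B"])
    show "A * map_mat (emb D) B = 1\<^sub>m n" "map_mat (emb D) B * A = 1\<^sub>m n"
      unfolding AA' using B A' by (simp_all flip: emb.mat_hom_mult add: emb.mat_hom_one)
    show "elements_mat (map_mat (emb D) B) \<subseteq> Q x x" unfolding elements_mat_map Q by blast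
  qed (use B in simp)
qed

lemma adm_trans: "adm x y \<Longrightarrow> adm y z \<Longrightarrow> adm x z"
  using pless_trans by (auto simp: adm_def)

lemma adm_ple: "adm y x \<Longrightarrow> x \<in> P \<Longrightarrow> ple D y x"
  by (auto simp: adm_def pless_def)

lemma adm_strict: "adm x y \<Longrightarrow> \<not> pless D y x"
  using pless_asym by (auto simp: adm_def pless_def)

lemma wf_pless: "wf {(y, x). pless D y x}"
proof (rule finite_acyclic_wf)
  show "finite {(y, x). pless D y x}"
    by (rule finite_subset[of _ "P \<times> P"]) (auto dest: pless_P)
  have "pless D a b" if "(a, b) \<in> {(y, x). pless D y x}\<^sup>+" for a b
    using that
  proof (induction rule: trancl_induct)
    case (step y z)
    then show ?case using pless_trans[of a y z] by simp
  qed simp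
  then show "acyclic {(y, x). pless D y x}" unfolding acyclic_def pless_def by blast
qed

definition blocks :: "('a pt \<Rightarrow> nat) \<Rightarrow> ('a pt \<times> nat) set" where
  "blocks d = Sigma P (\<lambda>x. {..<d x})"

definition btri :: "('a pt \<Rightarrow> nat) \<Rightarrow> ('a pt \<times> nat \<Rightarrow> 'a pt \<times> nat \<Rightarrow> 'g) \<Rightarrow> bool" where
  "btri d X \<longleftrightarrow> (\<forall>q\<in>blocks d. \<forall>p\<in>blocks d. X q p \<in> Q (fst q) (fst p) \<and> (adm (fst q) (fst p) \<or> X q p = 0))"

lemma finite_blocks [simp]: "finite (blocks d)"
  by (simp add: blocks_def)

lemma blocks_P: "p \<in> blocks d \<Longrightarrow> fst p \<in> P"
  by (auto simp: blocks_def)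

lemma sum_blocks_fst:
  assumes x: "x \<in> P"
  shows "(\<Sum>p\<in>blocks d. if fst p = x then f p else 0) = (\<Sum>i<d x. f (x, i))"
proof -
  have "(\<Sum>p\<in>blocks d. if fst p = x then f p else 0) = (\<Sum>p\<in>{p \<in> blocks d. fst p = x}. f p)"
    by (rule sum.inter_filter[symmetric]) simp
  also have "{p \<in> blocks d. fst p = x} = Pair x ` {..<d x}" using x by (auto simp: blocks_def)
  also have "(\<Sum>p\<in>Pair x ` {..<d x}. f p) = (\<Sum>i<d x. f (x, i))"
    by (subst sum.reindex) (auto simp: inj_on_def)
  finally show ?thesis .
qed

text \<open>Row \<open>q\<close> of the inverse is found by solving \<open>YX = 1\<close> block by block along the order; \<open>W\<^sub>x\<close> is
  the inverse of the diagonal block at \<open>x\<close>.\<close>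

lemma block_left_inverse:
  assumes X: "btri d X"
    and WQ: "\<And>x i k. x \<in> P \<Longrightarrow> i < d x \<Longrightarrow> k < d x \<Longrightarrow> W x i k \<in> Q x x"
    and WX: "\<And>x i j. x \<in> P \<Longrightarrow> i < d x \<Longrightarrow> j < d x \<Longrightarrow>
      (\<Sum>k<d x. W x i k * X (x, k) (x, j)) = (if i = j then 1 else 0)"
  shows "\<exists>Y. btri d Y \<and>
    (\<forall>q\<in>blocks d. \<forall>p\<in>blocks d. (\<Sum>r\<in>blocks d. Y q r * X r p) = (if q = p then 1 else 0)) \<and>
    (\<forall>x\<in>P. \<forall>i<d x. \<forall>k<d x. Y (x, i) (x, k) = W x i k)"
proof -
  \<comment> \<open>\<open>E\<close> is what remains of entry (q, (x, j)) in the equation YX = 1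
    once the blocks of Y below x are known; the block at x is then \<open>E\<close> multiplied by
    W_x on the right.\<close>
  define E where "E f q x j = (if q = (x, j) then 1 else 0) -
    (\<Sum>r\<in>blocks d. if pless D (fst r) x then f (fst r) (snd r) * X r (x, j) else 0)"
    for f :: "'a pt \<Rightarrow> nat \<Rightarrow> 'g" and q x j
  define F where "F q f x = (\<lambda>k. \<Sum>j<d x. E f q x j * W x j k)" for q f x
  define Y where "Y q p = wfrec {(y, x). pless D y x} (F q) (fst p) (snd p)" for q p
  \<comment> \<open>\<open>E\<close> consults \<open>f\<close> only at points below x.\<close>
  have "adm_wf {(y, x). pless D y x} (F q)" for q
    unfolding adm_wf_def F_def E_def by (auto simp: fun_eq_iff intro!: sum.cong arg_cong2[of _ _ _ _ "(-)"])
  note fixpoint = wfrec_fixpoint[OF wf_pless this]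
  have Y_eq: "Y q (x, k) = (\<Sum>j<d x. E (\<lambda>y i. Y q (y, i)) q x j * W x j k)" for q x k
    using fun_cong[OF fun_cong[OF fixpoint[of q]], of x k] by (simp only: Y_def fst_conv snd_conv F_def)
  let ?E = "\<lambda>q. E (\<lambda>y i. Y q (y, i)) q"
  have E: "?E q x j = (if q = (x, j) then 1 else 0) -
      (\<Sum>r\<in>blocks d. if pless D (fst r) x then Y q r * X r (x, j) else 0)" for q x j
    by (simp only: E_def prod.collapse)
  have XQ: "X r p \<in> Q (fst r) (fst p)" "X r p \<noteq> 0 \<Longrightarrow> adm (fst r) (fst p)" if "r \<in> blocks d" "p \<in> blocks d" for r p
    using X that unfolding btri_def by blast+
  \<comment> \<open>Membership in the spans and triangularity go through the induction together: a
    nonzero product of an entry of Y and an entry of X passes through two admissible pairs, and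
    these compose.\<close>
  have YQ: "x \<in> P \<Longrightarrow> \<forall>k<d x. Y q (x, k) \<in> Q (fst q) x \<and> (adm (fst q) x \<or> Y q (x, k) = 0)" if q: "q \<in> blocks d" for q x
  proof (induction x rule: wf_induct_rule[OF wf_pless])
    case (1 x)
    have EQ: "?E q x j \<in> Q (fst q) x \<and> (adm (fst q) x \<or> ?E q x j = 0)" if j: "j < d x" for j
    proof -
      have xj: "(x, j) \<in> blocks d" using 1(2) j by (simp add: blocks_def)
      have t: "Y q r * X r (x, j) \<in> Q (fst q) x \<and> (adm (fst q) x \<or> Y q r * X r (x, j) = 0)"
        if r: "r \<in> blocks d" "pless D (fst r) x" for r
      proof (cases "Y q r * X r (x, j) = 0")
        case False
        have "Y q r \<in> Q (fst q) (fst r) \<and> (adm (fst q) (fst r) \<or> Y q r = 0)"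
          using 1(1)[of "fst r"] r by (cases r) (auto simp: blocks_def)
        then have *: "Y q r \<in> Q (fst q) (fst r)" "adm (fst q) (fst r)" "adm (fst r) x"
          using False XQ(2)[OF r(1) xj] by auto
        then show ?thesis
          using Q_mult[OF adm_ple[OF *(2) blocks_P[OF r(1)]] adm_ple[OF *(3) 1(2)] *(1)] XQ(1)[OF r(1) xj]
            adm_trans by auto
      qed auto
      have "(\<Sum>r\<in>blocks d. if pless D (fst r) x then Y q r * X r (x, j) else 0) \<in> Q (fst q) x"
        using t by (auto intro!: Q_sum)
      moreover have "(if q = (x, j) then 1 else 0) \<in> Q (fst q) x" using 1(2) by (auto simp: Q_1)
      moreover have "?E q x j = 0" if n: "\<not> adm (fst q) x"
      proof -
        have "q \<noteq> (x, j)" using n by (auto simp: adm_def)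
        moreover have "(\<Sum>r\<in>blocks d. if pless D (fst r) x then Y q r * X r (x, j) else 0) = 0"
          using t n by (intro sum.neutral ballI) simp
        ultimately show ?thesis by (simp add: E)
      qed
      ultimately show ?thesis unfolding E using Q_diff by blast
    qed
    have "Y q (x, k) \<in> Q (fst q) x" if k: "k < d x" for k
    proof (subst Y_eq, rule Q_sum)
      fix j assume "j \<in> {..<d x}"
      then have j: "j < d x" by simp
      show "?E q x j * W x j k \<in> Q (fst q) x"
        using EQ[OF j] Q_mult[OF adm_ple[OF _ 1(2)] ple_refl[OF 1(2)] _ WQ[OF 1(2) j k], of "fst q" "?E q x j"] by auto
    qed
    moreover have "Y q (x, k) = 0" if "\<not> adm (fst q) x" for k
      using that EQ by (subst Y_eq, intro sum.neutral ballI) auto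
    ultimately show ?case by blast
  qed
  have Y: "btri d Y"
    unfolding btri_def
  proof (intro ballI)
    fix q p assume "q \<in> blocks d" "p \<in> blocks d"
    then show "Y q p \<in> Q (fst q) (fst p) \<and> (adm (fst q) (fst p) \<or> Y q p = 0)"
      using YQ[of q "fst p"] by (cases p) (auto simp: blocks_def)
  qed
  show ?thesis
  proof (intro exI[of _ Y] conjI ballI allI impI Y)
    fix q p assume q: "q \<in> blocks d" and p: "p \<in> blocks d"
    obtain x i where pi: "p = (x, i)" by (cases p)
    have x: "x \<in> P" "i < d x" using p by (auto simp: pi blocks_def)
    have "(\<Sum>r\<in>blocks d. Y q r * X r p) =
        (\<Sum>r\<in>blocks d. (if fst r = x then Y q r * X r p else 0) + (if pless D (fst r) x then Y q r * X r p else 0))"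
    proof (intro sum.cong HOL.refl)
      fix r assume r: "r \<in> blocks d"
      show "Y q r * X r p = (if fst r = x then Y q r * X r p else 0) + (if pless D (fst r) x then Y q r * X r p else 0)"
        using XQ(2)[OF r p] by (cases "X r p = 0") (auto simp: pi adm_def pless_def)
    qed
    also have "\<dots> = (\<Sum>k<d x. Y q (x, k) * X (x, k) p) +
        (\<Sum>r\<in>blocks d. if pless D (fst r) x then Y q r * X r p else 0)"
      unfolding sum.distrib sum_blocks_fst[OF x(1)] ..
    also have "(\<Sum>k<d x. Y q (x, k) * X (x, k) p) = (\<Sum>k<d x. \<Sum>j<d x. ?E q x j * (W x j k * X (x, k) p))"
      by (intro sum.cong HOL.refl, subst Y_eq) (simp only: sum_distrib_right mult.assoc)
    also have "\<dots> = (\<Sum>j<d x. \<Sum>k<d x. ?E q x j * (W x j k * X (x, k) p))"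
      by (rule sum.swap)
    also have "\<dots> = (\<Sum>j<d x. ?E q x j * (if j = i then 1 else 0))"
      unfolding sum_distrib_left[symmetric] pi using WX[OF x(1) _ x(2)] by (intro sum.cong) auto
    also have "\<dots> = ?E q x i" using x by (intro sum_times_delta) auto
    finally show "(\<Sum>r\<in>blocks d. Y q r * X r p) = (if q = p then 1 else 0)"
      unfolding E pi by simp
  next
    fix x i k assume x: "x \<in> P" "i < d x" "k < d x"
    have xi: "(x, i) \<in> blocks d" using x by (simp add: blocks_def)
    \<comment> \<open>In row block x no block of Y strictly below x contributes, so on the diagonal
      Y agrees with W.\<close>
    have "?E (x, i) x j = (if i = j then 1 else 0)" for j
    proof -
      have "(\<Sum>r\<in>blocks d. if pless D (fst r) x then Y (x, i) r * X r (x, j) else 0) = 0"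
      proof (intro sum.neutral ballI)
        fix r assume r: "r \<in> blocks d"
        have "Y (x, i) r = 0" if "pless D (fst r) x"
          using Y[unfolded btri_def, rule_format, OF xi r] adm_strict that by auto
        then show "(if pless D (fst r) x then Y (x, i) r * X r (x, j) else 0) = 0" by simp
      qed
      then show ?thesis by (simp add: E)
    qed
    then have "Y (x, i) (x, k) = (\<Sum>j<d x. (if i = j then 1 else 0) * W x j k)" by (subst Y_eq) simp
    also have "\<dots> = W x i k" using x by (intro sum_delta_times) auto
    finally show "Y (x, i) (x, k) = W x i k" .
  qed
qed

text \<open>The left inverse Y has the blocks of W on its diagonal, which are inverted by those of
  X. So Y has a left inverse Z in turn, and Z = Z Y X = X shows that Y is also a right inverse of
  X.\<close>

lemma block_inverse:
  assumes X: "btri d X"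
    and WQ: "\<And>x i k. x \<in> P \<Longrightarrow> i < d x \<Longrightarrow> k < d x \<Longrightarrow> W x i k \<in> Q x x"
    and WX: "\<And>x i j. x \<in> P \<Longrightarrow> i < d x \<Longrightarrow> j < d x \<Longrightarrow>
      (\<Sum>k<d x. W x i k * X (x, k) (x, j)) = (if i = j then 1 else 0)"
    and XW: "\<And>x i j. x \<in> P \<Longrightarrow> i < d x \<Longrightarrow> j < d x \<Longrightarrow>
      (\<Sum>k<d x. X (x, i) (x, k) * W x k j) = (if i = j then 1 else 0)"
  obtains Y where "btri d Y"
    "\<And>q p. q \<in> blocks d \<Longrightarrow> p \<in> blocks d \<Longrightarrow> (\<Sum>r\<in>blocks d. Y q r * X r p) = (if q = p then 1 else 0)"
    "\<And>q p. q \<in> blocks d \<Longrightarrow> p \<in> blocks d \<Longrightarrow> (\<Sum>r\<in>blocks d. X q r * Y r p) = (if q = p then 1 else 0)"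
proof -
  obtain Y where Y: "btri d Y"
    "\<And>q p. q \<in> blocks d \<Longrightarrow> p \<in> blocks d \<Longrightarrow> (\<Sum>r\<in>blocks d. Y q r * X r p) = (if q = p then 1 else 0)"
    "\<And>x i k. x \<in> P \<Longrightarrow> i < d x \<Longrightarrow> k < d x \<Longrightarrow> Y (x, i) (x, k) = W x i k"
    using block_left_inverse[OF X, of W] WQ WX by blast
  have XQ: "X (x, i) (x, k) \<in> Q x x" if "x \<in> P" "i < d x" "k < d x" for x i k
    using X[unfolded btri_def, rule_format, of "(x, i)" "(x, k)"] that by (simp add: blocks_def)
  have XY: "(\<Sum>k<d x. X (x, i) (x, k) * Y (x, k) (x, j)) = (if i = j then 1 else 0)"
    if "x \<in> P" "i < d x" "j < d x" for x i j
    using XW[OF that] Y(3)[OF that(1) _ that(3)] by simp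
  obtain Z where Z:
    "\<And>q p. q \<in> blocks d \<Longrightarrow> p \<in> blocks d \<Longrightarrow> (\<Sum>r\<in>blocks d. Z q r * Y r p) = (if q = p then 1 else 0)"
    using block_left_inverse[OF Y(1), of "\<lambda>x i k. X (x, i) (x, k)"] XQ XY by blast
  have "Z q p = X q p" if q: "q \<in> blocks d" and p: "p \<in> blocks d" for q p
  proof -
    have "Z q p = (\<Sum>s\<in>blocks d. Z q s * (if s = p then 1 else 0))"
      using p by (intro sum_times_delta[symmetric]) auto
    also have "\<dots> = (\<Sum>s\<in>blocks d. Z q s * (\<Sum>r\<in>blocks d. Y s r * X r p))"
      using Y(2)[OF _ p] by (intro sum.cong) auto
    also have "\<dots> = (\<Sum>r\<in>blocks d. \<Sum>s\<in>blocks d. Z q s * Y s r * X r p)"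
      unfolding sum_distrib_left mult.assoc by (rule sum.swap)
    also have "\<dots> = (\<Sum>r\<in>blocks d. (if q = r then 1 else 0) * X r p)"
      unfolding sum_distrib_right[symmetric] using Z[OF q] by (intro sum.cong) auto
    also have "\<dots> = X q p" using q by (intro sum_delta_times) auto
    finally show ?thesis .
  qed
  then have XY': "(\<Sum>r\<in>blocks d. X q r * Y r p) = (if q = p then 1 else 0)" if "q \<in> blocks d" "p \<in> blocks d" for q p
    using Z[OF that] that by (simp cong: sum.cong)
  show ?thesis using that[of Y] Y(1,2) XY' by blast
qed

end

section \<open>Isomorphisms and matrix equations\<close>

lemma mat_mult_index:
  fixes A B :: "'g::field mat"
  assumes "A \<in> carrier_mat n k" "B \<in> carrier_mat k m" "i < n" "j < m"
  shows "(A * B) $$ (i, j) = (\<Sum>l<k. A $$ (i, l) * B $$ (l, j))"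
  using assms by (auto simp: scalar_prod_def atLeast0LessThan intro!: sum.cong)

lemma mat_sum_carrier [simp]: "mat_sum n k S I \<in> carrier_mat n k"
  by (simp add: mat_sum_def)

lemma carrier_mat_eq_iff:
  "A \<in> carrier_mat n k \<Longrightarrow> A' \<in> carrier_mat n k \<Longrightarrow> A = A' \<longleftrightarrow> (\<forall>i<n. \<forall>j<k. A $$ (i, j) = A' $$ (i, j))"
  by (auto intro!: eq_matI)

lemma mult_mat_sum:
  fixes T :: "'g::field mat"
  assumes "T \<in> carrier_mat n n" "\<And>y. y \<in> I \<Longrightarrow> S y \<in> carrier_mat n k"
  shows "T * mat_sum n k S I = mat_sum n k (\<lambda>y. T * S y) I"
proof (rule eq_matI)
  fix i j assume "i < dim_row (mat_sum n k (\<lambda>y. T * S y) I)" "j < dim_col (mat_sum n k (\<lambda>y. T * S y) I)"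
  then have ij: "i < n" "j < k" by (auto simp: mat_sum_def)
  have "(T * mat_sum n k S I) $$ (i, j) = (\<Sum>l<n. \<Sum>y\<in>I. T $$ (i, l) * S y $$ (l, j))"
    unfolding mat_mult_index[OF assms(1) mat_sum_carrier ij] using ij by (simp add: mat_sum_def sum_distrib_left)
  also have "\<dots> = (\<Sum>y\<in>I. \<Sum>l<n. T $$ (i, l) * S y $$ (l, j))" by (rule sum.swap)
  also have "\<dots> = (\<Sum>y\<in>I. (T * S y) $$ (i, j))"
    using ij by (intro sum.cong HOL.refl mat_mult_index[symmetric]) (use assms ij in auto)
  finally show "(T * mat_sum n k S I) $$ (i, j) = mat_sum n k (\<lambda>y. T * S y) I $$ (i, j)"
    using ij by (simp add: mat_sum_def)
qed (use assms in \<open>auto simp: mat_sum_def\<close>)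

lemma mat_sum_cong: "(\<And>y. y \<in> I \<Longrightarrow> S y = S' y) \<Longrightarrow> mat_sum n k S I = mat_sum n k S' I"
  by (simp add: mat_sum_def)

text \<open>Moves between T_0 on the right-hand side of the matrix equations and its inverse X_0 on
  the left-hand side of \<open>intertwines\<close>.\<close>

lemma mult_inverse_eq_iff:
  fixes T A :: "'g::field mat"
  assumes "T \<in> carrier_mat n n" "A \<in> carrier_mat n n" "T * A = 1\<^sub>m n" "A * T = 1\<^sub>m n"
    and "M \<in> carrier_mat n k" "R \<in> carrier_mat n k"
  shows "M = T * R \<longleftrightarrow> A * M = R"
proof
  show "A * M = R" if "M = T * R"
    unfolding that using assms by (simp flip: assoc_mult_mat[of A n n T n R k])
  show "M = T * R" if "A * M = R"
    unfolding that[symmetric] using assms by (simp flip: assoc_mult_mat[of T n n A n M k])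
qed

lemma mult_mat_block_row:
  fixes T :: "'g::field mat"
  assumes "T \<in> carrier_mat n n" "N x \<in> carrier_mat n (l x)" "C \<in> carrier_mat (l x) k"
    and "\<And>y. y \<in> I \<Longrightarrow> N y \<in> carrier_mat n (l y)" "\<And>y. y \<in> I \<Longrightarrow> E y \<in> carrier_mat (l y) k"
  shows "T * N x * C + mat_sum n k (\<lambda>y. T * N y * E y) I = T * (N x * C + mat_sum n k (\<lambda>y. N y * E y) I)"
proof -
  have "mat_sum n k (\<lambda>y. T * N y * E y) I = mat_sum n k (\<lambda>y. T * (N y * E y)) I"
    by (rule mat_sum_cong) (rule assoc_mult_mat[OF assms(1,4,5)])
  also have "\<dots> = T * mat_sum n k (\<lambda>y. N y * E y) I"
    by (rule mult_mat_sum[symmetric, OF assms(1)]) (rule mult_carrier_mat[OF assms(4,5)])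
  finally show ?thesis
    using assms by (simp add: mult_add_distrib_mat[OF assms(1) mult_carrier_mat[OF assms(2,3)]] assoc_mult_mat[OF assms(1-3)])
qed

context eq_based_pair begin

text \<open>Linearity over R^e makes f^0 respect the components and the scalars of each Q_x, so it
  is given by its diagonal blocks.\<close>

lemma co_mor0:
  assumes add: "\<And>m m'. f0 (m + m') = f0 m + f0 m'"
    and lin: "\<And>m r. r \<in> carrier (Re D) \<Longrightarrow> f0 (actM m (inR D r)) = actN (f0 m) (inR D r)"
    and q: "q \<in> N.K"
  shows "N.co q (f0 m) = (\<Sum>p\<in>M.K. if fst p = fst q then N.co q (f0 (M.bvec p)) * M.co p m else 0)"
proof -
  have "N.co q (f0 m) = (\<Sum>p\<in>M.K. N.co q (f0 (M.sc (fst p) (M.co p m) (M.bvec p))))"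
    by (rule M.additive_expand) (simp add: add N.co_add[OF q])
  also have "\<dots> = (\<Sum>p\<in>M.K. if fst p = fst q then N.co q (f0 (M.bvec p)) * M.co p m else 0)"
  proof (intro sum.cong HOL.refl)
    fix p assume p: "p \<in> M.K"
    have "f0 (M.sc (fst p) (M.co p m) (M.bvec p)) = N.sc (fst p) (M.co p m) (f0 (M.bvec p))"
      unfolding unit_at_eq by (rule lin[OF ua_carrier[OF M.K_P[OF p] M.co_Q[OF p]]])
    then show "N.co q (f0 (M.sc (fst p) (M.co p m) (M.bvec p))) =
        (if fst p = fst q then N.co q (f0 (M.bvec p)) * M.co p m else 0)"
      using N.co_sc[OF q M.K_P[OF p] M.co_Q[OF p]] by auto
  qed
  finally show ?thesis .
qed

definition blk :: "('a pt \<times> nat \<Rightarrow> 'a pt \<times> nat \<Rightarrow> 'g) \<Rightarrow> 'a pt \<Rightarrow> 'a pt \<Rightarrow> 'g mat" where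
  "blk X y x = mat (length (bN y)) (length (bM x)) (\<lambda>(k, i). X (y, k) (x, i))"

lemma blk_carrier [simp]: "blk X y x \<in> carrier_mat (length (bN y)) (length (bM x))"
  by (simp add: blk_def)

lemma elements_blk: "tri X \<Longrightarrow> y \<in> P \<Longrightarrow> x \<in> P \<Longrightarrow> elements_mat (blk X y x) \<subseteq> Q y x"
proof
  fix a assume X: "tri X" and P: "y \<in> P" "x \<in> P" and "a \<in> elements_mat (blk X y x)"
  then obtain k i where "k < length (bN y)" "i < length (bM x)" "a = X (y, k) (x, i)"
    by (auto simp: blk_def dest!: elements_matD)
  then show "a \<in> Q y x" using X[unfolded tri_def, rule_format, of "(y, k)" "(x, i)"] P
    by (simp add: M.K_pair N.K_pair)
qed

text \<open>Compared entry by entry, the sum over all rows above 0 is regrouped into the block at x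
  and the blocks with 0 < y < x; triangularity removes all others.\<close>

lemma intertwines_iff:
  assumes X: "tri X"
  shows "intertwines X \<longleftrightarrow> (\<forall>x. pless D Bot x \<longrightarrow>
    blk X Bot Bot * matrix_of D actM bM x = matrix_of D actN bN x * blk X x x +
      mat_sum (length (bN Bot)) (length (bM x)) (\<lambda>y. matrix_of D actN bN y * blk X y x)
        {y. pless D Bot y \<and> pless D y x})"
    (is "_ = (\<forall>x. _ \<longrightarrow> ?L x = ?R x)")
proof -
  have M: "matrix_of D actM bM x \<in> carrier_mat (length (bM Bot)) (length (bM x))"
    and N: "matrix_of D actN bN x \<in> carrier_mat (length (bN Bot)) (length (bN x))" if "pless D Bot x" for x
    unfolding M.matrix_of_eq[OF that] N.matrix_of_eq[OF that] by simp_all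
  have L: "?L x $$ (j, i) = (\<Sum>r\<in>M.K. if fst r = Bot then X (Bot, j) r * M.Mt x (snd r) i else 0)"
    if "pless D Bot x" "j < length (bN Bot)" "i < length (bM x)" for x j i
    using that unfolding M.sum_K_fst[OF Bot_P] mat_mult_index[OF blk_carrier M[OF that(1)] that(2,3)]
    by (intro sum.cong) (auto simp: blk_def M.matrix_of_eq)
  have R: "?R x $$ (j, i) = (\<Sum>q\<in>N.K. if fst q \<noteq> Bot then N.Mt (fst q) j (snd q) * X q (x, i) else 0)"
    if x: "pless D Bot x" and j: "j < length (bN Bot)" and i: "i < length (bM x)" for x j i
  proof -
    let ?s = "\<lambda>y. \<Sum>k<length (bN y). N.Mt y j k * X (y, k) (x, i)"
    let ?Y = "{y. pless D Bot y \<and> pless D y x}"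
    have s: "(matrix_of D actN bN y * blk X y x) $$ (j, i) = ?s y" if "pless D Bot y" for y
      using that i j unfolding mat_mult_index[OF N[OF that] blk_carrier j i]
      by (intro sum.cong) (auto simp: blk_def N.matrix_of_eq)
    have xi: "x \<in> P" "(x, i) \<in> M.K" using x i pless_P by (auto simp: M.K_pair)
    have "(\<Sum>q\<in>N.K. if fst q \<noteq> Bot then N.Mt (fst q) j (snd q) * X q (x, i) else 0) =
        (\<Sum>y\<in>P. \<Sum>k<length (bN y). if y \<noteq> Bot then N.Mt y j k * X (y, k) (x, i) else 0)"
      unfolding N.K_def by (subst sum.Sigma) (simp_all add: case_prod_beta cong: if_cong)
    also have "\<dots> = (\<Sum>y\<in>P. if y \<noteq> Bot then ?s y else 0)"
      by (intro sum.cong) auto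
    also have "\<dots> = (\<Sum>y\<in>insert x ?Y. ?s y)"
    proof (rule sum.mono_neutral_cong_right)
      show "insert x ?Y \<subseteq> P" using xi by (auto dest: pless_P)
      show "\<forall>y\<in>P - insert x ?Y. (if y \<noteq> Bot then ?s y else 0) = 0"
      proof
        fix y assume y: "y \<in> P - insert x ?Y"
        have "X (y, k) (x, i) = 0" if "y \<noteq> Bot" "k < length (bN y)" for k
          using X[unfolded tri_def, rule_format, of "(y, k)" "(x, i)"] xi y that
          by (auto simp: N.K_pair adm_def pless_Bot)
        then show "(if y \<noteq> Bot then ?s y else 0) = 0" by simp
      qed
      show "(if y \<noteq> Bot then ?s y else 0) = ?s y" if "y \<in> insert x ?Y" for y
        using that x by (auto simp: pless_Bot)
    qed simp
    also have "\<dots> = ?s x + (\<Sum>y\<in>?Y. ?s y)"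
    proof (rule sum.insert)
      show "finite ?Y" by (rule finite_subset[OF _ finite_P]) (auto dest: pless_P)
    qed (simp add: pless_def)
    also have "(\<Sum>y\<in>?Y. ?s y) = (\<Sum>y\<in>?Y. (matrix_of D actN bN y * blk X y x) $$ (j, i))"
      using s by (intro sum.cong) auto
    finally show ?thesis
      using i j N[OF x] by (simp add: mat_sum_def s[OF x])
  qed
  have "?L x = ?R x \<longleftrightarrow> (\<forall>j<length (bN Bot). \<forall>i<length (bM x). ?L x $$ (j, i) = ?R x $$ (j, i))"
    if x: "pless D Bot x" for x
  proof -
    have "?L x \<in> carrier_mat (length (bN Bot)) (length (bM x))"
      by (rule mult_carrier_mat[OF blk_carrier M[OF x]])
    moreover have "?R x \<in> carrier_mat (length (bN Bot)) (length (bM x))"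
      by simp
    ultimately show ?thesis by (rule carrier_mat_eq_iff)
  qed
  then have "(\<forall>x. pless D Bot x \<longrightarrow> ?L x = ?R x) \<longleftrightarrow>
      (\<forall>x. pless D Bot x \<longrightarrow> (\<forall>j<length (bN Bot). \<forall>i<length (bM x). ?L x $$ (j, i) = ?R x $$ (j, i)))"
    by blast
  also have "\<dots> \<longleftrightarrow> intertwines X"
    unfolding intertwines_def
  proof safe
    fix j x i
    assume a: "\<forall>x. pless D Bot x \<longrightarrow> (\<forall>j<length (bN Bot). \<forall>i<length (bM x). ?L x $$ (j, i) = ?R x $$ (j, i))"
      and "(Bot, j) \<in> N.K" "(x, i) \<in> M.K" "fst (x, i) \<noteq> Bot"
    then have *: "pless D Bot x" "j < length (bN Bot)" "i < length (bM x)"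
      by (auto simp: N.K_pair M.K_pair pless_Bot)
    show "(\<Sum>r\<in>M.K. if fst r = Bot then X (Bot, j) r * M.Mt (fst (x, i)) (snd r) (snd (x, i)) else 0) =
      (\<Sum>q\<in>N.K. if fst q \<noteq> Bot then N.Mt (fst q) j (snd q) * X q (x, i) else 0)"
      unfolding fst_conv snd_conv L[OF *, symmetric] R[OF *, symmetric] using a * by blast
  next
    fix x j i
    assume a: "\<forall>j p. (Bot, j) \<in> N.K \<longrightarrow> p \<in> M.K \<longrightarrow> fst p \<noteq> Bot \<longrightarrow>
        (\<Sum>r\<in>M.K. if fst r = Bot then X (Bot, j) r * M.Mt (fst p) (snd r) (snd p) else 0) =
        (\<Sum>q\<in>N.K. if fst q \<noteq> Bot then N.Mt (fst q) j (snd q) * X q p else 0)"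
      and *: "pless D Bot x" "j < length (bN Bot)" "i < length (bM x)"
    show "?L x $$ (j, i) = ?R x $$ (j, i)"
      unfolding L[OF *] R[OF *] using a[rule_format, of j "(x, i)", unfolded fst_conv snd_conv] *
      by (simp add: N.K_pair M.K_pair pless_Bot)
  qed
  finally show ?thesis by simp
qed

end

section \<open>Invariance of the dimension vector\<close>

context eq_based_iso begin

lemma swap: "eq_based_iso D B actN actM bN bM"
  by (intro eq_based_iso.intro NM.eq_based_pair_axioms MN.eq_based_pair_axioms)

context
  fixes f0 :: "'m \<Rightarrow> 'n" and g0 :: "'n \<Rightarrow> 'm"
  assumes f: "\<And>m m'. f0 (m + m') = f0 m + f0 m'"
      "\<And>m r. r \<in> carrier (Re D) \<Longrightarrow> f0 (actM m (inR D r)) = actN (f0 m) (inR D r)"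
    and g: "\<And>m m'. g0 (m + m') = g0 m + g0 m'"
      "\<And>m r. r \<in> carrier (Re D) \<Longrightarrow> g0 (actN m (inR D r)) = actM (g0 m) (inR D r)"
    and gf: "\<And>m. g0 (f0 m) = m"
begin

lemma co_inverse:
  assumes x: "x \<in> pts D" "i < length (bM x)" "j < length (bM x)"
  shows "(\<Sum>l<length (bN x). MN.M.co (x, i) (g0 (bN x ! l)) * MN.N.co (x, l) (f0 (bM x ! j))) = (if i = j then 1 else 0)"
proof -
  have K: "(x, i) \<in> MN.M.K" "(x, j) \<in> MN.M.K" using x by (simp_all add: MN.M.K_pair)
  have "MN.M.co (x, i) (g0 (f0 (bM x ! j))) =
      (\<Sum>q\<in>MN.N.K. if fst q = x then MN.M.co (x, i) (g0 (MN.N.bvec q)) * MN.N.co q (f0 (bM x ! j)) else 0)"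
    using NM.co_mor0[OF g K(1)] by simp
  also have "\<dots> = (\<Sum>l<length (bN x). MN.M.co (x, i) (g0 (bN x ! l)) * MN.N.co (x, l) (f0 (bM x ! j)))"
    unfolding MN.N.sum_K_fst[OF x(1)] by simp
  finally show ?thesis using MN.M.co_bvec[OF K] by (simp add: gf)
qed

lemma dim_le: "x \<in> pts D \<Longrightarrow> length (bM x) \<le> length (bN x)"
  by (rule left_inverse_dim_le, rule co_inverse)

end

end

text \<open>\<open>dimvec\<close> refers to an arbitrarily chosen basis. Applying
  \<open>dim_le\<close> to the identity map in both directions between the given and the chosen
  basis shows that they have equal length.\<close>

lemma (in eq_bases) dimvec_eq:
  assumes "eq_based D act bs" "x \<in> P"
  shows "dimvec D act x = length (bs x)"
proof -
  interpret M: eq_based D act bs by fact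
  define c where "c x = (SOME b. is_Q_basis D act x b)" for x
  have "is_local_basis D act c"
    using M.local_basis unfolding is_local_basis_def c_def by (metis someI)
  then interpret MN: eq_based_iso D B act act bs c
    by unfold_locales
  interpret NM: eq_based_iso D B act act c bs by (rule MN.swap)
  have "length (bs x) \<le> length (c x)" "length (c x) \<le> length (bs x)"
    using MN.dim_le[of id id] NM.dim_le[of id id] assms(2) by simp_all
  then show ?thesis by (simp add: dimvec_def c_def)
qed

section \<open>From isomorphisms to solutions of the matrix equations and back\<close>

context eq_based_iso begin

text \<open>The system of conditions on the matrices, with d_x read off from the given basis of
  M.\<close>

definition block_equation where
  "block_equation T0 Tx Tyx \<longleftrightarrow>
       T0 \<in> carrier_mat (length (bM Bot)) (length (bM Bot)) \<and> det T0 \<noteq> 0 \<and>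
       (\<forall>x. pless D Bot x \<longrightarrow>
          Tx x \<in> carrier_mat (length (bM x)) (length (bM x)) \<and> det (Tx x) \<noteq> 0 \<and>
          elements_mat (Tx x) \<subseteq> (if strong D x then UNIV else range (emb D))) \<and>
       (\<forall>y x. pless D Bot y \<and> pless D y x \<longrightarrow>
          Tyx y x \<in> carrier_mat (length (bM y)) (length (bM x)) \<and>
          elements_mat (Tyx y x) \<subseteq> F_span_powers D (plev D y x)) \<and>
       (\<forall>x. pless D Bot x \<longrightarrow>
          matrix_of D actM bM x =
            T0 * matrix_of D actN bN x * Tx x +
            mat_sum (length (bM Bot)) (length (bM x)) (\<lambda>y. T0 * matrix_of D actN bN y * Tyx y x)
              {y. pless D Bot y \<and> pless D y x})"

lemma morphism_inverse_lin:
  assumes f: "is_morphism D B actM actN (f0, f1)" and g: "is_morphism D B actN actM (g0, g1)"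
  shows "\<And>m m'. f0 (m + m') = f0 m + f0 m'"
    "\<And>m r. r \<in> carrier (Re D) \<Longrightarrow> f0 (actM m (inR D r)) = actN (f0 m) (inR D r)"
    "\<And>m m'. g0 (m + m') = g0 m + g0 m'"
    "\<And>m r. r \<in> carrier (Re D) \<Longrightarrow> g0 (actN m (inR D r)) = actM (g0 m) (inR D r)"
  using MN.mor0[OF f] NM.mor0[OF g] by simp_all

lemma isomorphic_imp_block_equation:
  assumes f: "is_morphism D B actM actN (f0, f1)" and g: "is_morphism D B actN actM (g0, g1)"
    and gf: "\<And>m. g0 (f0 m) = m" and fg: "\<And>n. f0 (g0 n) = n"
  shows "\<forall>x\<in>pts D. length (bM x) = length (bN x)" "\<exists>T0 Tx Tyx. block_equation T0 Tx Tyx"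
proof -
  interpret sw: eq_based_iso D B actN actM bN bM by (rule swap)
  note lin = morphism_inverse_lin[OF f g]
  have d: "length (bM x) = length (bN x)" if "x \<in> pts D" for x
    using dim_le[OF lin gf that] sw.dim_le[OF lin(3,4,1,2) fg that] by simp
  then show "\<forall>x\<in>pts D. length (bM x) = length (bN x)" by blast
  let ?X = "MN.mor_mat f0 f1"
  let ?A = "\<lambda>x. MN.blk ?X x x"
  \<comment> \<open>The diagonal blocks of g^0. They invert those of f^0, and the one at 0 is the
    matrix T_0.\<close>
  define T where "T x = mat (length (bM x)) (length (bN x)) (\<lambda>(i, k). MN.M.co (x, i) (g0 (bN x ! k)))" for x
  have A: "?A x $$ (k, i) = MN.N.co (x, k) (f0 (bM x ! i))" if "k < length (bN x)" "i < length (bM x)" for x k i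
    using that by (simp add: MN.blk_def MN.mor_mat_def)
  have Ac: "?A x \<in> carrier_mat (length (bM x)) (length (bM x))" if "x \<in> pts D" for x
    using MN.blk_carrier[of ?X x x] d[OF that] by simp
  have Tc: "T x \<in> carrier_mat (length (bM x)) (length (bM x))" if "x \<in> pts D" for x
    using d[OF that] by (simp add: T_def)
  have TA: "T x * ?A x = 1\<^sub>m (length (bM x))" if x: "x \<in> pts D" for x
  proof (rule eq_matI)
    fix i j assume "i < dim_row (1\<^sub>m (length (bM x)))" "j < dim_col (1\<^sub>m (length (bM x)))"
    then have ij: "i < length (bM x)" "j < length (bM x)" by simp_all
    have "(T x * ?A x) $$ (i, j) =
        (\<Sum>l<length (bN x). MN.M.co (x, i) (g0 (bN x ! l)) * MN.N.co (x, l) (f0 (bM x ! j)))"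
      unfolding mat_mult_index[OF Tc[OF x] Ac[OF x] ij] using ij d[OF x] by (intro sum.cong) (auto simp: T_def A)
    then show "(T x * ?A x) $$ (i, j) = 1\<^sub>m (length (bM x)) $$ (i, j)"
      using co_inverse[OF lin gf x ij] ij by simp
  qed (use Ac[OF x] Tc[OF x] in auto)
  have AT: "?A x * T x = 1\<^sub>m (length (bM x))" if x: "x \<in> pts D" for x
    by (rule mat_mult_left_right_inverse[OF Tc[OF x] Ac[OF x] TA[OF x]])
  note X = MN.mor_mat_tri[of f0 f1]
  have Bot: "Bot \<in> pts D" by simp
  have N: "matrix_of D actN bN y \<in> carrier_mat (length (bM Bot)) (length (bM y))" if "pless D Bot y" for y
    using d[OF Bot] d[of y] that MN.pless_P(2)[OF that] unfolding MN.N.matrix_of_eq[OF that] by simp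
  have M: "matrix_of D actM bM y \<in> carrier_mat (length (bM Bot)) (length (bM y))" if "pless D Bot y" for y
    unfolding MN.M.matrix_of_eq[OF that] by simp
  have E: "MN.blk ?X y x \<in> carrier_mat (length (bM y)) (length (bM x))" if "y \<in> pts D" for y x
    using MN.blk_carrier[of ?X y x] d[OF that] by simp
  have "block_equation (T Bot) ?A (MN.blk ?X)"
    unfolding block_equation_def
  proof (intro conjI allI impI)
    show "T Bot \<in> carrier_mat (length (bM Bot)) (length (bM Bot))" by (rule Tc[OF Bot])
    show "det (T Bot) \<noteq> 0" by (rule mat_det_nonzero[OF Tc[OF Bot] Ac[OF Bot] TA[OF Bot]])
  next
    fix x assume "pless D Bot x"
    then have x: "x \<in> pts D" by (rule MN.pless_P)
    show "?A x \<in> carrier_mat (length (bM x)) (length (bM x))" by (rule Ac[OF x])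
    show "det (?A x) \<noteq> 0" by (rule mat_det_nonzero[OF Ac[OF x] Tc[OF x] AT[OF x]])
    show "elements_mat (?A x) \<subseteq> (if strong D x then UNIV else range (emb D))"
      using MN.elements_blk[OF X x x] unfolding MN.Q_self[OF x] .
  next
    fix y x assume yx: "pless D Bot y \<and> pless D y x"
    then have y: "y \<in> pts D" and x: "x \<in> pts D" using MN.pless_P by blast+
    show "MN.blk ?X y x \<in> carrier_mat (length (bM y)) (length (bM x))" by (rule E[OF y])
    show "elements_mat (MN.blk ?X y x) \<subseteq> F_span_powers D (plev D y x)"
      using MN.elements_blk[OF X y x] unfolding Qsys_def .
  next
    fix x assume x: "pless D Bot x"
    note xP = MN.pless_P(2)[OF x]
    let ?I = "{y. pless D Bot y \<and> pless D y x}"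
    let ?R = "matrix_of D actN bN x * ?A x +
      mat_sum (length (bM Bot)) (length (bM x)) (\<lambda>y. matrix_of D actN bN y * MN.blk ?X y x) ?I"
    have "?A Bot * matrix_of D actM bM x = ?R"
      using MN.mor_mat_intertwines[OF f] x d[OF Bot] unfolding MN.intertwines_iff[OF X] by simp
    moreover have "?R \<in> carrier_mat (length (bM Bot)) (length (bM x))" by simp
    ultimately have "matrix_of D actM bM x = T Bot * ?R"
      using mult_inverse_eq_iff[OF Tc[OF Bot] Ac[OF Bot] TA[OF Bot] AT[OF Bot] M[OF x]] by blast
    also have "\<dots> = T Bot * matrix_of D actN bN x * ?A x + mat_sum (length (bM Bot)) (length (bM x))
        (\<lambda>y. T Bot * matrix_of D actN bN y * MN.blk ?X y x) ?I"
      by (rule mult_mat_block_row[symmetric, OF Tc[OF Bot], where l = "\<lambda>y. length (bM y)"])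
         (use N[OF x] Ac[OF xP] N E in \<open>auto dest: MN.pless_P\<close>)
    finally show "matrix_of D actM bM x = \<dots>" .
  qed
  then show "\<exists>T0 Tx Tyx. block_equation T0 Tx Tyx" by blast
qed

lemma block_equation_imp_isomorphic:
  assumes dims: "\<And>x. x \<in> pts D \<Longrightarrow> length (bM x) = length (bN x)"
    and eq: "block_equation T0 Tx Tyx"
  shows "isomorphic D B actM actN"
proof -
  interpret sw: eq_based_iso D B actN actM bN bM by (rule swap)
  let ?d = "\<lambda>x. length (bM x)"
  have Bot: "Bot \<in> pts D" by simp
  have T0: "T0 \<in> carrier_mat (?d Bot) (?d Bot)" "det T0 \<noteq> 0"
    and Tx: "\<And>x. pless D Bot x \<Longrightarrow> Tx x \<in> carrier_mat (?d x) (?d x)" "\<And>x. pless D Bot x \<Longrightarrow> det (Tx x) \<noteq> 0"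
      "\<And>x. pless D Bot x \<Longrightarrow> elements_mat (Tx x) \<subseteq> Qsys D x x"
    and Tyx: "\<And>y x. pless D Bot y \<Longrightarrow> pless D y x \<Longrightarrow> Tyx y x \<in> carrier_mat (?d y) (?d x)"
      "\<And>y x. pless D Bot y \<Longrightarrow> pless D y x \<Longrightarrow> elements_mat (Tyx y x) \<subseteq> Qsys D y x"
    and eqn: "\<And>x. pless D Bot x \<Longrightarrow> matrix_of D actM bM x = T0 * matrix_of D actN bN x * Tx x +
      mat_sum (?d Bot) (?d x) (\<lambda>y. T0 * matrix_of D actN bN y * Tyx y x) {y. pless D Bot y \<and> pless D y x}"
    using eq MN.Q_self[OF MN.pless_P(2)] unfolding block_equation_def Qsys_def by auto
  obtain A0 where A0: "A0 \<in> carrier_mat (?d Bot) (?d Bot)" "T0 * A0 = 1\<^sub>m (?d Bot)" "A0 * T0 = 1\<^sub>m (?d Bot)"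
    by (rule mat_inverse_exists[OF T0])
  have detA0: "det A0 \<noteq> 0" by (rule mat_det_nonzero[OF A0(1) T0(1) A0(3)])
  \<comment> \<open>The block of X at 0 stands on the other side of \<open>intertwines\<close>,
    hence the inverse of T_0 there.\<close>
  define Dg where "Dg x = (if x = Bot then A0 else Tx x)" for x
  have Dg: "Dg x \<in> carrier_mat (?d x) (?d x)" "det (Dg x) \<noteq> 0" "elements_mat (Dg x) \<subseteq> Qsys D x x"
    if "x \<in> pts D" for x
    using that A0 detA0 Tx[of x] MN.pless_Bot[of x] by (auto simp: Dg_def MN.Q_Bot)
  define X where "X q p = (if fst q = fst p then Dg (fst p) $$ (snd q, snd p)
      else if fst q \<noteq> Bot \<and> pless D (fst q) (fst p) then Tyx (fst q) (fst p) $$ (snd q, snd p) else 0)"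
    for q p :: "'a pt \<times> nat"
  have K: "MN.M.K = MN.blocks ?d" "MN.N.K = MN.blocks ?d"
    unfolding MN.M.K_def MN.N.K_def MN.blocks_def using dims by (auto intro!: Sigma_cong)
  have Xb: "MN.btri ?d X"
    unfolding MN.btri_def
  proof (intro ballI)
    fix q p assume "q \<in> MN.blocks ?d" "p \<in> MN.blocks ?d"
    then have q: "fst q \<in> pts D" "snd q < ?d (fst q)" and p: "fst p \<in> pts D" "snd p < ?d (fst p)"
      by (auto simp: MN.blocks_def)
    consider "fst q = fst p" | "fst q \<noteq> fst p" "fst q \<noteq> Bot" "pless D (fst q) (fst p)"
      | "fst q \<noteq> fst p" "\<not> (fst q \<noteq> Bot \<and> pless D (fst q) (fst p))" by blast
    then show "X q p \<in> Qsys D (fst q) (fst p) \<and> (MN.adm (fst q) (fst p) \<or> X q p = 0)"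
    proof cases
      case 1
      have "Dg (fst p) $$ (snd q, snd p) \<in> elements_mat (Dg (fst p))"
        using elements_matI[OF Dg(1)[OF p(1)]] q p 1 by simp
      then show ?thesis using 1 Dg(3)[OF p(1)] by (auto simp: X_def MN.adm_def)
    next
      case 2
      then have b: "pless D Bot (fst q)" using q by (simp add: MN.pless_Bot)
      have "Tyx (fst q) (fst p) $$ (snd q, snd p) \<in> elements_mat (Tyx (fst q) (fst p))"
        using elements_matI[OF Tyx(1)[OF b 2(3)]] q p by simp
      then show ?thesis using 2 Tyx(2)[OF b 2(3)] by (auto simp: X_def MN.adm_def)
    next
      case 3
      then show ?thesis unfolding X_def by auto
    qed
  qed
  then have X: "MN.tri X" unfolding MN.tri_def MN.btri_def K .
  have blk: "MN.blk X x x = Dg x" if "x \<in> pts D" for x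
    using Dg(1)[OF that] dims[OF that] by (intro eq_matI) (auto simp: MN.blk_def X_def)
  have blk': "MN.blk X y x = Tyx y x" if "pless D Bot y" "pless D y x" for y x
  proof -
    have "y \<noteq> Bot" "y \<noteq> x" "y \<in> pts D" using that MN.pless_Bot pless_def by (metis, metis, metis)
    then show ?thesis
      using Tyx(1)[OF that] dims[of y] that by (intro eq_matI) (auto simp: MN.blk_def X_def)
  qed
  have N: "matrix_of D actN bN y \<in> carrier_mat (?d Bot) (?d y)" if "pless D Bot y" for y
    using dims[OF Bot] dims[OF MN.pless_P(2)[OF that]] unfolding MN.N.matrix_of_eq[OF that] by simp
  have M: "matrix_of D actM bM y \<in> carrier_mat (?d Bot) (?d y)" if "pless D Bot y" for y
    unfolding MN.M.matrix_of_eq[OF that] by simp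
  have CX: "MN.intertwines X"
    unfolding MN.intertwines_iff[OF X]
  proof (intro allI impI)
    fix x assume x: "pless D Bot x"
    note xP = MN.pless_P(2)[OF x]
    let ?I = "{y. pless D Bot y \<and> pless D y x}"
    let ?R = "matrix_of D actN bN x * Tx x + mat_sum (?d Bot) (?d x) (\<lambda>y. matrix_of D actN bN y * Tyx y x) ?I"
    have "matrix_of D actM bM x = T0 * ?R"
      unfolding eqn[OF x]
      by (rule mult_mat_block_row[OF T0(1), where l = ?d]) (use N Tx(1)[OF x] Tyx(1) x in auto)
    moreover have "?R \<in> carrier_mat (?d Bot) (?d x)" by simp
    ultimately have "A0 * matrix_of D actM bM x = ?R"
      using mult_inverse_eq_iff[OF T0(1) A0 M[OF x]] by blast
    moreover have "MN.blk X Bot Bot = A0" "MN.blk X x x = Tx x"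
      using blk[OF Bot] blk[OF xP] x by (auto simp: Dg_def MN.pless_Bot)
    moreover have "mat_sum (?d Bot) (?d x) (\<lambda>y. matrix_of D actN bN y * Tyx y x) ?I =
        mat_sum (?d Bot) (?d x) (\<lambda>y. matrix_of D actN bN y * MN.blk X y x) ?I"
      by (rule mat_sum_cong) (simp add: blk')
    ultimately show "MN.blk X Bot Bot * matrix_of D actM bM x = matrix_of D actN bN x * MN.blk X x x +
        mat_sum (length (bN Bot)) (?d x) (\<lambda>y. matrix_of D actN bN y * MN.blk X y x) ?I"
      using dims[OF Bot] by simp
  qed
  \<comment> \<open>The diagonal blocks must be invertible within their own Q_x, that is, over F at
    weak points.\<close>
  have "\<exists>V. V \<in> carrier_mat (?d x) (?d x) \<and> Dg x * V = 1\<^sub>m (?d x) \<and> V * Dg x = 1\<^sub>m (?d x) \<and> elements_mat V \<subseteq> Qsys D x x"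
    if "x \<in> pts D" for x
    using MN.mat_inverse_Q[OF Dg(1,2)[OF that] that Dg(3)[OF that]] by metis
  then obtain V where V: "\<And>x. x \<in> pts D \<Longrightarrow> V x \<in> carrier_mat (?d x) (?d x)"
      "\<And>x. x \<in> pts D \<Longrightarrow> Dg x * V x = 1\<^sub>m (?d x)" "\<And>x. x \<in> pts D \<Longrightarrow> V x * Dg x = 1\<^sub>m (?d x)"
      "\<And>x. x \<in> pts D \<Longrightarrow> elements_mat (V x) \<subseteq> Qsys D x x"
    by metis
  obtain Y where Y: "MN.btri ?d Y"
    "\<And>q p. q \<in> MN.blocks ?d \<Longrightarrow> p \<in> MN.blocks ?d \<Longrightarrow> (\<Sum>r\<in>MN.blocks ?d. Y q r * X r p) = (if q = p then 1 else 0)"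
    "\<And>q p. q \<in> MN.blocks ?d \<Longrightarrow> p \<in> MN.blocks ?d \<Longrightarrow> (\<Sum>r\<in>MN.blocks ?d. X q r * Y r p) = (if q = p then 1 else 0)"
  proof (rule MN.block_inverse[where W = "\<lambda>x i k. V x $$ (i, k)", OF Xb])
    fix x i j assume x: "x \<in> pts D" "i < ?d x" "j < ?d x"
    show "V x $$ (i, j) \<in> Qsys D x x" using V(4)[OF x(1)] elements_matI[OF V(1)[OF x(1)] x(2,3)] by blast
    have "(V x * Dg x) $$ (i, j) = (if i = j then 1 else 0)" using V(3)[OF x(1)] x by simp
    then show "(\<Sum>k<?d x. V x $$ (i, k) * X (x, k) (x, j)) = (if i = j then 1 else 0)"
      unfolding mat_mult_index[OF V(1)[OF x(1)] Dg(1)[OF x(1)] x(2,3)] by (simp add: X_def)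
    have "(Dg x * V x) $$ (i, j) = (if i = j then 1 else 0)" using V(2)[OF x(1)] x by simp
    then show "(\<Sum>k<?d x. X (x, i) (x, k) * V x $$ (k, j)) = (if i = j then 1 else 0)"
      unfolding mat_mult_index[OF Dg(1)[OF x(1)] V(1)[OF x(1)] x(2,3)] by (simp add: X_def)
  qed blast
  have Yt: "NM.tri Y" using Y(1) unfolding NM.tri_def MN.btri_def K .
  have YX: "(\<Sum>r\<in>MN.N.K. Y q r * X r p) = (if q = p then 1 else 0)" if "q \<in> MN.M.K" "p \<in> MN.M.K" for q p
    using Y(2) that unfolding K .
  have XY: "(\<Sum>r\<in>MN.M.K. X q r * Y r p) = (if q = p then 1 else 0)" if "q \<in> MN.N.K" "p \<in> MN.N.K" for q p
    using Y(3) that unfolding K .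
  have CY: "NM.intertwines Y" by (rule inverse_intertwines[OF X Yt CX YX XY])
  show ?thesis
    unfolding isomorphic_def
    using MN.mat_morphism[OF X CX] NM.mat_morphism[OF Yt CY] mat_mor_inverse[OF X Yt CX CY YX]
      sw.mat_mor_inverse[OF Yt X CY CX XY] by blast
qed

end

theorem corollary37:
  fixes D :: "('a, 'f::field, 'g::field) eq_data"
    and B :: "'a pt \<Rightarrow> 'a pt \<Rightarrow> ('a, 'g) pmat set"
    and actM :: "('m::ab_group_add, 'a, 'g) action"
    and actN :: "('n::ab_group_add, 'a, 'g) action"
    and \<B>M :: "'a pt \<Rightarrow> 'm list" and \<B>N :: "'a pt \<Rightarrow> 'n list"
  assumes "prime (prm D)"
    and "p_equipped (prm D) (pts0 D) (ord0 D) (lev0 D)"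
    and "field_hom (emb D)"
    and "subfield_generated (range (emb D) \<union> {xi D}) = UNIV"
    and "normal_extension (emb D)" and "extension_degree (emb D) = prm D"
    and "xi D ^ prm D \<in> range (emb D)"
    and "is_J_bases D B"
    and "is_object D actM" and "is_object D actN"
    and "is_local_basis D actM \<B>M" and "is_local_basis D actN \<B>N"
  shows "isomorphic D B actM actN \<longleftrightarrow>
    (\<forall>x\<in>pts D. dimvec D actM x = dimvec D actN x) \<and>
    (let d = dimvec D actM in
     \<exists>(T0 :: 'g mat) (Tx :: 'a pt \<Rightarrow> 'g mat) (Tyx :: 'a pt \<Rightarrow> 'a pt \<Rightarrow> 'g mat).
       T0 \<in> carrier_mat (d Bot) (d Bot) \<and> det T0 \<noteq> 0 \<and>
       (\<forall>x. pless D Bot x \<longrightarrow>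
          Tx x \<in> carrier_mat (d x) (d x) \<and> det (Tx x) \<noteq> 0 \<and>
          elements_mat (Tx x) \<subseteq> (if strong D x then UNIV else range (emb D))) \<and>
       (\<forall>y x. pless D Bot y \<and> pless D y x \<longrightarrow>
          Tyx y x \<in> carrier_mat (d y) (d x) \<and>
          elements_mat (Tyx y x) \<subseteq> F_span_powers D (plev D y x)) \<and>
       (\<forall>x. pless D Bot x \<longrightarrow>
          matrix_of D actM \<B>M x =
            T0 * matrix_of D actN \<B>N x * Tx x +
            mat_sum (d Bot) (d x) (\<lambda>y. T0 * matrix_of D actN \<B>N y * Tyx y x)
              {y. pless D Bot y \<and> pless D y x}))"
proof -
  interpret eq_based_iso D B actM actN \<B>M \<B>N
    by (intro eq_based_iso.intro eq_based_pair.intro eq_pair.intro eq_bases.intro eq_bases_axioms.intro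
        eq_based.intro eq_based_axioms.intro eq_module.intro eq_module_axioms.intro eq_system.intro assms)
  have dM: "dimvec D actM x = length (\<B>M x)" and dN: "dimvec D actN x = length (\<B>N x)" if "x \<in> pts D" for x
    using that by (intro MN.dimvec_eq MN.M.eq_based_axioms MN.N.eq_based_axioms; simp)+
  have P: "pless D y x \<Longrightarrow> y \<in> pts D \<and> x \<in> pts D" for y x
    using MN.pless_P by blast
  have "isomorphic D B actM actN \<longleftrightarrow>
    (\<forall>x\<in>pts D. length (\<B>M x) = length (\<B>N x)) \<and> (\<exists>T0 Tx Tyx. block_equation T0 Tx Tyx)"
  proof
    assume "isomorphic D B actM actN"
    then obtain f0 f1 g0 g1 where f: "is_morphism D B actM actN (f0, f1)"
      and g: "is_morphism D B actN actM (g0, g1)"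
      and c: "comp_mor D B (g0, g1) (f0, f1) = id_mor" "comp_mor D B (f0, f1) (g0, g1) = id_mor"
      unfolding isomorphic_def by (metis surj_pair)
    \<comment> \<open>The degree 0 parts of the composites: mutually inverse f^0 and g^0 make the
      diagonal blocks invertible.\<close>
    have "g0 \<circ> f0 = id" "f0 \<circ> g0 = id" using c unfolding comp_mor_def id_mor_def by auto
    then have "g0 (f0 m) = m" "f0 (g0 n) = n" for m n by (simp_all add: fun_eq_iff)
    from isomorphic_imp_block_equation[OF f g this]
    show "(\<forall>x\<in>pts D. length (\<B>M x) = length (\<B>N x)) \<and> (\<exists>T0 Tx Tyx. block_equation T0 Tx Tyx)" by blast
  qed (use block_equation_imp_isomorphic in blast)
  \<comment> \<open>The function \<open>d\<close> is evaluated only at points of P, where it equals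
    the length of the basis.\<close>
  moreover have "(\<exists>T0 Tx Tyx. block_equation T0 Tx Tyx) \<longleftrightarrow>
    (let d = dimvec D actM in
     \<exists>(T0 :: 'g mat) (Tx :: 'a pt \<Rightarrow> 'g mat) (Tyx :: 'a pt \<Rightarrow> 'a pt \<Rightarrow> 'g mat).
       T0 \<in> carrier_mat (d Bot) (d Bot) \<and> det T0 \<noteq> 0 \<and>
       (\<forall>x. pless D Bot x \<longrightarrow>
          Tx x \<in> carrier_mat (d x) (d x) \<and> det (Tx x) \<noteq> 0 \<and>
          elements_mat (Tx x) \<subseteq> (if strong D x then UNIV else range (emb D))) \<and>
       (\<forall>y x. pless D Bot y \<and> pless D y x \<longrightarrow>
          Tyx y x \<in> carrier_mat (d y) (d x) \<and>
          elements_mat (Tyx y x) \<subseteq> F_span_powers D (plev D y x)) \<and>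
       (\<forall>x. pless D Bot x \<longrightarrow>
          matrix_of D actM \<B>M x =
            T0 * matrix_of D actN \<B>N x * Tx x +
            mat_sum (d Bot) (d x) (\<lambda>y. T0 * matrix_of D actN \<B>N y * Tyx y x)
              {y. pless D Bot y \<and> pless D y x}))"
    unfolding block_equation_def Let_def
    by (intro arg_cong[of _ _ Ex] ext conj_cong all_cong1 imp_cong HOL.refl)
       (auto simp: dM dest!: P)
  ultimately show ?thesis by (simp add: dM dN)
qed

end
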